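(* Let $K$ be a field, and let $G$ be a chordal graph on the vertex set $[n]=\{1,\ldots,n\}$ (finite, without loops, multiple edges and isolated vertices). Let $F_1,\ldots,F_m$ be the facets of the clique complex $\Delta(G)$ which admit a free vertex. Then the following conditions are equivalent: (a) $G$ is Cohen-Macaulay (that is, Cohen-Macaulay over every field); (b) $G$ is Cohen-Macaulay over $K$; (c) $G$ is unmixed; (d) $[n]$ is the disjoint union of $F_1,\ldots,F_m$.
   Context: All graphs are finite, without loops, multiple edges and isolated vertices. A graph $G$ on the vertex set $[n]$ with edge set $E(G)$ is chordal if every cycle of length $>3$ has a chord. A clique (called also a stable subset in this setting) of $G$ is a subset $F\subset[n]$ such that $\{i,j\}\in E(G)$ for all $i,j\in F$ with $i\neq j$. $\Delta(G)$ denotes the simplicial complex on $[n]$ whose faces are the cliques of $G$; its facets are the maximal cliques of $G$. A free vertex of a facet $F$ is a vertex of $F$ that belongs to no other facet of $\Delta(G)$. The list $F_1,\ldots,F_m$ consists of pairwise distinct facets. For a field $K$, the edge ideal of $G$ is the ideal $I(G)$ of $S=K[x_1,\ldots,x_n]$ generated by all monomials $x_ix_j$ with $\{i,j\}\in E(G)$. $G$ is Cohen-Macaulay over $K$ if $S/I(G)$ is a Cohen-Macaulay ring, and $G$ is Cohen-Macaulay if it is Cohen-Macaulay over any (every) field. A vertex cover of $G$ is a subset $C\subset[n]$ with $C\cap\{i,j\}\neq\emptyset$ for all $\{i,j\}\in E(G)$; it is minimal if no proper subset of $C$ is a vertex cover. The minimal prime ideals of $I(G)$ are exactly the ideals $(x_i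 : i\in C)$ with $C$ a minimal vertex cover of $G$. $G$ is unmixed if $I(G)$ is height unmixed, equivalently if all minimal vertex covers of $G$ have the same cardinality. *)

theory Defs
  imports "HOL-Algebra.Algebra" "HOL-Library.Extended_Nat" "HOL-Library.Disjoint_Sets"
    "HOL-Library.Infinite_Typeclass"
begin

section \<open>Graphs and clique complexes\<close>

text \<open>A graph is a vertex set \<open>V\<close> together with a set \<open>E\<close> of two-element subsets of \<open>V\<close>.
  Isolated vertices are excluded.\<close>

definition simple_graph :: "'v set \<Rightarrow> 'v set set \<Rightarrow> bool" where
  "simple_graph V E \<longleftrightarrow>
     finite V \<and>
     (\<forall>e\<in>E. \<exists>i\<in>V. \<exists>j\<in>V. i \<noteq> j \<and> e = {i, j}) \<and>
     (\<forall>i\<in>V. \<exists>e\<in>E. i \<in> e)"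

text \<open>Cycles are given by their lists of vertices, the last vertex being joined to the first one.\<close>

definition graph_cycle :: "'v set set \<Rightarrow> 'v list \<Rightarrow> bool" where
  "graph_cycle E vs \<longleftrightarrow>
     3 \<le> length vs \<and> distinct vs \<and>
     (\<forall>i<length vs. {vs ! i, vs ! (Suc i mod length vs)} \<in> E)"

definition has_chord :: "'v set set \<Rightarrow> 'v list \<Rightarrow> bool" where
  "has_chord E vs \<longleftrightarrow>
     (\<exists>i<length vs. \<exists>j<length vs. i \<noteq> j \<and>
        j \<noteq> Suc i mod length vs \<and> i \<noteq> Suc j mod length vs \<and> {vs ! i, vs ! j} \<in> E)"

definition chordal :: "'v set set \<Rightarrow> bool" where
  "chordal E \<longleftrightarrow> (\<forall>vs. graph_cycle E vs \<and> 3 < length vs \<longrightarrow> has_chord E vs)"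

definition clique :: "'v set \<Rightarrow> 'v set set \<Rightarrow> 'v set \<Rightarrow> bool" where
  "clique V E F \<longleftrightarrow> F \<subseteq> V \<and> (\<forall>i\<in>F. \<forall>j\<in>F. i \<noteq> j \<longrightarrow> {i, j} \<in> E)"

definition clique_complex :: "'v set \<Rightarrow> 'v set set \<Rightarrow> 'v set set" where
  "clique_complex V E = {F. clique V E F}"

definition facets :: "'v set set \<Rightarrow> 'v set set" where
  "facets \<Delta> = {F \<in> \<Delta>. \<forall>H\<in>\<Delta>. F \<subseteq> H \<longrightarrow> F = H}"

definition free_vertex :: "'v set set \<Rightarrow> 'v set \<Rightarrow> 'v \<Rightarrow> bool" where
  "free_vertex \<Delta> F v \<longleftrightarrow> v \<in> F \<and> (\<forall>H\<in>facets \<Delta>. v \<in> H \<longrightarrow> H = F)"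

section \<open>Polynomial rings in several variables\<close>

text \<open>The library provides the set of polynomials in variables indexed by \<open>I\<close>, realised as
  functions from monomials (multisets of variables) to coefficients, but not their product.\<close>

definition indexed_poly_mult ::
    "('a, 'm) ring_scheme \<Rightarrow> ('v multiset \<Rightarrow> 'a) \<Rightarrow> ('v multiset \<Rightarrow> 'a) \<Rightarrow> ('v multiset \<Rightarrow> 'a)" where
  "indexed_poly_mult R f g = (\<lambda>m. \<Oplus>\<^bsub>R\<^esub> p \<in> {p. p \<subseteq># m}. f p \<otimes>\<^bsub>R\<^esub> g (m - p))"

definition indexed_poly_ring :: "('a, 'm) ring_scheme \<Rightarrow> 'v set \<Rightarrow> ('v multiset \<Rightarrow> 'a) ring" where
  "indexed_poly_ring R I =
     \<lparr>carrier = ring.indexed_pset R I (carrier R),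
      monoid.mult = indexed_poly_mult R,
      monoid.one = ring.indexed_const R \<one>\<^bsub>R\<^esub>,
      ring.zero = ring.indexed_const R \<zero>\<^bsub>R\<^esub>,
      ring.add = ring.indexed_padd R\<rparr>"

section \<open>Krull dimension, height and height unmixed ideals\<close>

definition prime_chain :: "('a, 'm) ring_scheme \<Rightarrow> nat \<Rightarrow> (nat \<Rightarrow> 'a set) \<Rightarrow> bool" where
  "prime_chain R r P \<longleftrightarrow> (\<forall>i\<le>r. primeideal (P i) R) \<and> (\<forall>i<r. P i \<subset> P (Suc i))"

definition krull_dim :: "('a, 'm) ring_scheme \<Rightarrow> enat" where
  "krull_dim R = Sup {enat r | r P. prime_chain R r P}"

definition prime_height :: "('a, 'm) ring_scheme \<Rightarrow> 'a set \<Rightarrow> enat" where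
  "prime_height R Q = Sup {enat r | r P. prime_chain R r P \<and> P r = Q}"

text \<open>The associated primes of \<open>R / I\<close> are the prime ideals of the form \<open>I : f\<close>; for a radical
  ideal of a Noetherian ring, such as an edge ideal, they are the minimal primes of \<open>I\<close>.\<close>

definition associated_prime :: "('a, 'm) ring_scheme \<Rightarrow> 'a set \<Rightarrow> 'a set \<Rightarrow> bool" where
  "associated_prime R I P \<longleftrightarrow>
     primeideal P R \<and> (\<exists>f\<in>carrier R. P = {a \<in> carrier R. a \<otimes>\<^bsub>R\<^esub> f \<in> I})"

definition height_unmixed :: "('a, 'm) ring_scheme \<Rightarrow> 'a set \<Rightarrow> bool" where
  "height_unmixed R I \<longleftrightarrow>
     (\<forall>P Q. associated_prime R I P \<and> associated_prime R I Q \<longrightarrow> prime_height R P = prime_height R Q)"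

section \<open>Localization at a prime ideal\<close>

definition loc_rel ::
    "('a, 'm) ring_scheme \<Rightarrow> 'a set \<Rightarrow> (('a \<times> 'a) \<times> ('a \<times> 'a)) set" where
  "loc_rel R P =
     {((a, s), (b, t)) | a s b t.
        a \<in> carrier R \<and> b \<in> carrier R \<and> s \<in> carrier R - P \<and> t \<in> carrier R - P \<and>
        (\<exists>u\<in>carrier R - P. u \<otimes>\<^bsub>R\<^esub> (a \<otimes>\<^bsub>R\<^esub> t) = u \<otimes>\<^bsub>R\<^esub> (b \<otimes>\<^bsub>R\<^esub> s))}"

text \<open>The fraction \<open>a / s\<close>.\<close>

definition loc_frac :: "('a, 'm) ring_scheme \<Rightarrow> 'a set \<Rightarrow> 'a \<Rightarrow> 'a \<Rightarrow> ('a \<times> 'a) set" where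
  "loc_frac R P a s = loc_rel R P `` {(a, s)}"

text \<open>The unions below range over the representatives of two fractions; all their members
  coincide, as in the library's construction of quotient rings.\<close>

definition localization :: "('a, 'm) ring_scheme \<Rightarrow> 'a set \<Rightarrow> ('a \<times> 'a) set ring" where
  "localization R P =
     \<lparr>carrier = {loc_frac R P a s | a s. a \<in> carrier R \<and> s \<in> carrier R - P},
      monoid.mult = (\<lambda>A B. \<Union>(a, s)\<in>A. \<Union>(b, t)\<in>B. loc_frac R P (a \<otimes>\<^bsub>R\<^esub> b) (s \<otimes>\<^bsub>R\<^esub> t)),
      monoid.one = loc_frac R P \<one>\<^bsub>R\<^esub> \<one>\<^bsub>R\<^esub>,
      ring.zero = loc_frac R P \<zero>\<^bsub>R\<^esub> \<one>\<^bsub>R\<^esub>,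
      ring.add = (\<lambda>A B. \<Union>(a, s)\<in>A. \<Union>(b, t)\<in>B.
                    loc_frac R P ((a \<otimes>\<^bsub>R\<^esub> t) \<oplus>\<^bsub>R\<^esub> (b \<otimes>\<^bsub>R\<^esub> s)) (s \<otimes>\<^bsub>R\<^esub> t))\<rparr>"

section \<open>Cohen--Macaulay rings\<close>

text \<open>\<open>x\<^sub>1, \<dots>, x\<^sub>r\<close> is a regular sequence if each \<open>x\<^sub>i\<close> is a nonzerodivisor modulo
  \<open>(x\<^sub>1, \<dots>, x\<^sub>i\<^sub>-\<^sub>1)\<close> and \<open>(x\<^sub>1, \<dots>, x\<^sub>r)\<close> is a proper ideal.\<close>

definition regular_sequence :: "('a, 'm) ring_scheme \<Rightarrow> 'a list \<Rightarrow> bool" where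
  "regular_sequence R xs \<longleftrightarrow>
     set xs \<subseteq> carrier R \<and>
     (\<forall>i<length xs. \<forall>a\<in>carrier R.
        xs ! i \<otimes>\<^bsub>R\<^esub> a \<in> Idl\<^bsub>R\<^esub> (set (take i xs)) \<longrightarrow> a \<in> Idl\<^bsub>R\<^esub> (set (take i xs))) \<and>
     Idl\<^bsub>R\<^esub> (set xs) \<noteq> carrier R"

text \<open>The supremum of the lengths of the regular sequences in the ideal \<open>M\<close>; for a local ring
  with maximal ideal \<open>M\<close> this is the depth of the ring.\<close>

definition ring_depth :: "('a, 'm) ring_scheme \<Rightarrow> 'a set \<Rightarrow> enat" where
  "ring_depth R M = Sup {enat (length xs) | xs. regular_sequence R xs \<and> set xs \<subseteq> M}"

definition local_cohen_macaulay :: "('a, 'm) ring_scheme \<Rightarrow> bool" where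
  "local_cohen_macaulay R \<longleftrightarrow>
     cring R \<and> noetherian_ring R \<and>
     (\<exists>M. {I. maximalideal I R} = {M} \<and> ring_depth R M = krull_dim R)"

definition cohen_macaulay :: "('a, 'm) ring_scheme \<Rightarrow> bool" where
  "cohen_macaulay R \<longleftrightarrow>
     cring R \<and> noetherian_ring R \<and>
     (\<forall>M. maximalideal M R \<longrightarrow> local_cohen_macaulay (localization R M))"

section \<open>Edge ideals\<close>

definition edge_ideal ::
    "('a, 'm) ring_scheme \<Rightarrow> 'v set \<Rightarrow> 'v set set \<Rightarrow> ('v multiset \<Rightarrow> 'a) set" where
  "edge_ideal K V E =
     Idl\<^bsub>indexed_poly_ring K V\<^esub>
       {ring.indexed_var K i \<otimes>\<^bsub>indexed_poly_ring K V\<^esub> ring.indexed_var K j | i j. {i, j} \<in> E}"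

definition cohen_macaulay_graph :: "('a, 'm) ring_scheme \<Rightarrow> 'v set \<Rightarrow> 'v set set \<Rightarrow> bool" where
  "cohen_macaulay_graph K V E \<longleftrightarrow> cohen_macaulay (indexed_poly_ring K V Quot edge_ideal K V E)"

definition unmixed_graph :: "('a, 'm) ring_scheme \<Rightarrow> 'v set \<Rightarrow> 'v set set \<Rightarrow> bool" where
  "unmixed_graph K V E \<longleftrightarrow> height_unmixed (indexed_poly_ring K V) (edge_ideal K V E)"

end

theory Submission
  imports Defs "HOL-Library.Multiset_Order"
begin

text \<open>The associated primes of the edge ideal \<open>I\<close> are the primes generated by the complements of the
  maximal independent sets, so \<open>G\<close> is unmixed if and only if all maximal independent sets have the
  same size.

  If \<open>G\<close> is Cohen--Macaulay, localize at the origin. In a Noetherian local ring every regular sequence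
  of length \<open>r\<close> yields a chain of primes of length \<open>r\<close> above any given associated prime; as a chain above
  the prime of a maximal independent set \<open>A\<close> has length at most \<open>|A|\<close>, depth and dimension can only agree
  if all maximal independent sets have the same size.

  If \<open>G\<close> is chordal and unmixed, remove the closed neighbourhood of a simplicial vertex. By induction
  the rest is partitioned by facets with a free vertex, and since four-cycles have chords, a facet that
  loses all its free vertices in \<open>G\<close> would be dominated by an independent set disjoint from it, which
  extends to a maximal independent set that is too small.

  If the facets \<open>F\<^sub>1, \<dots>, F\<^sub>m\<close> with a free vertex partition the vertices, let \<open>\<theta>\<^sub>i\<close> be the sum of the variables in
  \<open>F\<^sub>i\<close>. A maximal ideal \<open>M\<close> above \<open>I\<close> contains nonzero polynomials \<open>f\<^sub>i(\<theta>\<^sub>i)\<close> by the Nullstellensatz. They form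
  a regular sequence modulo \<open>I\<close>: the exact sequences for the colon ideals of vertices that are not the
  chosen representatives reduce this to a polynomial ring with one variable for each \<open>F\<^sub>i\<close>. So the
  localization at \<open>M\<close> has depth at least \<open>m\<close>, and its dimension is at most \<open>m\<close>, the largest size of an
  independent set.\<close>

section \<open>Polynomial rings\<close>

text \<open>Cohen-Macaulayness concerns every maximal ideal over an arbitrary field, not only the
  origin. Away from the origin the sums \<theta> need not lie in the maximal ideal, and over a field
  that is not algebraically closed no translate \<theta> - c need do so either. This is why
  polynomials in \<theta> enter. They cost little: modulo an ideal that is homogeneous in one
  variable, every nonzero polynomial in that variable is a nonzerodivisor. Dimension theory is
  reduced to one fact, that a chain of primes in the polynomial ring has at most as many steps as
  there are variables. It comes from counting power products, and heights and dimensions follow by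
  gluing chains. Regular sequences are turned into chains of primes with prescribed bottom, so the
  dimension of a quotient by a regular sequence is never computed. The localizations of S/I are
  studied through one map from S. All ideal computations thus stay in S, where squarefree monomial
  ideals are conditions on sets of variables.\<close>

lemma finite_submultisets: "finite {p. p \<subseteq># m}"
proof (induction m)
  case empty
  then show ?case by simp
next
  case (add x m)
  have "{p. p \<subseteq># add_mset x m} \<subseteq> {p. p \<subseteq># m} \<union> add_mset x ` {p. p \<subseteq># m}"
  proof
    fix p assume p: "p \<in> {p. p \<subseteq># add_mset x m}"
    show "p \<in> {p. p \<subseteq># m} \<union> add_mset x ` {p. p \<subseteq># m}"
    proof (cases "x \<in># p")
      case True
      then obtain q where "p = add_mset x q" by (blast dest: multi_member_split)
      with p show ?thesis by auto
    next
      case False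
      have "count p a \<le> count m a" for a
        using p False by (cases "a = x") (auto simp: subseteq_mset_def not_in_iff dest: spec[of _ a])
      then show ?thesis by (auto simp: subseteq_mset_def)
    qed
  qed
  then show ?case
    by (rule finite_subset) (use add in auto)
qed

text \<open>The sort \<open>wellorder\<close> makes the multiset order on monomials a well-order
  compatible with addition. This supplies leading monomials and the termination of division.\<close>

locale mpoly_ring = K: field K
  for K :: "('a, 'm) ring_scheme" and V :: "'v :: wellorder set" and S (structure) +
  assumes S_def: "S = indexed_poly_ring K V" and finite_vars: "finite V"
begin

definition mon :: "'a \<Rightarrow> 'v multiset \<Rightarrow> 'v multiset \<Rightarrow> 'a" where
  "mon c p = (\<lambda>m. if m = p then c else \<zero>\<^bsub>K\<^esub>)"

definition supp :: "('v multiset \<Rightarrow> 'a) \<Rightarrow> 'v multiset set" where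
  "supp f = {m. f m \<noteq> \<zero>\<^bsub>K\<^esub>}"

section \<open>Ring operations on coefficient functions\<close>

lemma add_S: "f \<oplus> g = (\<lambda>m. f m \<oplus>\<^bsub>K\<^esub> g m)"
  unfolding S_def indexed_poly_ring_def K.indexed_padd_def by simp

lemma zero_S: "\<zero> = (\<lambda>m. \<zero>\<^bsub>K\<^esub>)"
  unfolding S_def indexed_poly_ring_def K.indexed_const_def by auto

lemma one_S: "\<one> = mon \<one>\<^bsub>K\<^esub> {#}"
  unfolding S_def indexed_poly_ring_def K.indexed_const_def mon_def by auto

lemma mult_S: "f \<otimes> g = (\<lambda>m. \<Oplus>\<^bsub>K\<^esub> p \<in> {p. p \<subseteq># m}. f p \<otimes>\<^bsub>K\<^esub> g (m - p))"
  unfolding S_def indexed_poly_ring_def indexed_poly_mult_def by simp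

lemma mon_in_pset:
  assumes "c \<in> carrier K" "set_mset p \<subseteq> V"
  shows "mon c p \<in> K.indexed_pset V (carrier K)"
  using assms(2)
proof (induction p)
  case empty
  have "mon c {#} = K.indexed_const c" by (auto simp: mon_def K.indexed_const_def)
  then show ?case using assms(1) by (auto intro: K.indexed_pset.indexed_const)
next
  case (add x p)
  have "mon c (add_mset x p) = K.indexed_pmult (mon c p) x"
    by (auto simp: mon_def K.indexed_pmult_def fun_eq_iff)
  then show ?case using add by (auto intro: K.indexed_pset.indexed_pmult)
qed

text \<open>Turns the inductive set of polynomials into a condition on supports. One inclusion is
  rule induction; the other splits off one monomial at a time, by induction on the support.\<close>

lemma carrier_S:
  "carrier S = {f. (\<forall>m. f m \<in> carrier K) \<and> finite (supp f) \<and> (\<forall>m\<in>supp f. set_mset m \<subseteq> V)}"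
proof -
  have "carrier S = K.indexed_pset V (carrier K)"
    unfolding S_def indexed_poly_ring_def by simp
  also have "\<dots> = {f. (\<forall>m. f m \<in> carrier K) \<and> finite (supp f) \<and> (\<forall>m\<in>supp f. set_mset m \<subseteq> V)}" (is "_ = ?C")
  proof (intro subset_antisym subsetI)
    fix f assume "f \<in> K.indexed_pset V (carrier K)"
    then show "f \<in> ?C"
    proof induction
      case (indexed_const k)
      have "supp (K.indexed_const k) \<subseteq> {{#}}" by (auto simp: supp_def K.indexed_const_def)
      moreover from this have "finite (supp (K.indexed_const k))" by (rule finite_subset) simp
      ultimately show ?case using indexed_const by (auto simp: K.indexed_const_def)
    next
      case (indexed_padd P Q)
      have "supp (K.indexed_padd P Q) \<subseteq> supp P \<union> supp Q"
        by (auto simp: supp_def K.indexed_padd_def)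
      moreover from this have "finite (supp (K.indexed_padd P Q))"
        by (rule finite_subset) (use indexed_padd in auto)
      ultimately show ?case using indexed_padd by (simp add: K.indexed_padd_def) blast
    next
      case (indexed_pmult P i)
      have "supp (K.indexed_pmult P i) \<subseteq> add_mset i ` supp P"
      proof
        fix m assume "m \<in> supp (K.indexed_pmult P i)"
        then show "m \<in> add_mset i ` supp P"
          by (intro image_eqI[of _ _ "m - {#i#}"])
            (auto simp: supp_def K.indexed_pmult_def split: if_splits)
      qed
      moreover from this have "finite (supp (K.indexed_pmult P i))"
        by (rule finite_subset) (use indexed_pmult in auto)
      moreover have "K.indexed_pmult P i m \<in> carrier K" for m
        using indexed_pmult by (auto simp: K.indexed_pmult_def)
      ultimately show ?case using indexed_pmult by (auto dest!: subsetD)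
    qed
  next
    fix f assume f: "f \<in> ?C"
    then have "finite (supp f)" by simp
    from this f show "f \<in> K.indexed_pset V (carrier K)"
    proof (induction "supp f" arbitrary: f rule: finite_psubset_induct)
      case (psubset f)
      show ?case
      proof (cases "supp f = {}")
        case True
        then have "f = K.indexed_const \<zero>\<^bsub>K\<^esub>" by (auto simp: supp_def K.indexed_const_def fun_eq_iff)
        then show ?thesis by (auto intro: K.indexed_pset.indexed_const)
      next
        case False
        then obtain p where p: "p \<in> supp f" by blast
        define g where "g = f(p := \<zero>\<^bsub>K\<^esub>)"
        have s: "supp g = supp f - {p}" by (auto simp: g_def supp_def)
        have "g \<in> K.indexed_pset V (carrier K)"
          by (rule psubset(2)) (use psubset(3) p s in \<open>auto simp: g_def\<close>)
        moreover have "mon (f p) p \<in> K.indexed_pset V (carrier K)"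
          by (rule mon_in_pset) (use psubset(3) p in auto)
        moreover have "f = K.indexed_padd (mon (f p) p) g"
          using psubset(3) by (auto simp: g_def K.indexed_padd_def mon_def fun_eq_iff)
        ultimately show ?thesis by (metis K.indexed_pset.indexed_padd)
      qed
    qed
  qed
  finally show ?thesis .
qed

lemma finite_supp: "f \<in> carrier S \<Longrightarrow> finite (supp f)"
  by (auto simp: carrier_S)

lemma supp_vars: "f \<in> carrier S \<Longrightarrow> m \<in> supp f \<Longrightarrow> set_mset m \<subseteq> V"
  by (auto simp: carrier_S)

lemma carrier_SI:
  assumes "\<And>m. f m \<in> carrier K" "finite (supp f)" "\<And>m. m \<in> supp f \<Longrightarrow> set_mset m \<subseteq> V"
  shows "f \<in> carrier S"
  using assms by (auto simp: carrier_S)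

lemma coeff_closed [simp]: "f \<in> carrier S \<Longrightarrow> f m \<in> carrier K"
  by (auto simp: carrier_S)

lemma supp_mon: "supp (mon c p) \<subseteq> {p}"
  by (auto simp: supp_def mon_def split: if_splits)

lemma mon_closed: "c \<in> carrier K \<Longrightarrow> set_mset p \<subseteq> V \<Longrightarrow> mon c p \<in> carrier S"
  using supp_mon[of c p] by (intro carrier_SI) (auto simp: mon_def finite_subset)

lemma zero_closed_S: "\<zero> \<in> carrier S"
  by (rule carrier_SI) (auto simp: zero_S supp_def)

lemma add_closed_S:
  assumes "f \<in> carrier S" "g \<in> carrier S" shows "f \<oplus> g \<in> carrier S"
proof -
  have s: "supp (f \<oplus> g) \<subseteq> supp f \<union> supp g"
    by (auto simp: supp_def add_S)
  have "finite (supp (f \<oplus> g))"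
    by (rule finite_subset[OF s]) (use assms in \<open>auto simp: finite_supp\<close>)
  with s assms show ?thesis by (intro carrier_SI) (auto simp: add_S dest: supp_vars)
qed

text \<open>Reduces bilinear identities to monomials.\<close>

lemma mpoly_induct [consumes 1, case_names zero mon_add]:
  assumes f: "f \<in> carrier S" and zero: "P \<zero>"
    and step: "\<And>c p g. \<lbrakk>c \<in> carrier K; c \<noteq> \<zero>\<^bsub>K\<^esub>; set_mset p \<subseteq> V; p \<in> supp f; g \<in> carrier S;
       supp g \<subseteq> supp f; P g\<rbrakk> \<Longrightarrow> P (mon c p \<oplus> g)"
  shows "P f"
proof -
  have "h \<in> carrier S \<Longrightarrow> supp h \<subseteq> supp f \<Longrightarrow> P h" if "finite (supp h)" for h
    using that
  proof (induction "supp h" arbitrary: h rule: finite_psubset_induct)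
    case (psubset h)
    show ?case
    proof (cases "supp h = {}")
      case True
      then have "h = \<zero>" by (auto simp: supp_def zero_S fun_eq_iff)
      then show ?thesis using zero by simp
    next
      case False
      then obtain p where p: "p \<in> supp h" by blast
      define g where "g = h(p := \<zero>\<^bsub>K\<^esub>)"
      have s: "supp g = supp h - {p}" by (auto simp: g_def supp_def)
      have g: "g \<in> carrier S"
        by (rule carrier_SI) (use psubset s in \<open>auto simp: g_def finite_supp dest: supp_vars\<close>)
      have "P g"
        by (rule psubset(2)) (use g p s psubset in auto)
      moreover have "h = mon (h p) p \<oplus> g"
        using psubset(3) by (auto simp: g_def add_S mon_def fun_eq_iff)
      moreover have "P (mon (h p) p \<oplus> g)"
        by (rule step) (use p g s \<open>P g\<close> psubset supp_vars in \<open>auto simp: supp_def\<close>)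
      ultimately show ?thesis by simp
    qed
  qed
  then show ?thesis using f finite_supp by blast
qed

text \<open>Only the term \<open>q = p\<close> of the convolution survives. Together with
  \<open>mpoly_induct\<close> this spares later bilinear arguments the convolution sums.\<close>

lemma mult_mon:
  assumes "c \<in> carrier K" "g \<in> carrier S"
  shows "(mon c p \<otimes> g) m = (if p \<subseteq># m then c \<otimes>\<^bsub>K\<^esub> g (m - p) else \<zero>\<^bsub>K\<^esub>)"
proof -
  have "(mon c p \<otimes> g) m
      = (\<Oplus>\<^bsub>K\<^esub> q \<in> {q. q \<subseteq># m}. if p = q then c \<otimes>\<^bsub>K\<^esub> g (m - q) else \<zero>\<^bsub>K\<^esub>)"
    unfolding mult_S
    by (rule K.finsum_cong') (use assms in \<open>auto simp: mon_def\<close>)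
  also have "\<dots> = (if p \<subseteq># m then c \<otimes>\<^bsub>K\<^esub> g (m - p) else \<zero>\<^bsub>K\<^esub>)"
  proof (cases "p \<subseteq># m")
    case True
    then show ?thesis
      using K.finsum_singleton[of p "{q. q \<subseteq># m}" "\<lambda>q. c \<otimes>\<^bsub>K\<^esub> g (m - q)"] assms finite_submultisets[of m]
      by auto
  next
    case False
    then have "(\<Oplus>\<^bsub>K\<^esub> q \<in> {q. q \<subseteq># m}. if p = q then c \<otimes>\<^bsub>K\<^esub> g (m - q) else \<zero>\<^bsub>K\<^esub>)
       = (\<Oplus>\<^bsub>K\<^esub> q \<in> {q. q \<subseteq># m}. \<zero>\<^bsub>K\<^esub>)"
      by (intro K.finsum_cong') auto
    with False show ?thesis by simp
  qed
  finally show ?thesis .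
qed

lemma mon_mult_mon:
  assumes "c \<in> carrier K" "d \<in> carrier K" "set_mset q \<subseteq> V"
  shows "mon c p \<otimes> mon d q = mon (c \<otimes>\<^bsub>K\<^esub> d) (p + q)"
proof
  fix m :: "'v multiset"
  have "p \<subseteq># m \<Longrightarrow> (m - p = q) = (m = p + q)" by auto
  then show "(mon c p \<otimes> mon d q) m = mon (c \<otimes>\<^bsub>K\<^esub> d) (p + q) m"
    using assms by (simp add: mult_mon mon_closed) (auto simp: mon_def)
qed

text \<open>The involution \<open>p \<mapsto> m - p\<close> on the submultisets of \<open>m\<close>
  exchanges the two factors of each summand.\<close>

lemma mult_comm_S:
  assumes "f \<in> carrier S" "g \<in> carrier S" shows "f \<otimes> g = g \<otimes> f"
proof
  fix m :: "'v multiset"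
  have diff: "m - (m - p) = p" if "p \<subseteq># m" for p
    using that by (auto simp: multiset_eq_iff subseteq_mset_def)
  have bij: "inj_on (\<lambda>p. m - p) {p. p \<subseteq># m}" "(\<lambda>p. m - p) ` {p. p \<subseteq># m} = {p. p \<subseteq># m}"
    using diff by (auto simp: inj_on_def image_iff) (metis, metis diff_subset_eq_self)
  have "(f \<otimes> g) m = (\<Oplus>\<^bsub>K\<^esub> p \<in> (\<lambda>p. m - p) ` {p. p \<subseteq># m}. f p \<otimes>\<^bsub>K\<^esub> g (m - p))"
    unfolding mult_S bij(2) ..
  also have "\<dots> = (\<Oplus>\<^bsub>K\<^esub> p \<in> {p. p \<subseteq># m}. f (m - p) \<otimes>\<^bsub>K\<^esub> g (m - (m - p)))"
    by (rule K.finsum_reindex) (use assms bij in auto)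
  also have "\<dots> = (g \<otimes> f) m"
    unfolding mult_S
    by (rule K.finsum_cong') (use assms in \<open>auto simp: diff K.m_comm\<close>)
  finally show "(f \<otimes> g) m = (g \<otimes> f) m" .
qed

lemma l_distr_S:
  assumes "f \<in> carrier S" "g \<in> carrier S" "h \<in> carrier S"
  shows "(f \<oplus> g) \<otimes> h = (f \<otimes> h) \<oplus> (g \<otimes> h)"
proof
  fix m :: "'v multiset"
  have "((f \<oplus> g) \<otimes> h) m
     = (\<Oplus>\<^bsub>K\<^esub> p \<in> {p. p \<subseteq># m}. f p \<otimes>\<^bsub>K\<^esub> h (m - p) \<oplus>\<^bsub>K\<^esub> g p \<otimes>\<^bsub>K\<^esub> h (m - p))"
    unfolding mult_S add_S
    by (rule K.finsum_cong') (use assms in \<open>auto simp: K.l_distr\<close>)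
  also have "\<dots> = ((f \<otimes> h) \<oplus> (g \<otimes> h)) m"
    unfolding mult_S add_S by (rule K.finsum_addf) (use assms in auto)
  finally show "((f \<oplus> g) \<otimes> h) m = ((f \<otimes> h) \<oplus> (g \<otimes> h)) m" .
qed

lemma zero_mult_S: "f \<in> carrier S \<Longrightarrow> \<zero> \<otimes> f = \<zero>"
proof
  fix m assume f: "f \<in> carrier S"
  have "(\<zero> \<otimes> f) m = (\<Oplus>\<^bsub>K\<^esub> p \<in> {p. p \<subseteq># m}. \<zero>\<^bsub>K\<^esub>)"
    unfolding mult_S zero_S by (rule K.finsum_cong') (use f in auto)
  then show "(\<zero> \<otimes> f) m = \<zero> m" by (simp add: zero_S)
qed

lemma mon_mult_closed:
  assumes "c \<in> carrier K" "set_mset p \<subseteq> V" "g \<in> carrier S" shows "mon c p \<otimes> g \<in> carrier S"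
proof -
  have s: "supp (mon c p \<otimes> g) \<subseteq> (\<lambda>m. p + m) ` supp g"
  proof
    fix m assume "m \<in> supp (mon c p \<otimes> g)"
    then have "p \<subseteq># m" "g (m - p) \<noteq> \<zero>\<^bsub>K\<^esub>"
      using assms by (auto simp: supp_def mult_mon split: if_splits)
    then show "m \<in> (\<lambda>m. p + m) ` supp g" by (auto simp: supp_def image_iff intro!: bexI[of _ "m - p"])
  qed
  then have "finite (supp (mon c p \<otimes> g))"
    by (rule finite_subset) (use assms finite_supp in auto)
  moreover have "(mon c p \<otimes> g) m \<in> carrier K" for m
    using assms by (auto simp: mult_mon)
  moreover have "\<forall>m\<in>supp (mon c p \<otimes> g). set_mset m \<subseteq> V"
  proof
    fix m assume "m \<in> supp (mon c p \<otimes> g)"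
    then obtain q where "q \<in> supp g" "m = p + q" using s by blast
    then show "set_mset m \<subseteq> V" using assms supp_vars[of g q] by auto
  qed
  ultimately show ?thesis by (blast intro: carrier_SI)
qed

lemma mult_closed_S:
  assumes "f \<in> carrier S" "g \<in> carrier S" shows "f \<otimes> g \<in> carrier S"
  using assms
  by (induction rule: mpoly_induct)
    (auto simp: zero_mult_S zero_closed_S l_distr_S mon_closed add_closed_S mon_mult_closed)

lemma r_distr_S:
  assumes "f \<in> carrier S" "g \<in> carrier S" "h \<in> carrier S"
  shows "h \<otimes> (f \<oplus> g) = (h \<otimes> f) \<oplus> (h \<otimes> g)"
  using assms by (simp add: mult_comm_S[of h] add_closed_S l_distr_S)

lemma mult_zero_S: "f \<in> carrier S \<Longrightarrow> f \<otimes> \<zero> = \<zero>"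
  using mult_comm_S[of f \<zero>] by (simp add: zero_mult_S zero_closed_S)

text \<open>Three nested inductions leave a product of three monomials, where associativity is that
  of \<open>K\<close> and of the multiset sum.\<close>

lemma mult_assoc_S:
  assumes "f \<in> carrier S" "g \<in> carrier S" "h \<in> carrier S"
  shows "(f \<otimes> g) \<otimes> h = f \<otimes> (g \<otimes> h)"
  using assms(1)
proof (induction rule: mpoly_induct)
  case zero
  then show ?case using assms by (simp add: zero_mult_S mult_closed_S)
next
  case (mon_add c p f')
  have "(mon c p \<otimes> g) \<otimes> h = mon c p \<otimes> (g \<otimes> h)"
    using assms(2)
  proof (induction rule: mpoly_induct)
    case zero
    then show ?case using assms mon_add by (simp add: zero_mult_S mult_zero_S mon_closed)
  next
    case (mon_add d q g')
    have "(mon c p \<otimes> mon d q) \<otimes> h = mon c p \<otimes> (mon d q \<otimes> h)"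
      using assms(3)
    proof (induction rule: mpoly_induct)
      case zero
      then show ?case using mon_add \<open>c \<in> carrier K\<close> \<open>set_mset p \<subseteq> V\<close>
        by (simp add: mult_zero_S mon_closed mult_closed_S)
    next
      case (mon_add e r h')
      then show ?case using \<open>c \<in> carrier K\<close> \<open>set_mset p \<subseteq> V\<close> \<open>d \<in> carrier K\<close> \<open>set_mset q \<subseteq> V\<close>
        by (simp add: r_distr_S mon_closed mult_closed_S mon_mult_mon K.m_assoc add.assoc)
    qed
    then show ?case using mon_add assms \<open>c \<in> carrier K\<close> \<open>set_mset p \<subseteq> V\<close>
      by (simp add: r_distr_S l_distr_S mon_closed mult_closed_S)
  qed
  then show ?case using mon_add assms
    by (simp add: l_distr_S mon_closed mult_closed_S)
qed

lemma one_mult_S: "f \<in> carrier S \<Longrightarrow> \<one> \<otimes> f = f"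
  by (auto simp: one_S mult_mon fun_eq_iff)

lemma cring_S: "cring S"
proof (rule cringI)
  show "abelian_group S"
  proof (rule abelian_groupI)
    fix f assume f: "f \<in> carrier S"
    define g where "g = (\<lambda>m. \<ominus>\<^bsub>K\<^esub> f m)"
    have "supp g = supp f" using f by (auto simp: supp_def g_def)
    then have "g \<in> carrier S" using f by (intro carrier_SI) (auto simp: g_def finite_supp dest: supp_vars)
    moreover have "g \<oplus> f = \<zero>" using f by (auto simp: g_def add_S zero_S fun_eq_iff K.l_neg)
    ultimately show "\<exists>g\<in>carrier S. g \<oplus> f = \<zero>" by blast
  qed (simp add: add_closed_S, simp add: zero_closed_S,
      auto simp: add_S zero_S fun_eq_iff K.a_assoc intro!: K.a_comm)
  show "comm_monoid S"
  proof (rule comm_monoidI)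
    show "\<one> \<in> carrier S" by (simp add: one_S mon_closed)
  qed (simp_all add: mult_closed_S mult_assoc_S one_mult_S, simp add: mult_comm_S)
qed (simp add: l_distr_S)

end

sublocale mpoly_ring \<subseteq> cring S
  by (rule cring_S)

section \<open>Monomial ideals\<close>

lemma (in ideal) diff_closed: "a \<in> I \<Longrightarrow> b \<in> I \<Longrightarrow> a \<ominus> b \<in> I"
  by (simp add: a_minus_def)

lemma (in cring) ideal_criterion:
  assumes sub: "I \<subseteq> carrier R" and zero: "\<zero> \<in> I"
    and add: "\<And>a b. a \<in> I \<Longrightarrow> b \<in> I \<Longrightarrow> a \<oplus> b \<in> I"
    and mult: "\<And>a x. a \<in> I \<Longrightarrow> x \<in> carrier R \<Longrightarrow> x \<otimes> a \<in> I"
  shows "ideal I R"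
proof (rule idealI)
  show "ring R" by (rule ring_axioms)
  show "subgroup I (add_monoid R)"
  proof (rule add.subgroupI)
    fix a assume a: "a \<in> I"
    then have "(\<ominus> \<one>) \<otimes> a \<in> I" by (intro mult) auto
    with a sub have "\<ominus> a \<in> I" by (auto simp: l_minus)
    then show "\<ominus> a \<in> I" .
  qed (use sub zero add in auto)
  show "x \<otimes> a \<in> I" "a \<otimes> x \<in> I" if "a \<in> I" "x \<in> carrier R" for a x
    using mult[OF that] that sub m_comm[of a x] by auto
qed

text \<open>The ideal J + (x), written so that membership yields a decomposition at once;
  \<open>adjoin_Idl\<close> links it with generated ideals.\<close>

definition adjoin :: "('a, 'm) ring_scheme \<Rightarrow> 'a set \<Rightarrow> 'a \<Rightarrow> 'a set" where
  "adjoin R J x = {b \<oplus>\<^bsub>R\<^esub> x \<otimes>\<^bsub>R\<^esub> r | b r. b \<in> J \<and> r \<in> carrier R}"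

lemma adjoinI: "b \<in> J \<Longrightarrow> r \<in> carrier R \<Longrightarrow> b \<oplus>\<^bsub>R\<^esub> x \<otimes>\<^bsub>R\<^esub> r \<in> adjoin R J x"
  by (auto simp: adjoin_def)

lemma adjoinE:
  assumes "a \<in> adjoin R J x"
  obtains b r where "b \<in> J" "r \<in> carrier R" "a = b \<oplus>\<^bsub>R\<^esub> x \<otimes>\<^bsub>R\<^esub> r"
  using assms by (auto simp: adjoin_def)

context mpoly_ring
begin

abbreviation var :: "'v \<Rightarrow> 'v multiset \<Rightarrow> 'a" where "var v \<equiv> mon \<one>\<^bsub>K\<^esub> {#v#}"

lemma indexed_var_eq: "ring.indexed_var K v = var v"
  by (auto simp: K.indexed_var_def K.indexed_pmult_def K.indexed_const_def mon_def fun_eq_iff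
      dest: multi_member_split)

lemma var_closed: "v \<in> V \<Longrightarrow> var v \<in> carrier S"
  by (simp add: mon_closed)

lemma uminus_S: "f \<in> carrier S \<Longrightarrow> \<ominus> f = (\<lambda>m. \<ominus>\<^bsub>K\<^esub> f m)"
proof -
  assume f: "f \<in> carrier S"
  have "f \<oplus> \<ominus> f = \<zero>" using f by (simp add: r_neg)
  then have "f m \<oplus>\<^bsub>K\<^esub> (\<ominus> f) m = \<zero>\<^bsub>K\<^esub>" for m by (metis add_S zero_S)
  then show ?thesis using f by (auto simp: fun_eq_iff intro!: K.minus_equality[symmetric] simp: K.a_comm)
qed

lemma supp_add: "supp (f \<oplus> g) \<subseteq> supp f \<union> supp g"
  by (auto simp: supp_def add_S)

lemma supp_uminus: "f \<in> carrier S \<Longrightarrow> supp (\<ominus> f) = supp f"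
  by (auto simp: supp_def uminus_S)

lemma supp_minus: "f \<in> carrier S \<Longrightarrow> g \<in> carrier S \<Longrightarrow> supp (f \<ominus> g) \<subseteq> supp f \<union> supp g"
  using supp_add[of f "\<ominus> g"] by (simp add: a_minus_def supp_uminus)

lemma supp_zero: "supp \<zero> = {}"
  by (auto simp: supp_def zero_S)

lemma supp_empty_iff: "supp f = {} \<longleftrightarrow> f = \<zero>"
  by (auto simp: supp_def zero_S fun_eq_iff)

lemma supp_one: "supp \<one> = {{#}}"
  by (auto simp: supp_def one_S mon_def)

lemma supp_mon_eq: "c \<noteq> \<zero>\<^bsub>K\<^esub> \<Longrightarrow> supp (mon c p) = {p}"
  by (auto simp: supp_def mon_def)

lemma supp_mult:
  assumes f: "f \<in> carrier S" "g \<in> carrier S" and m: "m \<in> supp (f \<otimes> g)"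
  obtains p q where "p \<in> supp f" "q \<in> supp g" "m = p + q"
proof -
  have "\<exists>p. p \<subseteq># m \<and> p \<in> supp f \<and> m - p \<in> supp g"
  proof (rule ccontr)
    assume n: "\<not> ?thesis"
    have "(f \<otimes> g) m = (\<Oplus>\<^bsub>K\<^esub> p \<in> {p. p \<subseteq># m}. \<zero>\<^bsub>K\<^esub>)"
      unfolding mult_S
      by (rule K.finsum_cong') (use n f in \<open>auto simp: supp_def\<close>)
    with m show False by (simp add: supp_def)
  qed
  then obtain p where "p \<subseteq># m" "p \<in> supp f" "m - p \<in> supp g" by blast
  with that[of p "m - p"] show ?thesis by simp
qed

text \<open>If \<open>p + q\<close> splits in only one way over the two supports, a single
  convolution term remains. The intended use is the product of leading terms.\<close>

lemma mult_coeff_unique: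
  assumes f: "f \<in> carrier S" "g \<in> carrier S"
    and u: "\<And>p' q'. p' \<in> supp f \<Longrightarrow> q' \<in> supp g \<Longrightarrow> p' + q' = p + q \<Longrightarrow> p' = p"
  shows "(f \<otimes> g) (p + q) = f p \<otimes>\<^bsub>K\<^esub> g q"
proof -
  have "(f \<otimes> g) (p + q) = (\<Oplus>\<^bsub>K\<^esub> r \<in> {r. r \<subseteq># p + q}. if p = r then f r \<otimes>\<^bsub>K\<^esub> g (p + q - r) else \<zero>\<^bsub>K\<^esub>)"
    unfolding mult_S
  proof (rule K.finsum_cong')
    fix r assume r: "r \<in> {r. r \<subseteq># p + q}"
    show "f r \<otimes>\<^bsub>K\<^esub> g (p + q - r) = (if p = r then f r \<otimes>\<^bsub>K\<^esub> g (p + q - r) else \<zero>\<^bsub>K\<^esub>)"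
    proof (cases "r \<in> supp f \<and> p + q - r \<in> supp g")
      case True
      with r u[of r "p + q - r"] show ?thesis by simp
    next
      case False
      then show ?thesis using f by (auto simp: supp_def)
    qed
  qed (use f in auto)
  also have "\<dots> = f p \<otimes>\<^bsub>K\<^esub> g (p + q - p)"
    by (rule K.finsum_singleton) (use f finite_submultisets[of "p + q"] in auto)
  finally show ?thesis by simp
qed

definition part :: "('v multiset \<Rightarrow> bool) \<Rightarrow> ('v multiset \<Rightarrow> 'a) \<Rightarrow> 'v multiset \<Rightarrow> 'a" where
  "part Q f = (\<lambda>m. if Q m then f m else \<zero>\<^bsub>K\<^esub>)"

lemma supp_part: "supp (part Q f) = {m \<in> supp f. Q m}"
  by (auto simp: supp_def part_def)

lemma part_closed: "f \<in> carrier S \<Longrightarrow> part Q f \<in> carrier S"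
  by (rule carrier_SI) (auto simp: supp_part finite_supp dest: supp_vars, auto simp: part_def)

lemma part_split: "f \<in> carrier S \<Longrightarrow> f = part Q f \<oplus> part (\<lambda>m. \<not> Q m) f"
  by (auto simp: part_def add_S fun_eq_iff)

text \<open>The quotient of \<open>f\<close> by the variable \<open>v\<close>, with the terms free
  of \<open>v\<close> dropped; \<open>shift_decomp\<close> is the resulting division with
  remainder.\<close>

definition shift :: "'v \<Rightarrow> ('v multiset \<Rightarrow> 'a) \<Rightarrow> 'v multiset \<Rightarrow> 'a" where
  "shift v f = (\<lambda>m. f (add_mset v m))"

lemma supp_shift: "m \<in> supp (shift v f) \<longleftrightarrow> add_mset v m \<in> supp f"
  by (auto simp: supp_def shift_def)

lemma shift_closed:
  assumes f: "f \<in> carrier S" shows "shift v f \<in> carrier S"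
proof (rule carrier_SI)
  have "supp (shift v f) \<subseteq> (\<lambda>m. m - {#v#}) ` supp f"
    by (auto simp: supp_shift image_iff intro!: bexI[of _ "add_mset v _"])
  then show "finite (supp (shift v f))" by (rule finite_subset) (use f finite_supp in auto)
  show "set_mset m \<subseteq> V" if "m \<in> supp (shift v f)" for m
    using that supp_vars[OF f, of "add_mset v m"] by (auto simp: supp_shift)
qed (use f in \<open>simp add: shift_def\<close>)

lemma shift_decomp:
  assumes f: "f \<in> carrier S" shows "f = part (\<lambda>m. v \<notin># m) f \<oplus> var v \<otimes> shift v f"
proof
  fix m
  show "f m = (part (\<lambda>m. v \<notin># m) f \<oplus> var v \<otimes> shift v f) m"
    using f shift_closed[OF f, of v] by (simp add: add_S mult_mon part_def) (simp add: shift_def)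
qed

lemma ideal_memI:
  assumes J: "ideal J S" and f: "f \<in> carrier S"
    and m: "\<And>m. m \<in> supp f \<Longrightarrow> mon \<one>\<^bsub>K\<^esub> m \<in> J"
  shows "f \<in> J"
  using f
proof (induction rule: mpoly_induct)
  case zero
  show ?case using J by (simp add: additive_subgroup.zero_closed ideal.axioms(1))
next
  case (mon_add c p g)
  interpret J: ideal J S by fact
  have "mon c {#} \<otimes> mon \<one>\<^bsub>K\<^esub> p \<in> J"
    using mon_add m by (intro J.I_l_closed) (auto simp: mon_closed)
  then show ?case using mon_add by (simp add: mon_mult_mon)
qed

text \<open>Squarefree monomial ideals: whether a monomial belongs depends only on its set of
  variables. A predicate in place of generators turns colons and added variables into operations on
  predicates; monotonicity of \<open>D\<close> makes it an ideal.\<close>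

definition mono_ideal :: "('v set \<Rightarrow> bool) \<Rightarrow> ('v multiset \<Rightarrow> 'a) set" where
  "mono_ideal D = {f \<in> carrier S. \<forall>m\<in>supp f. D (set_mset m)}"

lemma mono_ideal_cong:
  "(\<And>A. A \<subseteq> V \<Longrightarrow> D A = D' A) \<Longrightarrow> mono_ideal D = mono_ideal D'"
  using supp_vars by (auto simp: mono_ideal_def)

lemma mono_ideal_is_ideal:
  assumes "mono D" shows "ideal (mono_ideal D) S"
proof (rule ideal_criterion)
  show "mono_ideal D \<subseteq> carrier S" "\<zero> \<in> mono_ideal D" by (auto simp: mono_ideal_def supp_zero)
  show "x \<oplus> y \<in> mono_ideal D" if "x \<in> mono_ideal D" "y \<in> mono_ideal D" for x y
    using that supp_add[of x y] by (auto simp: mono_ideal_def)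
  show "x \<otimes> a \<in> mono_ideal D" if a: "a \<in> mono_ideal D" and x: "x \<in> carrier S" for a x
  proof -
    have "D (set_mset m)" if m: "m \<in> supp (x \<otimes> a)" for m
    proof -
      have "a \<in> carrier S" using a by (simp add: mono_ideal_def)
      then obtain p q where "q \<in> supp a" "m = p + q"
        using supp_mult[OF x _ m] by metis
      moreover from this have "D (set_mset q)" using a by (auto simp: mono_ideal_def)
      ultimately show ?thesis using monoD[OF assms, of "set_mset q" "set_mset m"] by auto
    qed
    then show ?thesis using a x by (auto simp: mono_ideal_def)
  qed
qed

text \<open>Multiplication by a monomial translates the support injectively, so nothing cancels and
  the condition is transported monomial by monomial.\<close>

lemma mono_ideal_colon:
  assumes p: "set_mset p \<subseteq> V" and f: "f \<in> carrier S"
  shows "mon \<one>\<^bsub>K\<^esub> p \<otimes> f \<in> mono_ideal D \<longleftrightarrow> f \<in> mono_ideal (\<lambda>A. D (A \<union> set_mset p))"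
proof -
  have "supp (mon \<one>\<^bsub>K\<^esub> p \<otimes> f) = (+) p ` supp f"
  proof (intro subset_antisym subsetI)
    fix m assume "m \<in> supp (mon \<one>\<^bsub>K\<^esub> p \<otimes> f)"
    then show "m \<in> (+) p ` supp f"
      using f by (intro image_eqI[of _ _ "m - p"]) (auto simp: supp_def mult_mon split: if_splits)
  qed (use f in \<open>auto simp: supp_def mult_mon\<close>)
  then show ?thesis using p f by (auto simp: mono_ideal_def mon_closed Un_commute)
qed

text \<open>For the inclusion from right to left \<open>f\<close> is divided by the variable: no
  monomial of the remainder contains \<open>v\<close>, so all of them satisfy
  \<open>D\<close>.\<close>

lemma mono_ideal_add_var:
  assumes D: "mono D" and v: "v \<in> V"
  shows "adjoin S (mono_ideal D) (var v) = mono_ideal (\<lambda>A. v \<in> A \<or> D A)"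
proof (intro subset_antisym subsetI)
  have D': "mono (\<lambda>A. v \<in> A \<or> D A)" using D by (auto simp: mono_def)
  then have I: "ideal (mono_ideal (\<lambda>A. v \<in> A \<or> D A)) S" by (rule mono_ideal_is_ideal)
  fix f assume "f \<in> adjoin S (mono_ideal D) (var v)"
  then obtain g h where gh: "g \<in> mono_ideal D" "h \<in> carrier S" "f = g \<oplus> var v \<otimes> h"
    by (rule adjoinE)
  have "var v \<in> mono_ideal (\<lambda>A. v \<in> A \<or> D A)"
    using v by (simp add: mono_ideal_def var_closed supp_mon_eq)
  moreover have "g \<in> mono_ideal (\<lambda>A. v \<in> A \<or> D A)"
    using gh by (auto simp: mono_ideal_def)
  ultimately show "f \<in> mono_ideal (\<lambda>A. v \<in> A \<or> D A)"
    using gh ideal.I_r_closed[OF I] additive_subgroup.a_closed[OF ideal.axioms(1)[OF I]] by simp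
next
  fix f assume f: "f \<in> mono_ideal (\<lambda>A. v \<in> A \<or> D A)"
  then have fc: "f \<in> carrier S" by (auto simp: mono_ideal_def)
  have "part (\<lambda>m. v \<notin># m) f \<in> mono_ideal D"
    using f by (auto simp: mono_ideal_def supp_part part_closed)
  then show "f \<in> adjoin S (mono_ideal D) (var v)"
    using adjoinI[of _ _ "shift v f" S "var v"] shift_closed[OF fc, of v] by (subst shift_decomp[OF fc, of v]) auto
qed

text \<open>Maximality is only asked among the monomials in \<open>W\<close>. A competing pair with
  the same sum also lies in \<open>W\<close>, since its variables occur in \<open>p + q\<close>;
  both members are then at most the maxima, and strictness of addition forces equality.\<close>

lemma lead_coeff_mult:
  assumes f: "f \<in> carrier S" "g \<in> carrier S"
    and p: "p \<in> supp f" "\<And>p'. p' \<in> supp f \<Longrightarrow> set_mset p' \<subseteq> W \<Longrightarrow> p' \<le> p"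
    and q: "q \<in> supp g" "\<And>q'. q' \<in> supp g \<Longrightarrow> set_mset q' \<subseteq> W \<Longrightarrow> q' \<le> q"
    and W: "set_mset p \<subseteq> W" "set_mset q \<subseteq> W"
  shows "p + q \<in> supp (f \<otimes> g)"
proof -
  have "(f \<otimes> g) (p + q) = f p \<otimes>\<^bsub>K\<^esub> g q"
  proof (rule mult_coeff_unique[OF f])
    fix p' q' assume *: "p' \<in> supp f" "q' \<in> supp g" "p' + q' = p + q"
    then have "set_mset p' \<subseteq> W" "set_mset q' \<subseteq> W"
      using W by (metis Un_subset_iff set_mset_union)+
    with * p q have le: "p' \<le> p" "q' \<le> q" by auto
    show "p' = p"
    proof (rule ccontr)
      assume "p' \<noteq> p"
      with le have "p' + q' < p + q" by (simp add: add_less_le_mono)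
      with * show False by simp
    qed
  qed
  moreover have "f p \<otimes>\<^bsub>K\<^esub> g q \<noteq> \<zero>\<^bsub>K\<^esub>"
    using f p q K.integral[of "f p" "g q"] by (auto simp: supp_def)
  ultimately show ?thesis by (simp add: supp_def)
qed

text \<open>The prime ideal generated by the variables outside \<open>W\<close>.\<close>

abbreviation face_prime :: "'v set \<Rightarrow> ('v multiset \<Rightarrow> 'a) set" where
  "face_prime W \<equiv> mono_ideal (\<lambda>A. \<not> A \<subseteq> W)"

lemma face_prime_ideal: "ideal (face_prime W) S"
  by (rule mono_ideal_is_ideal) (auto simp: mono_def)

text \<open>Two elements outside the ideal each have a largest monomial supported in
  \<open>W\<close>; the sum of the two occurs in the product and is again supported in
  \<open>W\<close>.\<close>

lemma primeideal_face_prime: "primeideal (face_prime W) S"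
proof (rule primeidealI)
  show "ideal (face_prime W) S" by (rule face_prime_ideal)
  show "cring S" by (rule is_cring)
  have "\<one> \<notin> face_prime W" by (simp add: mono_ideal_def supp_one)
  then show "carrier S \<noteq> face_prime W" by auto
  fix f g assume fg: "f \<in> carrier S" "g \<in> carrier S" "f \<otimes> g \<in> face_prime W"
  show "f \<in> face_prime W \<or> g \<in> face_prime W"
  proof (rule ccontr)
    assume n: "\<not> ?thesis"
    have max: "\<exists>p\<in>supp f. set_mset p \<subseteq> W \<and> (\<forall>p'\<in>supp f. set_mset p' \<subseteq> W \<longrightarrow> p' \<le> p)"
      if "f \<in> carrier S" "f \<notin> face_prime W" for f
    proof -
      let ?T = "{m \<in> supp f. set_mset m \<subseteq> W}"
      have "finite ?T" "?T \<noteq> {}" using that by (auto simp: mono_ideal_def finite_supp)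
      then have "Max ?T \<in> ?T" "\<forall>m\<in>?T. m \<le> Max ?T" by (auto intro: Max_in Max_ge simp del: mem_Collect_eq)
      then show ?thesis by blast
    qed
    from n have "f \<notin> face_prime W" "g \<notin> face_prime W" by auto
    from max[OF fg(1) this(1)] obtain p where
      p: "p \<in> supp f" "set_mset p \<subseteq> W" "\<forall>p'\<in>supp f. set_mset p' \<subseteq> W \<longrightarrow> p' \<le> p" by blast
    from max[OF fg(2) \<open>g \<notin> face_prime W\<close>] obtain q where
      q: "q \<in> supp g" "set_mset q \<subseteq> W" "\<forall>p'\<in>supp g. set_mset p' \<subseteq> W \<longrightarrow> p' \<le> q" by blast
    from p q have "p + q \<in> supp (f \<otimes> g)"
      by (intro lead_coeff_mult[OF fg(1,2), of p W q]) blast+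
    moreover have "set_mset (p + q) \<subseteq> W" using p q by simp
    ultimately show False using fg(3) unfolding mono_ideal_def by blast
  qed
qed

lemma face_prime_mono: "W \<subseteq> Y \<Longrightarrow> face_prime Y \<subseteq> face_prime W"
  by (auto simp: mono_ideal_def)

lemma face_prime_le_iff:
  assumes "W \<subseteq> V" shows "face_prime Y \<subseteq> face_prime W \<longleftrightarrow> W \<subseteq> Y"
proof
  assume s: "face_prime Y \<subseteq> face_prime W"
  show "W \<subseteq> Y"
  proof (rule subsetI, rule ccontr)
    fix v assume v: "v \<in> W" "v \<notin> Y"
    with assms have "var v \<in> face_prime Y" by (auto simp: mono_ideal_def var_closed supp_mon_eq)
    with s have "var v \<in> face_prime W" by blast
    with v show False by (auto simp: mono_ideal_def supp_mon_eq)
  qed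
qed (rule face_prime_mono)

lemma face_prime_vars: "face_prime V = {\<zero>}"
proof -
  have "f = \<zero>" if "f \<in> face_prime V" for f
  proof -
    have "supp f = {}" using that supp_vars[of f] by (auto simp: mono_ideal_def)
    then show ?thesis by (simp add: supp_empty_iff)
  qed
  then show ?thesis by (auto simp: mono_ideal_def supp_zero)
qed

text \<open>The case \<open>W = V\<close> of the primes above, where the ideal is zero.\<close>

lemma domain_S: "domain S"
  using primeideal_face_prime[of V] zeroprimeideal_domainI by (simp add: face_prime_vars)

lemma face_prime_le:
  assumes J: "ideal J S" and v: "\<And>v. v \<in> V - W \<Longrightarrow> var v \<in> J"
  shows "face_prime W \<subseteq> J"
proof
  fix f assume f: "f \<in> face_prime W"
  show "f \<in> J"
  proof (rule ideal_memI[OF J])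
    show "f \<in> carrier S" using f by (auto simp: mono_ideal_def)
    fix m assume m: "m \<in> supp f"
    then obtain v where v': "v \<in># m" "v \<notin> W" using f by (auto simp: mono_ideal_def)
    have mV: "set_mset m \<subseteq> V" using f m supp_vars by (auto simp: mono_ideal_def)
    obtain p where p: "m = add_mset v p" using v' by (blast dest: multi_member_split)
    have "mon \<one>\<^bsub>K\<^esub> m = var v \<otimes> mon \<one>\<^bsub>K\<^esub> p" using mV p by (simp add: mon_mult_mon)
    also have "\<dots> \<in> J"
      using v v' mV p by (intro ideal.I_r_closed[OF J]) (auto simp: mon_closed)
    finally show "mon \<one>\<^bsub>K\<^esub> m \<in> J" .
  qed
qed

text \<open>The polynomials in the variables \<open>Z\<close>, kept as a subset of \<open>S\<close>
  so that no embeddings between polynomial rings occur.\<close>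

definition subpolys :: "'v set \<Rightarrow> ('v multiset \<Rightarrow> 'a) set" where
  "subpolys Z = {f \<in> carrier S. \<forall>m\<in>supp f. set_mset m \<subseteq> Z}"

lemma subpolys_carrier: "f \<in> subpolys Z \<Longrightarrow> f \<in> carrier S"
  by (simp add: subpolys_def)

lemma subpolys_zero: "\<zero> \<in> subpolys Z"
  by (simp add: subpolys_def supp_zero)

lemma subpolys_one: "\<one> \<in> subpolys Z"
  by (simp add: subpolys_def supp_one)

lemma subpolys_var: "v \<in> Z \<Longrightarrow> v \<in> V \<Longrightarrow> var v \<in> subpolys Z"
  by (simp add: subpolys_def var_closed supp_mon_eq)

lemma subpolys_add: "f \<in> subpolys Z \<Longrightarrow> g \<in> subpolys Z \<Longrightarrow> f \<oplus> g \<in> subpolys Z"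
  using supp_add[of f g] unfolding subpolys_def by blast

lemma subpolys_mult:
  assumes "f \<in> subpolys Z" "g \<in> subpolys Z" shows "f \<otimes> g \<in> subpolys Z"
proof -
  have c: "f \<in> carrier S" "g \<in> carrier S" using assms by (auto simp: subpolys_def)
  have "set_mset m \<subseteq> Z" if m: "m \<in> supp (f \<otimes> g)" for m
    using supp_mult[OF c m] assms unfolding subpolys_def by (metis (no_types, lifting) Un_subset_iff mem_Collect_eq set_mset_union)
  with c show ?thesis by (simp add: subpolys_def)
qed

end

sublocale mpoly_ring \<subseteq> domain S
  by (rule domain_S)

section \<open>Noetherian polynomial rings\<close>

text \<open>Some subsequence is monotone; if it decreases, it is constant from the place of its
  minimum on.\<close>

lemma nat_seq_mono_subseq:
  fixes f :: "nat \<Rightarrow> nat"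
  shows "\<exists>r :: nat \<Rightarrow> nat. strict_mono r \<and> mono (f \<circ> r)"
proof -
  obtain r :: "nat \<Rightarrow> nat" where r: "strict_mono r" "monoseq (f \<circ> r)"
    using seq_monosub[of f] by (auto simp: comp_def)
  show ?thesis
  proof (cases "incseq (f \<circ> r)")
    case True
    with r show ?thesis by blast
  next
    case False
    with r have dec: "decseq (f \<circ> r)" by (simp add: monoseq_iff)
    obtain n where n: "\<And>k. f (r n) \<le> f (r k)"
      using ex_has_least_nat[of "\<lambda>_. True" _ "f \<circ> r"] by auto
    have const: "f (r (k + n)) = f (r n)" for k
      using n[of "k + n"] decseqD[OF dec, of n "k + n"] by simp
    have "strict_mono (\<lambda>k. r (k + n))" using r(1) by (simp add: strict_mono_def)
    then show ?thesis by (intro exI[of _ "\<lambda>k. r (k + n)"]) (simp add: comp_def const mono_def)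
  qed
qed

text \<open>The variables are treated one after the other; passing to a further subsequence keeps
  the monotonicity already obtained.\<close>

lemma dickson_subseq:
  fixes s :: "nat \<Rightarrow> 'v multiset"
  assumes "finite V"
  shows "\<exists>r :: nat \<Rightarrow> nat. strict_mono r \<and> (\<forall>v\<in>V. mono (\<lambda>i. count (s (r i)) v))"
  using assms
proof (induction V)
  case empty
  show ?case by (auto intro: exI[of _ id] simp: strict_mono_def)
next
  case (insert v V)
  then obtain r :: "nat \<Rightarrow> nat" where r: "strict_mono r" "\<forall>v\<in>V. mono (\<lambda>i. count (s (r i)) v)" by blast
  obtain q :: "nat \<Rightarrow> nat" where q: "strict_mono q" "mono ((\<lambda>i. count (s (r i)) v) \<circ> q)"
    using nat_seq_mono_subseq by blast
  have "strict_mono (r \<circ> q)" using r q by (simp add: strict_mono_o)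
  moreover have "mono (\<lambda>i. count (s (r (q i))) u)" if "u \<in> V" for u
    using r(2) that q(1) by (auto simp: mono_def strict_mono_less_eq)
  ultimately show ?case using q by (intro exI[of _ "r \<circ> q"]) (auto simp: comp_def)
qed

text \<open>\<open>B\<close> consists of the monomials minimal for divisibility. If it were
  infinite, the monotone subsequence would give two distinct members, one dividing the other. Below
  each monomial a minimal one is reached by descent on the size.\<close>

lemma dickson:
  fixes L :: "'v multiset set"
  assumes V: "finite V" and L: "\<And>m. m \<in> L \<Longrightarrow> set_mset m \<subseteq> V"
  obtains B where "finite B" "B \<subseteq> L" "\<And>m. m \<in> L \<Longrightarrow> \<exists>b\<in>B. b \<subseteq># m"
proof -
  define B where "B = {b \<in> L. \<forall>m\<in>L. m \<subseteq># b \<longrightarrow> m = b}"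
  have "finite B"
  proof (rule ccontr)
    assume "infinite B"
    then obtain s :: "nat \<Rightarrow> 'v multiset" where s: "inj s" "range s \<subseteq> B"
      using infinite_countable_subset by blast
    obtain r :: "nat \<Rightarrow> nat" where r: "strict_mono r" "\<forall>v\<in>V. mono (\<lambda>i. count (s (r i)) v)"
      using dickson_subseq[OF V] by blast
    have "count (s (r 0)) v \<le> count (s (r 1)) v" for v
    proof (cases "v \<in> V")
      case True
      with r(2) show ?thesis by (auto simp: mono_def)
    next
      case False
      have "s (r 0) \<in> L" using s(2) by (auto simp: B_def)
      with False L have "v \<notin># s (r 0)" by blast
      then show ?thesis by (simp add: not_in_iff)
    qed
    then have "s (r 0) \<subseteq># s (r 1)" by (simp add: subseteq_mset_def)
    moreover have "s (r 0) \<in> B" "s (r 1) \<in> B" using s(2) by auto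
    ultimately have "s (r 0) = s (r 1)" by (auto simp: B_def)
    then have "r 0 = r 1" using s(1) by (simp add: inj_eq)
    then show False using r(1) by (simp add: strict_mono_eq)
  qed
  moreover have "\<exists>b\<in>B. b \<subseteq># m" if "m \<in> L" for m
    using that
  proof (induction "size m" arbitrary: m rule: less_induct)
    case less
    show ?case
    proof (cases "m \<in> B")
      case False
      with less obtain m' where m': "m' \<in> L" "m' \<subset># m"
        by (auto simp: B_def subset_mset.less_le)
      then have "size m' < size m" by (simp add: mset_subset_size)
      with less m' obtain b where "b \<in> B" "b \<subseteq># m'" by blast
      with m' show ?thesis by (meson subset_mset.order_trans subset_mset.less_imp_le)
    qed auto
  qed
  ultimately show ?thesis using that[of B] by (auto simp: B_def)
qed

context mpoly_ring
begin

text \<open>Unspecified at the zero polynomial, whence the side conditions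
  \<open>f \<noteq> \<zero>\<close>.\<close>

definition lead :: "('v multiset \<Rightarrow> 'a) \<Rightarrow> 'v multiset" where
  "lead f = Max (supp f)"

lemma lead_max:
  assumes "f \<in> carrier S" "f \<noteq> \<zero>"
  shows "lead f \<in> supp f" "m \<in> supp f \<Longrightarrow> m \<le> lead f"
  using assms finite_supp[of f] supp_empty_iff[of f] by (auto simp: lead_def)

text \<open>Division by \<open>G\<close>: subtracting a suitable multiple of some \<open>g\<close>
  cancels the leading term of \<open>f\<close>, and the process stops because the monomial order is
  well-founded.\<close>

lemma ideal_generated_by_leads:
  assumes I: "ideal I S" and G: "G \<subseteq> I"
    and div: "\<And>f. f \<in> I \<Longrightarrow> f \<noteq> \<zero> \<Longrightarrow> \<exists>g\<in>G. g \<noteq> \<zero> \<and> lead g \<subseteq># lead f"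
  shows "I = Idl G"
proof
  have Ic: "I \<subseteq> carrier S" using I by (simp add: ideal.Icarr subsetI)
  with G have Gc: "G \<subseteq> carrier S" by blast
  have J: "ideal (Idl G) S" by (rule genideal_ideal[OF Gc])
  show "Idl G \<subseteq> I" by (rule genideal_minimal[OF I G])
  have "f \<in> Idl G" if "f \<in> I" "f \<noteq> \<zero>" for f
    using that
  proof (induction "lead f" arbitrary: f rule: less_induct)
    case less
    obtain g where g: "g \<in> G" "g \<noteq> \<zero>" "lead g \<subseteq># lead f" using div less by blast
    have fc: "f \<in> carrier S" and gc: "g \<in> carrier S" using less g Ic Gc by auto
    have gl: "g (lead g) \<noteq> \<zero>\<^bsub>K\<^esub>" using lead_max(1)[OF gc g(2)] by (simp add: supp_def)
    define c where "c = f (lead f) \<otimes>\<^bsub>K\<^esub> inv\<^bsub>K\<^esub> g (lead g)"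
    have gU: "g (lead g) \<in> Units K" using gl gc by (simp add: K.field_Units)
    have c: "c \<in> carrier K" unfolding c_def using gU fc by simp
    define p where "p = lead f - lead g"
    have pV: "set_mset p \<subseteq> V"
      using supp_vars[OF fc lead_max(1)[OF fc less(3)]] unfolding p_def by (meson in_diffD subset_eq)
    define h where "h = mon c p \<otimes> g"
    have hI: "h \<in> Idl G" unfolding h_def
      using g(1) genideal_self[OF Gc] mon_closed[OF c pV] ideal.I_l_closed[OF J] by auto
    then have hc: "h \<in> carrier S" using J by (simp add: ideal.Icarr)
    have fh: "f \<ominus> h \<in> I"
      using hI less(2) \<open>Idl G \<subseteq> I\<close> ideal.diff_closed[OF I] by blast
    have "(f \<ominus> h) \<in> Idl G"
    proof (cases "f \<ominus> h = \<zero>")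
      case True
      then show ?thesis using J by (simp add: additive_subgroup.zero_closed ideal.axioms(1))
    next
      case False
      have fhc: "f \<ominus> h \<in> carrier S" using fc hc by simp
      have "lead (f \<ominus> h) \<in> supp (f \<ominus> h)" by (rule lead_max(1)[OF fhc False])
      \<comment> \<open>A monomial of \<open>h\<close> is \<open>p\<close> plus a monomial of
        \<open>g\<close>, hence at most \<open>p + lead g = lead f\<close>; the coefficient at
        \<open>lead f\<close> itself cancels by the choice of \<open>c\<close>.\<close>
      moreover have "m < lead f" if m: "m \<in> supp (f \<ominus> h)" for m
      proof -
        have "m \<le> lead f"
        proof (cases "m \<in> supp f")
          case True
          then show ?thesis using lead_max(2)[OF fc less(3)] by simp
        next
          case False
          with m supp_minus[OF fc hc] have "m \<in> supp h" by blast
          then have "p \<subseteq># m" "m - p \<in> supp g"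
            unfolding h_def using c gc by (auto simp: supp_def mult_mon split: if_splits)
          then have "m - p \<le> lead g" using lead_max(2)[OF gc g(2)] by simp
          then have "(m - p) + p \<le> lead g + p" by (rule add_right_mono)
          then show ?thesis using \<open>p \<subseteq># m\<close> g(3) by (simp add: p_def)
        qed
        moreover have "(f \<ominus> h) (lead f) = \<zero>\<^bsub>K\<^esub>"
        proof -
          have "p \<subseteq># lead f" "lead f - p = lead g"
            using g(3) by (auto simp: p_def multiset_eq_iff subseteq_mset_def)
          then have "h (lead f) = c \<otimes>\<^bsub>K\<^esub> g (lead g)"
            unfolding h_def using c gc by (simp add: mult_mon)
          also have "\<dots> = f (lead f)"
            unfolding c_def using gU fc gc by (simp add: K.m_assoc)
          finally show ?thesis using fc hc by (simp add: a_minus_def add_S uminus_S K.r_neg)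
        qed
        ultimately show ?thesis using m by (auto simp: supp_def le_less)
      qed
      ultimately have "lead (f \<ominus> h) < lead f" by blast
      then show ?thesis by (rule less(1)[OF _ fh False])
    qed
    then have "(f \<ominus> h) \<oplus> h \<in> Idl G"
      using hI J by (simp add: additive_subgroup.a_closed ideal.axioms(1))
    moreover have "(f \<ominus> h) \<oplus> h = f" using fc hc by algebra
    ultimately show ?case by simp
  qed
  moreover have "\<zero> \<in> Idl G" using J by (simp add: additive_subgroup.zero_closed ideal.axioms(1))
  ultimately show "I \<subseteq> Idl G" by blast
qed

text \<open>By Dickson's lemma the leading monomials of an ideal have finitely many minimal
  elements; members realising these form a finite Groebner basis.\<close>

lemma noetherian_S: "noetherian_ring S"
proof (rule noetherian_ringI)
  fix I assume I: "ideal I S"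
  define L where "L = lead ` (I - {\<zero>})"
  have Ic: "I \<subseteq> carrier S" using I by (simp add: ideal.Icarr subsetI)
  have "set_mset m \<subseteq> V" if "m \<in> L" for m
  proof -
    obtain f where "f \<in> I" "f \<noteq> \<zero>" "m = lead f" using \<open>m \<in> L\<close> by (auto simp: L_def)
    with Ic lead_max(1)[of f] supp_vars[of f m] show ?thesis by auto
  qed
  from dickson[OF finite_vars this] obtain B where
    B: "finite B" "B \<subseteq> L" "\<And>m. m \<in> L \<Longrightarrow> \<exists>b\<in>B. b \<subseteq># m" by metis
  from B(1,2) obtain G where G: "G \<subseteq> I - {\<zero>}" "finite G" "B = lead ` G"
    unfolding L_def by (meson finite_subset_image)
  have "I = Idl G"
  proof (rule ideal_generated_by_leads[OF I])
    fix f assume "f \<in> I" "f \<noteq> \<zero>"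
    then have "lead f \<in> L" by (auto simp: L_def)
    with B(3) G show "\<exists>g\<in>G. g \<noteq> \<zero> \<and> lead g \<subseteq># lead f" by blast
  qed (use G in auto)
  then show "\<exists>A\<subseteq>carrier S. finite A \<and> I = Idl A" using G Ic by blast
qed

end

section \<open>The dimension of polynomial rings\<close>

text \<open>\<open>A\<close> indexes the unknowns and \<open>B\<close> the equations of a
  homogeneous linear system. Gaussian elimination: a trivial equation is discarded, any other one is
  solved for a pivot unknown.\<close>

lemma (in field) exists_linear_dependence:
  assumes "finite B" "finite A" "card B < card A"
    and "\<And>a b. a \<in> A \<Longrightarrow> b \<in> B \<Longrightarrow> f a b \<in> carrier R"
  shows "\<exists>c. c \<in> A \<rightarrow> carrier R \<and> (\<exists>a\<in>A. c a \<noteq> \<zero>) \<and> (\<forall>b\<in>B. (\<Oplus>a\<in>A. c a \<otimes> f a b) = \<zero>)"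
  using assms
proof (induction B arbitrary: A f)
  case empty
  then obtain a where "a \<in> A" by fastforce
  then show ?case by (intro exI[of _ "\<lambda>_. \<one>"]) (use one_not_zero in auto)
next
  case (insert b B)
  show ?case
  proof (cases "\<forall>a\<in>A. f a b = \<zero>")
    case True
    have "\<exists>c. c \<in> A \<rightarrow> carrier R \<and> (\<exists>a\<in>A. c a \<noteq> \<zero>) \<and> (\<forall>b\<in>B. (\<Oplus>a\<in>A. c a \<otimes> f a b) = \<zero>)"
      by (rule insert(3)) (use insert in auto)
    then obtain c where c: "c \<in> A \<rightarrow> carrier R" "\<exists>a\<in>A. c a \<noteq> \<zero>" "\<forall>b\<in>B. (\<Oplus>a\<in>A. c a \<otimes> f a b) = \<zero>"
      by blast
    have "(\<Oplus>a\<in>A. c a \<otimes> f a b) = (\<Oplus>a\<in>A. \<zero>)"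
      by (rule finsum_cong') (use True c(1) in \<open>auto simp: Pi_iff\<close>)
    with c show ?thesis by auto
  next
    case False
    then obtain a0 where a0: "a0 \<in> A" "f a0 b \<noteq> \<zero>" by blast
    define A' where "A' = A - {a0}"
    have A: "A = insert a0 A'" "a0 \<notin> A'" "finite A'" using a0 insert by (auto simp: A'_def)
    define q where "q a = f a b \<otimes> inv (f a0 b)" for a
    have u: "f a0 b \<in> Units R" using a0 insert by (simp add: field_Units)
    have fb [simp]: "f a b \<in> carrier R" if "a \<in> A" for a using insert that by simp
    have q [simp]: "q a \<in> carrier R" if "a \<in> A" for a
      unfolding q_def using u that by simp
    \<comment> \<open>Each remaining column is reduced by the multiple of the pivot column
      \<open>a0\<close> that clears its entry in equation \<open>b\<close>.\<close>
    define f' where "f' a b' = f a b' \<ominus> q a \<otimes> f a0 b'" for a b'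
    have "\<exists>c. c \<in> A' \<rightarrow> carrier R \<and> (\<exists>a\<in>A'. c a \<noteq> \<zero>) \<and> (\<forall>b\<in>B. (\<Oplus>a\<in>A'. c a \<otimes> f' a b) = \<zero>)"
      by (rule insert(3)) (use insert A in \<open>auto simp: f'_def\<close>)
    then obtain c where c: "c \<in> A' \<rightarrow> carrier R" "\<exists>a\<in>A'. c a \<noteq> \<zero>"
      "\<forall>b\<in>B. (\<Oplus>a\<in>A'. c a \<otimes> f' a b) = \<zero>" by blast
    define t where "t = (\<Oplus>a\<in>A'. c a \<otimes> q a)"
    have t: "t \<in> carrier R" unfolding t_def by (rule finsum_closed) (use c A in auto)
    \<comment> \<open>This value of the pivot unknown compensates the subtracted multiples: the full
      system at \<open>c'\<close> becomes the reduced one at \<open>c\<close>.\<close>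
    define c' where "c' = c(a0 := \<ominus> t)"
    have c': "c' \<in> A \<rightarrow> carrier R" using c t A by (auto simp: c'_def)
    have *: "(\<Oplus>a\<in>A. c' a \<otimes> f a b') = (\<Oplus>a\<in>A'. c a \<otimes> f' a b')" if b': "b' \<in> insert b B" for b'
    proof -
      have fc [simp]: "a \<in> A \<Longrightarrow> f a b' \<in> carrier R" for a using insert b' by blast
      have "(\<Oplus>a\<in>A. c' a \<otimes> f a b') = c' a0 \<otimes> f a0 b' \<oplus> (\<Oplus>a\<in>A'. c' a \<otimes> f a b')"
        unfolding A(1) by (rule finsum_insert) (use A c' in auto)
      also have "(\<Oplus>a\<in>A'. c' a \<otimes> f a b') = (\<Oplus>a\<in>A'. c a \<otimes> f' a b' \<oplus> (c a \<otimes> q a) \<otimes> f a0 b')"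
      proof (rule finsum_cong')
        fix a assume a: "a \<in> A'"
        then have m: "a \<in> A" "a \<noteq> a0" "c a \<in> carrier R" "f a b' \<in> carrier R" "q a \<in> carrier R" "f a0 b' \<in> carrier R"
          using A c by auto
        have "c a \<otimes> f a b' = c a \<otimes> (f a b' \<ominus> q a \<otimes> f a0 b') \<oplus> (c a \<otimes> q a) \<otimes> f a0 b'"
          using m(3-) by algebra
        then show "c' a \<otimes> f a b' = c a \<otimes> f' a b' \<oplus> (c a \<otimes> q a) \<otimes> f a0 b'"
          using m(2) by (simp add: c'_def f'_def)
      qed (use A c(1) in \<open>auto simp: f'_def Pi_iff\<close>)
      also have "\<dots> = (\<Oplus>a\<in>A'. c a \<otimes> f' a b') \<oplus> (\<Oplus>a\<in>A'. (c a \<otimes> q a) \<otimes> f a0 b')"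
        by (rule finsum_addf) (use A c(1) in \<open>auto simp: f'_def Pi_iff\<close>)
      also have "(\<Oplus>a\<in>A'. (c a \<otimes> q a) \<otimes> f a0 b') = t \<otimes> f a0 b'"
        unfolding t_def by (rule finsum_ldistr[symmetric]) (use A c in auto)
      finally have e: "(\<Oplus>a\<in>A. c' a \<otimes> f a b') =
         (\<ominus> t) \<otimes> f a0 b' \<oplus> ((\<Oplus>a\<in>A'. c a \<otimes> f' a b') \<oplus> t \<otimes> f a0 b')" by (simp add: c'_def)
      have s: "(\<Oplus>a\<in>A'. c a \<otimes> f' a b') \<in> carrier R"
        by (rule finsum_closed) (use A c(1) in \<open>auto simp: f'_def Pi_iff\<close>)
      have f0: "f a0 b' \<in> carrier R" using A by simp
      have "\<And>x y z. x \<in> carrier R \<Longrightarrow> y \<in> carrier R \<Longrightarrow> z \<in> carrier R \<Longrightarrow>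
         (\<ominus> x) \<otimes> y \<oplus> (z \<oplus> x \<otimes> y) = z" by algebra
      from this[OF t f0 s] e show ?thesis by simp
    qed
    have "(\<Oplus>a\<in>A'. c a \<otimes> f' a b) = (\<Oplus>a\<in>A'. \<zero>)"
    proof (rule finsum_cong')
      fix a assume a: "a \<in> A'"
      have "q a \<otimes> f a0 b = f a b" unfolding q_def using u a A by (simp add: m_assoc)
      moreover have "a \<in> A" "c a \<in> carrier R" using a A c(1) by auto
      ultimately show "c a \<otimes> f' a b = \<zero>" by (simp add: f'_def a_minus_def r_neg)
    qed auto
    then have "\<forall>b'\<in>insert b B. (\<Oplus>a\<in>A. c' a \<otimes> f a b') = \<zero>" using * c by auto
    moreover have "\<exists>a\<in>A. c' a \<noteq> \<zero>" using c(2) A by (auto simp: c'_def)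
    ultimately show ?thesis using c' by blast
  qed
qed

section \<open>The length of chains of primes, bounded by counting power products\<close>

primrec mpow :: "('a, 'm) ring_scheme \<Rightarrow> 'a list \<Rightarrow> nat list \<Rightarrow> 'a" where
  "mpow R [] ks = \<one>\<^bsub>R\<^esub>"
| "mpow R (a # as) ks = (a [^]\<^bsub>R\<^esub> (hd ks)) \<otimes>\<^bsub>R\<^esub> mpow R as (tl ks)"

lemma (in cring) mpow_closed: "set as \<subseteq> carrier R \<Longrightarrow> mpow R as ks \<in> carrier R"
  by (induction as arbitrary: ks) auto

text \<open>Elements taken from the successive steps of a chain of primes satisfy no polynomial relation
  with unit coefficients: the part of least degree in the first element would lie in the next prime.\<close>

lemma (in cring) prime_chain_independent:
  assumes "\<And>i. i \<le> length as \<Longrightarrow> primeideal (P i) R"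
    and "\<And>i. i < length as \<Longrightarrow> P i \<subseteq> P (Suc i)"
    and "\<And>i. i < length as \<Longrightarrow> as ! i \<in> P (Suc i) - P i"
    and "finite Y" "Y \<noteq> {}" "\<And>\<alpha>. \<alpha> \<in> Y \<Longrightarrow> length \<alpha> = length as" "c \<in> Y \<rightarrow> Units R"
  shows "(\<Oplus>\<alpha>\<in>Y. c \<alpha> \<otimes> mpow R as \<alpha>) \<notin> P 0"
  using assms
proof (induction as arbitrary: P Y c)
  case Nil
  then have Y: "Y = {[]}" by auto
  with Nil have u: "c [] \<in> Units R" by auto
  then have e: "(\<Oplus>\<alpha>\<in>Y. c \<alpha> \<otimes> mpow R [] \<alpha>) = c []"
    by (simp add: Y finsum_insert Units_closed)
  interpret P: primeideal "P 0" R using Nil by auto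
  show ?case
  proof
    assume "(\<Oplus>\<alpha>\<in>Y. c \<alpha> \<otimes> mpow R [] \<alpha>) \<in> P 0"
    then have "c [] \<in> P 0" by (simp only: e)
    then have "inv (c []) \<otimes> c [] \<in> P 0" using u by (intro P.I_l_closed) auto
    then have "\<one> \<in> P 0" using u by simp
    then show False using P.I_notcarr P.one_imp_carrier by simp
  qed
next
  case (Cons a as)
  interpret P0: primeideal "P 0" R using Cons by auto
  interpret P1: primeideal "P 1" R using Cons(2)[of 1] by auto
  have ax: "a \<in> P 1" "a \<notin> P 0" using Cons(4)[of 0] by auto
  then have ac [simp]: "a \<in> carrier R" by (simp add: P1.Icarr)
  have asc: "set as \<subseteq> carrier R"
  proof
    fix b assume "b \<in> set as"
    then obtain i where "i < length as" "b = as ! i" by (auto simp: in_set_conv_nth)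
    with Cons(4)[of "Suc i"] have "b \<in> P (Suc (Suc i))" by simp
    moreover have "primeideal (P (Suc (Suc i))) R" using Cons(2) \<open>i < length as\<close> by simp
    ultimately show "b \<in> carrier R" using primeideal.axioms(1) ideal.Icarr by metis
  qed
  have mc [simp]: "mpow R as \<beta> \<in> carrier R" for \<beta> using asc by (rule mpow_closed)
  have cu: "c \<alpha> \<in> Units R" "c \<alpha> \<in> carrier R" if "\<alpha> \<in> Y" for \<alpha> using Cons(8) that by auto
  have Ylen: "\<exists>k \<beta>. \<alpha> = k # \<beta> \<and> length \<beta> = length as" if "\<alpha> \<in> Y" for \<alpha>
    using Cons(7)[OF that] by (cases \<alpha>) auto
  \<comment> \<open>\<open>e\<close> is the least exponent of \<open>a\<close>, and \<open>Z\<close>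
    the terms attaining it. The sum is \<open>a [^] e\<close> times
    \<open>G \<oplus> a \<otimes> H\<close>. As \<open>a\<close> is outside the prime
    \<open>P 0\<close>, the second factor lies in \<open>P 0\<close>, thus in \<open>P 1\<close>; as
    \<open>a\<close> is in \<open>P 1\<close>, so is \<open>G\<close>. This contradicts the
    induction hypothesis for the chain from \<open>P 1\<close>.\<close>
  define e where "e = Min (hd ` Y)"
  have e: "e \<in> hd ` Y" "\<And>\<alpha>. \<alpha> \<in> Y \<Longrightarrow> e \<le> hd \<alpha>" using Cons(5,6) by (auto simp: e_def)
  define Z where "Z = {\<alpha> \<in> Y. hd \<alpha> = e}"
  define G where "G = (\<Oplus>\<alpha>\<in>Z. c \<alpha> \<otimes> mpow R as (tl \<alpha>))"
  define H where "H = (\<Oplus>\<alpha>\<in>Y - Z. c \<alpha> \<otimes> (a [^] (hd \<alpha> - Suc e) \<otimes> mpow R as (tl \<alpha>)))"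
  have ZY: "Z \<subseteq> Y" "finite Z" "finite (Y - Z)" using Cons(5) by (auto simp: Z_def)
  have Gc: "G \<in> carrier R" unfolding G_def by (rule finsum_closed) (use ZY cu in auto)
  have Hc: "H \<in> carrier R" unfolding H_def by (rule finsum_closed) (use ZY cu in auto)
  show ?case
  proof
    assume in0: "(\<Oplus>\<alpha>\<in>Y. c \<alpha> \<otimes> mpow R (a # as) \<alpha>) \<in> P 0"
    have t: "mpow R (a # as) \<alpha> = a [^] hd \<alpha> \<otimes> mpow R as (tl \<alpha>)" if "\<alpha> \<in> Y" for \<alpha>
      using Ylen[OF that] by auto
    have "(\<Oplus>\<alpha>\<in>Y. c \<alpha> \<otimes> mpow R (a # as) \<alpha>)
      = (\<Oplus>\<alpha>\<in>Z. c \<alpha> \<otimes> mpow R (a # as) \<alpha>) \<oplus> (\<Oplus>\<alpha>\<in>Y - Z. c \<alpha> \<otimes> mpow R (a # as) \<alpha>)"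
    proof -
      have "Y = Z \<union> (Y - Z)" using ZY by auto
      moreover have "(\<Oplus>\<alpha>\<in>Z \<union> (Y - Z). c \<alpha> \<otimes> mpow R (a # as) \<alpha>)
        = (\<Oplus>\<alpha>\<in>Z. c \<alpha> \<otimes> mpow R (a # as) \<alpha>) \<oplus> (\<Oplus>\<alpha>\<in>Y - Z. c \<alpha> \<otimes> mpow R (a # as) \<alpha>)"
        by (rule finsum_Un_disjoint) (use ZY cu in auto)
      ultimately show ?thesis by simp
    qed
    also have "(\<Oplus>\<alpha>\<in>Z. c \<alpha> \<otimes> mpow R (a # as) \<alpha>) = (\<Oplus>\<alpha>\<in>Z. a [^] e \<otimes> (c \<alpha> \<otimes> mpow R as (tl \<alpha>)))"
    proof (rule finsum_cong')
      fix \<alpha> assume "\<alpha> \<in> Z"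
      then have "\<alpha> \<in> Y" "hd \<alpha> = e" by (auto simp: Z_def)
      then show "c \<alpha> \<otimes> mpow R (a # as) \<alpha> = a [^] e \<otimes> (c \<alpha> \<otimes> mpow R as (tl \<alpha>))"
        using cu(2) by (simp add: t m_lcomm)
    qed (use ZY cu in auto)
    also have "\<dots> = a [^] e \<otimes> G"
      unfolding G_def by (rule finsum_rdistr[symmetric]) (use ZY cu in auto)
    also have "(\<Oplus>\<alpha>\<in>Y - Z. c \<alpha> \<otimes> mpow R (a # as) \<alpha>)
       = (\<Oplus>\<alpha>\<in>Y - Z. a [^] (Suc e) \<otimes> (c \<alpha> \<otimes> (a [^] (hd \<alpha> - Suc e) \<otimes> mpow R as (tl \<alpha>))))"
    proof (rule finsum_cong')
      fix \<alpha> assume "\<alpha> \<in> Y - Z"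
      then have \<alpha>: "\<alpha> \<in> Y" "Suc e \<le> hd \<alpha>" using e(2)[of \<alpha>] by (auto simp: Z_def)
      have "a [^] hd \<alpha> = a [^] (Suc e) \<otimes> a [^] (hd \<alpha> - Suc e)"
        using nat_pow_mult[OF ac, of "Suc e" "hd \<alpha> - Suc e"] \<alpha>(2) by (simp del: nat_pow_Suc)
      then show "c \<alpha> \<otimes> mpow R (a # as) \<alpha> = a [^] (Suc e) \<otimes> (c \<alpha> \<otimes> (a [^] (hd \<alpha> - Suc e) \<otimes> mpow R as (tl \<alpha>)))"
        using cu(2)[OF \<alpha>(1)] \<alpha>(1) by (simp add: t m_lcomm m_assoc del: nat_pow_Suc)
    qed (use ZY cu in auto)
    also have "\<dots> = a [^] (Suc e) \<otimes> H"
      unfolding H_def by (rule finsum_rdistr[symmetric]) (use ZY cu in auto)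
    also have "a [^] e \<otimes> G \<oplus> a [^] (Suc e) \<otimes> H = a [^] e \<otimes> (G \<oplus> a \<otimes> H)"
      using Gc Hc by (simp add: r_distr m_assoc)
    finally have "a [^] e \<otimes> (G \<oplus> a \<otimes> H) \<in> P 0" using in0 by simp
    moreover have "a [^] k \<notin> P 0" for k :: nat
    proof (induction k)
      case 0
      then show ?case using P0.I_notcarr P0.one_imp_carrier by auto
    next
      case (Suc k)
      then show ?case using P0.I_prime[of "a [^] k" a] ax by auto
    qed
    ultimately have "G \<oplus> a \<otimes> H \<in> P 0" using P0.I_prime[of "a [^] e" "G \<oplus> a \<otimes> H"] Gc Hc by auto
    then have 1: "G \<oplus> a \<otimes> H \<in> P 1" using Cons(3)[of 0] by auto
    have 2: "a \<otimes> H \<in> P 1" using ax Hc by (intro P1.I_r_closed)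
    have "(G \<oplus> a \<otimes> H) \<ominus> a \<otimes> H \<in> P 1" by (rule P1.diff_closed[OF 1 2])
    moreover have "(G \<oplus> a \<otimes> H) \<ominus> a \<otimes> H = G" using Gc Hc ac by algebra
    ultimately have G1: "G \<in> P 1" by simp
    have inj: "inj_on (\<lambda>\<beta>. e # \<beta>) (tl ` Z)" by (auto simp: inj_on_def)
    have img: "(\<lambda>\<beta>. e # \<beta>) ` tl ` Z = Z"
    proof -
      have "e # tl \<alpha> = \<alpha>" if "\<alpha> \<in> Z" for \<alpha> using that Ylen[of \<alpha>] by (auto simp: Z_def)
      then show ?thesis by (force simp: image_image)
    qed
    have "G = (\<Oplus>\<alpha>\<in>(\<lambda>\<beta>. e # \<beta>) ` tl ` Z. c \<alpha> \<otimes> mpow R as (tl \<alpha>))" by (simp add: G_def img)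
    also have "\<dots> = (\<Oplus>\<beta>\<in>tl ` Z. c (e # \<beta>) \<otimes> mpow R as (tl (e # \<beta>)))"
      by (rule finsum_reindex) (use inj ZY cu in \<open>auto simp: img\<close>)
    finally have G2: "G = (\<Oplus>\<beta>\<in>tl ` Z. c (e # \<beta>) \<otimes> mpow R as \<beta>)" by simp
    have "(\<Oplus>\<beta>\<in>tl ` Z. c (e # \<beta>) \<otimes> mpow R as \<beta>) \<notin> P (Suc 0)"
    proof (rule Cons(1)[of "\<lambda>i. P (Suc i)" "tl ` Z" "\<lambda>\<beta>. c (e # \<beta>)"])
      show "tl ` Z \<noteq> {}" using e(1) by (auto simp: Z_def)
      show "(\<lambda>\<beta>. c (e # \<beta>)) \<in> tl ` Z \<rightarrow> Units R"
      proof
        fix \<beta> assume "\<beta> \<in> tl ` Z"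
        then have "e # \<beta> \<in> Z" using img by blast
        then show "c (e # \<beta>) \<in> Units R" using ZY cu by blast
      qed
      show "length \<beta> = length as" if "\<beta> \<in> tl ` Z" for \<beta>
        using that ZY Ylen by force
      show "primeideal (P (Suc i)) R" if "i \<le> length as" for i using Cons(2)[of "Suc i"] that by simp
      show "P (Suc i) \<subseteq> P (Suc (Suc i))" if "i < length as" for i using Cons(3)[of "Suc i"] that by simp
      show "as ! i \<in> P (Suc (Suc i)) - P (Suc i)" if "i < length as" for i using Cons(4)[of "Suc i"] that by simp
    qed (use ZY in auto)
    with G1 G2 show False by simp
  qed
qed

text \<open>A monomial of size at most \<open>D\<close> is determined by its exponents, each at most
  \<open>D\<close>; the crude count of this box suffices.\<close>

lemma card_multisets_size_le:
  assumes V: "finite V"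
  shows "finite {m. set_mset m \<subseteq> V \<and> size m \<le> D}" (is "finite ?B")
    and "card {m. set_mset m \<subseteq> V \<and> size m \<le> D} \<le> (D + 1) ^ card V"
proof -
  have inj: "inj_on (\<lambda>m. restrict (count m) V) ?B"
  proof (rule inj_onI)
    fix m m' assume m: "m \<in> ?B" "m' \<in> ?B" "restrict (count m) V = restrict (count m') V"
    show "m = m'"
    proof (rule multiset_eqI)
      fix v
      show "count m v = count m' v"
      proof (cases "v \<in> V")
        case True
        then show ?thesis using fun_cong[OF m(3), of v] by simp
      next
        case False
        then have "v \<notin># m" "v \<notin># m'" using m by auto
        then show ?thesis by (simp add: not_in_iff)
      qed
    qed
  qed
  have sub: "(\<lambda>m. restrict (count m) V) ` ?B \<subseteq> (V \<rightarrow>\<^sub>E {..D})"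
    by (auto intro: order_trans[OF count_le_size])
  have fin: "finite (V \<rightarrow>\<^sub>E {..D})" using V by (simp add: finite_PiE)
  show "finite ?B" using finite_imageD[OF finite_subset[OF sub fin] inj] .
  have "card ?B \<le> card (V \<rightarrow>\<^sub>E {..D})" using card_inj_on_le[OF inj sub fin] .
  also have "\<dots> = (D + 1) ^ card V" using V by (simp add: card_PiE)
  finally show "card ?B \<le> (D + 1) ^ card V" .
qed

context mpoly_ring
begin

lemma finsum_coeff:
  assumes "finite A" "F \<in> A \<rightarrow> carrier S"
  shows "(\<Oplus>a\<in>A. F a) m = (\<Oplus>\<^bsub>K\<^esub>a\<in>A. F a m)"
  using assms
proof (induction A)
  case empty
  show ?case by (simp add: zero_S)
next
  case (insert a A)
  then have "(\<Oplus>a\<in>insert a A. F a) = F a \<oplus> (\<Oplus>a\<in>A. F a)" by (intro finsum_insert) auto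
  moreover have "(\<Oplus>\<^bsub>K\<^esub>a\<in>insert a A. F a m) = F a m \<oplus>\<^bsub>K\<^esub> (\<Oplus>\<^bsub>K\<^esub>a\<in>A. F a m)"
    using insert by (intro K.finsum_insert) (auto intro!: coeff_closed)
  ultimately show ?case using insert by (simp add: add_S)
qed

lemma const_unit:
  assumes "c \<in> carrier K" "c \<noteq> \<zero>\<^bsub>K\<^esub>" shows "mon c {#} \<in> Units S"
proof -
  have c: "c \<in> Units K" using assms by (simp add: K.field_Units)
  then have "mon c {#} \<otimes> mon (inv\<^bsub>K\<^esub> c) {#} = \<one>" using assms by (simp add: mon_mult_mon one_S)
  moreover have "mon (inv\<^bsub>K\<^esub> c) {#} \<in> carrier S" "mon c {#} \<in> carrier S"
    using c assms by (simp_all add: mon_closed)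
  ultimately show ?thesis using m_comm unfolding Units_def by fastforce
qed

lemma size_supp_mult:
  assumes "f \<in> carrier S" "g \<in> carrier S"
    "\<And>m. m \<in> supp f \<Longrightarrow> size m \<le> k" "\<And>m. m \<in> supp g \<Longrightarrow> size m \<le> l" "m \<in> supp (f \<otimes> g)"
  shows "size m \<le> k + l"
  using supp_mult[OF assms(1,2,5)] assms(3,4) by (metis add_mono size_union)

lemma size_supp_pow:
  assumes "f \<in> carrier S" "\<And>m. m \<in> supp f \<Longrightarrow> size m \<le> d" "m \<in> supp (f [^] (k :: nat))"
  shows "size m \<le> k * d"
  using assms(3)
proof (induction k arbitrary: m)
  case 0
  then show ?case by (simp add: supp_one)
next
  case (Suc k)
  have "size m \<le> k * d + d"
    by (rule size_supp_mult[of "f [^] k" f]) (use assms Suc in auto)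
  then show ?case by simp
qed

lemma size_supp_mpow:
  assumes "set as \<subseteq> carrier S" "\<And>a m. a \<in> set as \<Longrightarrow> m \<in> supp a \<Longrightarrow> size m \<le> d"
    "length \<alpha> = length as" "\<And>k. k \<in> set \<alpha> \<Longrightarrow> k \<le> N" "m \<in> supp (mpow S as \<alpha>)"
  shows "size m \<le> length as * (N * d)"
  using assms
proof (induction as arbitrary: \<alpha> m)
  case Nil
  then show ?case by (simp add: supp_one)
next
  case (Cons a as)
  then obtain k \<beta> where \<alpha>: "\<alpha> = k # \<beta>" "length \<beta> = length as" by (cases \<alpha>) auto
  have "size m \<le> N * d + length as * (N * d)"
  proof (rule size_supp_mult[of "a [^] k" "mpow S as \<beta>"])
    show "size m \<le> N * d" if "m \<in> supp (a [^] k)" for m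
    proof -
      have "size m \<le> k * d" by (rule size_supp_pow[of a]) (use Cons that in auto)
      also have "\<dots> \<le> N * d" using Cons \<alpha> by simp
      finally show ?thesis .
    qed
    show "size m \<le> length as * (N * d)" if "m \<in> supp (mpow S as \<beta>)" for m
      by (rule Cons(1)[of \<beta>]) (use Cons \<alpha> that in auto)
    show "m \<in> supp (a [^] k \<otimes> mpow S as \<beta>)" using Cons \<alpha> by simp
  qed (use Cons in \<open>auto intro: mpow_closed\<close>)
  then show ?case by simp
qed

text \<open>For large \<open>N\<close> the power products with exponents below \<open>N\<close>
  outnumber the monomials that can occur in them, because there are more factors than variables.
  This forces a linear dependence over \<open>K\<close>.\<close>

lemma exists_algebraic_relation:
  assumes as: "set as \<subseteq> carrier S" "card V < length as"
  obtains Y c where "finite Y" "Y \<noteq> {}" "\<And>\<alpha>. \<alpha> \<in> Y \<Longrightarrow> length \<alpha> = length as"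
    "c \<in> Y \<rightarrow> Units S" "(\<Oplus>\<alpha>\<in>Y. c \<alpha> \<otimes> mpow S as \<alpha>) = \<zero>"
proof -
  define n where "n = card V"
  define l where "l = length as"
  \<comment> \<open>A common degree bound; the extra 0 keeps the set non-empty when all the
    polynomials vanish.\<close>
  define d where "d = Max (size ` (\<Union>a\<in>set as. supp a) \<union> {0})"
  have fin: "finite (size ` (\<Union>a\<in>set as. supp a) \<union> {0})" using as finite_supp by auto
  have d: "size m \<le> d" if "a \<in> set as" "m \<in> supp a" for a m
    unfolding d_def by (rule Max_ge[OF fin]) (use that in auto)
  \<comment> \<open>The degrees are at most D = l N d, and D + 1 \<le> N C. As N exceeds C^n, the
    number of monomials is at most (N C)^n = N^n C^n < N^(n+1) \<le> N^l, the number of power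
    products.\<close>
  define C where "C = l * d + 1"
  define N where "N = C ^ n + 1"
  define A where "A = {\<alpha> :: nat list. set \<alpha> \<subseteq> {..<N} \<and> length \<alpha> = l}"
  define D where "D = l * (N * d)"
  define B where "B = {m. set_mset m \<subseteq> V \<and> size m \<le> D}"
  have A: "finite A" "card A = N ^ l" by (auto simp: A_def finite_lists_length_eq card_lists_length_eq)
  have B: "finite B" "card B \<le> (D + 1) ^ n"
    using card_multisets_size_le[OF finite_vars, of D] by (auto simp: B_def n_def)
  have "D + 1 \<le> N * C" by (simp add: D_def C_def N_def algebra_simps)
  then have "(D + 1) ^ n \<le> (N * C) ^ n" by (rule power_mono) simp
  also have "\<dots> = N ^ n * C ^ n" by (simp add: power_mult_distrib)
  also have "\<dots> < N ^ n * N" by (simp add: N_def)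
  also have "\<dots> \<le> N ^ l"
    using as(2) power_increasing[of "Suc n" l N] by (simp add: n_def l_def N_def mult.commute)
  finally have "card B < card A" using A B by simp
  then obtain c where c: "c \<in> A \<rightarrow> carrier K" "\<exists>a\<in>A. c a \<noteq> \<zero>\<^bsub>K\<^esub>"
    "\<forall>b\<in>B. (\<Oplus>\<^bsub>K\<^esub>a\<in>A. c a \<otimes>\<^bsub>K\<^esub> mpow S as a b) = \<zero>\<^bsub>K\<^esub>"
    using K.exists_linear_dependence[of B A "mpow S as"] A B mpow_closed[OF as(1)] by auto
  \<comment> \<open>Zero coefficients are discarded so that all remaining ones are units of
    \<open>S\<close>, as \<open>prime_chain_independent\<close> demands.\<close>
  define Y where "Y = {\<alpha> \<in> A. c \<alpha> \<noteq> \<zero>\<^bsub>K\<^esub>}"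
  have YA: "Y \<subseteq> A" "finite Y" using A by (auto simp: Y_def)
  have cY: "mon (c \<alpha>) {#} \<in> Units S" if "\<alpha> \<in> Y" for \<alpha>
    using that c by (auto simp: Y_def intro!: const_unit)
  have "(\<Oplus>\<alpha>\<in>Y. mon (c \<alpha>) {#} \<otimes> mpow S as \<alpha>) = \<zero>"
  proof
    fix m
    have "(\<Oplus>\<alpha>\<in>Y. mon (c \<alpha>) {#} \<otimes> mpow S as \<alpha>) m = (\<Oplus>\<^bsub>K\<^esub>\<alpha>\<in>Y. (mon (c \<alpha>) {#} \<otimes> mpow S as \<alpha>) m)"
      by (rule finsum_coeff) (use YA cY mpow_closed[OF as(1)] in auto)
    also have "\<dots> = (\<Oplus>\<^bsub>K\<^esub>\<alpha>\<in>A. c \<alpha> \<otimes>\<^bsub>K\<^esub> mpow S as \<alpha> m)"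
    proof (rule K.add.finprod_mono_neutral_cong_left)
      show "\<And>i. i \<in> A - Y \<Longrightarrow> c i \<otimes>\<^bsub>K\<^esub> mpow S as i m = \<zero>\<^bsub>K\<^esub>"
        using mpow_closed[OF as(1)] by (auto simp: Y_def)
      show "\<And>x. x \<in> Y \<Longrightarrow> (mon (c x) {#} \<otimes> mpow S as x) m = c x \<otimes>\<^bsub>K\<^esub> mpow S as x m"
        using YA c mpow_closed[OF as(1)] by (subst mult_mon) auto
      show "(\<lambda>\<alpha>. c \<alpha> \<otimes>\<^bsub>K\<^esub> mpow S as \<alpha> m) \<in> A \<rightarrow> carrier K"
        using c mpow_closed[OF as(1)] by auto
    qed (use A YA in auto)
    also have "\<dots> = \<zero>\<^bsub>K\<^esub>"
    proof (cases "m \<in> B")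
      case True
      with c show ?thesis by simp
    next
      case False
      have "mpow S as \<alpha> m = \<zero>\<^bsub>K\<^esub>" if "\<alpha> \<in> A" for \<alpha>
      proof (rule ccontr)
        assume "\<not> ?thesis"
        then have m: "m \<in> supp (mpow S as \<alpha>)" by (simp add: supp_def)
        have "size m \<le> length as * (N * d)"
          by (rule size_supp_mpow[OF as(1) _ _ _ m]) (use d that in \<open>auto simp: A_def l_def\<close>)
        moreover have "set_mset m \<subseteq> V" using supp_vars[OF mpow_closed[OF as(1)] m] .
        ultimately show False using False by (simp add: B_def D_def l_def)
      qed
      then have "(\<Oplus>\<^bsub>K\<^esub>\<alpha>\<in>A. c \<alpha> \<otimes>\<^bsub>K\<^esub> mpow S as \<alpha> m) = (\<Oplus>\<^bsub>K\<^esub>\<alpha>\<in>A. \<zero>\<^bsub>K\<^esub>)"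
        by (intro K.finsum_cong') (use c(1) in \<open>auto simp: Pi_iff\<close>)
      then show ?thesis by simp
    qed
    finally show "(\<Oplus>\<alpha>\<in>Y. mon (c \<alpha>) {#} \<otimes> mpow S as \<alpha>) m = \<zero> m" by (simp add: zero_S)
  qed
  moreover have "Y \<noteq> {}" using c by (auto simp: Y_def)
  moreover have "length \<alpha> = length as" if "\<alpha> \<in> Y" for \<alpha> using that by (auto simp: Y_def A_def l_def)
  ultimately show ?thesis using that[of Y "\<lambda>\<alpha>. mon (c \<alpha>) {#}"] YA cY by auto
qed

text \<open>One element from each step of a longer chain gives more elements than variables, hence a
  relation with unit coefficients; its value zero would have to lie outside the prime
  \<open>P 0\<close>.\<close>

theorem prime_chain_length_le:
  assumes "prime_chain S r P" shows "r \<le> card V"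
proof (rule ccontr)
  assume "\<not> ?thesis"
  then have r: "card V < r" by simp
  have pr: "primeideal (P i) S" if "i \<le> r" for i using assms that by (simp add: prime_chain_def)
  have st: "P i \<subset> P (Suc i)" if "i < r" for i using assms that by (simp add: prime_chain_def)
  define a where "a i = (SOME x. x \<in> P (Suc i) - P i)" for i
  have a: "a i \<in> P (Suc i) - P i" if "i < r" for i
    using st[OF that] someI_ex[of "\<lambda>x. x \<in> P (Suc i) - P i"] unfolding a_def by blast
  define as where "as = map a [0..<r]"
  have as: "set as \<subseteq> carrier S"
  proof
    fix x assume "x \<in> set as"
    then obtain i where "i < r" "x = a i" by (auto simp: as_def)
    then have "x \<in> P (Suc i)" "primeideal (P (Suc i)) S" using a[of i] pr[of "Suc i"] by auto
    then show "x \<in> carrier S" using primeideal.axioms(1) ideal.Icarr by metis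
  qed
  have len: "length as = r" by (simp add: as_def)
  obtain Y c where Y: "finite Y" "Y \<noteq> {}" "\<And>\<alpha>. \<alpha> \<in> Y \<Longrightarrow> length \<alpha> = length as"
    "c \<in> Y \<rightarrow> Units S" "(\<Oplus>\<alpha>\<in>Y. c \<alpha> \<otimes> mpow S as \<alpha>) = \<zero>"
    by (rule exists_algebraic_relation[OF as]) (use r len in simp_all)
  have "(\<Oplus>\<alpha>\<in>Y. c \<alpha> \<otimes> mpow S as \<alpha>) \<notin> P 0"
    proof (rule prime_chain_independent)
    show "as ! i \<in> P (Suc i) - P i" if "i < length as" for i
      using a[of i] that len by (simp add: as_def)
    show "P i \<subseteq> P (Suc i)" if "i < length as" for i using st[of i] that len by auto
  qed (use Y pr len in simp_all)
  moreover have "\<zero> \<in> P 0"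
    using pr[of 0] by (simp add: additive_subgroup.zero_closed ideal.axioms(1) primeideal.axioms(1))
  ultimately show False using Y by simp
qed

end

section \<open>Algebraicity modulo maximal ideals\<close>

context mpoly_ring
begin

section \<open>Submodules over a polynomial subring, modulo an ideal\<close>

lemma mon_in_subpolys: "c \<in> carrier K \<Longrightarrow> set_mset p \<subseteq> Z \<Longrightarrow> set_mset p \<subseteq> V \<Longrightarrow> mon c p \<in> subpolys Z"
  using supp_mon[of c p] by (auto simp: subpolys_def mon_closed)

lemma subpolys_pow: "f \<in> subpolys Z \<Longrightarrow> f [^] (k :: nat) \<in> subpolys Z"
  by (induction k) (auto simp: subpolys_one subpolys_mult)

text \<open>The free submodule over the polynomials in \<open>Z\<close> whose basis are the monomials in \<open>B\<close>
  (which do not involve the variables in \<open>Z\<close>).\<close>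

definition box :: "'v set \<Rightarrow> 'v multiset set \<Rightarrow> ('v multiset \<Rightarrow> 'a) set" where
  "box Z B = {f \<in> carrier S. \<forall>m\<in>supp f. filter_mset (\<lambda>v. v \<notin> Z) m \<in> B}"

lemma box_carrier: "f \<in> box Z B \<Longrightarrow> f \<in> carrier S"
  by (simp add: box_def)

lemma box_mono: "B \<subseteq> B' \<Longrightarrow> box Z B \<subseteq> box Z B'"
  by (auto simp: box_def)

lemma box_zero: "\<zero> \<in> box Z B"
  by (simp add: box_def supp_zero)

lemma box_add: "f \<in> box Z B \<Longrightarrow> g \<in> box Z B \<Longrightarrow> f \<oplus> g \<in> box Z B"
  using supp_add[of f g] unfolding box_def by blast

lemma box_minus: "f \<in> box Z B \<Longrightarrow> g \<in> box Z B \<Longrightarrow> f \<ominus> g \<in> box Z B"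
  using supp_minus[of f g] unfolding box_def by blast

lemma filter_subpolys:
  "p \<in> supp f \<Longrightarrow> f \<in> subpolys Z \<Longrightarrow> filter_mset (\<lambda>v. v \<notin> Z) p = {#}"
  by (auto simp: subpolys_def)

lemma box_mult:
  assumes "f \<in> subpolys Z" "g \<in> box Z B" shows "f \<otimes> g \<in> box Z B"
proof -
  have c: "f \<in> carrier S" "g \<in> carrier S" using assms by (auto simp: subpolys_carrier box_carrier)
  have "filter_mset (\<lambda>v. v \<notin> Z) m \<in> B" if m: "m \<in> supp (f \<otimes> g)" for m
  proof -
    obtain p q where pq: "p \<in> supp f" "q \<in> supp g" "m = p + q" by (rule supp_mult[OF c m])
    show ?thesis unfolding pq(3) filter_union_mset filter_subpolys[OF pq(1) assms(1)]
      using pq(2) assms(2) by (simp add: box_def)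
  qed
  then show ?thesis using c by (simp add: box_def)
qed

lemma subpolys_box: "{#} \<in> B \<Longrightarrow> subpolys Z \<subseteq> box Z B"
  by (auto simp: box_def subpolys_carrier filter_subpolys)

lemma box_singleton: "box Z {{#}} = subpolys Z"
  by (auto simp: box_def subpolys_def)

text \<open>The sum of \<open>box Z B\<close> and \<open>M\<close>. For maximal \<open>M\<close> and
  \<open>Z\<close> algebraically independent modulo \<open>M\<close>, it models the span of the
  monomials \<open>B\<close> over the polynomials in \<open>Z\<close> inside the residue
  field.\<close>

definition box_mod :: "('v multiset \<Rightarrow> 'a) set \<Rightarrow> 'v set \<Rightarrow> 'v multiset set \<Rightarrow> ('v multiset \<Rightarrow> 'a) set" where
  "box_mod M Z B = {f \<in> carrier S. \<exists>b\<in>box Z B. f \<ominus> b \<in> M}"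

lemma box_mod_carrier: "f \<in> box_mod M Z B \<Longrightarrow> f \<in> carrier S"
  by (simp add: box_mod_def)

lemma box_modI:
  assumes "ideal M S" "b \<in> box Z B" "\<mu> \<in> M" shows "b \<oplus> \<mu> \<in> box_mod M Z B"
proof -
  have "b \<in> carrier S" "\<mu> \<in> carrier S" using assms by (auto simp: box_carrier ideal.Icarr)
  moreover from this have "(b \<oplus> \<mu>) \<ominus> b = \<mu>" by algebra
  ultimately show ?thesis using assms(2,3) by (auto simp: box_mod_def intro!: bexI[of _ b])
qed

lemma box_modE:
  assumes "ideal M S" "f \<in> box_mod M Z B"
  obtains b \<mu> where "b \<in> box Z B" "\<mu> \<in> M" "f = b \<oplus> \<mu>"
proof -
  obtain b where b: "b \<in> box Z B" "f \<ominus> b \<in> M" using assms by (auto simp: box_mod_def)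
  have "b \<in> carrier S" "f \<in> carrier S" using b assms by (auto simp: box_carrier box_mod_carrier)
  then have "f = b \<oplus> (f \<ominus> b)" by algebra
  with b that show ?thesis by blast
qed

lemma box_mod_box: "ideal M S \<Longrightarrow> b \<in> box Z B \<Longrightarrow> b \<in> box_mod M Z B"
  using box_modI[of M b Z B \<zero>] by (simp add: box_carrier additive_subgroup.zero_closed ideal.axioms(1))

lemma box_mod_add:
  assumes M: "ideal M S" and f: "f \<in> box_mod M Z B" "g \<in> box_mod M Z B"
  shows "f \<oplus> g \<in> box_mod M Z B"
proof -
  obtain b \<mu> where b: "b \<in> box Z B" "\<mu> \<in> M" "f = b \<oplus> \<mu>" by (rule box_modE[OF M f(1)])
  obtain b' \<mu>' where b': "b' \<in> box Z B" "\<mu>' \<in> M" "g = b' \<oplus> \<mu>'" by (rule box_modE[OF M f(2)])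
  have "b \<in> carrier S" "b' \<in> carrier S" "\<mu> \<in> carrier S" "\<mu>' \<in> carrier S"
    using b b' M by (auto simp: box_carrier ideal.Icarr)
  then have "f \<oplus> g = (b \<oplus> b') \<oplus> (\<mu> \<oplus> \<mu>')" using b b' by algebra
  then show ?thesis
    using b b' by (simp only:) (intro box_modI[OF M] box_add additive_subgroup.a_closed[OF ideal.axioms(1)[OF M]])
qed

lemma box_mod_mult:
  assumes M: "ideal M S" and f: "f \<in> subpolys Z" "g \<in> box_mod M Z B"
  shows "f \<otimes> g \<in> box_mod M Z B"
proof -
  obtain b \<mu> where b: "b \<in> box Z B" "\<mu> \<in> M" "g = b \<oplus> \<mu>" by (rule box_modE[OF M f(2)])
  have "b \<in> carrier S" "\<mu> \<in> carrier S" "f \<in> carrier S"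
    using b f M by (auto simp: box_carrier ideal.Icarr subpolys_carrier)
  then have "f \<otimes> g = f \<otimes> b \<oplus> f \<otimes> \<mu>" using b by (simp add: r_distr)
  then show ?thesis
    using b f by (simp only:) (intro box_modI[OF M] box_mult ideal.I_l_closed[OF M] subpolys_carrier)
qed

text \<open>Each variable of a monomial is absorbed at the price of one factor \<open>s\<close>, so
  the exponent is the degree; for a sum the exponents are added.\<close>

lemma box_mod_absorbs:
  assumes M: "ideal M S" and s: "s \<in> subpolys Z" and one: "\<one> \<in> box_mod M Z B"
    and step: "\<And>v b. v \<in> V \<Longrightarrow> b \<in> box Z B \<Longrightarrow> s \<otimes> (var v \<otimes> b) \<in> box_mod M Z B"
    and g: "g \<in> carrier S"
  shows "\<exists>k :: nat. s [^] k \<otimes> g \<in> box_mod M Z B"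
proof -
  have sc: "s \<in> carrier S" using s by (rule subpolys_carrier)
  have step': "s \<otimes> (var v \<otimes> w) \<in> box_mod M Z B" if v: "v \<in> V" and w: "w \<in> box_mod M Z B" for v w
  proof -
    obtain b \<mu> where b: "b \<in> box Z B" "\<mu> \<in> M" "w = b \<oplus> \<mu>" by (rule box_modE[OF M w])
    have c: "b \<in> carrier S" "\<mu> \<in> carrier S" "var v \<in> carrier S"
      using b M v by (auto simp: box_carrier ideal.Icarr var_closed)
    have "\<zero> \<oplus> s \<otimes> (var v \<otimes> \<mu>) \<in> box_mod M Z B"
      using b c sc by (intro box_modI[OF M] box_zero ideal.I_l_closed[OF M]) auto
    then have "s \<otimes> (var v \<otimes> \<mu>) \<in> box_mod M Z B" using c sc by simp
    moreover have "s \<otimes> (var v \<otimes> w) = s \<otimes> (var v \<otimes> b) \<oplus> s \<otimes> (var v \<otimes> \<mu>)"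
      using b(3) c sc by (simp add: r_distr)
    ultimately show ?thesis using step[OF v b(1)] box_mod_add[OF M] by simp
  qed
  have mon: "s [^] size p \<otimes> mon \<one>\<^bsub>K\<^esub> p \<in> box_mod M Z B" if "set_mset p \<subseteq> V" for p
    using that
  proof (induction p)
    case empty
    then show ?case using one by (simp flip: one_S)
  next
    case (add v p)
    have c: "var v \<in> carrier S" "mon \<one>\<^bsub>K\<^esub> p \<in> carrier S" "s [^] size p \<in> carrier S"
      using add sc by (simp_all add: mon_closed)
    have "mon \<one>\<^bsub>K\<^esub> (add_mset v p) = var v \<otimes> mon \<one>\<^bsub>K\<^esub> p" using add by (simp add: mon_mult_mon)
    then have "s [^] size (add_mset v p) \<otimes> mon \<one>\<^bsub>K\<^esub> (add_mset v p)
       = (s [^] size p \<otimes> s) \<otimes> (var v \<otimes> mon \<one>\<^bsub>K\<^esub> p)" by simp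
    also have "\<dots> = s \<otimes> (var v \<otimes> (s [^] size p \<otimes> mon \<one>\<^bsub>K\<^esub> p))"
      using c sc by algebra
    finally show ?case using step'[of v] add by simp
  qed
  show ?thesis using g
  proof (induction rule: mpoly_induct)
    case zero
    show ?case using sc by (auto intro!: box_mod_box[OF M] box_zero)
  next
    case (mon_add c p g)
    then obtain k :: nat where k: "s [^] k \<otimes> g \<in> box_mod M Z B" by blast
    have c: "mon c {#} \<in> subpolys Z" "mon c {#} \<in> carrier S" "mon c p \<in> carrier S"
      "mon \<one>\<^bsub>K\<^esub> p \<in> carrier S" "s [^] size p \<in> carrier S" "s [^] k \<in> carrier S"
      using mon_add sc by (simp_all add: mon_closed mon_in_subpolys)
    have e: "mon c p = mon c {#} \<otimes> mon \<one>\<^bsub>K\<^esub> p" using mon_add by (simp add: mon_mult_mon)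
    have "s [^] size p \<otimes> mon c p = mon c {#} \<otimes> (s [^] size p \<otimes> mon \<one>\<^bsub>K\<^esub> p)"
      unfolding e using c by algebra
    then have 1: "s [^] size p \<otimes> mon c p \<in> box_mod M Z B"
      using box_mod_mult[OF M c(1) mon[OF mon_add(3)]] by simp
    have "s [^] (k + size p) = s [^] k \<otimes> s [^] size p" using sc by (simp add: nat_pow_mult)
    then have "s [^] (k + size p) \<otimes> (mon c p \<oplus> g)
       = s [^] k \<otimes> (s [^] size p \<otimes> mon c p) \<oplus> s [^] size p \<otimes> (s [^] k \<otimes> g)"
      using c mon_add(5) by algebra
    moreover have "s [^] k \<otimes> (s [^] size p \<otimes> mon c p) \<in> box_mod M Z B"
      by (rule box_mod_mult[OF M subpolys_pow[OF s] 1])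
    moreover have "s [^] size p \<otimes> (s [^] k \<otimes> g) \<in> box_mod M Z B"
      by (rule box_mod_mult[OF M subpolys_pow[OF s] k])
    ultimately have "s [^] (k + size p) \<otimes> (mon c p \<oplus> g) \<in> box_mod M Z B"
      using box_mod_add[OF M] by simp
    then show ?case by blast
  qed
qed

text \<open>With \<open>f\<close> viewed as a polynomial in the variables violating
  \<open>Q\<close>, this is its coefficient at the monomial \<beta>, itself a polynomial in the
  variables satisfying \<open>Q\<close>.\<close>

definition coeff_at :: "('v \<Rightarrow> bool) \<Rightarrow> 'v multiset \<Rightarrow> ('v multiset \<Rightarrow> 'a) \<Rightarrow> 'v multiset \<Rightarrow> 'a" where
  "coeff_at Q \<beta> f = (\<lambda>m. if \<forall>v\<in>#m. Q v then f (m + \<beta>) else \<zero>\<^bsub>K\<^esub>)"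

lemma supp_coeff_at: "m \<in> supp (coeff_at Q \<beta> f) \<longleftrightarrow> (\<forall>v\<in>#m. Q v) \<and> m + \<beta> \<in> supp f"
  by (auto simp: supp_def coeff_at_def)

lemma coeff_at_closed:
  assumes f: "f \<in> carrier S" shows "coeff_at Q \<beta> f \<in> carrier S"
proof (rule carrier_SI)
  have "supp (coeff_at Q \<beta> f) \<subseteq> (\<lambda>m. m - \<beta>) ` supp f"
  proof
    fix m assume "m \<in> supp (coeff_at Q \<beta> f)"
    then show "m \<in> (\<lambda>m. m - \<beta>) ` supp f"
      by (intro image_eqI[of _ _ "m + \<beta>"]) (auto simp: supp_coeff_at)
  qed
  then show "finite (supp (coeff_at Q \<beta> f))" by (rule finite_subset) (use f finite_supp in auto)
  show "set_mset m \<subseteq> V" if "m \<in> supp (coeff_at Q \<beta> f)" for m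
    using that supp_vars[OF f, of "m + \<beta>"] by (auto simp: supp_coeff_at)
qed (use f in \<open>simp add: coeff_at_def\<close>)

lemma part_eq_coeff_at:
  assumes f: "f \<in> carrier S" and \<beta>: "\<And>v. v \<in># \<beta> \<Longrightarrow> \<not> Q v"
  shows "part (\<lambda>m. filter_mset (\<lambda>v. \<not> Q v) m = \<beta>) f = mon \<one>\<^bsub>K\<^esub> \<beta> \<otimes> coeff_at Q \<beta> f"
proof
  fix m
  have c: "coeff_at Q \<beta> f \<in> carrier S" by (rule coeff_at_closed[OF f])
  have "filter_mset (\<lambda>v. \<not> Q v) m = \<beta> \<longleftrightarrow> \<beta> \<subseteq># m \<and> (\<forall>v\<in>#m - \<beta>. Q v)"
  proof
    assume e: "filter_mset (\<lambda>v. \<not> Q v) m = \<beta>"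
    have "m - \<beta> = filter_mset Q m"
      unfolding e[symmetric] by (rule multiset_eqI) simp
    moreover have "\<beta> \<subseteq># m" unfolding e[symmetric] by simp
    ultimately show "\<beta> \<subseteq># m \<and> (\<forall>v\<in>#m - \<beta>. Q v)" by simp
  next
    assume a: "\<beta> \<subseteq># m \<and> (\<forall>v\<in>#m - \<beta>. Q v)"
    then obtain r where r: "m = \<beta> + r" by (auto simp: subset_mset.le_iff_add)
    have "filter_mset (\<lambda>v. \<not> Q v) r = {#}" using a r by (auto)
    moreover have "filter_mset (\<lambda>v. \<not> Q v) \<beta> = \<beta>" using \<beta> by (simp add: filter_mset_eq_conv)
    ultimately show "filter_mset (\<lambda>v. \<not> Q v) m = \<beta>" using r by simp
  qed
  then show "part (\<lambda>m. filter_mset (\<lambda>v. \<not> Q v) m = \<beta>) f m = (mon \<one>\<^bsub>K\<^esub> \<beta> \<otimes> coeff_at Q \<beta> f) m"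
    using f c by (simp add: part_def mult_mon) (auto simp: coeff_at_def)
qed

lemma coeff_at_split:
  assumes "f \<in> carrier S" "\<And>v. v \<in># \<beta> \<Longrightarrow> \<not> Q v"
  shows "f = mon \<one>\<^bsub>K\<^esub> \<beta> \<otimes> coeff_at Q \<beta> f \<oplus> part (\<lambda>m. \<not> filter_mset (\<lambda>v. \<not> Q v) m = \<beta>) f"
proof -
  have e: "part (\<lambda>m. filter_mset (\<lambda>v. \<not> Q v) m = \<beta>) f = mon \<one>\<^bsub>K\<^esub> \<beta> \<otimes> coeff_at Q \<beta> f"
    using assms by (rule part_eq_coeff_at)
  show ?thesis
    unfolding e[symmetric] by (rule part_split[OF assms(1)])
qed

lemma filter_eq_replicate: "filter_mset (\<lambda>u. u = v) m = replicate_mset d v \<longleftrightarrow> count m v = d"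
  by (auto simp: multiset_eq_iff dest: spec[of _ v])

text \<open>Read \<open>h\<close> as a polynomial in \<open>v\<close> over the polynomials in
  \<open>Z\<close>; \<open>s\<close> is its leading coefficient. Multiplication by powers of
  \<open>v\<close> reaches every degree \<open>D\<close> from that of \<open>h\<close> on, so that
  one \<open>D\<close> can later serve all variables.\<close>

lemma leading_relation:
  assumes M: "ideal M S" and h: "h \<in> subpolys (insert v Z)" "h \<noteq> \<zero>" "h \<in> M" and v: "v \<in> V" "v \<notin> Z"
  shows "\<exists>d. \<forall>D\<ge>d. \<exists>s\<in>subpolys Z - {\<zero>}. \<exists>r\<in>subpolys (insert v Z).
     (\<forall>m\<in>supp r. count m v < D) \<and> s \<otimes> mon \<one>\<^bsub>K\<^esub> (replicate_mset D v) \<oplus> r \<in> M"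
proof -
  have hc: "h \<in> carrier S" using h(1) by (rule subpolys_carrier)
  define d where "d = Max ((\<lambda>m. count m v) ` supp h)"
  have fin: "finite ((\<lambda>m. count m v) ` supp h)" and ne: "(\<lambda>m. count m v) ` supp h \<noteq> {}"
    using hc h(2) finite_supp supp_empty_iff by auto
  have d: "\<And>m. m \<in> supp h \<Longrightarrow> count m v \<le> d" "\<exists>m\<in>supp h. count m v = d"
    using Max_ge[OF fin] Max_in[OF fin ne] by (auto simp: d_def)
  define s where "s = coeff_at (\<lambda>u. u \<noteq> v) (replicate_mset d v) h"
  define r where "r = part (\<lambda>m. \<not> filter_mset (\<lambda>u. \<not> u \<noteq> v) m = replicate_mset d v) h"
  have sc: "s \<in> carrier S" unfolding s_def by (rule coeff_at_closed[OF hc])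
  have rc: "r \<in> carrier S" unfolding r_def by (rule part_closed[OF hc])
  have h_eq: "h = mon \<one>\<^bsub>K\<^esub> (replicate_mset d v) \<otimes> s \<oplus> r"
    unfolding s_def r_def by (rule coeff_at_split[OF hc]) (simp split: if_splits)
  have s: "s \<in> subpolys Z"
  proof -
    have "set_mset m \<subseteq> Z" if "m \<in> supp s" for m
    proof
      fix u assume u: "u \<in># m"
      have "u \<noteq> v" "m + replicate_mset d v \<in> supp h" using u that by (auto simp: s_def supp_coeff_at)
      then have "set_mset (m + replicate_mset d v) \<subseteq> insert v Z" using h(1) unfolding subpolys_def by blast
      then show "u \<in> Z" using u \<open>u \<noteq> v\<close> by auto
    qed
    with sc show ?thesis by (simp add: subpolys_def)
  qed
  have "s \<noteq> \<zero>"
  proof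
    assume "s = \<zero>"
    with h_eq rc v have "h = r" by (simp add: mon_closed)
    obtain m where m: "m \<in> supp h" "count m v = d" using d(2) by blast
    have "m \<notin> supp r" unfolding r_def by (simp add: supp_part filter_eq_replicate m(2))
    with m(1) \<open>h = r\<close> show False by metis
  qed
  have r: "r \<in> subpolys (insert v Z)" "\<And>m. m \<in> supp r \<Longrightarrow> count m v < d"
  proof -
    show "r \<in> subpolys (insert v Z)" using h(1) rc by (auto simp: subpolys_def r_def supp_part)
    fix m assume "m \<in> supp r"
    then have "m \<in> supp h" "count m v \<noteq> d" by (auto simp: r_def supp_part filter_eq_replicate)
    then show "count m v < d" using d(1)[of m] by simp
  qed
  have "\<exists>s\<in>subpolys Z - {\<zero>}. \<exists>r\<in>subpolys (insert v Z).
     (\<forall>m\<in>supp r. count m v < D) \<and> s \<otimes> mon \<one>\<^bsub>K\<^esub> (replicate_mset D v) \<oplus> r \<in> M" if D: "d \<le> D" for D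
  proof -
    define t where "t = mon \<one>\<^bsub>K\<^esub> (replicate_mset (D - d) v)"
    have t: "t \<in> subpolys (insert v Z)" "t \<in> carrier S"
      using v by (auto simp: t_def mon_in_subpolys mon_closed)
    have rD: "mon \<one>\<^bsub>K\<^esub> (replicate_mset D v) = t \<otimes> mon \<one>\<^bsub>K\<^esub> (replicate_mset d v)"
    proof -
      have "replicate_mset D v = replicate_mset (D - d) v + replicate_mset d v"
        using D by (simp add: multiset_eq_iff)
      then show ?thesis using v by (simp add: t_def mon_mult_mon)
    qed
    have mc: "mon \<one>\<^bsub>K\<^esub> (replicate_mset d v) \<in> carrier S" using v by (simp add: mon_closed)
    have "s \<otimes> mon \<one>\<^bsub>K\<^esub> (replicate_mset D v) \<oplus> t \<otimes> r = t \<otimes> h"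
      unfolding rD using h_eq sc rc t mc by algebra
    moreover have "t \<otimes> h \<in> M" using t h by (intro ideal.I_l_closed[OF M])
    moreover have "t \<otimes> r \<in> subpolys (insert v Z)" by (rule subpolys_mult[OF t(1) r(1)])
    moreover have "count m v < D" if m: "m \<in> supp (t \<otimes> r)" for m
    proof -
      obtain p q where pq: "p \<in> supp t" "q \<in> supp r" "m = p + q" by (rule supp_mult[OF t(2) rc m])
      have "p = replicate_mset (D - d) v" using pq(1) supp_mon unfolding t_def by fast
      then show ?thesis using r(2)[OF pq(2)] pq(3) D by simp
    qed
    ultimately show ?thesis using s \<open>s \<noteq> \<zero>\<close> by (intro bexI[of _ s] bexI[of _ "t \<otimes> r"]) auto
  qed
  then show ?thesis by blast
qed

text \<open>The product of the separate multipliers works, and it is nonzero since \<open>S\<close>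
  is a domain.\<close>

lemma common_multiplier:
  assumes "finite A"
    and ex: "\<And>x. x \<in> A \<Longrightarrow> \<exists>c\<in>subpolys Z - {\<zero>}. Q x c"
    and mult: "\<And>x c d. x \<in> A \<Longrightarrow> c \<in> subpolys Z \<Longrightarrow> d \<in> subpolys Z \<Longrightarrow> Q x c \<Longrightarrow> Q x (d \<otimes> c)"
  shows "\<exists>c\<in>subpolys Z - {\<zero>}. \<forall>x\<in>A. Q x c"
  using assms
proof (induction A)
  case empty
  show ?case using subpolys_one[of Z] one_not_zero by auto
next
  case (insert x A)
  then obtain c where c: "c \<in> subpolys Z - {\<zero>}" "\<forall>x\<in>A. Q x c" by auto
  obtain d where d: "d \<in> subpolys Z - {\<zero>}" "Q x d" using insert(4) by auto
  have cd: "d \<otimes> c \<in> subpolys Z - {\<zero>}"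
    using c d integral[of d c] subpolys_mult subpolys_carrier by auto
  have "Q y (d \<otimes> c)" if "y \<in> insert x A" for y
  proof (cases "y = x")
    case True
    have "d \<otimes> c = c \<otimes> d" using c d subpolys_carrier m_comm by auto
    then show ?thesis using True insert(5)[of x d c] c d by simp
  next
    case False
    with that show ?thesis using insert(5)[of y c d] c d by simp
  qed
  with cd show ?case by blast
qed

text \<open>Split \<open>b\<close> into the terms of degree exactly \<open>D - 1\<close> in
  \<open>v\<close> and the rest \<open>b1\<close>. Multiplication by \<open>v\<close> keeps
  \<open>b1\<close> in the box; the degree \<open>D\<close> produced by the other terms is lowered
  by the relation with \<open>r\<close>, after multiplication by \<open>s\<close>.\<close>

lemma box_mult_var:
  assumes M: "ideal M S" and D: "D \<ge> 1" and s: "s \<in> subpolys Z" and v: "v \<in> V" "v \<notin> Z"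
    and r: "r \<in> subpolys (insert v Z)" "\<And>m. m \<in> supp r \<Longrightarrow> count m v < D"
      "s \<otimes> mon \<one>\<^bsub>K\<^esub> (replicate_mset D v) \<oplus> r \<in> M"
    and b: "b \<in> box Z {\<beta>. set_mset \<beta> \<subseteq> V - Z \<and> (\<forall>v. count \<beta> v < D)}"
  shows "s \<otimes> (var v \<otimes> b) \<in> box_mod M Z {\<beta>. set_mset \<beta> \<subseteq> V - Z \<and> (\<forall>v. count \<beta> v < D)}"
    (is "_ \<in> box_mod M Z ?B")
proof -
  have bc: "b \<in> carrier S" using b by (rule box_carrier)
  have sc: "s \<in> carrier S" using s by (rule subpolys_carrier)
  have rc: "r \<in> carrier S" using r(1) by (rule subpolys_carrier)
  have vc: "var v \<in> carrier S" using v by (simp add: var_closed)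
  define b1 where "b1 = part (\<lambda>m. \<not> filter_mset (\<lambda>u. \<not> u \<noteq> v) m = replicate_mset (D - 1) v) b"
  define b2 where "b2 = coeff_at (\<lambda>u. u \<noteq> v) (replicate_mset (D - 1) v) b"
  have b1c: "b1 \<in> carrier S" unfolding b1_def by (rule part_closed[OF bc])
  have b2c: "b2 \<in> carrier S" unfolding b2_def by (rule coeff_at_closed[OF bc])
  have mc: "mon \<one>\<^bsub>K\<^esub> (replicate_mset (D - 1) v) \<in> carrier S" "mon \<one>\<^bsub>K\<^esub> (replicate_mset D v) \<in> carrier S"
    using v by (simp_all add: mon_closed)
  have b_eq: "b = mon \<one>\<^bsub>K\<^esub> (replicate_mset (D - 1) v) \<otimes> b2 \<oplus> b1"
    unfolding b1_def b2_def by (rule coeff_at_split[OF bc]) (simp split: if_splits)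
  have "var v \<otimes> mon \<one>\<^bsub>K\<^esub> (replicate_mset (D - 1) v) = mon \<one>\<^bsub>K\<^esub> (replicate_mset D v)"
  proof -
    have "replicate_mset D v = add_mset v (replicate_mset (D - 1) v)"
      using D by (simp flip: replicate_mset_Suc)
    then show ?thesis using v by (simp add: mon_mult_mon)
  qed
  then have "var v \<otimes> b = mon \<one>\<^bsub>K\<^esub> (replicate_mset D v) \<otimes> b2 \<oplus> var v \<otimes> b1"
    using b_eq vc mc b1c b2c by algebra
  then have eq: "s \<otimes> (var v \<otimes> b) =
      ((\<ominus> \<one>) \<otimes> (r \<otimes> b2) \<oplus> s \<otimes> (var v \<otimes> b1)) \<oplus> b2 \<otimes> (s \<otimes> mon \<one>\<^bsub>K\<^esub> (replicate_mset D v) \<oplus> r)"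
    using sc vc mc b1c b2c rc by algebra
  have cnt: "set_mset (filter_mset (\<lambda>v. v \<notin> Z) m) \<subseteq> V - Z" "\<And>u. u \<notin> Z \<Longrightarrow> count m u < D"
    if "m \<in> supp b" for m
  proof -
    have m: "set_mset (filter_mset (\<lambda>v. v \<notin> Z) m) \<subseteq> V - Z" "\<And>u. count (filter_mset (\<lambda>v. v \<notin> Z) m) u < D"
      using b that unfolding box_def by blast+
    show "set_mset (filter_mset (\<lambda>v. v \<notin> Z) m) \<subseteq> V - Z" by (rule m)
    show "count m u < D" if "u \<notin> Z" for u using m(2)[of u] that by simp
  qed
  have "r \<otimes> b2 \<in> box Z ?B"
  proof -
    have "filter_mset (\<lambda>v. v \<notin> Z) m \<in> ?B" if m: "m \<in> supp (r \<otimes> b2)" for m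
    proof -
      obtain p q where pq: "p \<in> supp r" "q \<in> supp b2" "m = p + q" by (rule supp_mult[OF rc b2c m])
      have p: "set_mset p \<subseteq> insert v Z" "count p v < D" using r pq(1) by (auto simp: subpolys_def)
      have q: "v \<notin># q" "q + replicate_mset (D - 1) v \<in> supp b"
        using pq(2) by (auto simp: b2_def supp_coeff_at)
      have "count m u < D" if "u \<notin> Z" for u
      proof (cases "u = v")
        case True
        then show ?thesis using p q pq by (simp add: not_in_iff)
      next
        case False
        with p(1) that have "count p u = 0" by (auto simp flip: not_in_iff)
        then show ?thesis using cnt(2)[OF q(2) that] pq(3) False by simp
      qed
      moreover have "set_mset m \<subseteq> V" using supp_vars[OF _ m] rc b2c by simp
      ultimately show ?thesis using D by auto
    qed
    with rc b2c show ?thesis by (simp add: box_def)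
  qed
  moreover have "(\<ominus> \<one>) \<in> subpolys Z"
    by (simp add: subpolys_def supp_uminus supp_one)
  moreover have "var v \<otimes> b1 \<in> box Z ?B"
  proof -
    have "filter_mset (\<lambda>v. v \<notin> Z) m \<in> ?B" if m: "m \<in> supp (var v \<otimes> b1)" for m
    proof -
      obtain p q where pq: "p \<in> supp (var v)" "q \<in> supp b1" "m = p + q" by (rule supp_mult[OF vc b1c m])
      have p: "p = {#v#}" using pq(1) supp_mon by fast
      have q: "q \<in> supp b" "count q v \<noteq> D - 1"
        using pq(2) by (auto simp: b1_def supp_part filter_eq_replicate)
      have "count m u < D" if "u \<notin> Z" for u
        using cnt(2)[OF q(1) that] q(2) pq(3) p D by (cases "u = v") auto
      moreover have "set_mset m \<subseteq> V" using supp_vars[OF _ m] vc b1c by simp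
      ultimately show ?thesis using D by auto
    qed
    with vc b1c show ?thesis by (simp add: box_def)
  qed
  ultimately have "(\<ominus> \<one>) \<otimes> (r \<otimes> b2) \<oplus> s \<otimes> (var v \<otimes> b1) \<in> box Z ?B"
    using s box_add box_mult by blast
  then show ?thesis unfolding eq
    by (intro box_modI[OF M] ideal.I_l_closed[OF M] r(3) b2c)
qed

text \<open>\<open>s\<close> is invertible modulo \<open>\<one> \<oplus> s \<otimes> var x\<close>,
  so dividing a power of \<open>s\<close> makes this element a unit. But it has the monomial
  \<open>add_mset x (lead s)\<close>, whereas the leading monomial of a unit is constant.\<close>

lemma not_one_plus_var_divides_power:
  assumes s: "s \<in> carrier S" "s \<noteq> \<zero>" and x: "x \<in> V" and b: "b \<in> carrier S"
    and eq: "(\<one> \<oplus> s \<otimes> var x) \<otimes> b = s [^] (k :: nat)"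
  shows False
proof -
  define p where "p = \<one> \<oplus> s \<otimes> var x"
  have xc: "var x \<in> carrier S" using x by (simp add: var_closed)
  have pc: "p \<in> carrier S" using s xc by (simp add: p_def)
  have unit: "\<exists>e\<in>carrier S. p \<otimes> e = \<one>" if "b \<in> carrier S" "p \<otimes> b = s [^] k" for k :: nat and b
    using that
  proof (induction k arbitrary: b)
    case 0
    then show ?case by auto
  next
    case (Suc k)
    have sk: "s [^] k \<in> carrier S" using s by simp
    \<comment> \<open>From \<open>p \<otimes> b = s [^] Suc k\<close> one power of \<open>s\<close>
      is removed by replacing \<open>b\<close> with
      \<open>s [^] k \<ominus> b \<otimes> var x\<close>.\<close>
    have "p \<otimes> (s [^] k \<ominus> b \<otimes> var x) = s [^] k \<otimes> p \<ominus> (p \<otimes> b) \<otimes> var x"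
      using Suc(2) pc xc sk by algebra
    also have "\<dots> = s [^] k \<otimes> (\<one> \<oplus> s \<otimes> var x) \<ominus> (s [^] k \<otimes> s) \<otimes> var x"
      by (simp add: Suc(3)) (simp add: p_def)
    also have "\<dots> = s [^] k" using sk s(1) xc by algebra
    finally have "p \<otimes> (s [^] k \<ominus> b \<otimes> var x) = s [^] k" .
    moreover have "s [^] k \<ominus> b \<otimes> var x \<in> carrier S" using Suc(2) sk xc by simp
    ultimately show ?case using Suc(1) by blast
  qed
  obtain e where e: "e \<in> carrier S" "p \<otimes> e = \<one>" using unit[OF b] eq by (auto simp: p_def)
  have p0: "p \<noteq> \<zero>" "e \<noteq> \<zero>" using e pc one_not_zero by auto
  have "lead p + lead e \<in> supp (p \<otimes> e)"
    by (rule lead_coeff_mult[where W = UNIV]) (use pc e p0 lead_max in auto)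
  then have lp: "lead p = {#}" by (simp add: e(2) supp_one)
  have "(var x \<otimes> s) (add_mset x (lead s)) = s (lead s)"
    using s x by (simp add: mult_mon)
  moreover have "s \<otimes> var x = var x \<otimes> s" using s xc by (simp add: m_comm)
  moreover have "s (lead s) \<noteq> \<zero>\<^bsub>K\<^esub>" using lead_max(1)[OF s] by (simp add: supp_def)
  ultimately have "add_mset x (lead s) \<in> supp p"
    using s by (simp add: p_def add_S supp_def one_S mon_def)
  then have "add_mset x (lead s) \<le> {#}" using lead_max(2)[OF pc p0(1)] lp by metis
  then show False by simp
qed

text \<open>Zariski's lemma, without field extensions. Take a largest set \<open>Z\<close> of
  variables algebraically independent modulo \<open>M\<close>. If it were non-empty, the residue
  field would be finite over the rational functions in \<open>Z\<close>, with all denominators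
  dividing powers of one polynomial \<open>s'\<close>; this fails for the inverse of
  \<open>\<one> \<oplus> s' \<otimes> var x\<close>. Maximality of \<open>M\<close> enters as the
  existence of inverses modulo \<open>M\<close>.\<close>

theorem algebraic_mod_maximal:
  assumes M: "primeideal M S"
    and inv: "\<And>g. g \<in> carrier S \<Longrightarrow> g \<notin> M \<Longrightarrow> \<exists>h\<in>carrier S. g \<otimes> h \<ominus> \<one> \<in> M"
    and v: "v \<in> V"
  obtains f where "f \<in> subpolys {v}" "f \<noteq> \<zero>" "f \<in> M"
proof -
  interpret M: primeideal M S by fact
  have MI: "ideal M S" by (rule M.is_ideal)
  define ind where "ind Z \<longleftrightarrow> Z \<subseteq> V \<and> subpolys Z \<inter> M = {\<zero>}" for Z
  have zM: "\<zero> \<in> M" by simp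
  have "ind {}"
  proof -
    have "f = \<zero>" if f: "f \<in> subpolys {}" "f \<in> M" for f
    proof (rule ccontr)
      assume "f \<noteq> \<zero>"
      have "supp f \<subseteq> {{#}}" using f by (auto simp: subpolys_def)
      then have "f = mon (f {#}) {#}" by (auto simp: supp_def mon_def fun_eq_iff)
      moreover have "f {#} \<in> carrier K" using f subpolys_carrier by simp
      moreover have "f {#} \<noteq> \<zero>\<^bsub>K\<^esub>"
      proof
        assume "f {#} = \<zero>\<^bsub>K\<^esub>"
        with \<open>supp f \<subseteq> {{#}}\<close> have "supp f = {}" by (auto simp: supp_def)
        with \<open>f \<noteq> \<zero>\<close> show False by (simp add: supp_empty_iff)
      qed
      ultimately have "f \<in> Units S" using const_unit by metis
      then have "inv f \<otimes> f \<in> M" using f by (intro ideal.I_l_closed[OF MI]) auto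
      then have "\<one> \<in> M" using \<open>f \<in> Units S\<close> by simp
      then show False using M.I_notcarr M.one_imp_carrier by simp
    qed
    then show ?thesis using zM by (auto simp: ind_def subpolys_zero)
  qed
  moreover have "card Z \<le> card V" if "ind Z" for Z
    using that finite_vars by (auto simp: ind_def intro: card_mono)
  ultimately obtain Z where Z: "ind Z" "\<And>Z'. ind Z' \<Longrightarrow> card Z' \<le> card Z"
    using ex_has_greatest_nat[of ind "{}" card "Suc (card V)"] by (auto simp: less_Suc_eq_le)
  have ZV: "Z \<subseteq> V" and ZM: "subpolys Z \<inter> M = {\<zero>}" using Z by (auto simp: ind_def)
  have finZ: "finite Z" using ZV finite_vars by (rule finite_subset)
  have rel: "\<exists>h\<in>subpolys (insert v Z). h \<noteq> \<zero> \<and> h \<in> M" if v: "v \<in> V" "v \<notin> Z" for v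
  proof (rule ccontr)
    assume "\<not> ?thesis"
    then have "ind (insert v Z)" using v ZV zM by (auto simp: ind_def subpolys_zero)
    then have "card (insert v Z) \<le> card Z" by (rule Z(2))
    then show False using v finZ by simp
  qed
  have "Z = {}"
  proof (rule ccontr)
    assume "Z \<noteq> {}"
    then obtain x where x: "x \<in> Z" "x \<in> V" using ZV by blast
    have "\<forall>v\<in>V - Z. \<exists>d. \<forall>D\<ge>d. \<exists>s\<in>subpolys Z - {\<zero>}. \<exists>r\<in>subpolys (insert v Z).
     (\<forall>m\<in>supp r. count m v < D) \<and> s \<otimes> mon \<one>\<^bsub>K\<^esub> (replicate_mset D v) \<oplus> r \<in> M"
    proof
      fix v assume v: "v \<in> V - Z"
      then obtain h where "h \<in> subpolys (insert v Z)" "h \<noteq> \<zero>" "h \<in> M" using rel by blast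
      then show "\<exists>d. \<forall>D\<ge>d. \<exists>s\<in>subpolys Z - {\<zero>}. \<exists>r\<in>subpolys (insert v Z).
     (\<forall>m\<in>supp r. count m v < D) \<and> s \<otimes> mon \<one>\<^bsub>K\<^esub> (replicate_mset D v) \<oplus> r \<in> M"
        using v by (intro leading_relation[OF MI]) auto
    qed
    then obtain d where d: "\<And>v D. v \<in> V - Z \<Longrightarrow> D \<ge> d v \<Longrightarrow> \<exists>s\<in>subpolys Z - {\<zero>}. \<exists>r\<in>subpolys (insert v Z).
     (\<forall>m\<in>supp r. count m v < D) \<and> s \<otimes> mon \<one>\<^bsub>K\<^esub> (replicate_mset D v) \<oplus> r \<in> M"
      by (metis (no_types, lifting))
    \<comment> \<open>One degree beyond all thresholds \<open>d v\<close>; the successor makes it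
      positive also for \<open>Z = V\<close>.\<close>
    define D where "D = Suc (\<Sum>v\<in>V - Z. d v)"
    have D: "D \<ge> 1" "\<And>v. v \<in> V - Z \<Longrightarrow> d v \<le> D"
      using member_le_sum[of _ "V - Z" d] finite_vars by (auto simp: D_def le_SucI)
    let ?Q = "\<lambda>v s. \<exists>r\<in>subpolys (insert v Z).
     (\<forall>m\<in>supp r. count m v < D) \<and> s \<otimes> mon \<one>\<^bsub>K\<^esub> (replicate_mset D v) \<oplus> r \<in> M"
    have "\<exists>s\<in>subpolys Z - {\<zero>}. \<forall>v\<in>V - Z. ?Q v s"
    proof (rule common_multiplier)
      show "finite (V - Z)" using finite_vars by simp
      show "\<exists>s\<in>subpolys Z - {\<zero>}. ?Q v s" if "v \<in> V - Z" for v using d[OF that D(2)[OF that]] .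
      fix v s t assume v: "v \<in> V - Z" and st: "s \<in> subpolys Z" "t \<in> subpolys Z" and "?Q v s"
      then obtain r where r: "r \<in> subpolys (insert v Z)" "\<forall>m\<in>supp r. count m v < D"
        "s \<otimes> mon \<one>\<^bsub>K\<^esub> (replicate_mset D v) \<oplus> r \<in> M" by blast
      have c: "s \<in> carrier S" "t \<in> carrier S" "r \<in> carrier S" "mon \<one>\<^bsub>K\<^esub> (replicate_mset D v) \<in> carrier S"
        using st r v by (auto simp: subpolys_carrier mon_closed)
      have "t \<otimes> r \<in> subpolys (insert v Z)"
        using st r by (intro subpolys_mult) (auto simp: subpolys_def)
      moreover have "count m v < D" if m: "m \<in> supp (t \<otimes> r)" for m
      proof -
        obtain p q where pq: "p \<in> supp t" "q \<in> supp r" "m = p + q" by (rule supp_mult[OF c(2,3) m])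
        have "v \<notin># p" using st(2) pq(1) v by (auto simp: subpolys_def)
        then show ?thesis using r(2) pq by (simp add: not_in_iff)
      qed
      moreover have "(t \<otimes> s) \<otimes> mon \<one>\<^bsub>K\<^esub> (replicate_mset D v) \<oplus> t \<otimes> r \<in> M"
      proof -
        have "(t \<otimes> s) \<otimes> mon \<one>\<^bsub>K\<^esub> (replicate_mset D v) \<oplus> t \<otimes> r = t \<otimes> (s \<otimes> mon \<one>\<^bsub>K\<^esub> (replicate_mset D v) \<oplus> r)"
          using c by algebra
        then show ?thesis using ideal.I_l_closed[OF MI r(3) c(2)] by simp
      qed
      ultimately show "?Q v (t \<otimes> s)" by blast
    qed
    then obtain s where s: "s \<in> subpolys Z" "s \<noteq> \<zero>" "\<And>v. v \<in> V - Z \<Longrightarrow> ?Q v s" by blast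
    \<comment> \<open>By the relations, the monomials with exponents below \<open>D\<close> in the
      variables outside \<open>Z\<close> span everything modulo \<open>M\<close> up to powers of
      \<open>s\<close>.\<close>
    define B where "B = {\<beta>. set_mset \<beta> \<subseteq> V - Z \<and> (\<forall>v. count \<beta> v < D)}"
    have "finite B"
    proof (rule finite_subset)
      show "finite {\<beta>. set_mset \<beta> \<subseteq> V \<and> size \<beta> \<le> card V * D}"
        by (rule card_multisets_size_le(1)[OF finite_vars])
      show "B \<subseteq> {\<beta>. set_mset \<beta> \<subseteq> V \<and> size \<beta> \<le> card V * D}"
      proof
        fix \<beta> assume \<beta>: "\<beta> \<in> B"
        have "size \<beta> = (\<Sum>v\<in>set_mset \<beta>. count \<beta> v)" by (rule size_multiset_overloaded_eq)
        also have "\<dots> \<le> card (set_mset \<beta>) * D"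
          using sum_bounded_above[of "set_mset \<beta>" "count \<beta>" D] \<beta> by (auto simp: B_def less_imp_le)
        also have "\<dots> \<le> card V * D"
          using \<beta> finite_vars by (intro mult_right_mono card_mono) (auto simp: B_def)
        finally show "\<beta> \<in> {\<beta>. set_mset \<beta> \<subseteq> V \<and> size \<beta> \<le> card V * D}" using \<beta> by (auto simp: B_def)
      qed
    qed
    \<comment> \<open>A largest independent subset \<open>B'\<close> of \<open>B\<close> plays the
      role of a basis of the residue field over the rational functions in \<open>Z\<close>;
      \<open>{#}\<close> is included so that the polynomials in \<open>Z\<close> are among its
      combinations.\<close>
    define ok where "ok B' \<longleftrightarrow> B' \<subseteq> B \<and> {#} \<in> B' \<and> box Z B' \<inter> M = {\<zero>}" for B'
    have "ok {{#}}" using D ZM by (auto simp: ok_def B_def box_singleton)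
    moreover have "card B' \<le> card B" if "ok B'" for B'
      using that \<open>finite B\<close> by (auto simp: ok_def intro: card_mono)
    ultimately obtain B' where B': "ok B'" "\<And>B''. ok B'' \<Longrightarrow> card B'' \<le> card B'"
      using ex_has_greatest_nat[of ok "{{#}}" card "Suc (card B)"] by (auto simp: less_Suc_eq_le)
    have B'B: "B' \<subseteq> B" and B'0: "{#} \<in> B'" and B'M: "box Z B' \<inter> M = {\<zero>}" using B' by (auto simp: ok_def)
    have finB': "finite B'" using B'B \<open>finite B\<close> by (rule finite_subset)
    \<comment> \<open>By maximality of \<open>B'\<close> each further \<beta> satisfies a relation
      modulo \<open>M\<close>; its coefficient at \<beta> multiplies \<beta> into the span of
      \<open>B'\<close>.\<close>
    have "\<exists>c\<in>subpolys Z - {\<zero>}. \<forall>\<beta>\<in>B. c \<otimes> mon \<one>\<^bsub>K\<^esub> \<beta> \<in> box_mod M Z B'"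
    proof (rule common_multiplier[OF \<open>finite B\<close>])
      fix \<beta> assume \<beta>: "\<beta> \<in> B"
      have \<beta>V: "set_mset \<beta> \<subseteq> V - Z" using \<beta> by (simp add: B_def)
      have \<beta>c: "mon \<one>\<^bsub>K\<^esub> \<beta> \<in> carrier S" using \<beta>V by (intro mon_closed) auto
      have f\<beta>: "filter_mset (\<lambda>v. v \<notin> Z) \<beta> = \<beta>" using \<beta>V by (auto simp: filter_mset_eq_conv)
      show "\<exists>c\<in>subpolys Z - {\<zero>}. c \<otimes> mon \<one>\<^bsub>K\<^esub> \<beta> \<in> box_mod M Z B'"
      proof (cases "\<beta> \<in> B'")
        case True
        then have "mon \<one>\<^bsub>K\<^esub> \<beta> \<in> box Z B'" using \<beta>c f\<beta> by (simp add: box_def supp_mon_eq)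
        then have "\<one> \<otimes> mon \<one>\<^bsub>K\<^esub> \<beta> \<in> box_mod M Z B'" using \<beta>c box_mod_box[OF MI] by simp
        then show ?thesis using subpolys_one one_not_zero by blast
      next
        case False
        have "\<not> ok (insert \<beta> B')" using B'(2)[of "insert \<beta> B'"] False finB' by auto
        then have "box Z (insert \<beta> B') \<inter> M \<noteq> {\<zero>}" using \<beta> B'B B'0 by (auto simp: ok_def)
        then obtain h where h: "h \<in> box Z (insert \<beta> B')" "h \<in> M" "h \<noteq> \<zero>"
          using zM box_zero by blast
        have hc: "h \<in> carrier S" using h(1) by (rule box_carrier)
        define c where "c = coeff_at (\<lambda>v. v \<in> Z) \<beta> h"
        define h1 where "h1 = part (\<lambda>m. \<not> filter_mset (\<lambda>v. v \<notin> Z) m = \<beta>) h"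
        have cc: "c \<in> carrier S" unfolding c_def by (rule coeff_at_closed[OF hc])
        have h1c: "h1 \<in> carrier S" unfolding h1_def by (rule part_closed[OF hc])
        have c: "c \<in> subpolys Z" using cc by (auto simp: subpolys_def c_def supp_coeff_at)
        have h_eq: "h = mon \<one>\<^bsub>K\<^esub> \<beta> \<otimes> c \<oplus> h1"
          unfolding h1_def c_def by (rule coeff_at_split[OF hc]) (use \<beta>V in auto)
        have h1: "h1 \<in> box Z B'" using h(1) h1c by (auto simp: box_def h1_def supp_part)
        have "c \<noteq> \<zero>"
        proof
          assume "c = \<zero>"
          then have "h = h1" using h_eq \<beta>c h1c by simp
          with h1 h B'M show False by blast
        qed
        have "c \<otimes> mon \<one>\<^bsub>K\<^esub> \<beta> = (\<ominus> \<one>) \<otimes> h1 \<oplus> h" using h_eq cc \<beta>c h1c by algebra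
        moreover have "(\<ominus> \<one>) \<otimes> h1 \<in> box Z B'"
          by (intro box_mult h1) (simp add: subpolys_def supp_uminus supp_one)
        ultimately have "c \<otimes> mon \<one>\<^bsub>K\<^esub> \<beta> \<in> box_mod M Z B'" using box_modI[OF MI _ h(2)] by simp
        with c \<open>c \<noteq> \<zero>\<close> show ?thesis by blast
      qed
      fix c d assume "c \<in> subpolys Z" "d \<in> subpolys Z" "c \<otimes> mon \<one>\<^bsub>K\<^esub> \<beta> \<in> box_mod M Z B'"
      then show "d \<otimes> c \<otimes> mon \<one>\<^bsub>K\<^esub> \<beta> \<in> box_mod M Z B'"
        using box_mod_mult[OF MI] \<beta>c by (simp add: m_assoc subpolys_carrier)
    qed
    then obtain c where c: "c \<in> subpolys Z" "c \<noteq> \<zero>" "\<And>\<beta>. \<beta> \<in> B \<Longrightarrow> c \<otimes> mon \<one>\<^bsub>K\<^esub> \<beta> \<in> box_mod M Z B'"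
      by blast
    have cc: "c \<in> carrier S" using c(1) by (rule subpolys_carrier)
    have sc: "s \<in> carrier S" using s(1) by (rule subpolys_carrier)
    have cb: "c \<otimes> b \<in> box_mod M Z B'" if b: "b \<in> box Z B" for b
    proof -
      have "b \<in> carrier S" using b by (rule box_carrier)
      then show ?thesis
      proof (induction rule: mpoly_induct)
        case zero
        then show ?case using cc by (auto intro: box_mod_box[OF MI] box_zero)
      next
        case (mon_add a p g)
        define \<beta> where "\<beta> = filter_mset (\<lambda>v. v \<notin> Z) p"
        define q where "q = filter_mset (\<lambda>v. v \<in> Z) p"
        have p: "p = q + \<beta>" unfolding \<beta>_def q_def by (rule multiset_partition)
        have "\<beta> \<in> B" using b mon_add(4) by (auto simp: box_def \<beta>_def)
        have q: "set_mset q \<subseteq> V" "set_mset \<beta> \<subseteq> V" "set_mset q \<subseteq> Z" using mon_add(3) by (auto simp: \<beta>_def q_def)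
        have mc: "mon a q \<in> carrier S" "mon \<one>\<^bsub>K\<^esub> \<beta> \<in> carrier S" using q mon_add by (simp_all add: mon_closed)
        have "mon a p = mon a q \<otimes> mon \<one>\<^bsub>K\<^esub> \<beta>" using q mon_add p by (simp add: mon_mult_mon)
        then have "c \<otimes> (mon a p \<oplus> g) = mon a q \<otimes> (c \<otimes> mon \<one>\<^bsub>K\<^esub> \<beta>) \<oplus> c \<otimes> g"
          using mc cc mon_add(5) by algebra
        then show ?case
          using box_mod_add[OF MI box_mod_mult[OF MI mon_in_subpolys c(3)[OF \<open>\<beta> \<in> B\<close>]] mon_add(7)] q mon_add
          by simp
      qed
    qed
    \<comment> \<open>\<open>s\<close> brings products with a variable back into the span of
      \<open>B\<close>, and \<open>c\<close> brings the span of \<open>B\<close> into that of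
      \<open>B'\<close>.\<close>
    define s' where "s' = c \<otimes> s"
    have s': "s' \<in> subpolys Z" "s' \<noteq> \<zero>" "s' \<in> carrier S"
      using c s integral[of c s] cc sc subpolys_mult by (auto simp: s'_def)
    have one': "\<one> \<in> box_mod M Z B'"
      using subpolys_box[OF B'0] subpolys_one by (intro box_mod_box[OF MI]) auto
    have absorb: "s' \<otimes> (var v \<otimes> b) \<in> box_mod M Z B'" if v: "v \<in> V" and b: "b \<in> box Z B'" for v b
    proof (cases "v \<in> Z")
      case True
      then show ?thesis using v b s' by (intro box_mod_box[OF MI] box_mult) (auto simp: subpolys_var)
    next
      case False
      have bB: "b \<in> box Z B" using b box_mono[OF B'B] by blast
      obtain r where r: "r \<in> subpolys (insert v Z)" "\<forall>m\<in>supp r. count m v < D"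
        "s \<otimes> mon \<one>\<^bsub>K\<^esub> (replicate_mset D v) \<oplus> r \<in> M" using s(3)[of v] v False by blast
      have "s \<otimes> (var v \<otimes> b) \<in> box_mod M Z B"
        unfolding B_def by (rule box_mult_var[OF MI D(1) s(1) v False r(1) _ r(3)])
          (use r(2) bB in \<open>auto simp: B_def\<close>)
      then obtain b' \<mu> where b': "b' \<in> box Z B" "\<mu> \<in> M" "s \<otimes> (var v \<otimes> b) = b' \<oplus> \<mu>"
        by (rule box_modE[OF MI])
      have cs: "b' \<in> carrier S" "\<mu> \<in> carrier S" "b \<in> carrier S" "var v \<in> carrier S"
        using b' b v M.Icarr by (auto simp: box_carrier var_closed)
      have "s' \<otimes> (var v \<otimes> b) = c \<otimes> (s \<otimes> (var v \<otimes> b))"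
        unfolding s'_def using cc sc cs by (simp add: m_assoc)
      also have "\<dots> = c \<otimes> b' \<oplus> (\<zero> \<oplus> c \<otimes> \<mu>)" using b'(3) cc cs by (simp add: r_distr)
      also have "\<dots> \<in> box_mod M Z B'"
        by (intro box_mod_add[OF MI] cb b' box_modI[OF MI] box_zero ideal.I_l_closed[OF MI] cc)
      finally show ?thesis .
    qed
    \<comment> \<open>A nonzero polynomial in \<open>Z\<close>, hence invertible modulo
      \<open>M\<close>, yet coprime to \<open>s'\<close>. Clearing denominators in its inverse gives
      \<open>p \<otimes> b = s' [^] k\<close>, an exact equation because \<open>box Z B'\<close>
      meets \<open>M\<close> only in zero.\<close>
    define p where "p = \<one> \<oplus> s' \<otimes> var x"
    have p: "p \<in> subpolys Z" using s' x by (auto simp: p_def intro!: subpolys_add subpolys_one subpolys_mult subpolys_var)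
    have pc: "p \<in> carrier S" using p by (rule subpolys_carrier)
    have "p \<noteq> \<zero>"
    proof
      assume "p = \<zero>"
      have "(\<one> \<oplus> s' \<otimes> var x) {#} = \<one>\<^bsub>K\<^esub>"
      proof -
        have "s' \<otimes> var x = var x \<otimes> s'" using s' x by (simp add: m_comm var_closed)
        then show ?thesis using s' by (simp add: add_S mult_mon one_S mon_def[of _ "{#}"])
      qed
      with \<open>p = \<zero>\<close> show False unfolding p_def by (simp add: zero_S)
    qed
    then have "p \<notin> M" using p ZM by blast
    then obtain g where g: "g \<in> carrier S" "p \<otimes> g \<ominus> \<one> \<in> M" using inv pc by blast
    obtain k :: nat where "s' [^] k \<otimes> g \<in> box_mod M Z B'"
      using box_mod_absorbs[OF MI s'(1) one' absorb g(1)] by blast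
    then obtain b \<mu> where b: "b \<in> box Z B'" "\<mu> \<in> M" "s' [^] k \<otimes> g = b \<oplus> \<mu>" by (rule box_modE[OF MI])
    have cs: "b \<in> carrier S" "\<mu> \<in> carrier S" "s' [^] k \<in> carrier S"
      using b s' M.Icarr by (auto simp: box_carrier)
    have "p \<otimes> b \<ominus> s' [^] k = s' [^] k \<otimes> (p \<otimes> g \<ominus> \<one>) \<ominus> p \<otimes> \<mu>"
    proof -
      have "b = s' [^] k \<otimes> g \<ominus> \<mu>" using b(3) cs g by algebra
      then show ?thesis using cs g pc by algebra
    qed
    also have "\<dots> \<in> M"
      by (rule M.diff_closed[OF ideal.I_l_closed[OF MI g(2) cs(3)] ideal.I_l_closed[OF MI b(2) pc]])
    finally have "p \<otimes> b \<ominus> s' [^] k \<in> M" .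
    moreover have "p \<otimes> b \<ominus> s' [^] k \<in> box Z B'"
      using box_minus[OF box_mult[OF p b(1)]] subpolys_box[OF B'0] subpolys_pow[OF s'(1), of k] by blast
    ultimately have "p \<otimes> b \<ominus> s' [^] k = \<zero>" using B'M by blast
    then have "p \<otimes> b = s' [^] k" using pc cs by simp
    then show False
      unfolding p_def by (rule not_one_plus_var_divides_power[OF s'(3,2) x(2) cs(1)])
  qed
  then show ?thesis using rel[OF v] that by auto
qed

end

section \<open>Regular sequences and chains of primes\<close>

lemma ideal_zero: "ideal I R \<Longrightarrow> \<zero>\<^bsub>R\<^esub> \<in> I"
  by (simp add: additive_subgroup.zero_closed ideal.axioms(1))

lemma ideal_add: "ideal I R \<Longrightarrow> a \<in> I \<Longrightarrow> b \<in> I \<Longrightarrow> a \<oplus>\<^bsub>R\<^esub> b \<in> I"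
  by (simp add: additive_subgroup.a_closed ideal.axioms(1))

text \<open>Regularity on the quotient by \<open>J\<close>, recursive in the ideal so that
  inductions can change \<open>J\<close>. Properness of the final ideal is separated off and
  reappears in \<open>regular_sequence_iff\<close>.\<close>

primrec weakly_regular :: "('a, 'm) ring_scheme \<Rightarrow> 'a set \<Rightarrow> 'a list \<Rightarrow> bool" where
  "weakly_regular R J [] \<longleftrightarrow> True"
| "weakly_regular R J (x # xs) \<longleftrightarrow>
     (\<forall>a\<in>carrier R. x \<otimes>\<^bsub>R\<^esub> a \<in> J \<longrightarrow> a \<in> J) \<and> weakly_regular R (adjoin R J x) xs"

definition colon :: "('a, 'm) ring_scheme \<Rightarrow> 'a set \<Rightarrow> 'a \<Rightarrow> 'a set" where
  "colon R J x = {a \<in> carrier R. a \<otimes>\<^bsub>R\<^esub> x \<in> J}"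

context cring
begin

section \<open>Adjoining elements, colon ideals and associated primes\<close>

lemma adjoin_ideal:
  assumes J: "ideal J R" and x: "x \<in> carrier R" shows "ideal (adjoin R J x) R"
proof (rule ideal_criterion)
  have Jc: "b \<in> J \<Longrightarrow> b \<in> carrier R" for b using ideal.Icarr[OF J] .
  show "adjoin R J x \<subseteq> carrier R" using x Jc by (auto simp: adjoin_def)
  show "\<zero> \<in> adjoin R J x" using adjoinI[OF ideal_zero[OF J], of \<zero> R x] x by simp
  fix a assume a: "a \<in> adjoin R J x"
  then obtain b r where b: "b \<in> J" "r \<in> carrier R" "a = b \<oplus> x \<otimes> r" by (rule adjoinE)
  show "a \<oplus> a' \<in> adjoin R J x" if a': "a' \<in> adjoin R J x" for a'
  proof -
    obtain b' r' where b': "b' \<in> J" "r' \<in> carrier R" "a' = b' \<oplus> x \<otimes> r'" using a' by (rule adjoinE)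
    have "a \<oplus> a' = (b \<oplus> b') \<oplus> x \<otimes> (r \<oplus> r')" using b b' x Jc by algebra
    then show ?thesis using b b' by (auto intro: adjoinI ideal_add[OF J])
  qed
  show "c \<otimes> a \<in> adjoin R J x" if c: "c \<in> carrier R" for c
  proof -
    have "c \<otimes> a = c \<otimes> b \<oplus> x \<otimes> (c \<otimes> r)" using b c x Jc by algebra
    then show ?thesis using b c by (auto intro: adjoinI ideal.I_l_closed[OF J])
  qed
qed

lemma subset_adjoin:
  assumes J: "ideal J R" and x: "x \<in> carrier R" shows "J \<subseteq> adjoin R J x"
proof
  fix b assume b: "b \<in> J"
  then have "b = b \<oplus> x \<otimes> \<zero>" using x ideal.Icarr[OF J] by simp
  then show "b \<in> adjoin R J x" using adjoinI[OF b zero_closed, of x] by simp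
qed

lemma mem_adjoin:
  assumes J: "ideal J R" and x: "x \<in> carrier R" shows "x \<in> adjoin R J x"
  using adjoinI[OF ideal_zero[OF J] one_closed, of x] x by simp

lemma adjoin_minimal:
  assumes "ideal L R" "J \<subseteq> L" "x \<in> L" shows "adjoin R J x \<subseteq> L"
  using assms by (auto simp: adjoin_def intro!: ideal_add ideal.I_r_closed)

lemma adjoin_Idl:
  assumes A: "A \<subseteq> carrier R" and x: "x \<in> carrier R"
  shows "adjoin R (Idl A) x = Idl (insert x A)"
proof
  have Ax: "insert x A \<subseteq> carrier R" using A x by simp
  note I = genideal_ideal[OF A] and I' = genideal_ideal[OF Ax]
  show "adjoin R (Idl A) x \<subseteq> Idl (insert x A)"
    using subset_Idl_subset[OF Ax, of A] genideal_self[OF Ax] by (intro adjoin_minimal[OF I']) auto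
  show "Idl (insert x A) \<subseteq> adjoin R (Idl A) x"
    using genideal_self[OF A] subset_adjoin[OF I x] mem_adjoin[OF I x]
    by (intro genideal_minimal adjoin_ideal I x) auto
qed

lemma weakly_regular_Idl:
  assumes "A \<subseteq> carrier R" "set xs \<subseteq> carrier R"
  shows "weakly_regular R (Idl A) xs \<longleftrightarrow> (\<forall>i<length xs. \<forall>a\<in>carrier R.
    xs ! i \<otimes> a \<in> Idl (A \<union> set (take i xs)) \<longrightarrow> a \<in> Idl (A \<union> set (take i xs)))"
  using assms
proof (induction xs arbitrary: A)
  case Nil
  show ?case by simp
next
  case (Cons x xs)
  have "weakly_regular R (adjoin R (Idl A) x) xs \<longleftrightarrow> (\<forall>i<length xs. \<forall>a\<in>carrier R.
    xs ! i \<otimes> a \<in> Idl (insert x A \<union> set (take i xs)) \<longrightarrow> a \<in> Idl (insert x A \<union> set (take i xs)))"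
    using Cons by (simp add: adjoin_Idl)
  then show ?case by (simp add: All_less_Suc2)
qed

lemma Idl_empty: "Idl {} = {\<zero>}"
  using genideal_minimal[OF zeroideal, of "{}"] ideal_zero[OF genideal_ideal[of "{}"]] by auto

lemma regular_sequence_iff:
  assumes "set xs \<subseteq> carrier R"
  shows "regular_sequence R xs \<longleftrightarrow> weakly_regular R {\<zero>} xs \<and> Idl (set xs) \<noteq> carrier R"
  using weakly_regular_Idl[of "{}" xs] assms by (simp add: regular_sequence_def Idl_empty)

lemma adjoin_cong:
  assumes J: "ideal J R" and xy: "x \<in> carrier R" "y \<in> carrier R" "x \<ominus> y \<in> J"
  shows "adjoin R J x = adjoin R J y"
proof -
  have le: "adjoin R J x \<subseteq> adjoin R J y" if xy: "x \<in> carrier R" "y \<in> carrier R" "x \<ominus> y \<in> J" for x y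
  proof (rule adjoin_minimal[OF adjoin_ideal[OF J xy(2)] subset_adjoin[OF J xy(2)]])
    have "x = (x \<ominus> y) \<oplus> y \<otimes> \<one>" using xy by algebra
    then show "x \<in> adjoin R J y" using adjoinI[OF xy(3) one_closed, of y] by simp
  qed
  have "y \<ominus> x = \<ominus> (x \<ominus> y)" using xy by algebra
  then have "y \<ominus> x \<in> J" using xy(3) J by (simp add: additive_subgroup.a_inv_closed ideal.axioms(1))
  then show ?thesis using le xy by blast
qed

text \<open>Regularity depends only on residue classes modulo \<open>J\<close>. This allows a sum of
  variables to be exchanged for the one variable that survives modulo \<open>J\<close>.\<close>

lemma weakly_regular_cong:
  assumes "ideal J R" "list_all2 (\<lambda>x y. x \<in> carrier R \<and> y \<in> carrier R \<and> x \<ominus> y \<in> J) xs ys"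
    and "weakly_regular R J xs"
  shows "weakly_regular R J ys"
  using assms
proof (induction xs arbitrary: J ys)
  case Nil
  then show ?case by simp
next
  case (Cons x xs J zs)
  then obtain y ys where zs: "zs = y # ys" "x \<in> carrier R" "y \<in> carrier R" "x \<ominus> y \<in> J"
    "list_all2 (\<lambda>x y. x \<in> carrier R \<and> y \<in> carrier R \<and> x \<ominus> y \<in> J) xs ys"
    by (auto simp: list_all2_Cons1)
  have J: "ideal J R" by fact
  note xy = zs(2-4)
  have "a \<in> J" if a: "a \<in> carrier R" "y \<otimes> a \<in> J" for a
  proof -
    have "x \<otimes> a = (x \<ominus> y) \<otimes> a \<oplus> y \<otimes> a" using xy a by algebra
    also have "\<dots> \<in> J" by (rule ideal_add[OF J ideal.I_r_closed[OF J xy(3) a(1)] a(2)])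
    finally show ?thesis using Cons(4) a by simp
  qed
  moreover have "weakly_regular R (adjoin R J x) ys"
  proof (rule Cons(1))
    show "ideal (adjoin R J x) R" by (rule adjoin_ideal[OF J xy(1)])
    show "list_all2 (\<lambda>u v. u \<in> carrier R \<and> v \<in> carrier R \<and> u \<ominus> v \<in> adjoin R J x) xs ys"
      using zs(5) by (rule list_all2_mono) (use subset_adjoin[OF J xy(1)] in auto)
  qed (use Cons in auto)
  ultimately show ?case using adjoin_cong[OF J xy] zs(1) by simp
qed

lemma colon_ideal:
  assumes J: "ideal J R" and x: "x \<in> carrier R" shows "ideal (colon R J x) R"
proof (rule ideal_criterion)
  show "colon R J x \<subseteq> carrier R" by (auto simp: colon_def)
  show "\<zero> \<in> colon R J x" using x ideal_zero[OF J] by (simp add: colon_def)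
  show "a \<oplus> b \<in> colon R J x" if "a \<in> colon R J x" "b \<in> colon R J x" for a b
    using that x by (simp add: colon_def l_distr ideal_add[OF J])
  show "c \<otimes> a \<in> colon R J x" if "a \<in> colon R J x" "c \<in> carrier R" for a c
    using that x by (simp add: colon_def m_assoc ideal.I_l_closed[OF J])
qed

lemma adjoin_commute:
  assumes J: "ideal J R" and x: "x \<in> carrier R" "y \<in> carrier R"
  shows "adjoin R (adjoin R J x) y = adjoin R (adjoin R J y) x"
proof -
  have le: "adjoin R (adjoin R J x) y \<subseteq> adjoin R (adjoin R J y) x"
    if x: "x \<in> carrier R" "y \<in> carrier R" for x y
  proof -
    note Jy = adjoin_ideal[OF J x(2)]
    note I = adjoin_ideal[OF Jy x(1)]
    show ?thesis
      using subset_adjoin[OF J x(2)] subset_adjoin[OF Jy x(1)] mem_adjoin[OF J x(2)] mem_adjoin[OF Jy x(1)]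
      by (intro adjoin_minimal I) auto
  qed
  show ?thesis using le x by blast
qed

text \<open>The two outer terms of the exact sequence \<open>0 \<rightarrow> R/(J : x) \<rightarrow> R/J \<rightarrow> R/(J + x) \<rightarrow> 0\<close> control
  the middle one.\<close>

lemma weakly_regular_exact:
  assumes "ideal J R" "x \<in> carrier R" "set fs \<subseteq> carrier R"
    and "weakly_regular R (colon R J x) fs" "weakly_regular R (adjoin R J x) fs"
  shows "weakly_regular R J fs"
  using assms
proof (induction fs arbitrary: J)
  case Nil
  show ?case by simp
next
  case (Cons f fs)
  have J: "ideal J R" and x: "x \<in> carrier R" and f: "f \<in> carrier R" using Cons by auto
  have Jc: "b \<in> J \<Longrightarrow> b \<in> carrier R" for b using ideal.Icarr[OF J] .
  have reg: "a \<in> J" if a: "a \<in> carrier R" "f \<otimes> a \<in> J" for a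
  proof -
    have "a \<in> adjoin R J x" using Cons(6) a subset_adjoin[OF J x] by auto
    then obtain j b where b: "j \<in> J" "b \<in> carrier R" "a = j \<oplus> x \<otimes> b" by (rule adjoinE)
    have "(f \<otimes> b) \<otimes> x = f \<otimes> a \<ominus> f \<otimes> j" using b f x Jc by algebra
    also have "\<dots> \<in> J" by (rule ideal.diff_closed[OF J a(2) ideal.I_l_closed[OF J b(1) f]])
    finally have "f \<otimes> b \<in> colon R J x" using b f by (simp add: colon_def)
    then have "b \<in> colon R J x" using Cons(5) b by simp
    then have "x \<otimes> b \<in> J" using b x by (simp add: colon_def m_comm)
    then show ?thesis using b ideal_add[OF J] by simp
  qed
  \<comment> \<open>Adjoining \<open>f\<close> commutes with the colon by \<open>x\<close> because
    \<open>f\<close> is regular modulo \<open>J + (x)\<close>: if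
    \<open>a \<otimes> x = j \<oplus> f \<otimes> c\<close>, then \<open>c\<close> lies in that
    ideal. So both hypotheses pass to \<open>adjoin R J f\<close>.\<close>
  have "colon R (adjoin R J f) x = adjoin R (colon R J x) f"
  proof (intro subset_antisym subsetI)
    fix a assume "a \<in> colon R (adjoin R J f) x"
    then have a: "a \<in> carrier R" "a \<otimes> x \<in> adjoin R J f" by (auto simp: colon_def)
    obtain j c where c: "j \<in> J" "c \<in> carrier R" "a \<otimes> x = j \<oplus> f \<otimes> c" using a(2) by (rule adjoinE)
    have "f \<otimes> c = (\<ominus> j) \<oplus> x \<otimes> a" using c a f x Jc by algebra
    moreover have "\<ominus> j \<in> J" using c J by (simp add: additive_subgroup.a_inv_closed ideal.axioms(1))
    ultimately have "f \<otimes> c \<in> adjoin R J x" using a by (auto intro: adjoinI)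
    then have "c \<in> adjoin R J x" using Cons(6) c by simp
    then obtain j' d where d: "j' \<in> J" "d \<in> carrier R" "c = j' \<oplus> x \<otimes> d" by (rule adjoinE)
    have "(a \<ominus> f \<otimes> d) \<otimes> x = j \<oplus> f \<otimes> j'"
    proof -
      have "(a \<ominus> f \<otimes> d) \<otimes> x = a \<otimes> x \<ominus> f \<otimes> (x \<otimes> d)" using a d f x by algebra
      also have "\<dots> = j \<oplus> f \<otimes> j'" unfolding c(3) d(3) using c d f x Jc by algebra
      finally show ?thesis .
    qed
    also have "\<dots> \<in> J" using c d f by (intro ideal_add[OF J] ideal.I_l_closed[OF J])
    finally have "a \<ominus> f \<otimes> d \<in> colon R J x" using a d f by (simp add: colon_def)
    moreover have "a = (a \<ominus> f \<otimes> d) \<oplus> f \<otimes> d" using a d f by algebra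
    ultimately show "a \<in> adjoin R (colon R J x) f" using d adjoinI by metis
  next
    fix a assume "a \<in> adjoin R (colon R J x) f"
    then obtain e c where c: "e \<in> colon R J x" "c \<in> carrier R" "a = e \<oplus> f \<otimes> c" by (rule adjoinE)
    have e: "e \<in> carrier R" "e \<otimes> x \<in> J" using c(1) by (auto simp: colon_def)
    have "a \<otimes> x = e \<otimes> x \<oplus> f \<otimes> (c \<otimes> x)" using c e f x by algebra
    then have "a \<otimes> x \<in> adjoin R J f" using e c x adjoinI[of "e \<otimes> x" J "c \<otimes> x" R f] by simp
    then show "a \<in> colon R (adjoin R J f) x" using c e f by (simp add: colon_def)
  qed
  moreover have "adjoin R (adjoin R J f) x = adjoin R (adjoin R J x) f"
    by (rule adjoin_commute[OF J f x])
  ultimately have "weakly_regular R (adjoin R J f) fs"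
    using Cons(4-6) by (intro Cons.IH[OF adjoin_ideal[OF J f] x]) simp_all
  then show ?case using reg by simp
qed

text \<open>A non-empty chain of ideals in a Noetherian ring contains its union, so Zorn's lemma
  applies.\<close>

lemma exists_maximal_member:
  assumes "noetherian_ring R" "\<A> \<noteq> {}" "\<And>I. I \<in> \<A> \<Longrightarrow> ideal I R"
  obtains I where "I \<in> \<A>" "\<And>L. L \<in> \<A> \<Longrightarrow> I \<subseteq> L \<Longrightarrow> L = I"
proof -
  interpret noetherian_ring R by fact
  have "\<exists>I\<in>\<A>. \<forall>L\<in>\<A>. I \<subseteq> L \<longrightarrow> L = I"
  proof (rule subset_Zorn_nonempty[OF assms(2)])
    fix C assume C: "C \<noteq> {}" "subset.chain \<A> C"
    then have "subset.chain {I. ideal I R} C"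
      using assms(3) by (auto simp: pred_on.chain_def)
    then have "\<Union>C \<in> C" by (rule ideal_chain_is_trivial[OF C(1)])
    then show "\<Union>C \<in> \<A>" using C(2) by (auto simp: pred_on.chain_def)
  qed
  then show ?thesis using that by blast
qed

text \<open>A maximal one among the proper colons \<open>colon R J w\<close> above
  \<open>colon R J z\<close> is prime: if \<open>a \<otimes> b\<close> is in it and \<open>b\<close>
  is not, replacing \<open>w\<close> by \<open>b \<otimes> w\<close> cannot enlarge the colon, which
  then contains \<open>a\<close>.\<close>

lemma exists_associated_prime:
  assumes N: "noetherian_ring R" and J: "ideal J R" and z: "z \<in> carrier R" "z \<notin> J"
  obtains w where "w \<in> carrier R" "w \<notin> J" "primeideal (colon R J w) R" "colon R J z \<subseteq> colon R J w"
proof -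
  let ?\<A> = "{colon R J w | w. w \<in> carrier R \<and> w \<notin> J \<and> colon R J z \<subseteq> colon R J w}"
  obtain I where I: "I \<in> ?\<A>" "\<And>L. L \<in> ?\<A> \<Longrightarrow> I \<subseteq> L \<Longrightarrow> L = I"
  proof (rule exists_maximal_member[OF N, of ?\<A>])
    show "?\<A> \<noteq> {}" using z by blast
    show "ideal I R" if "I \<in> ?\<A>" for I using that colon_ideal[OF J] by auto
  qed blast
  then obtain w where w: "w \<in> carrier R" "w \<notin> J" "colon R J z \<subseteq> colon R J w" "I = colon R J w" by blast
  have "primeideal (colon R J w) R"
  proof (rule primeidealI)
    show "ideal (colon R J w) R" by (rule colon_ideal[OF J w(1)])
    show "cring R" by (rule is_cring)
    have "\<one> \<notin> colon R J w" using w by (simp add: colon_def)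
    then show "carrier R \<noteq> colon R J w" by auto
    fix a b assume ab: "a \<in> carrier R" "b \<in> carrier R" "a \<otimes> b \<in> colon R J w"
    show "a \<in> colon R J w \<or> b \<in> colon R J w"
    proof (cases "b \<in> colon R J w")
      case False
      then have bw: "b \<otimes> w \<in> carrier R" "b \<otimes> w \<notin> J" using ab w by (auto simp: colon_def)
      have le: "colon R J w \<subseteq> colon R J (b \<otimes> w)"
      proof
        fix c assume "c \<in> colon R J w"
        then have c: "c \<in> carrier R" "c \<otimes> w \<in> J" by (auto simp: colon_def)
        have "c \<otimes> (b \<otimes> w) = b \<otimes> (c \<otimes> w)" using c ab w by algebra
        then show "c \<in> colon R J (b \<otimes> w)" using c ab ideal.I_l_closed[OF J] by (simp add: colon_def)
      qed
      have "colon R J (b \<otimes> w) \<in> ?\<A>" using bw le w(3) by blast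
      then have "colon R J (b \<otimes> w) = colon R J w" using I(2) le w(4) by blast
      moreover have "a \<in> colon R J (b \<otimes> w)" using ab w by (simp add: colon_def m_assoc)
      ultimately show ?thesis by simp
    qed simp
  qed
  with w that show ?thesis by blast
qed

text \<open>Nakayama's argument: otherwise an element \<open>z\<close> annihilated by \<open>colon R J y\<close> with \<open>J + (z)\<close>
  maximal would be \<open>z = j + x w\<close>, and \<open>w\<close> would be a multiple of \<open>x w\<close> modulo \<open>J\<close>.\<close>

lemma associated_prime_lift:
  assumes N: "noetherian_ring R" and J: "ideal J R" and x: "x \<in> carrier R"
    and reg: "\<And>a. a \<in> carrier R \<Longrightarrow> x \<otimes> a \<in> J \<Longrightarrow> a \<in> J"
    and unit: "\<And>r. r \<in> carrier R \<Longrightarrow> \<one> \<ominus> x \<otimes> r \<in> Units R"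
    and y: "y \<in> carrier R" "y \<notin> J"
  obtains z where "z \<in> carrier R" "z \<notin> adjoin R J x"
    "insert x (colon R J y) \<subseteq> colon R (adjoin R J x) z"
proof -
  have Jc: "b \<in> J \<Longrightarrow> b \<in> carrier R" for b using ideal.Icarr[OF J] .
  \<comment> \<open>The elements annihilated by \<open>colon R J y\<close> modulo \<open>J\<close>.
    One of them outside \<open>J + (x)\<close> is wanted, since its colon modulo that ideal contains
    \<open>x\<close> as well.\<close>
  define A where "A = {z \<in> carrier R. \<forall>p\<in>colon R J y. p \<otimes> z \<in> J}"
  have yA: "y \<in> A" using y by (simp add: A_def colon_def)
  have "\<exists>z\<in>A. z \<notin> adjoin R J x"
  proof (rule ccontr)
    assume n: "\<not> ?thesis"
    let ?\<A> = "{adjoin R J z | z. z \<in> A \<and> z \<notin> J}"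
    obtain I where I: "I \<in> ?\<A>" "\<And>L. L \<in> ?\<A> \<Longrightarrow> I \<subseteq> L \<Longrightarrow> L = I"
    proof (rule exists_maximal_member[OF N, of ?\<A>])
      show "?\<A> \<noteq> {}" using yA y by blast
      show "ideal I R" if "I \<in> ?\<A>" for I using that adjoin_ideal[OF J] by (auto simp: A_def)
    qed blast
    then obtain z where z: "z \<in> A" "z \<notin> J" "I = adjoin R J z" by blast
    have zc: "z \<in> carrier R" using z by (simp add: A_def)
    have "z \<in> adjoin R J x" using n z by blast
    then obtain j w where w: "j \<in> J" "w \<in> carrier R" "z = j \<oplus> x \<otimes> w" by (rule adjoinE)
    have "p \<otimes> w \<in> J" if p: "p \<in> colon R J y" for p
    proof -
      have pc: "p \<in> carrier R" using p by (simp add: colon_def)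
      have "x \<otimes> (p \<otimes> w) = p \<otimes> z \<ominus> p \<otimes> j" using w pc x Jc by algebra
      also have "\<dots> \<in> J"
        using z(1) p by (intro ideal.diff_closed[OF J _ ideal.I_l_closed[OF J w(1) pc]]) (auto simp: A_def)
      finally show ?thesis using reg pc w by simp
    qed
    then have wA: "w \<in> A" using w by (simp add: A_def)
    have wJ: "w \<notin> J"
    proof
      assume "w \<in> J"
      then have "z \<in> J" using w x by (auto intro!: ideal_add[OF J] ideal.I_l_closed[OF J])
      with z show False by simp
    qed
    note Jw = adjoin_ideal[OF J w(2)]
    have "z \<in> adjoin R J w"
    proof -
      have "z = j \<oplus> w \<otimes> x" using w x by (simp add: m_comm)
      then show ?thesis using adjoinI[OF w(1) x, of w] by simp
    qed
    then have "adjoin R J z \<subseteq> adjoin R J w"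
      by (intro adjoin_minimal Jw subset_adjoin[OF J w(2)])
    then have "adjoin R J w = adjoin R J z" using I(2)[of "adjoin R J w"] wA wJ z(3) by auto
    then have "w \<in> adjoin R J z" using mem_adjoin[OF J w(2)] by simp
    then obtain j' r where r: "j' \<in> J" "r \<in> carrier R" "w = j' \<oplus> z \<otimes> r" by (rule adjoinE)
    have u: "\<one> \<ominus> x \<otimes> r \<in> Units R" by (rule unit[OF r(2)])
    have "w = j' \<oplus> (j \<oplus> x \<otimes> w) \<otimes> r" using r(3) w(3) by simp
    \<comment> \<open>The equation for \<open>w\<close> has \<open>w\<close> on both sides;
      \<open>w'\<close> and \<open>q\<close> separate the occurrence to be replaced from the one
      inside \<open>x \<otimes> w\<close>.\<close>
    moreover have "w' \<ominus> q \<otimes> r = j' \<oplus> r \<otimes> j"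
      if "w' = j' \<oplus> (j \<oplus> q) \<otimes> r" "q \<in> carrier R" for w' q
      unfolding that(1) using that(2) w(1) r(1,2) Jc by algebra
    ultimately have "w \<ominus> (x \<otimes> w) \<otimes> r = j' \<oplus> r \<otimes> j" using w(2) x by blast
    moreover have "(\<one> \<ominus> x \<otimes> r) \<otimes> w = w \<ominus> (x \<otimes> w) \<otimes> r" using w(2) r(2) x by algebra
    ultimately have "(\<one> \<ominus> x \<otimes> r) \<otimes> w = j' \<oplus> r \<otimes> j" by simp
    also have "\<dots> \<in> J" using w r by (intro ideal_add[OF J] ideal.I_l_closed[OF J])
    finally have uw: "(\<one> \<ominus> x \<otimes> r) \<otimes> w \<in> J" .
    define u where "u = \<one> \<ominus> x \<otimes> r"
    have u': "u \<in> Units R" "u \<otimes> w \<in> J" using u uw by (simp_all add: u_def)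
    have "inv u \<otimes> (u \<otimes> w) \<in> J"
      by (rule ideal.I_l_closed[OF J u'(2)]) (use u'(1) in simp)
    moreover have "inv u \<otimes> (u \<otimes> w) = w" using u'(1) w(2) by (simp add: Units_closed flip: m_assoc)
    ultimately have "w \<in> J" by simp
    with wJ show False by simp
  qed
  then obtain z where z: "z \<in> A" "z \<notin> adjoin R J x" by blast
  have zc: "z \<in> carrier R" using z by (simp add: A_def)
  have "x \<otimes> z \<in> adjoin R J x" using adjoinI[OF ideal_zero[OF J] zc, of x] x zc by simp
  moreover have "p \<otimes> z \<in> adjoin R J x" if "p \<in> colon R J y" for p
    using z that subset_adjoin[OF J x] by (auto simp: A_def)
  ultimately have "insert x (colon R J y) \<subseteq> colon R (adjoin R J x) z"
    using x by (auto simp: colon_def)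
  with z zc that show ?thesis by blast
qed

text \<open>The prime \<open>colon R J y\<close> lies in an associated prime of
  \<open>J + (x)\<close> that also contains \<open>x\<close>. The inclusion is strict because
  \<open>x\<close>, being regular modulo \<open>J\<close>, is outside the smaller prime. The
  hypothesis on units expresses that \<open>xs\<close> lies in the Jacobson radical.\<close>

theorem regular_sequence_prime_chain:
  assumes N: "noetherian_ring R" and "ideal J R" "set xs \<subseteq> carrier R" "weakly_regular R J xs"
    and "\<And>x r. x \<in> set xs \<Longrightarrow> r \<in> carrier R \<Longrightarrow> \<one> \<ominus> x \<otimes> r \<in> Units R"
    and "y \<in> carrier R" "y \<notin> J" "primeideal (colon R J y) R"
  shows "\<exists>Q. prime_chain R (length xs) Q \<and> Q 0 = colon R J y"
  using assms(2-)
proof (induction xs arbitrary: J y)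
  case Nil
  then show ?case by (intro exI[of _ "\<lambda>_. colon R J y"]) (simp add: prime_chain_def)
next
  case (Cons x xs)
  have J: "ideal J R" and x: "x \<in> carrier R" using Cons by auto
  obtain z where z: "z \<in> carrier R" "z \<notin> adjoin R J x"
    "insert x (colon R J y) \<subseteq> colon R (adjoin R J x) z"
    by (rule associated_prime_lift[OF N J x, of y]) (use Cons in auto)
  obtain w where w: "w \<in> carrier R" "w \<notin> adjoin R J x" "primeideal (colon R (adjoin R J x) w) R"
    "colon R (adjoin R J x) z \<subseteq> colon R (adjoin R J x) w"
    by (rule exists_associated_prime[OF N adjoin_ideal[OF J x] z(1,2)])
  have "\<exists>Q. prime_chain R (length xs) Q \<and> Q 0 = colon R (adjoin R J x) w"
    by (rule Cons(1)) (use Cons w adjoin_ideal[OF J x] in auto)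
  then obtain Q where Q: "prime_chain R (length xs) Q" "Q 0 = colon R (adjoin R J x) w" by blast
  have "x \<notin> colon R J y" using Cons(4,6,7) x by (auto simp: colon_def)
  then have lt: "colon R J y \<subset> Q 0" using z(3) w(4) Q(2) by blast
  define Q' where "Q' i = (case i of 0 \<Rightarrow> colon R J y | Suc k \<Rightarrow> Q k)" for i
  have "prime_chain R (length (x # xs)) Q'"
    using Q(1) lt Cons(8) unfolding prime_chain_def Q'_def by (auto split: nat.split)
  moreover have "Q' 0 = colon R J y" by (simp add: Q'_def)
  ultimately show ?case by blast
qed

end

section \<open>Localizations\<close>

context primeideal
begin

lemma one_not_mem: "\<one> \<notin> I"
  using I_notcarr one_imp_carrier by blast

lemma compl_mult: "s \<in> carrier R - I \<Longrightarrow> t \<in> carrier R - I \<Longrightarrow> s \<otimes> t \<in> carrier R - I"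
  using I_prime[of s t] by auto

lemma compl_one: "\<one> \<in> carrier R - I"
  using one_not_mem by auto

text \<open>For transitivity the two multipliers and the middle denominator are multiplied together;
  primality keeps the product outside \<open>I\<close>.\<close>

lemma equiv_loc_rel: "equiv (carrier R \<times> (carrier R - I)) (loc_rel R I)"
proof (rule equivI)
  show "loc_rel R I \<subseteq> (carrier R \<times> (carrier R - I)) \<times> (carrier R \<times> (carrier R - I))"
    by (auto simp: loc_rel_def)
  show "refl_on (carrier R \<times> (carrier R - I)) (loc_rel R I)"
    using compl_one by (auto simp: refl_on_def loc_rel_def)
  show "sym (loc_rel R I)"
  proof (rule symI)
    fix p q assume "(p, q) \<in> loc_rel R I"
    then obtain a s b t u where "p = (a, s)" "q = (b, t)" "a \<in> carrier R" "b \<in> carrier R"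
      "s \<in> carrier R - I" "t \<in> carrier R - I" "u \<in> carrier R - I" "u \<otimes> (b \<otimes> s) = u \<otimes> (a \<otimes> t)"
      unfolding loc_rel_def by fastforce
    then show "(q, p) \<in> loc_rel R I" unfolding loc_rel_def by blast
  qed
  show "trans (loc_rel R I)"
  proof (rule transI)
    fix p q r assume pq: "(p, q) \<in> loc_rel R I" and qr: "(q, r) \<in> loc_rel R I"
    obtain a s b t u where 1: "p = (a, s)" "q = (b, t)" "a \<in> carrier R" "b \<in> carrier R"
      "s \<in> carrier R - I" "t \<in> carrier R - I" "u \<in> carrier R - I" "u \<otimes> (a \<otimes> t) = u \<otimes> (b \<otimes> s)"
      using pq by (auto simp: loc_rel_def)
    obtain c w v where 2: "r = (c, w)" "c \<in> carrier R" "w \<in> carrier R - I" "v \<in> carrier R - I"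
      "v \<otimes> (b \<otimes> w) = v \<otimes> (c \<otimes> t)"
      using qr 1(2) by (auto simp: loc_rel_def)
    have m: "s \<in> carrier R" "t \<in> carrier R" "u \<in> carrier R" "v \<in> carrier R" "w \<in> carrier R"
      using 1 2 by auto
    have "(u \<otimes> v \<otimes> t) \<otimes> (a \<otimes> w) = v \<otimes> w \<otimes> (u \<otimes> (a \<otimes> t))"
      using 1(3,4) 2(2) m by algebra
    also have "\<dots> = u \<otimes> s \<otimes> (v \<otimes> (b \<otimes> w))" unfolding 1(8) using 1(3,4) 2(2) m by algebra
    also have "\<dots> = (u \<otimes> v \<otimes> t) \<otimes> (c \<otimes> s)" unfolding 2(5) using 1(3,4) 2(2) m by algebra
    finally have "(u \<otimes> v \<otimes> t) \<otimes> (a \<otimes> w) = (u \<otimes> v \<otimes> t) \<otimes> (c \<otimes> s)" .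
    moreover have "u \<otimes> v \<otimes> t \<in> carrier R - I" using 1 2 compl_mult by blast
    ultimately show "(p, r) \<in> loc_rel R I" using 1 2 unfolding loc_rel_def by blast
  qed
qed

abbreviation frac :: "'a \<Rightarrow> 'a \<Rightarrow> ('a \<times> 'a) set" where
  "frac a s \<equiv> loc_frac R I a s"

lemma frac_eq_iff:
  assumes "a \<in> carrier R" "b \<in> carrier R" "s \<in> carrier R - I" "t \<in> carrier R - I"
  shows "frac a s = frac b t \<longleftrightarrow> (\<exists>u\<in>carrier R - I. u \<otimes> (a \<otimes> t) = u \<otimes> (b \<otimes> s))"
proof -
  have "frac a s = frac b t \<longleftrightarrow> ((a, s), (b, t)) \<in> loc_rel R I"
    unfolding loc_frac_def using assms by (intro eq_equiv_class_iff[OF equiv_loc_rel]) auto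
  then show ?thesis using assms by (auto simp: loc_rel_def)
qed

lemma frac_eqI:
  assumes "a \<in> carrier R" "b \<in> carrier R" "s \<in> carrier R - I" "t \<in> carrier R - I" "a \<otimes> t = b \<otimes> s"
  shows "frac a s = frac b t"
  using assms compl_one by (subst frac_eq_iff) auto

lemma mem_frac:
  assumes "a \<in> carrier R" "s \<in> carrier R - I" "(a', s') \<in> frac a s"
  shows "a' \<in> carrier R" "s' \<in> carrier R - I" "frac a' s' = frac a s"
proof -
  have "((a, s), (a', s')) \<in> loc_rel R I" using assms by (simp add: loc_frac_def)
  then show "a' \<in> carrier R" "s' \<in> carrier R - I" by (auto simp: loc_rel_def)
  show "frac a' s' = frac a s"
    using equiv_class_eq[OF equiv_loc_rel \<open>((a, s), (a', s')) \<in> loc_rel R I\<close>] by (simp add: loc_frac_def)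
qed

lemma frac_self: "a \<in> carrier R \<Longrightarrow> s \<in> carrier R - I \<Longrightarrow> (a, s) \<in> frac a s"
  using equiv_class_self[OF equiv_loc_rel, of "(a, s)"] by (simp add: loc_frac_def)

text \<open>The ring operations are unions over all representatives; once the value does not depend
  on them, the union over the non-empty classes collapses to it.\<close>

lemma Union_frac:
  assumes "a \<in> carrier R" "s \<in> carrier R - I" "b \<in> carrier R" "t \<in> carrier R - I"
    and f: "\<And>a' s' b' t'. \<lbrakk>a' \<in> carrier R; s' \<in> carrier R - I; b' \<in> carrier R; t' \<in> carrier R - I;
      frac a' s' = frac a s; frac b' t' = frac b t\<rbrakk> \<Longrightarrow> f a' s' b' t' = f a s b t"
  shows "(\<Union>(a', s')\<in>frac a s. \<Union>(b', t')\<in>frac b t. f a' s' b' t') = f a s b t"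
proof -
  have "f a' s' b' t' = f a s b t" if "(a', s') \<in> frac a s" "(b', t') \<in> frac b t" for a' s' b' t'
    using mem_frac[OF assms(1,2) that(1)] mem_frac[OF assms(3,4) that(2)] f by blast
  then have "(\<Union>(a', s')\<in>frac a s. \<Union>(b', t')\<in>frac b t. f a' s' b' t')
      = (\<Union>p\<in>frac a s. \<Union>q\<in>frac b t. f a s b t)"
    by (intro SUP_cong refl) (auto split: prod.splits)
  also have "\<dots> = f a s b t" using frac_self assms(1-4) by fastforce
  finally show ?thesis .
qed

lemma carrier_localization:
  "carrier (localization R I) = {frac a s | a s. a \<in> carrier R \<and> s \<in> carrier R - I}"
  by (simp add: localization_def)

lemma mult_localization:
  assumes "a \<in> carrier R" "s \<in> carrier R - I" "b \<in> carrier R" "t \<in> carrier R - I"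
  shows "frac a s \<otimes>\<^bsub>localization R I\<^esub> frac b t = frac (a \<otimes> b) (s \<otimes> t)"
proof -
  have "(\<Union>(a', s')\<in>frac a s. \<Union>(b', t')\<in>frac b t. frac (a' \<otimes> b') (s' \<otimes> t')) = frac (a \<otimes> b) (s \<otimes> t)"
  proof (rule Union_frac[OF assms, of "\<lambda>a s b t. frac (a \<otimes> b) (s \<otimes> t)"])
    fix a' s' b' t'
    assume m: "a' \<in> carrier R" "s' \<in> carrier R - I" "b' \<in> carrier R" "t' \<in> carrier R - I"
      and e: "frac a' s' = frac a s" "frac b' t' = frac b t"
    obtain u where u: "u \<in> carrier R - I" "u \<otimes> (a' \<otimes> s) = u \<otimes> (a \<otimes> s')"
      using e(1) m assms by (auto simp: frac_eq_iff)
    obtain v where v: "v \<in> carrier R - I" "v \<otimes> (b' \<otimes> t) = v \<otimes> (b \<otimes> t')"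
      using e(2) m assms by (auto simp: frac_eq_iff)
    have c: "s' \<in> carrier R" "t' \<in> carrier R" "s \<in> carrier R" "t \<in> carrier R" "u \<in> carrier R" "v \<in> carrier R"
      using m assms u v by auto
    have "(u \<otimes> v) \<otimes> ((a' \<otimes> b') \<otimes> (s \<otimes> t)) = (u \<otimes> (a' \<otimes> s)) \<otimes> (v \<otimes> (b' \<otimes> t))"
      using m(1,3) assms(1,3) c by algebra
    also have "\<dots> = (u \<otimes> v) \<otimes> ((a \<otimes> b) \<otimes> (s' \<otimes> t'))"
      unfolding u(2) v(2) using m(1,3) assms(1,3) c by algebra
    finally show "frac (a' \<otimes> b') (s' \<otimes> t') = frac (a \<otimes> b) (s \<otimes> t)"
      using compl_mult m assms u v c
      by (subst frac_eq_iff) (auto simp del: Diff_iff intro!: bexI[of _ "u \<otimes> v"])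
  qed
  then show ?thesis by (simp add: localization_def)
qed

lemma add_localization:
  assumes "a \<in> carrier R" "s \<in> carrier R - I" "b \<in> carrier R" "t \<in> carrier R - I"
  shows "frac a s \<oplus>\<^bsub>localization R I\<^esub> frac b t = frac ((a \<otimes> t) \<oplus> (b \<otimes> s)) (s \<otimes> t)"
proof -
  have "(\<Union>(a', s')\<in>frac a s. \<Union>(b', t')\<in>frac b t. frac ((a' \<otimes> t') \<oplus> (b' \<otimes> s')) (s' \<otimes> t'))
      = frac ((a \<otimes> t) \<oplus> (b \<otimes> s)) (s \<otimes> t)"
  proof (rule Union_frac[OF assms, of "\<lambda>a s b t. frac ((a \<otimes> t) \<oplus> (b \<otimes> s)) (s \<otimes> t)"])
    fix a' s' b' t'
    assume m: "a' \<in> carrier R" "s' \<in> carrier R - I" "b' \<in> carrier R" "t' \<in> carrier R - I"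
      and e: "frac a' s' = frac a s" "frac b' t' = frac b t"
    obtain u where u: "u \<in> carrier R - I" "u \<otimes> (a' \<otimes> s) = u \<otimes> (a \<otimes> s')"
      using e(1) m assms by (auto simp: frac_eq_iff)
    obtain v where v: "v \<in> carrier R - I" "v \<otimes> (b' \<otimes> t) = v \<otimes> (b \<otimes> t')"
      using e(2) m assms by (auto simp: frac_eq_iff)
    have c: "s' \<in> carrier R" "t' \<in> carrier R" "s \<in> carrier R" "t \<in> carrier R" "u \<in> carrier R" "v \<in> carrier R"
      using m assms u v by auto
    have "(u \<otimes> v) \<otimes> (((a' \<otimes> t') \<oplus> (b' \<otimes> s')) \<otimes> (s \<otimes> t))
       = (u \<otimes> (a' \<otimes> s)) \<otimes> (v \<otimes> (t \<otimes> t')) \<oplus> (v \<otimes> (b' \<otimes> t)) \<otimes> (u \<otimes> (s \<otimes> s'))"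
      using m(1,3) assms(1,3) c by algebra
    also have "\<dots> = (u \<otimes> v) \<otimes> (((a \<otimes> t) \<oplus> (b \<otimes> s)) \<otimes> (s' \<otimes> t'))"
      unfolding u(2) v(2) using m(1,3) assms(1,3) c by algebra
    finally show "frac ((a' \<otimes> t') \<oplus> (b' \<otimes> s')) (s' \<otimes> t') = frac ((a \<otimes> t) \<oplus> (b \<otimes> s)) (s \<otimes> t)"
      using compl_mult m assms u v c
      by (subst frac_eq_iff) (auto simp del: Diff_iff intro!: bexI[of _ "u \<otimes> v"])
  qed
  then show ?thesis by (simp add: localization_def)
qed

lemma zero_localization: "\<zero>\<^bsub>localization R I\<^esub> = frac \<zero> \<one>"
  and one_localization: "\<one>\<^bsub>localization R I\<^esub> = frac \<one> \<one>"
  by (simp_all add: localization_def)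

lemma cring_localization: "cring (localization R I)"
proof -
  let ?L = "localization R I"
  have cE: "\<exists>a s. a \<in> carrier R \<and> s \<in> carrier R - I \<and> s \<in> carrier R \<and> x = frac a s" if "x \<in> carrier ?L" for x
    using that by (auto simp: carrier_localization)
  have cI: "a \<in> carrier R \<Longrightarrow> s \<in> carrier R - I \<Longrightarrow> frac a s \<in> carrier ?L" for a s
    by (auto simp: carrier_localization)
  note ops = mult_localization add_localization zero_localization one_localization
  note cl = compl_mult compl_one
  show ?thesis
  proof (rule cringI)
    show "abelian_group ?L"
    proof (rule abelian_groupI)
      fix x y assume "x \<in> carrier ?L" "y \<in> carrier ?L"
      then obtain a s b t where e: "a \<in> carrier R" "s \<in> carrier R - I" "s \<in> carrier R" "x = frac a s"
        "b \<in> carrier R" "t \<in> carrier R - I" "t \<in> carrier R" "y = frac b t" using cE by meson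
      show "x \<oplus>\<^bsub>?L\<^esub> y \<in> carrier ?L" using e cl by (simp add: ops cI del: Diff_iff)
      show "x \<oplus>\<^bsub>?L\<^esub> y = y \<oplus>\<^bsub>?L\<^esub> x"
        using e cl by (simp add: ops a_comm m_comm del: Diff_iff)
      show "x \<oplus>\<^bsub>?L\<^esub> y \<oplus>\<^bsub>?L\<^esub> z = x \<oplus>\<^bsub>?L\<^esub> (y \<oplus>\<^bsub>?L\<^esub> z)" if "z \<in> carrier ?L" for z
      proof -
        obtain c w where c: "c \<in> carrier R" "w \<in> carrier R - I" "w \<in> carrier R" "z = frac c w"
          using cE[OF \<open>z \<in> carrier ?L\<close>] by blast
        have "frac (((a \<otimes> t) \<oplus> (b \<otimes> s)) \<otimes> w \<oplus> c \<otimes> (s \<otimes> t)) (s \<otimes> t \<otimes> w)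
          = frac (a \<otimes> (t \<otimes> w) \<oplus> ((b \<otimes> w) \<oplus> (c \<otimes> t)) \<otimes> s) (s \<otimes> (t \<otimes> w))"
        proof (rule arg_cong2[where f = frac])
          show "((a \<otimes> t) \<oplus> (b \<otimes> s)) \<otimes> w \<oplus> c \<otimes> (s \<otimes> t) = a \<otimes> (t \<otimes> w) \<oplus> ((b \<otimes> w) \<oplus> (c \<otimes> t)) \<otimes> s"
            using e(1,3,5,7) c(1,3) by algebra
          show "s \<otimes> t \<otimes> w = s \<otimes> (t \<otimes> w)" using e c by (simp add: m_assoc)
        qed
        then show ?thesis using e c cl by (simp add: ops del: Diff_iff)
      qed
    next
      show "\<zero>\<^bsub>?L\<^esub> \<in> carrier ?L" using cl by (simp add: ops cI del: Diff_iff)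
      fix x assume "x \<in> carrier ?L"
      then obtain a s where e: "a \<in> carrier R" "s \<in> carrier R - I" "s \<in> carrier R" "x = frac a s" using cE by meson
      show "\<zero>\<^bsub>?L\<^esub> \<oplus>\<^bsub>?L\<^esub> x = x" using e cl by (simp add: ops del: Diff_iff)
      have "frac ((\<ominus> a) \<otimes> s \<oplus> a \<otimes> s) (s \<otimes> s) = frac \<zero> \<one>"
      proof (rule frac_eqI)
        show "(\<ominus> a \<otimes> s \<oplus> a \<otimes> s) \<otimes> \<one> = \<zero> \<otimes> (s \<otimes> s)" using e(1,3) by algebra
      qed (use e cl in \<open>auto simp del: Diff_iff\<close>)
      moreover have "frac (\<ominus> a) s \<oplus>\<^bsub>?L\<^esub> x = frac ((\<ominus> a) \<otimes> s \<oplus> a \<otimes> s) (s \<otimes> s)"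
        unfolding e(4) by (rule add_localization) (use e in auto)
      ultimately have "frac (\<ominus> a) s \<oplus>\<^bsub>?L\<^esub> x = \<zero>\<^bsub>?L\<^esub>" by (simp only: zero_localization)
      then show "\<exists>y\<in>carrier ?L. y \<oplus>\<^bsub>?L\<^esub> x = \<zero>\<^bsub>?L\<^esub>"
        by (rule bexI) (rule cI[OF a_inv_closed[OF e(1)] e(2)])
    qed
    show "comm_monoid ?L"
    proof (rule comm_monoidI)
      show "\<one>\<^bsub>?L\<^esub> \<in> carrier ?L" using cl by (simp add: ops cI del: Diff_iff)
      fix x assume "x \<in> carrier ?L"
      then obtain a s where e: "a \<in> carrier R" "s \<in> carrier R - I" "s \<in> carrier R" "x = frac a s" using cE by meson
      show "\<one>\<^bsub>?L\<^esub> \<otimes>\<^bsub>?L\<^esub> x = x" using e cl by (simp add: ops del: Diff_iff)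
    next
      fix x y assume "x \<in> carrier ?L" "y \<in> carrier ?L"
      then obtain a s b t where e: "a \<in> carrier R" "s \<in> carrier R - I" "s \<in> carrier R" "x = frac a s"
        "b \<in> carrier R" "t \<in> carrier R - I" "t \<in> carrier R" "y = frac b t" using cE by meson
      show "x \<otimes>\<^bsub>?L\<^esub> y \<in> carrier ?L" using e cl by (simp add: ops cI del: Diff_iff)
      show "x \<otimes>\<^bsub>?L\<^esub> y = y \<otimes>\<^bsub>?L\<^esub> x" using e cl by (simp add: ops m_comm del: Diff_iff)
      show "x \<otimes>\<^bsub>?L\<^esub> y \<otimes>\<^bsub>?L\<^esub> z = x \<otimes>\<^bsub>?L\<^esub> (y \<otimes>\<^bsub>?L\<^esub> z)" if "z \<in> carrier ?L" for z
      proof -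
        obtain c w where c: "c \<in> carrier R" "w \<in> carrier R - I" "w \<in> carrier R" "z = frac c w"
          using cE[OF \<open>z \<in> carrier ?L\<close>] by blast
        then show ?thesis using e c cl by (simp add: ops m_assoc del: Diff_iff)
      qed
    qed
    fix x y z assume "x \<in> carrier ?L" "y \<in> carrier ?L" "z \<in> carrier ?L"
    then obtain a s b t c w where e: "a \<in> carrier R" "s \<in> carrier R - I" "s \<in> carrier R" "x = frac a s"
      "b \<in> carrier R" "t \<in> carrier R - I" "t \<in> carrier R" "y = frac b t"
      "c \<in> carrier R" "w \<in> carrier R - I" "w \<in> carrier R" "z = frac c w" using cE by meson
    have "frac ((a \<otimes> t \<oplus> b \<otimes> s) \<otimes> c) (s \<otimes> t \<otimes> w)
      = frac ((a \<otimes> c) \<otimes> (t \<otimes> w) \<oplus> (b \<otimes> c) \<otimes> (s \<otimes> w)) (s \<otimes> w \<otimes> (t \<otimes> w))"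
    proof (rule frac_eqI)
      show "(a \<otimes> t \<oplus> b \<otimes> s) \<otimes> c \<otimes> (s \<otimes> w \<otimes> (t \<otimes> w))
        = (a \<otimes> c \<otimes> (t \<otimes> w) \<oplus> b \<otimes> c \<otimes> (s \<otimes> w)) \<otimes> (s \<otimes> t \<otimes> w)"
        using e(1,3,5,7,9,11) by algebra
    qed (use e cl in \<open>auto simp del: Diff_iff\<close>)
    then show "(x \<oplus>\<^bsub>?L\<^esub> y) \<otimes>\<^bsub>?L\<^esub> z = x \<otimes>\<^bsub>?L\<^esub> z \<oplus>\<^bsub>?L\<^esub> y \<otimes>\<^bsub>?L\<^esub> z"
      using e cl by (simp add: ops del: Diff_iff)
  qed
qed

end

text \<open>The localization of \<open>R/I\<close> at the image of the prime ideal \<open>M\<close>, described by the map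
  \<open>h\<close> from \<open>R\<close>.\<close>

locale loc_map = R?: cring R + T: cring T
  for R (structure) and T +
  fixes h M I
  assumes hom: "h \<in> ring_hom R T" and M: "primeideal M R" and I: "ideal I R" "I \<subseteq> M"
    and frac: "t \<in> carrier T \<Longrightarrow> \<exists>a\<in>carrier R. \<exists>s\<in>carrier R - M. t \<otimes>\<^bsub>T\<^esub> h s = h a"
    and unit: "s \<in> carrier R - M \<Longrightarrow> h s \<in> Units T"
    and ker: "a \<in> carrier R \<Longrightarrow> h a = \<zero>\<^bsub>T\<^esub> \<longleftrightarrow> (\<exists>s\<in>carrier R - M. s \<otimes> a \<in> I)"

lemma (in primeideal) loc_map_localization:
  "loc_map R (localization R I) (\<lambda>a. frac a \<one>) I {\<zero>}"
proof -
  let ?L = "localization R I"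
  interpret L: cring ?L by (rule cring_localization)
  note ops = mult_localization add_localization zero_localization one_localization
  note cl = compl_mult compl_one
  have cI: "a \<in> carrier R \<Longrightarrow> s \<in> carrier R - I \<Longrightarrow> frac a s \<in> carrier ?L" for a s
    by (auto simp: carrier_localization)
  show ?thesis
  proof (intro loc_map.intro loc_map_axioms.intro)
    show "cring R" "cring ?L" by (rule is_cring, rule L.is_cring)
    show "(\<lambda>a. frac a \<one>) \<in> ring_hom R ?L"
      by (rule ring_hom_memI) (use cl in \<open>simp_all add: ops cI del: Diff_iff\<close>)
    show "primeideal I R" by (rule primeideal)
    show "ideal {\<zero>} R" by (rule zeroideal)
    show "{\<zero>} \<subseteq> I" by simp
    fix t assume "t \<in> carrier ?L"
    then obtain a s where t: "a \<in> carrier R" "s \<in> carrier R - I" "t = frac a s"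
      by (auto simp: carrier_localization)
    have sc: "s \<in> carrier R" using t by simp
    have "frac (a \<otimes> s) (s \<otimes> \<one>) = frac a \<one>"
      by (rule frac_eqI) (use t sc cl in \<open>auto simp del: Diff_iff\<close>)
    then have "t \<otimes>\<^bsub>?L\<^esub> frac s \<one> = frac a \<one>" using t sc cl by (simp add: ops del: Diff_iff)
    then show "\<exists>a\<in>carrier R. \<exists>s\<in>carrier R - I. t \<otimes>\<^bsub>?L\<^esub> frac s \<one> = frac a \<one>" using t by blast
  next
    fix s assume s: "s \<in> carrier R - I"
    then have sc: "s \<in> carrier R" by simp
    have "frac (s \<otimes> \<one>) (\<one> \<otimes> s) = frac \<one> \<one>" by (rule frac_eqI) (use s sc cl in \<open>auto simp del: Diff_iff\<close>)
    then have "frac s \<one> \<otimes>\<^bsub>?L\<^esub> frac \<one> s = \<one>\<^bsub>?L\<^esub>" using s sc cl by (simp add: ops del: Diff_iff)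
    moreover have "frac s \<one> \<in> carrier ?L" "frac \<one> s \<in> carrier ?L" using s sc cl cI by blast+
    ultimately show "frac s \<one> \<in> Units ?L" using L.m_comm unfolding Units_def by fastforce
  next
    fix a assume a: "a \<in> carrier R"
    have "frac a \<one> = frac \<zero> \<one> \<longleftrightarrow> (\<exists>u\<in>carrier R - I. u \<otimes> (a \<otimes> \<one>) = u \<otimes> (\<zero> \<otimes> \<one>))"
      using a cl by (intro frac_eq_iff) auto
    then show "frac a \<one> = \<zero>\<^bsub>?L\<^esub> \<longleftrightarrow> (\<exists>s\<in>carrier R - I. s \<otimes> a \<in> {\<zero>})"
      using a by (simp add: ops)
  qed
qed

context loc_map
begin

section \<open>Contraction and extension of ideals along the localization map\<close>

interpretation h: ring_hom_cring R T h
  by (rule ring_hom_cringI) (use hom in \<open>auto intro: R.is_cring T.is_cring simp: ring_hom_def\<close>)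

interpretation M: primeideal M R by (rule M)

lemma h_closed [simp]: "a \<in> carrier R \<Longrightarrow> h a \<in> carrier T" by simp

definition contr :: "'c set \<Rightarrow> 'a set" where "contr J = {a \<in> carrier R. h a \<in> J}"

text \<open>The elements having some representation with numerator in \<open>J\<close>;
  \<open>mem_ext_iff\<close> tests this on any given representation, up to a multiplier outside
  \<open>M\<close>.\<close>

definition ext :: "'a set \<Rightarrow> 'c set" where
  "ext J = {t \<in> carrier T. \<exists>a\<in>J. \<exists>s\<in>carrier R - M. t \<otimes>\<^bsub>T\<^esub> h s = h a}"

text \<open>Denominators are units of \<open>T\<close>, so membership is decided on the
  numerator.\<close>

lemma mem_ideal_iff:
  assumes J: "ideal J T" and t: "t \<in> carrier T" "s \<in> carrier R - M" "t \<otimes>\<^bsub>T\<^esub> h s = h a"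
  shows "t \<in> J \<longleftrightarrow> h a \<in> J"
proof
  assume "t \<in> J"
  then show "h a \<in> J" using ideal.I_r_closed[OF J, of t "h s"] t by simp
next
  assume "h a \<in> J"
  then have "h a \<otimes>\<^bsub>T\<^esub> inv\<^bsub>T\<^esub> h s \<in> J" using ideal.I_r_closed[OF J] unit[OF t(2)] by simp
  moreover have "h a \<otimes>\<^bsub>T\<^esub> inv\<^bsub>T\<^esub> h s = t"
    using t unit[OF t(2)] by (simp flip: t(3) add: T.m_assoc)
  ultimately show "t \<in> J" by simp
qed

lemma contr_ideal: "ideal J T \<Longrightarrow> ideal (contr J) R"
  unfolding contr_def by (rule R.ideal_criterion)
    (auto simp: ideal_zero ideal_add ideal.I_l_closed)

text \<open>An ideal of \<open>T\<close> is determined by the numerators it contains. Contraction is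
  thus an order embedding, which transports strict chains.\<close>

lemma contr_subset_iff:
  assumes "ideal J T" "ideal L T" shows "contr J \<subseteq> contr L \<longleftrightarrow> J \<subseteq> L"
proof
  assume s: "contr J \<subseteq> contr L"
  show "J \<subseteq> L"
  proof
    fix t assume t: "t \<in> J"
    then have tc: "t \<in> carrier T" using ideal.Icarr[OF assms(1)] by simp
    obtain a s' where a: "a \<in> carrier R" "s' \<in> carrier R - M" "t \<otimes>\<^bsub>T\<^esub> h s' = h a" using frac[OF tc] by blast
    have "a \<in> contr J" using t mem_ideal_iff[OF assms(1) tc a(2,3)] a by (simp add: contr_def)
    then show "t \<in> L" using s mem_ideal_iff[OF assms(2) tc a(2,3)] by (auto simp: contr_def)
  qed
qed (auto simp: contr_def)

lemma proper_contr:
  assumes J: "ideal J T" "J \<noteq> carrier T" shows "contr J \<subseteq> M"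
proof
  fix a assume a: "a \<in> contr J"
  show "a \<in> M"
  proof (rule ccontr)
    assume "a \<notin> M"
    then have u: "h a \<in> Units T" using a unit by (simp add: contr_def)
    have "inv\<^bsub>T\<^esub> h a \<otimes>\<^bsub>T\<^esub> h a \<in> J" using a u by (intro ideal.I_l_closed[OF J(1)]) (auto simp: contr_def)
    then have "\<one>\<^bsub>T\<^esub> \<in> J" using u by simp
    then show False using ideal.one_imp_carrier[OF J(1)] J(2) by simp
  qed
qed

lemma subset_contr: "ideal J T \<Longrightarrow> I \<subseteq> contr J"
proof
  fix a assume J: "ideal J T" and a: "a \<in> I"
  then have ac: "a \<in> carrier R" using ideal.Icarr[OF I(1)] by simp
  have "\<one> \<otimes> a \<in> I" using a ac by simp
  then have "h a = \<zero>\<^bsub>T\<^esub>" using ker[OF ac] M.compl_one by blast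
  then show "a \<in> contr J" using ac ideal_zero[OF J] by (simp add: contr_def)
qed

lemma contr_primeideal:
  assumes P: "primeideal P T" shows "primeideal (contr P) R"
proof (rule primeidealI)
  have Pi: "ideal P T" using P by (rule primeideal.axioms)
  show "ideal (contr P) R" by (rule contr_ideal[OF Pi])
  show "cring R" by (rule R.is_cring)
  show "carrier R \<noteq> contr P"
    using proper_contr[OF Pi] primeideal.I_notcarr[OF P] M.one_not_mem by auto
  fix a b assume "a \<in> carrier R" "b \<in> carrier R" "a \<otimes> b \<in> contr P"
  then show "a \<in> contr P \<or> b \<in> contr P"
    using primeideal.I_prime[OF P, of "h a" "h b"] by (auto simp: contr_def)
qed

lemma prime_chain_contr:
  assumes "prime_chain T r P"
  shows "prime_chain R r (\<lambda>i. contr (P i))" "I \<subseteq> contr (P 0)" "contr (P r) \<subseteq> M"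
proof -
  have P: "primeideal (P i) T" if "i \<le> r" for i using assms that by (simp add: prime_chain_def)
  have Pi: "ideal (P i) T" if "i \<le> r" for i using P[OF that] by (rule primeideal.axioms)
  show "prime_chain R r (\<lambda>i. contr (P i))"
    unfolding prime_chain_def
  proof (intro conjI allI impI)
    fix i assume i: "i < r"
    then have "P i \<subset> P (Suc i)" using assms by (simp add: prime_chain_def)
    then show "contr (P i) \<subset> contr (P (Suc i))"
      using contr_subset_iff[of "P i" "P (Suc i)"] contr_subset_iff[of "P (Suc i)" "P i"] Pi i by auto
  qed (use P contr_primeideal in auto)
  show "I \<subseteq> contr (P 0)" using subset_contr Pi by simp
  show "contr (P r) \<subseteq> M" using proper_contr[OF Pi[of r]] primeideal.I_notcarr[OF P[of r]] by auto
qed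

text \<open>Two representations of \<open>t\<close> agree in \<open>T\<close>, so some element
  outside \<open>M\<close> multiplies the difference of their cross products into \<open>I\<close>;
  this is where the description of the kernel enters.\<close>

lemma mem_ext_iff:
  assumes J: "ideal J R" "I \<subseteq> J" and t: "t \<in> carrier T" "s \<in> carrier R - M" "a \<in> carrier R" "t \<otimes>\<^bsub>T\<^esub> h s = h a"
  shows "t \<in> ext J \<longleftrightarrow> (\<exists>u\<in>carrier R - M. u \<otimes> a \<in> J)"
proof
  assume "t \<in> ext J"
  then obtain b w where b: "b \<in> J" "w \<in> carrier R - M" "t \<otimes>\<^bsub>T\<^esub> h w = h b" by (auto simp: ext_def)
  have c: "b \<in> carrier R" "w \<in> carrier R" "s \<in> carrier R" using b t ideal.Icarr[OF J(1)] by auto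
  have "h (a \<otimes> w) = h (b \<otimes> s)"
  proof -
    have "h (a \<otimes> w) = (t \<otimes>\<^bsub>T\<^esub> h s) \<otimes>\<^bsub>T\<^esub> h w" unfolding t(4) using c t(3) by simp
    also have "\<dots> = (t \<otimes>\<^bsub>T\<^esub> h w) \<otimes>\<^bsub>T\<^esub> h s" using c t(1) by (simp add: T.m_ac)
    finally show ?thesis unfolding b(3) using c by simp
  qed
  then have "h (a \<otimes> w \<ominus> b \<otimes> s) = \<zero>\<^bsub>T\<^esub>" using c t by (simp add: a_minus_def T.r_neg)
  then obtain u where u: "u \<in> carrier R - M" "u \<otimes> (a \<otimes> w \<ominus> b \<otimes> s) \<in> I"
    using ker[of "a \<otimes> w \<ominus> b \<otimes> s"] c t by auto
  have uc: "u \<in> carrier R" using u by simp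
  have "(u \<otimes> w) \<otimes> a = u \<otimes> (a \<otimes> w \<ominus> b \<otimes> s) \<oplus> (u \<otimes> s) \<otimes> b" using c t uc by algebra
  also have "\<dots> \<in> J" using u J(2) b c uc by (intro ideal_add[OF J(1) _ ideal.I_l_closed[OF J(1) b(1)]]) (use I(1) in \<open>auto intro: ideal.I_l_closed\<close>)
  finally show "\<exists>u\<in>carrier R - M. u \<otimes> a \<in> J" using M.compl_mult[OF u(1) b(2)] by blast
next
  assume "\<exists>u\<in>carrier R - M. u \<otimes> a \<in> J"
  then obtain u where u: "u \<in> carrier R - M" "u \<otimes> a \<in> J" by blast
  have "t \<otimes>\<^bsub>T\<^esub> h (u \<otimes> s) = h (u \<otimes> a)" using u t by (simp add: T.m_lcomm flip: t(4))
  then show "t \<in> ext J" using u(2) t(1) M.compl_mult[OF u(1) t(2)] unfolding ext_def by blast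
qed

lemma h_mem_ext_iff:
  assumes J: "ideal J R" "I \<subseteq> J" and a: "a \<in> carrier R"
  shows "h a \<in> ext J \<longleftrightarrow> (\<exists>u\<in>carrier R - M. u \<otimes> a \<in> J)"
  by (rule mem_ext_iff[OF J, of "h a" \<one>]) (use a M.compl_one in auto)

lemma ext_ideal:
  assumes J: "ideal J R" "I \<subseteq> J" shows "ideal (ext J) T"
proof (rule T.ideal_criterion)
  show "ext J \<subseteq> carrier T" by (auto simp: ext_def)
  show "\<zero>\<^bsub>T\<^esub> \<in> ext J"
    using h_mem_ext_iff[OF J, of \<zero>] ideal_zero[OF J(1)] M.compl_one by force
  fix t assume t: "t \<in> ext J"
  then obtain a s where a: "t \<in> carrier T" "a \<in> J" "s \<in> carrier R - M" "t \<otimes>\<^bsub>T\<^esub> h s = h a" by (auto simp: ext_def)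
  have ac: "a \<in> carrier R" "s \<in> carrier R" using a ideal.Icarr[OF J(1)] by auto
  show "t \<oplus>\<^bsub>T\<^esub> t' \<in> ext J" if t': "t' \<in> ext J" for t'
  proof -
    obtain b w where b: "t' \<in> carrier T" "b \<in> J" "w \<in> carrier R - M" "t' \<otimes>\<^bsub>T\<^esub> h w = h b"
      using t' by (auto simp: ext_def)
    have bc: "b \<in> carrier R" "w \<in> carrier R" using b ideal.Icarr[OF J(1)] by auto
    have "(t \<oplus>\<^bsub>T\<^esub> t') \<otimes>\<^bsub>T\<^esub> h (s \<otimes> w) = (t \<otimes>\<^bsub>T\<^esub> h s) \<otimes>\<^bsub>T\<^esub> h w \<oplus>\<^bsub>T\<^esub> (t' \<otimes>\<^bsub>T\<^esub> h w) \<otimes>\<^bsub>T\<^esub> h s"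
    proof -
      have "(x \<oplus>\<^bsub>T\<^esub> y) \<otimes>\<^bsub>T\<^esub> (p \<otimes>\<^bsub>T\<^esub> q) = (x \<otimes>\<^bsub>T\<^esub> p) \<otimes>\<^bsub>T\<^esub> q \<oplus>\<^bsub>T\<^esub> (y \<otimes>\<^bsub>T\<^esub> q) \<otimes>\<^bsub>T\<^esub> p"
        if "x \<in> carrier T" "y \<in> carrier T" "p \<in> carrier T" "q \<in> carrier T" for x y p q
        using that by algebra
      from this[OF a(1) b(1) h_closed h_closed] show ?thesis using ac bc by simp
    qed
    also have "\<dots> = h (a \<otimes> w \<oplus> b \<otimes> s)" using a(4) b(4) ac bc by simp
    finally have "(t \<oplus>\<^bsub>T\<^esub> t') \<otimes>\<^bsub>T\<^esub> h (s \<otimes> w) = h (a \<otimes> w \<oplus> b \<otimes> s)" .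
    moreover have "a \<otimes> w \<oplus> b \<otimes> s \<in> J"
      by (rule ideal_add[OF J(1) ideal.I_r_closed[OF J(1) a(2) bc(2)] ideal.I_r_closed[OF J(1) b(2) ac(2)]])
    ultimately show ?thesis using a(1) b(1) M.compl_mult[OF a(3) b(3)] by (auto simp: ext_def)
  qed
  show "x \<otimes>\<^bsub>T\<^esub> t \<in> ext J" if x: "x \<in> carrier T" for x
  proof -
    obtain b w where b: "b \<in> carrier R" "w \<in> carrier R - M" "x \<otimes>\<^bsub>T\<^esub> h w = h b" using frac[OF x] by blast
    have wc: "w \<in> carrier R" using b by simp
    have "(x \<otimes>\<^bsub>T\<^esub> t) \<otimes>\<^bsub>T\<^esub> h (w \<otimes> s) = (x \<otimes>\<^bsub>T\<^esub> h w) \<otimes>\<^bsub>T\<^esub> (t \<otimes>\<^bsub>T\<^esub> h s)"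
      using a(1) x ac wc by (simp add: T.m_ac)
    also have "\<dots> = h (b \<otimes> a)" using a(4) b(3) ac b(1) by simp
    finally have "(x \<otimes>\<^bsub>T\<^esub> t) \<otimes>\<^bsub>T\<^esub> h (w \<otimes> s) = h (b \<otimes> a)" .
    moreover have "b \<otimes> a \<in> J" by (rule ideal.I_l_closed[OF J(1) a(2) b(1)])
    ultimately show ?thesis using a(1) x M.compl_mult[OF b(2) a(3)] by (auto simp: ext_def)
  qed
qed

text \<open>The multiplier \<open>u\<close> in the description of the extension lies outside
  \<open>M\<close>, hence outside \<open>P\<close>, and primality cancels it.\<close>

lemma contr_ext_prime:
  assumes P: "primeideal P R" "I \<subseteq> P" "P \<subseteq> M" shows "contr (ext P) = P"
proof -
  have Pi: "ideal P R" using P(1) by (rule primeideal.axioms)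
  have "h a \<in> ext P \<longleftrightarrow> a \<in> P" if a: "a \<in> carrier R" for a
  proof -
    have "(\<exists>u\<in>carrier R - M. u \<otimes> a \<in> P) \<longleftrightarrow> a \<in> P"
    proof
      assume "\<exists>u\<in>carrier R - M. u \<otimes> a \<in> P"
      then obtain u where "u \<in> carrier R - M" "u \<otimes> a \<in> P" by blast
      then show "a \<in> P" using primeideal.I_prime[OF P(1), of u a] a P(3) by auto
    next
      assume "a \<in> P"
      then show "\<exists>u\<in>carrier R - M. u \<otimes> a \<in> P" using a M.compl_one by (intro bexI[of _ \<one>]) auto
    qed
    then show ?thesis using h_mem_ext_iff[OF Pi P(2) a] by simp
  qed
  then show ?thesis using ideal.Icarr[OF Pi] by (auto simp: contr_def)
qed

lemma ext_primeideal:
  assumes P: "primeideal P R" "I \<subseteq> P" "P \<subseteq> M" shows "primeideal (ext P) T"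
proof (rule primeidealI)
  have Pi: "ideal P R" using P(1) by (rule primeideal.axioms)
  show E: "ideal (ext P) T" by (rule ext_ideal[OF Pi P(2)])
  show "cring T" by (rule T.is_cring)
  have "\<one> \<notin> contr (ext P)" using contr_ext_prime[OF P] P(3) M.one_not_mem by auto
  then have "\<one>\<^bsub>T\<^esub> \<notin> ext P" by (simp add: contr_def)
  then show "carrier T \<noteq> ext P" by auto
  fix x y assume xy: "x \<in> carrier T" "y \<in> carrier T" "x \<otimes>\<^bsub>T\<^esub> y \<in> ext P"
  obtain a s where a: "a \<in> carrier R" "s \<in> carrier R - M" "x \<otimes>\<^bsub>T\<^esub> h s = h a" using frac[OF xy(1)] by blast
  obtain b w where b: "b \<in> carrier R" "w \<in> carrier R - M" "y \<otimes>\<^bsub>T\<^esub> h w = h b" using frac[OF xy(2)] by blast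
  have "(x \<otimes>\<^bsub>T\<^esub> y) \<otimes>\<^bsub>T\<^esub> h (s \<otimes> w) = (x \<otimes>\<^bsub>T\<^esub> h s) \<otimes>\<^bsub>T\<^esub> (y \<otimes>\<^bsub>T\<^esub> h w)"
    using xy a(2) b(2) by (simp add: T.m_ac)
  also have "\<dots> = h (a \<otimes> b)" using a(1,3) b(1,3) by simp
  finally have e: "(x \<otimes>\<^bsub>T\<^esub> y) \<otimes>\<^bsub>T\<^esub> h (s \<otimes> w) = h (a \<otimes> b)" .
  have "x \<otimes>\<^bsub>T\<^esub> y \<in> carrier T" using xy by simp
  from mem_ideal_iff[OF E this M.compl_mult[OF a(2) b(2)] e] xy(3) have "h (a \<otimes> b) \<in> ext P" by (rule iffD1)
  then have "a \<otimes> b \<in> contr (ext P)" using a(1) b(1) unfolding contr_def by simp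
  then have "a \<in> P \<or> b \<in> P" using primeideal.I_prime[OF P(1) a(1) b(1)] contr_ext_prime[OF P] by simp
  then have "a \<in> contr (ext P) \<or> b \<in> contr (ext P)" using contr_ext_prime[OF P] by simp
  then have "h a \<in> ext P \<or> h b \<in> ext P" unfolding contr_def by blast
  then show "x \<in> ext P \<or> y \<in> ext P"
    using mem_ideal_iff[OF E xy(1) a(2,3)] mem_ideal_iff[OF E xy(2) b(2,3)] by blast
qed

lemma prime_chain_ext:
  assumes P: "prime_chain R r P" "I \<subseteq> P 0" "P r \<subseteq> M"
  shows "prime_chain T r (\<lambda>i. ext (P i))"
proof -
  have st: "P i \<subset> P (Suc i)" if "i < r" for i using P that by (simp add: prime_chain_def)
  have mono: "P i \<subseteq> P j" if "i \<le> j" "j \<le> r" for i j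
    using that
  proof (induction rule: dec_induct)
    case (step n)
    then show ?case using st[of n] by auto
  qed simp
  have pr: "primeideal (P i) R" "I \<subseteq> P i" "P i \<subseteq> M" if "i \<le> r" for i
    using P mono[of 0 i] mono[of i r] that by (auto simp: prime_chain_def)
  have ce: "contr (ext (P i)) = P i" if "i \<le> r" for i using contr_ext_prime pr[OF that] by blast
  have ei: "ideal (ext (P i)) T" if "i \<le> r" for i
    using ext_primeideal[OF pr[OF that]] by (rule primeideal.axioms)
  show ?thesis
    unfolding prime_chain_def
  proof (intro conjI allI impI)
    fix i assume i: "i < r"
    then show "ext (P i) \<subset> ext (P (Suc i))"
    proof -
      have lt: "contr (ext (P i)) \<subset> contr (ext (P (Suc i)))"
        unfolding ce[of i, OF less_imp_le[OF i]] ce[of "Suc i", OF Suc_leI[OF i]] by (rule st[OF i])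
      have "ext (P i) \<subseteq> ext (P (Suc i))"
        by (rule iffD1[OF contr_subset_iff[OF ei[of i] ei[of "Suc i"]]]) (use i psubset_imp_subset[OF lt] in auto)
      moreover have "ext (P i) \<noteq> ext (P (Suc i))"
      proof
        assume "ext (P i) = ext (P (Suc i))"
        then have "contr (ext (P i)) = contr (ext (P (Suc i)))" by (rule arg_cong)
        with lt show False by blast
      qed
      ultimately show ?thesis by (rule psubsetI)
    qed
  qed (use ext_primeideal pr in auto)
qed

lemma ext_M: "primeideal (ext M) T" "contr (ext M) = M"
  using ext_primeideal[OF M I(2)] contr_ext_prime[OF M I(2)] by auto

lemma proper_ideal_subset: "ideal J T \<Longrightarrow> J \<noteq> carrier T \<Longrightarrow> J \<subseteq> ext M"
  using contr_subset_iff[of J "ext M"] proper_contr[of J] ext_M primeideal.axioms(1)[OF ext_M(1)] by auto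

lemma maximal_ideals: "{J. maximalideal J T} = {ext M}"
proof -
  have E: "ideal (ext M) T" "ext M \<noteq> carrier T"
    using primeideal.axioms(1)[OF ext_M(1)] primeideal.I_notcarr[OF ext_M(1)] by auto
  have "maximalideal (ext M) T"
    by (rule maximalidealI) (use E proper_ideal_subset in auto)
  moreover have "J = ext M" if J: "maximalideal J T" for J
  proof -
    have "ideal J T" "J \<noteq> carrier T"
      using J maximalideal.axioms(1) maximalideal.I_notcarr by auto
    then have "J \<subseteq> ext M" by (rule proper_ideal_subset)
    then show ?thesis
      using maximalideal.I_maximal[OF J E(1)] E ideal.Icarr[OF E(1)] by auto
  qed
  ultimately show ?thesis by blast
qed

text \<open>The images of finitely many generators of the contraction generate \<open>J\<close>,
  since inclusions of ideals may be checked after contraction.\<close>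

lemma noetherian: assumes N: "noetherian_ring R" shows "noetherian_ring T"
proof (rule T.noetherian_ringI)
  fix J assume J: "ideal J T"
  obtain A where A: "A \<subseteq> carrier R" "finite A" "contr J = Idl A"
    using noetherian_ring.finetely_gen[OF N contr_ideal[OF J]] by blast
  have AJ: "h ` A \<subseteq> J" using R.genideal_self[OF A(1)] A(3) by (auto simp: contr_def)
  have hA: "h ` A \<subseteq> carrier T" using A by auto
  have I': "ideal (Idl\<^bsub>T\<^esub> (h ` A)) T" by (rule T.genideal_ideal[OF hA])
  have "A \<subseteq> contr (Idl\<^bsub>T\<^esub> (h ` A))" using A(1) T.genideal_self[OF hA] by (auto simp: contr_def)
  then have "contr J \<subseteq> contr (Idl\<^bsub>T\<^esub> (h ` A))"
    unfolding A(3) by (intro R.genideal_minimal contr_ideal I')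
  then have "J \<subseteq> Idl\<^bsub>T\<^esub> (h ` A)" using contr_subset_iff[OF J I'] by simp
  moreover have "Idl\<^bsub>T\<^esub> (h ` A) \<subseteq> J" by (rule T.genideal_minimal[OF J AJ])
  ultimately show "\<exists>A\<subseteq>carrier T. finite A \<and> J = Idl\<^bsub>T\<^esub> A" using A hA by blast
qed

text \<open>The element is outside \<open>ext M\<close>, so its numerator is outside
  \<open>M\<close> and becomes a unit. This supplies the hypothesis on units of
  \<open>regular_sequence_prime_chain\<close>.\<close>

lemma unit_minus_multiple:
  assumes "x \<in> ext M" "r \<in> carrier T" shows "\<one>\<^bsub>T\<^esub> \<ominus>\<^bsub>T\<^esub> x \<otimes>\<^bsub>T\<^esub> r \<in> Units T"
proof -
  have E: "ideal (ext M) T" using ext_M(1) by (rule primeideal.axioms)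
  have xc: "x \<in> carrier T" using assms ideal.Icarr[OF E] by simp
  let ?t = "\<one>\<^bsub>T\<^esub> \<ominus>\<^bsub>T\<^esub> x \<otimes>\<^bsub>T\<^esub> r"
  have tc: "?t \<in> carrier T" using xc assms by simp
  have xr: "x \<otimes>\<^bsub>T\<^esub> r \<in> ext M" by (rule ideal.I_r_closed[OF E assms])
  have "?t \<notin> ext M"
  proof
    assume "?t \<in> ext M"
    then have "?t \<oplus>\<^bsub>T\<^esub> x \<otimes>\<^bsub>T\<^esub> r \<in> ext M" using xr by (rule ideal_add[OF E])
    moreover have "?t \<oplus>\<^bsub>T\<^esub> x \<otimes>\<^bsub>T\<^esub> r = \<one>\<^bsub>T\<^esub>" using xc assms(2) by algebra
    ultimately show False using primeideal.one_not_mem[OF ext_M(1)] by simp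
  qed
  obtain a s where a: "a \<in> carrier R" "s \<in> carrier R - M" "?t \<otimes>\<^bsub>T\<^esub> h s = h a" using frac[OF tc] by blast
  have "h a \<notin> ext M" using mem_ideal_iff[OF E tc a(2,3)] \<open>?t \<notin> ext M\<close> by simp
  then have "a \<notin> M" using ext_M(2) a by (auto simp: contr_def)
  then have "?t \<otimes>\<^bsub>T\<^esub> h s \<in> Units T" using unit a by simp
  then show ?thesis using T.unit_factor[of ?t "h s"] a(2) tc by simp
qed

text \<open>Makes extension compatible with the recursion of \<open>weakly_regular\<close>.\<close>

lemma adjoin_ext:
  assumes J: "ideal J R" "I \<subseteq> J" and x: "x \<in> carrier R"
  shows "adjoin T (ext J) (h x) = ext (adjoin R J x)"
proof
  note JR = R.adjoin_ideal[OF J(1) x]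
  have IJ: "I \<subseteq> adjoin R J x" using J(2) R.subset_adjoin[OF J(1) x] by blast
  have hx: "h x \<in> ext (adjoin R J x)"
    using h_mem_ext_iff[OF JR IJ x] R.mem_adjoin[OF J(1) x] M.compl_one x by (auto intro!: bexI[of _ \<one>])
  show "adjoin T (ext J) (h x) \<subseteq> ext (adjoin R J x)"
    by (rule T.adjoin_minimal[OF ext_ideal[OF JR IJ] _ hx])
      (use R.subset_adjoin[OF J(1) x] in \<open>auto simp: ext_def\<close>)
  note E = T.adjoin_ideal[OF ext_ideal[OF J] h_closed[OF x]]
  show "ext (adjoin R J x) \<subseteq> adjoin T (ext J) (h x)"
  proof
    fix t assume "t \<in> ext (adjoin R J x)"
    then obtain a s where a: "t \<in> carrier T" "a \<in> adjoin R J x" "s \<in> carrier R - M" "t \<otimes>\<^bsub>T\<^esub> h s = h a"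
      by (auto simp: ext_def)
    obtain b r where b: "b \<in> J" "r \<in> carrier R" "a = b \<oplus> x \<otimes> r" using a(2) by (rule adjoinE)
    have bc: "b \<in> carrier R" using b ideal.Icarr[OF J(1)] by simp
    have "h b \<in> ext J" using h_mem_ext_iff[OF J bc] b M.compl_one bc by (auto intro!: bexI[of _ \<one>])
    then have "h b \<oplus>\<^bsub>T\<^esub> h x \<otimes>\<^bsub>T\<^esub> h r \<in> adjoin T (ext J) (h x)" using b by (intro adjoinI) auto
    then have "h a \<in> adjoin T (ext J) (h x)" using b bc x by simp
    then show "t \<in> adjoin T (ext J) (h x)" using mem_ideal_iff[OF E a(1,3,4)] by simp
  qed
qed

text \<open>If \<open>u \<otimes> (x \<otimes> a)\<close> is in \<open>J\<close> for some
  \<open>u\<close> outside \<open>M\<close>, regularity of \<open>x\<close> puts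
  \<open>u \<otimes> a\<close> into \<open>J\<close>, and so the fraction with numerator
  \<open>a\<close> into the extension.\<close>

lemma weakly_regular_ext:
  assumes "ideal J R" "I \<subseteq> J" "set xs \<subseteq> carrier R" "weakly_regular R J xs"
  shows "weakly_regular T (ext J) (map h xs)"
  using assms
proof (induction xs arbitrary: J)
  case Nil
  show ?case by simp
next
  case (Cons x xs)
  have J: "ideal J R" "I \<subseteq> J" and x: "x \<in> carrier R" using Cons by auto
  have "t \<in> ext J" if t: "t \<in> carrier T" "h x \<otimes>\<^bsub>T\<^esub> t \<in> ext J" for t
  proof -
    obtain a s where a: "a \<in> carrier R" "s \<in> carrier R - M" "t \<otimes>\<^bsub>T\<^esub> h s = h a" using frac[OF t(1)] by blast
    have "(h x \<otimes>\<^bsub>T\<^esub> t) \<otimes>\<^bsub>T\<^esub> h s = h x \<otimes>\<^bsub>T\<^esub> (t \<otimes>\<^bsub>T\<^esub> h s)" using t x a(2) by (simp add: T.m_assoc)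
    then have e: "(h x \<otimes>\<^bsub>T\<^esub> t) \<otimes>\<^bsub>T\<^esub> h s = h (x \<otimes> a)" using a x by simp
    obtain u where u: "u \<in> carrier R - M" "u \<otimes> (x \<otimes> a) \<in> J"
      using mem_ext_iff[OF J _ a(2) _ e] t x a(1) by auto
    have "x \<otimes> (u \<otimes> a) = u \<otimes> (x \<otimes> a)" using u(1) x a(1) by (simp add: m_lcomm)
    then have "u \<otimes> a \<in> J" using Cons(5) u a by simp
    then show ?thesis using mem_ext_iff[OF J t(1) a(2,1,3)] u by blast
  qed
  moreover have "weakly_regular T (ext (adjoin R J x)) (map h xs)"
    using J x R.subset_adjoin[OF J(1) x] R.adjoin_ideal[OF J(1) x] Cons(4,5) by (intro Cons.IH) auto
  ultimately show ?case using adjoin_ext[OF J x] by simp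
qed

lemma ext_I: "ext I = {\<zero>\<^bsub>T\<^esub>}"
proof -
  have "t = \<zero>\<^bsub>T\<^esub>" if t: "t \<in> ext I" for t
  proof -
    obtain a s where a: "t \<in> carrier T" "a \<in> I" "s \<in> carrier R - M" "t \<otimes>\<^bsub>T\<^esub> h s = h a"
      using t unfolding ext_def by blast
    have "a \<in> contr {\<zero>\<^bsub>T\<^esub>}" using subset_contr[OF T.zeroideal] a by blast
    then show ?thesis using mem_ideal_iff[OF T.zeroideal a(1,3,4)] by (simp add: contr_def)
  qed
  moreover have "\<zero>\<^bsub>T\<^esub> \<in> ext I" by (rule ideal_zero[OF ext_ideal[OF I(1) subset_refl]])
  ultimately show ?thesis by blast
qed

lemma regular_sequence_ext:
  assumes "set xs \<subseteq> M" "weakly_regular R I xs"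
  shows "regular_sequence T (map h xs)" "set (map h xs) \<subseteq> ext M"
proof -
  have xc: "set xs \<subseteq> carrier R" using assms M.Icarr by blast
  show s: "set (map h xs) \<subseteq> ext M" using assms(1) ext_M(2) by (auto simp: contr_def)
  have E: "ideal (ext M) T" "ext M \<noteq> carrier T"
    using primeideal.axioms(1)[OF ext_M(1)] primeideal.I_notcarr[OF ext_M(1)] by auto
  have "Idl\<^bsub>T\<^esub> (set (map h xs)) \<subseteq> ext M" by (rule T.genideal_minimal[OF E(1) s])
  then have "Idl\<^bsub>T\<^esub> (set (map h xs)) \<noteq> carrier T" using E ideal.Icarr[OF E(1)] by blast
  moreover have "weakly_regular T {\<zero>\<^bsub>T\<^esub>} (map h xs)"
    using weakly_regular_ext[OF I(1) _ xc assms(2)] by (simp add: ext_I)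
  ultimately show "regular_sequence T (map h xs)"
    using xc by (subst T.regular_sequence_iff) auto
qed

text \<open>The extension of \<open>P\<close> is the annihilator of \<open>h f\<close>, so it is
  associated to zero in the local ring \<open>T\<close>; the chain that starts there contracts to
  one starting at \<open>P\<close>. The prescribed start is what bounds the depth by each maximal
  independent set separately.\<close>

lemma regular_sequence_chain_from:
  assumes N: "noetherian_ring R" and xs: "regular_sequence T xs" "set xs \<subseteq> ext M"
    and P: "primeideal P R" "P \<subseteq> M" and f: "f \<in> carrier R" "P = {a \<in> carrier R. a \<otimes> f \<in> I}"
  obtains Q where "prime_chain R (length xs) Q" "Q 0 = P"
proof -
  have IP: "I \<subseteq> P" using f ideal.Icarr[OF I(1)] ideal.I_r_closed[OF I(1)] by auto
  have PI: "ideal P R" using P(1) by (rule primeideal.axioms)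
  have xc: "set xs \<subseteq> carrier T" using xs(1) by (simp add: regular_sequence_def)
  have w: "weakly_regular T {\<zero>\<^bsub>T\<^esub>} xs" using xs(1) T.regular_sequence_iff[OF xc] by simp
  have eq: "colon T {\<zero>\<^bsub>T\<^esub>} (h f) = ext P"
  proof -
    have "t \<otimes>\<^bsub>T\<^esub> h f = \<zero>\<^bsub>T\<^esub> \<longleftrightarrow> t \<in> ext P" if t: "t \<in> carrier T" for t
    proof -
      obtain a s where a: "a \<in> carrier R" "s \<in> carrier R - M" "t \<otimes>\<^bsub>T\<^esub> h s = h a" using frac[OF t] by blast
      have "(t \<otimes>\<^bsub>T\<^esub> h f) \<otimes>\<^bsub>T\<^esub> h s = h (a \<otimes> f)"
        using t f a by (simp add: T.m_ac flip: a(3))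
      then have "t \<otimes>\<^bsub>T\<^esub> h f = \<zero>\<^bsub>T\<^esub> \<longleftrightarrow> (\<exists>u\<in>carrier R - M. u \<otimes> (a \<otimes> f) \<in> I)"
        using mem_ext_iff[OF I(1) subset_refl _ a(2), of "t \<otimes>\<^bsub>T\<^esub> h f" "a \<otimes> f"] t f a by (simp add: ext_I)
      also have "\<dots> \<longleftrightarrow> (\<exists>u\<in>carrier R - M. u \<otimes> a \<in> P)" using a f by (auto simp: m_assoc)
      also have "\<dots> \<longleftrightarrow> t \<in> ext P" using mem_ext_iff[OF PI IP t a(2,1,3)] by simp
      finally show ?thesis .
    qed
    then show ?thesis by (auto simp: colon_def ext_def)
  qed
  have pr: "primeideal (ext P) T" by (rule ext_primeideal[OF P(1) IP P(2)])
  have "h f \<noteq> \<zero>\<^bsub>T\<^esub>"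
  proof
    assume "h f = \<zero>\<^bsub>T\<^esub>"
    then have "\<one>\<^bsub>T\<^esub> \<in> colon T {\<zero>\<^bsub>T\<^esub>} (h f)" by (simp add: colon_def)
    then show False using eq primeideal.one_not_mem[OF pr] by simp
  qed
  then obtain Q where Q: "prime_chain T (length xs) Q" "Q 0 = colon T {\<zero>\<^bsub>T\<^esub>} (h f)"
    using T.regular_sequence_prime_chain[OF noetherian[OF N] T.zeroideal xc w, of "h f"]
      unit_minus_multiple xs(2) f pr eq by auto
  show ?thesis
    by (rule that[OF prime_chain_contr(1)[OF Q(1)]]) (use Q(2) eq contr_ext_prime[OF P(1) IP P(2)] in simp)
qed

text \<open>The same with an arbitrary associated prime of zero as bottom, for the inequality
  between depth and dimension.\<close>

lemma regular_sequence_chain: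
  assumes N: "noetherian_ring R" and xs: "regular_sequence T xs" "set xs \<subseteq> ext M"
  obtains Q where "prime_chain T (length xs) Q"
proof -
  have xc: "set xs \<subseteq> carrier T" using xs(1) by (simp add: regular_sequence_def)
  have w: "weakly_regular T {\<zero>\<^bsub>T\<^esub>} xs" using xs(1) T.regular_sequence_iff[OF xc] by simp
  have "\<one>\<^bsub>T\<^esub> \<notin> {\<zero>\<^bsub>T\<^esub>}"
    using primeideal.one_not_mem[OF ext_M(1)] ideal_zero[OF primeideal.axioms(1)[OF ext_M(1)]] by auto
  then obtain y where y: "y \<in> carrier T" "y \<notin> {\<zero>\<^bsub>T\<^esub>}" "primeideal (colon T {\<zero>\<^bsub>T\<^esub>} y) T"
    using T.exists_associated_prime[OF noetherian[OF N] T.zeroideal T.one_closed] by metis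
  then show ?thesis
    using T.regular_sequence_prime_chain[OF noetherian[OF N] T.zeroideal xc w _ y(1,2,3)]
      unit_minus_multiple xs(2) that by blast
qed

end

section \<open>Chordal graphs\<close>

definition adj :: "'v set set \<Rightarrow> 'v \<Rightarrow> 'v \<Rightarrow> bool" where
  "adj E u v \<longleftrightarrow> u \<noteq> v \<and> {u, v} \<in> E"

lemma adj_sym: "adj E u v \<Longrightarrow> adj E v u"
  by (auto simp: adj_def insert_commute)

lemma adj_irrefl [simp]: "\<not> adj E u u"
  by (simp add: adj_def)

text \<open>\<open>W\<close> selects an induced subgraph while \<open>E\<close> stays fixed, here
  and in the notions below; chordality of \<open>E\<close> then serves all induced subgraphs at
  once.\<close>

definition closed_nbhd :: "'v set set \<Rightarrow> 'v set \<Rightarrow> 'v \<Rightarrow> 'v set" where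
  "closed_nbhd E W v = {u \<in> W. u = v \<or> adj E v u}"

definition pairwise_adj :: "'v set set \<Rightarrow> 'v set \<Rightarrow> bool" where
  "pairwise_adj E A \<longleftrightarrow> (\<forall>u\<in>A. \<forall>v\<in>A. u \<noteq> v \<longrightarrow> adj E u v)"

definition simplicial :: "'v set set \<Rightarrow> 'v set \<Rightarrow> 'v \<Rightarrow> bool" where
  "simplicial E W v \<longleftrightarrow> v \<in> W \<and> pairwise_adj E (closed_nbhd E W v)"

definition indep :: "'v set set \<Rightarrow> 'v set \<Rightarrow> bool" where
  "indep E A \<longleftrightarrow> (\<forall>u\<in>A. \<forall>v\<in>A. \<not> adj E u v)"

definition max_indep :: "'v set set \<Rightarrow> 'v set \<Rightarrow> 'v set \<Rightarrow> bool" where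
  "max_indep E W A \<longleftrightarrow> A \<subseteq> W \<and> indep E A \<and> (\<forall>v\<in>W - A. \<exists>u\<in>A. adj E v u)"

definition well_covered :: "'v set set \<Rightarrow> 'v set \<Rightarrow> bool" where
  "well_covered E W \<longleftrightarrow> (\<forall>A B. max_indep E W A \<and> max_indep E W B \<longrightarrow> card A = card B)"

lemma indep_mono: "indep E A \<Longrightarrow> B \<subseteq> A \<Longrightarrow> indep E B"
  by (auto simp: indep_def)

lemma indep_insert: "indep E (insert v A) \<longleftrightarrow> indep E A \<and> (\<forall>u\<in>A. \<not> adj E v u)"
  by (auto simp: indep_def dest: adj_sym)

lemma extend_indep:
  assumes W: "finite W" and A: "indep E A" "A \<subseteq> W"
  obtains B where "A \<subseteq> B" "max_indep E W B"
proof -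
  let ?P = "\<lambda>B. A \<subseteq> B \<and> B \<subseteq> W \<and> indep E B"
  have "\<forall>B. ?P B \<longrightarrow> card B < Suc (card W)"
    using W by (auto simp: less_Suc_eq_le intro: card_mono)
  then obtain B where B: "?P B" "\<And>B'. ?P B' \<Longrightarrow> card B' \<le> card B"
    using ex_has_greatest_nat[of ?P A card "Suc (card W)"] A by blast
  have "\<exists>u\<in>B. adj E v u" if v: "v \<in> W - B" for v
  proof (rule ccontr)
    assume "\<not> ?thesis"
    then have "?P (insert v B)" using B(1) v by (auto simp: indep_insert)
    from B(2)[OF this] show False using v B(1) W finite_subset[of B W] by auto
  qed
  with B(1) show ?thesis by (intro that[of B]) (auto simp: max_indep_def)
qed

lemma chordal_four_cycle:
  assumes "chordal E" "adj E a b" "adj E b c" "adj E c d" "adj E d a" "a \<noteq> c" "b \<noteq> d"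
  shows "adj E a c \<or> adj E b d"
proof -
  let ?vs = "[a, b, c, d]"
  have "distinct ?vs" using assms by (auto simp: adj_def)
  moreover have "\<forall>i<4. {?vs ! i, ?vs ! (Suc i mod 4)} \<in> E"
  proof (intro allI impI)
    fix i :: nat assume "i < 4"
    then have "i \<in> {0, 1, 2, 3}" by auto
    then show "{?vs ! i, ?vs ! (Suc i mod 4)} \<in> E"
      using assms(2-5) by (elim insertE emptyE) (simp_all add: adj_def)
  qed
  ultimately have "graph_cycle E ?vs" unfolding graph_cycle_def by simp
  then have "has_chord E ?vs" using assms(1) unfolding chordal_def by simp
  then obtain i j where ij: "i < length ?vs" "j < length ?vs" "i \<noteq> j"
    "j \<noteq> Suc i mod length ?vs" "i \<noteq> Suc j mod length ?vs" "{?vs ! i, ?vs ! j} \<in> E"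
    unfolding has_chord_def by blast
  have "i \<in> {0, 1, 2, 3}" "j \<in> {0, 1, 2, 3}" using ij(1,2) by auto
  then have "i = 0 \<and> j = 2 \<or> i = 2 \<and> j = 0 \<or> i = 1 \<and> j = 3 \<or> i = 3 \<and> j = 1"
    using ij(3-5) by (elim insertE emptyE) simp_all
  then have "{a, c} \<in> E \<or> {b, d} \<in> E"
    using ij(6) by (elim disjE) (simp_all add: insert_commute numeral_eq_Suc)
  then show ?thesis using assms(6,7) by (simp add: adj_def)
qed

text \<open>Two vertices in the common boundary of \<open>a\<close> and of a connected set \<open>C\<close> avoiding the
  neighbours of \<open>a\<close> are adjacent: a shortest path between them through \<open>C\<close>, closed up by \<open>a\<close>,
  is a cycle without chord.\<close>

lemma chordal_boundary_adj:
  assumes ch: "chordal E"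
    and b: "adj E a b1" "adj E a b2" "b1 \<noteq> b2"
    and C: "\<And>c. c \<in> C \<Longrightarrow> c \<noteq> a \<and> \<not> adj E a c"
    and conn: "(b1, b2) \<in> {(x, y). x \<in> insert b1 (insert b2 C) \<and> y \<in> insert b1 (insert b2 C) \<and> adj E x y}\<^sup>*"
      (is "_ \<in> ?T\<^sup>*")
  shows "adj E b1 b2"
proof (rule ccontr)
  assume nadj: "\<not> adj E b1 b2"
  obtain n0 where n0: "(b1, b2) \<in> ?T ^^ n0" using rtrancl_imp_relpow[OF conn] by blast
  define n where "n = (LEAST n. (b1, b2) \<in> ?T ^^ n)"
  have n: "(b1, b2) \<in> ?T ^^ n" "\<And>k. (b1, b2) \<in> ?T ^^ k \<Longrightarrow> n \<le> k"
    unfolding n_def by (rule LeastI[of "\<lambda>n. (b1, b2) \<in> ?T ^^ n", OF n0]) (rule Least_le)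
  obtain f where f: "f 0 = b1" "f n = b2" "\<And>i. i < n \<Longrightarrow> (f i, f (Suc i)) \<in> ?T"
    using n(1) by (auto simp only: relpow_fun_conv)
  have seg: "(f i, f (i + k)) \<in> ?T ^^ k" if "i + k \<le> n" for i k
    unfolding relpow_fun_conv using f(3) that by (intro exI[of _ "\<lambda>l. f (i + l)"]) auto
  \<comment> \<open>An equality or adjacency between vertices further apart could be spliced in and
    would give a shorter walk, against the choice of \<open>n\<close>.\<close>
  have short: "j \<le> Suc i" if ij: "i < j" "j \<le> n" "adj E (f i) (f j) \<or> f i = f j" for i j
  proof -
    have 1: "(b1, f i) \<in> ?T ^^ i" using seg[of 0 i] ij f by simp
    have 2: "(f j, b2) \<in> ?T ^^ (n - j)" using seg[of j "n - j"] ij f by simp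
    show ?thesis
    proof (cases "f i = f j")
      case True
      with 1 2 have "(b1, b2) \<in> ?T ^^ (i + (n - j))" by (auto simp: relpow_add)
      from n(2)[OF this] ij show ?thesis by simp
    next
      case False
      have "(f i, f (Suc i)) \<in> ?T" using f(3)[of i] ij by simp
      moreover have "(f (j - 1), f (Suc (j - 1))) \<in> ?T" using f(3)[of "j - 1"] ij by simp
      ultimately have "(f i, f j) \<in> ?T" using ij False by auto
      with 1 have "(b1, f j) \<in> ?T ^^ Suc i" by auto
      with 2 have "(b1, b2) \<in> ?T ^^ (Suc i + (n - j))" unfolding relpow_add by blast
      from n(2)[OF this] ij show ?thesis by simp
    qed
  qed
  have adjf: "adj E (f i) (f (Suc i))" if "i < n" for i using f(3)[OF that] by simp
  have dist: "f i \<noteq> f j" if "i < j" "j \<le> n" for i j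
  proof
    assume "f i = f j"
    with short[of i j] that have "j = Suc i" by simp
    with adjf[of i] \<open>f i = f j\<close> that show False by simp
  qed
  have n2: "n \<ge> 2"
  proof (rule ccontr)
    assume "\<not> ?thesis"
    then have "n = 0 \<or> n = 1" by auto
    then show False using f b adjf[of 0] nadj by auto
  qed
  have inner: "f i \<in> C" if "0 < i" "i < n" for i
    using f(3)[OF that(2)] dist[of 0 i] dist[of i n] that f by auto
  have na: "f i \<noteq> a" if "i \<le> n" for i
    using that f b inner[of i] C[of "f i"] by (cases "i = 0"; cases "i = n") auto
  \<comment> \<open>The vertex \<open>f i\<close> sits at position \<open>Suc i\<close> of the
    cycle, with \<open>a\<close> at position 0.\<close>
  let ?vs = "a # map f [0..<Suc n]"
  have len: "length ?vs = Suc (Suc n)" by simp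
  have nth: "?vs ! Suc i = f i" if "i \<le> n" for i
    using that by (simp only: nth_Cons_Suc) (simp add: nth_append less_Suc_eq_le del: upt_Suc)
  have "distinct ?vs"
  proof -
    have "inj_on f {0..<Suc n}"
      by (rule linorder_inj_onI') (use dist in auto)
    moreover have "a \<notin> f ` {0..<Suc n}" using na by (metis imageE atLeastLessThan_iff less_Suc_eq_le)
    ultimately show ?thesis by (simp add: distinct_map del: upt_Suc)
  qed
  moreover have "{?vs ! i, ?vs ! (Suc i mod length ?vs)} \<in> E" if i: "i < length ?vs" for i
  proof (cases i)
    case 0
    then show ?thesis using nth[of 0] b f by (simp add: adj_def del: upt_Suc)
  next
    case (Suc k)
    show ?thesis
    proof (cases "k = n")
      case True
      then have "Suc i mod length ?vs = 0" using Suc by simp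
      moreover have "?vs ! i = b2" using nth[of k] True Suc f by simp
      ultimately show ?thesis using b by (simp add: adj_def insert_commute del: upt_Suc)
    next
      case False
      then have k: "k < n" using i Suc by simp
      then have "Suc i mod length ?vs = Suc (Suc k)" using Suc by simp
      then show ?thesis using nth[of k] nth[of "Suc k"] k adjf[OF k] Suc by (simp add: adj_def del: upt_Suc)
    qed
  qed
  ultimately have "graph_cycle E ?vs" using n2 by (simp only: graph_cycle_def len) auto
  moreover have "3 < length ?vs" using n2 by simp
  ultimately have "has_chord E ?vs" using ch unfolding chordal_def by blast
  then obtain i j where ij: "i < Suc (Suc n)" "j < Suc (Suc n)" "i \<noteq> j"
     "j \<noteq> Suc i mod Suc (Suc n)" "i \<noteq> Suc j mod Suc (Suc n)" "{?vs ! i, ?vs ! j} \<in> E"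
    unfolding has_chord_def len by blast
  \<comment> \<open>By symmetry \<open>i < j\<close>. A chord from position 0 would join
    \<open>a\<close> to a vertex of \<open>C\<close>; any other joins two vertices of the walk, and
    \<open>short\<close> makes them consecutive.\<close>
  have *: False if ij: "i < j" "j < Suc (Suc n)" "j \<noteq> Suc i mod Suc (Suc n)" "i \<noteq> Suc j mod Suc (Suc n)"
     "{?vs ! i, ?vs ! j} \<in> E" for i j
  proof -
    obtain l where l: "j = Suc l" "l \<le> n" using ij by (cases j) auto
    have j1: "j \<noteq> Suc i" using ij by auto
    show False
    proof (cases i)
      case 0
      then have "l \<noteq> 0" "l \<noteq> n" using j1 l ij by auto
      then have "f l \<in> C" using inner[of l] l by simp
      moreover have "{a, f l} \<in> E" using ij(5) 0 l nth[of l] by simp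
      ultimately show False using C[of "f l"] by (auto simp: adj_def)
    next
      case (Suc k)
      then have kl: "k < l" "k \<le> n" using ij l by auto
      have "{f k, f l} \<in> E" using ij(5) Suc l nth[of k] nth[of l] kl by simp
      then have "adj E (f k) (f l)" using dist[OF kl(1) l(2)] by (simp add: adj_def)
      with short[OF kl(1) l(2)] kl have "l = Suc k" by simp
      with j1 Suc l show False by simp
    qed
  qed
  show False
  proof (cases "i < j")
    case True
    then show False using *[of i j] ij by blast
  next
    case False
    then show False using *[of j i] ij by (auto simp: insert_commute)
  qed
qed

text \<open>Dirac's argument. \<open>C\<close> is the component of \<open>b\<close> among the
  non-neighbours of \<open>a\<close>, and its boundary \<open>B\<close> is a clique. A simplicial
  vertex of the smaller graph on \<open>C \<union> B\<close> that lies in \<open>C\<close> is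
  simplicial in \<open>W\<close>, since \<open>C\<close> has no neighbours elsewhere. Asking for a
  non-neighbour of \<open>a\<close> allows the induction to be steered away from
  \<open>B\<close>.\<close>

lemma chordal_simplicial_nonadjacent:
  assumes "chordal E" "finite W" "a \<in> W" "b \<in> W" "b \<noteq> a" "\<not> adj E a b"
  shows "\<exists>s. simplicial E W s \<and> s \<noteq> a \<and> \<not> adj E a s"
  using assms(2-)
proof (induction "card W" arbitrary: W a b rule: less_induct)
  case less
  define U where "U = {x \<in> W. x \<noteq> a \<and> \<not> adj E a x}"
  define R where "R = {(x, y). x \<in> U \<and> y \<in> U \<and> adj E x y}"
  define C where "C = R\<^sup>* `` {b}"
  define B where "B = {x \<in> W. adj E a x \<and> (\<exists>c\<in>C. adj E x c)}"
  define W' where "W' = C \<union> B"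
  have bU: "b \<in> U" using less by (simp add: U_def)
  have CU: "C \<subseteq> U"
  proof
    fix c assume "c \<in> C"
    then have "(b, c) \<in> R\<^sup>*" by (simp add: C_def)
    then show "c \<in> U" by (induction) (use bU in \<open>auto simp: R_def\<close>)
  qed
  have bC: "b \<in> C" by (simp add: C_def)
  have symR: "sym R" by (auto simp: R_def sym_def dest: adj_sym)
  have connC: "(c, d) \<in> R\<^sup>*" if "c \<in> C" "d \<in> C" for c d
  proof -
    have "(b, c) \<in> R\<^sup>*" "(b, d) \<in> R\<^sup>*" using that by (auto simp: C_def)
    then show ?thesis using symD[OF sym_rtrancl[OF symR]] by (meson rtrancl_trans)
  qed
  have RC: "(c, d) \<in> R \<Longrightarrow> c \<in> C \<Longrightarrow> d \<in> C" for c d by (auto simp: C_def intro: rtrancl_into_rtrancl)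
  have bdC: "y \<in> W'" if "c \<in> C" "y \<in> W" "adj E c y" for c y
  proof (cases "adj E a y")
    case True
    then show ?thesis using that by (auto simp: W'_def B_def dest: adj_sym)
  next
    case False
    have "y \<noteq> a" using that CU adj_sym[of E c y] by (auto simp: U_def)
    then have "(c, y) \<in> R" using that CU False by (auto simp: R_def U_def)
    then show ?thesis using RC that by (auto simp: W'_def)
  qed
  have Badj: "adj E x y" if xy: "x \<in> B" "y \<in> B" "x \<noteq> y" for x y
  proof (rule chordal_boundary_adj[OF assms(1), where a = a and C = C])
    show "adj E a x" "adj E a y" "x \<noteq> y" using xy by (auto simp: B_def)
    show "c \<noteq> a \<and> \<not> adj E a c" if "c \<in> C" for c using that CU by (auto simp: U_def)
    let ?T = "{(u, v). u \<in> insert x (insert y C) \<and> v \<in> insert x (insert y C) \<and> adj E u v}"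
    obtain c d where cd: "c \<in> C" "d \<in> C" "adj E x c" "adj E y d" using xy by (auto simp: B_def)
    have "(c, e) \<in> ?T\<^sup>* \<and> e \<in> C" if "(c, e) \<in> R\<^sup>*" for e
      using that
    proof induction
      case base
      show ?case using cd by simp
    next
      case (step u v)
      then have "v \<in> C" using RC by blast
      then have "(u, v) \<in> ?T" using step by (auto simp: R_def)
      then show ?case using step \<open>v \<in> C\<close> by (meson rtrancl_into_rtrancl)
    qed
    then have "(c, d) \<in> ?T\<^sup>*" using connC cd by blast
    moreover have "(x, c) \<in> ?T" "(d, y) \<in> ?T" using cd by (auto dest: adj_sym)
    ultimately show "(x, y) \<in> ?T\<^sup>*" by (meson converse_rtrancl_into_rtrancl rtrancl_into_rtrancl)
  qed
  have W'W: "W' \<subset> W" using CU less by (auto simp: W'_def B_def U_def)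
  have finW': "finite W'" "card W' < card W"
    using W'W less finite_subset psubset_card_mono by blast+
  have "\<exists>s\<in>C. simplicial E W' s"
  proof (cases "pairwise_adj E W'")
    case True
    then show ?thesis using bC by (auto simp: simplicial_def pairwise_adj_def closed_nbhd_def W'_def)
  next
    case False
    then obtain x0 y0 where x0: "x0 \<in> W'" "y0 \<in> W'" "x0 \<noteq> y0" "\<not> adj E x0 y0"
      by (auto simp: pairwise_adj_def)
    \<comment> \<open>\<open>x\<close> is taken in \<open>B\<close> whenever some vertex of
      \<open>B\<close> has a non-neighbour in \<open>W'\<close>. Then a non-neighbour of
      \<open>x\<close> is outside the clique \<open>B\<close>; in the other case every vertex of
      \<open>B\<close> is adjacent to all others, and \<open>B\<close> is avoided too.\<close>
    obtain x y where x: "x \<in> W'" "y \<in> W'" "y \<noteq> x" "\<not> adj E x y"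
      and xB: "x \<in> B \<or> (\<forall>u\<in>B. \<forall>v\<in>W'. v \<noteq> u \<longrightarrow> adj E u v)"
    proof (cases "\<exists>u\<in>B. \<exists>v\<in>W'. v \<noteq> u \<and> \<not> adj E u v")
      case True
      then show ?thesis using that by (auto simp: W'_def)
    next
      case False
      then show ?thesis using that[of x0 y0] x0 by blast
    qed
    obtain s where s: "simplicial E W' s" "s \<noteq> x" "\<not> adj E x s"
      using less(1)[OF finW'(2) finW'(1) x] by blast
    have "s \<notin> B"
    proof
      assume sB: "s \<in> B"
      from xB show False
      proof
        assume "x \<in> B"
        then show False using Badj[of x s] sB s by blast
      next
        assume "\<forall>u\<in>B. \<forall>v\<in>W'. v \<noteq> u \<longrightarrow> adj E u v"
        then have "adj E s x" using sB x s by metis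
        then show False using s adj_sym by metis
      qed
    qed
    then have "s \<in> C" using s(1) by (auto simp: simplicial_def W'_def)
    with s show ?thesis by blast
  qed
  then obtain s where s: "s \<in> C" "simplicial E W' s" by blast
  have "closed_nbhd E W s \<subseteq> closed_nbhd E W' s"
    using bdC[OF s(1)] s by (auto simp: closed_nbhd_def simplicial_def)
  then have "simplicial E W s"
    using s CU unfolding simplicial_def pairwise_adj_def U_def by blast
  moreover have "s \<noteq> a" "\<not> adj E a s" using s CU by (auto simp: U_def)
  ultimately show ?case by blast
qed

lemma chordal_exists_simplicial:
  assumes "chordal E" "finite W" "W \<noteq> {}"
  shows "\<exists>s. simplicial E W s"
proof (cases "pairwise_adj E W")
  case True
  then show ?thesis using assms(3) by (auto simp: simplicial_def pairwise_adj_def closed_nbhd_def)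
next
  case False
  then obtain a b where "a \<in> W" "b \<in> W" "b \<noteq> a" "\<not> adj E a b" by (auto simp: pairwise_adj_def)
  then show ?thesis using chordal_simplicial_nonadjacent[OF assms(1,2)] by blast
qed

text \<open>Take \<open>T\<close> of least size; each of its members then has a private neighbour in
  \<open>R\<close>. Two adjacent members of \<open>T\<close> and their private neighbours, adjacent
  in the clique \<open>R\<close>, would form a four-cycle without chord.\<close>

lemma chordal_independent_domination:
  assumes ch: "chordal E" and "finite U" and R: "pairwise_adj E R" "R \<inter> U = {}"
    and dom: "\<And>r. r \<in> R \<Longrightarrow> \<exists>u\<in>U. adj E r u"
  obtains T where "T \<subseteq> U" "indep E T" "\<And>r. r \<in> R \<Longrightarrow> \<exists>t\<in>T. adj E r t"
    "\<And>t. t \<in> T \<Longrightarrow> \<exists>r\<in>R. adj E r t"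
proof -
  let ?P = "\<lambda>T. T \<subseteq> U \<and> (\<forall>r\<in>R. \<exists>t\<in>T. adj E r t)"
  have "?P U" using dom by blast
  then obtain T where T: "?P T" "\<And>T'. ?P T' \<Longrightarrow> card T \<le> card T'"
    using ex_has_least_nat[of ?P U card] by blast
  have finT: "finite T" using T(1) assms(2) finite_subset by blast
  have priv: "\<exists>r\<in>R. adj E r t \<and> (\<forall>t'\<in>T - {t}. \<not> adj E r t')" if t: "t \<in> T" for t
  proof (rule ccontr)
    assume n: "\<not> ?thesis"
    have "?P (T - {t})"
    proof (intro conjI ballI)
      show "T - {t} \<subseteq> U" using T(1) by blast
      fix r assume r: "r \<in> R"
      with T(1) obtain t' where "t' \<in> T" "adj E r t'" by blast
      with n r show "\<exists>t\<in>T - {t}. adj E r t" by (cases "t' = t") auto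
    qed
    from T(2)[OF this] show False using card_Diff1_less[OF finT t] by simp
  qed
  have "indep E T"
    unfolding indep_def
  proof (intro ballI notI)
    fix t t' assume t: "t \<in> T" "t' \<in> T" "adj E t t'"
    then have tt: "t \<noteq> t'" by auto
    obtain r where r: "r \<in> R" "adj E r t" "\<not> adj E r t'" using priv[OF t(1)] t tt by blast
    obtain r' where r': "r' \<in> R" "adj E r' t'" "\<not> adj E r' t" using priv[OF t(2)] t tt by blast
    have "r \<noteq> r'" using r r' by auto
    then have "adj E r' r" using R(1) r r' by (auto simp: pairwise_adj_def)
    then have "adj E r t' \<or> adj E t r'"
      using r r' t R T(1) by (intro chordal_four_cycle[OF ch]) (auto dest: adj_sym)
    then show False using r r' adj_sym by metis
  qed
  then show ?thesis using T(1) priv that[of T] by blast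
qed

text \<open>The extension adds exactly one vertex. This carries equality of sizes from
  \<open>W\<close> to the graph without the closed neighbourhood of \<open>v\<close>.\<close>

lemma max_indep_insert_simplicial:
  assumes v: "v \<in> W" and A: "max_indep E (W - closed_nbhd E W v) A"
  shows "max_indep E W (insert v A)"
  using A v by (auto simp: max_indep_def indep_insert closed_nbhd_def dest: adj_sym)

theorem chordal_well_covered_partition:
  assumes "chordal E" "finite W" "well_covered E W"
  shows "\<exists>Y. Y \<subseteq> W \<and> (\<forall>y\<in>Y. simplicial E W y) \<and> W = (\<Union>y\<in>Y. closed_nbhd E W y) \<and>
    (\<forall>y\<in>Y. \<forall>z\<in>Y. y \<noteq> z \<longrightarrow> closed_nbhd E W y \<inter> closed_nbhd E W z = {})"
  using assms(2,3)
proof (induction "card W" arbitrary: W rule: less_induct)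
  case less
  show ?case
  proof (cases "W = {}")
    case True
    then show ?thesis by auto
  next
    case False
    then obtain v where v: "simplicial E W v" using chordal_exists_simplicial[OF assms(1) less(2)] by blast
    have vW: "v \<in> W" using v by (simp add: simplicial_def)
    define F where "F = closed_nbhd E W v"
    define W' where "W' = W - F"
    have vF: "v \<in> F" using vW by (simp add: F_def closed_nbhd_def)
    have FW: "F \<subseteq> W" by (auto simp: F_def closed_nbhd_def)
    have Fadj: "\<And>a b. a \<in> F \<Longrightarrow> b \<in> F \<Longrightarrow> a \<noteq> b \<Longrightarrow> adj E a b"
      using v by (auto simp: simplicial_def pairwise_adj_def F_def)
    have W': "finite W'" "card W' < card W" "W' \<subseteq> W"
      using less(2) vF vW by (auto simp: W'_def intro!: psubset_card_mono)
    have ins: "max_indep E W (insert v A)" "v \<notin> A" "finite A" if "max_indep E W' A" for A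
      using max_indep_insert_simplicial[OF vW, of E A] that vF W'(1) finite_subset[of A W']
      by (auto simp: W'_def F_def max_indep_def)
    have "well_covered E W'"
      unfolding well_covered_def
    proof (intro allI impI, elim conjE)
      fix A B assume AB: "max_indep E W' A" "max_indep E W' B"
      then have "card (insert v A) = card (insert v B)"
        using less(3) ins unfolding well_covered_def by blast
      then show "card A = card B" using ins[OF AB(1)] ins[OF AB(2)] by simp
    qed
    from less(1)[OF W'(2,1) this] obtain Y where Y0: "Y \<subseteq> W'" "\<forall>y\<in>Y. simplicial E W' y"
      "W' = (\<Union>y\<in>Y. closed_nbhd E W' y)"
      "\<forall>y\<in>Y. \<forall>z\<in>Y. y \<noteq> z \<longrightarrow> closed_nbhd E W' y \<inter> closed_nbhd E W' z = {}"
      by (elim exE conjE)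
    note Y = Y0(1) Y0(2)[rule_format] Y0(3) Y0(4)[rule_format]
    have finY: "finite Y" using Y(1) W'(1) finite_subset by blast
    have selfN: "y \<in> closed_nbhd E W' y" if "y \<in> W'" for y using that by (simp add: closed_nbhd_def)
    \<comment> \<open>One vertex per block gives a maximal independent set of \<open>W'\<close>;
      adding \<open>v\<close> shows that the common size in \<open>W\<close> is one more than the
      number of these blocks.\<close>
    have "max_indep E W' Y"
      unfolding max_indep_def
    proof (intro conjI ballI)
      show "indep E Y"
        unfolding indep_def
      proof (intro ballI notI)
        fix y z assume yz: "y \<in> Y" "z \<in> Y" "adj E y z"
        then have "z \<in> closed_nbhd E W' y" "y \<noteq> z" using Y(1) by (auto simp: closed_nbhd_def)
        then show False using Y(4)[of y z] yz selfN[of z] Y(1) by blast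
      qed
      fix u assume u: "u \<in> W' - Y"
      then obtain y where "y \<in> Y" "u \<in> closed_nbhd E W' y" using Y(3) by blast
      then show "\<exists>y\<in>Y. adj E u y" using u by (auto simp: closed_nbhd_def dest: adj_sym)
    qed (use Y(1) in auto)
    then have cardW: "max_indep E W A \<Longrightarrow> card A = Suc (card Y)" for A
    proof -
      assume "max_indep E W A"
      moreover have "max_indep E W (insert v Y)" "v \<notin> Y" using ins[OF \<open>max_indep E W' Y\<close>] by auto
      ultimately show "card A = Suc (card Y)"
        using less(3) finY unfolding well_covered_def by (metis card_insert_disjoint)
    qed
    \<comment> \<open>Each block has to keep a vertex that sees its whole block in \<open>W'\<close>
      and nothing of \<open>F\<close>, for its closed neighbourhood in \<open>W\<close> is then
      still the block.\<close>
    have key: "\<exists>z\<in>W'. closed_nbhd E W' z = closed_nbhd E W' y \<and> (\<forall>b\<in>F. \<not> adj E z b)" if y: "y \<in> Y" for y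
    proof (rule ccontr)
      assume n: "\<not> ?thesis"
      define H where "H = closed_nbhd E W' y"
      \<comment> \<open>The free vertices of the block \<open>H\<close> within \<open>W'\<close>; by
        assumption each of them has a neighbour in \<open>F\<close>.\<close>
      define Z where "Z = {z \<in> W'. closed_nbhd E W' z = H}"
      have yW: "y \<in> W'" using y Y(1) by blast
      have yZ: "y \<in> Z" using yW by (simp add: Z_def H_def)
      have HW: "H \<subseteq> W'" by (auto simp: H_def closed_nbhd_def)
      have Hadj: "\<And>a b. a \<in> H \<Longrightarrow> b \<in> H \<Longrightarrow> a \<noteq> b \<Longrightarrow> adj E a b"
        using Y(2)[OF y] by (auto simp: simplicial_def pairwise_adj_def H_def)
      have ZH: "Z \<subseteq> H" using selfN by (auto simp: Z_def)
      have finZ: "finite Z" using W'(1) by (simp add: Z_def)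
      have finF: "finite F" using FW less(2) finite_subset by blast
      have nz: "\<exists>b\<in>F. adj E z b" if "z \<in> Z" for z using n that by (auto simp: Z_def H_def)
      \<comment> \<open>A vertex of \<open>F\<close> with the most neighbours in \<open>Z\<close>.
        As four-cycles have chords, the neighbourhoods in \<open>Z\<close> of the vertices of
        \<open>F\<close> are nested, so \<open>b\<close> sees all of \<open>Z\<close>.\<close>
      obtain b where b: "b \<in> F" "\<And>b'. b' \<in> F \<Longrightarrow> card {z \<in> Z. adj E z b'} \<le> card {z \<in> Z. adj E z b}"
        using ex_has_greatest_nat[of "\<lambda>b. b \<in> F" v "\<lambda>b. card {z \<in> Z. adj E z b}" "Suc (card Z)"]
          vF card_mono[OF finZ, of "{z \<in> Z. adj E z _}"] by (auto simp: less_Suc_eq_le)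
      have bZ: "adj E z b" if z: "z \<in> Z" for z
      proof (rule ccontr)
        assume nzb: "\<not> adj E z b"
        obtain b' where b': "b' \<in> F" "adj E z b'" using nz[OF z] by blast
        have "\<exists>z'\<in>Z. adj E z' b \<and> \<not> adj E z' b'"
        proof (rule ccontr)
          assume "\<not> ?thesis"
          then have "{z \<in> Z. adj E z b} \<subset> {z \<in> Z. adj E z b'}" using z nzb b' by blast
          then have "card {z \<in> Z. adj E z b} < card {z \<in> Z. adj E z b'}"
            using finZ by (intro psubset_card_mono) auto
          with b(2)[OF b'(1)] show False by simp
        qed
        then obtain z' where z': "z' \<in> Z" "adj E z' b" "\<not> adj E z' b'" by blast
        have "adj E b b'" using Fadj[OF b(1) b'(1)] nzb b' by auto
        moreover have "adj E z z'" using Hadj[of z z'] ZH z z' nzb by auto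
        moreover have "b \<noteq> z" "b' \<noteq> z'" using b b' z z' by (auto simp: Z_def W'_def)
        ultimately have "adj E b z \<or> adj E b' z'"
          using b' z' by (intro chordal_four_cycle[OF assms(1)]) (auto dest: adj_sym)
        then show False using nzb z'(3) adj_sym by metis
      qed
      \<comment> \<open>The vertices of \<open>H\<close> that \<open>b\<close> does not see. None is
        in \<open>Z\<close>, so each has a neighbour in \<open>W'\<close> outside \<open>H\<close>,
        and an independent set \<open>T\<close> of such vertices dominates them.\<close>
      define R where "R = {r \<in> H. \<not> adj E r b}"
      have "\<exists>T. T \<subseteq> W' - H \<and> indep E T \<and> (\<forall>r\<in>R. \<exists>t\<in>T. adj E r t) \<and> (\<forall>t\<in>T. \<exists>r\<in>R. adj E r t)"
      proof -
        obtain T where "T \<subseteq> W' - H" "indep E T" "\<And>r. r \<in> R \<Longrightarrow> \<exists>t\<in>T. adj E r t"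
          "\<And>t. t \<in> T \<Longrightarrow> \<exists>r\<in>R. adj E r t"
        proof (rule chordal_independent_domination[OF assms(1), of "W' - H" R])
          show "finite (W' - H)" using W'(1) by simp
          show "pairwise_adj E R" using Hadj by (auto simp: pairwise_adj_def R_def)
          show "R \<inter> (W' - H) = {}" by (auto simp: R_def)
          fix r assume r: "r \<in> R"
          then have rH: "r \<in> H" "r \<notin> Z" using bZ by (auto simp: R_def)
          have "H \<subseteq> closed_nbhd E W' r" using Hadj[OF rH(1)] HW by (auto simp: closed_nbhd_def)
          moreover have "closed_nbhd E W' r \<noteq> H" using rH HW by (auto simp: Z_def)
          ultimately obtain u where "u \<in> closed_nbhd E W' r" "u \<notin> H" by blast
          then show "\<exists>u\<in>W' - H. adj E r u" using rH by (auto simp: closed_nbhd_def)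
        qed blast
        then show ?thesis by blast
      qed
      then obtain T where T: "T \<subseteq> W' - H" "indep E T" "\<forall>r\<in>R. \<exists>t\<in>T. adj E r t" "\<forall>t\<in>T. \<exists>r\<in>R. adj E r t"
        by blast
      \<comment> \<open>An edge from \<open>b\<close> to \<open>t\<close> would close the four-cycle
        \<open>b\<close>, \<open>t\<close>, \<open>r\<close>, \<open>y\<close> for some
        \<open>r\<close> in \<open>R\<close>; neither \<open>b\<close> and \<open>r\<close> nor
        \<open>t\<close> and \<open>y\<close> are adjacent.\<close>
      have bT: "\<not> adj E b t" if t: "t \<in> T" for t
      proof
        assume bt: "adj E b t"
        obtain r where r: "r \<in> R" "adj E r t" using T(4) t by blast
        have ry: "r \<noteq> y" "r \<in> H" using r bZ[OF yZ] by (auto simp: R_def)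
        have "adj E r y" using Hadj[of r y] ry yZ ZH by blast
        moreover have "b \<noteq> r" using b(1) ry HW by (auto simp: W'_def)
        moreover have "t \<noteq> y" using t T(1) yZ ZH by blast
        ultimately have "adj E b r \<or> adj E t y"
          using bt r bZ[OF yZ] by (intro chordal_four_cycle[OF assms(1)]) (auto dest: adj_sym)
        moreover have "\<not> adj E b r" using r adj_sym[of E b r] by (auto simp: R_def)
        moreover have "\<not> adj E t y" using t T(1) adj_sym[of E t y] by (auto simp: H_def closed_nbhd_def)
        ultimately show False by blast
      qed
      have "indep E (insert b T)" using T(2) bT by (simp add: indep_insert)
      moreover have "insert b T \<subseteq> W" using b(1) FW T(1) W'(3) by blast
      ultimately obtain A where A: "insert b T \<subseteq> A" "max_indep E W A"
        using extend_indep[OF less(2)] by metis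
      have indA: "indep E A" and AW: "A \<subseteq> W" using A(2) by (auto simp: max_indep_def)
      have AH: "A \<inter> H = {}"
      proof (rule ccontr)
        assume "\<not> ?thesis"
        then obtain h where h: "h \<in> A" "h \<in> H" by blast
        show False
        proof (cases "adj E h b")
          case True
          then show False using h A(1) indA by (auto simp: indep_def)
        next
          case False
          then have "h \<in> R" using h by (simp add: R_def)
          then obtain t where "t \<in> T" "adj E h t" using T(3) by blast
          then show False using h A(1) indA by (auto simp: indep_def)
        qed
      qed
      \<comment> \<open>\<open>A\<close> avoids \<open>H\<close> and meets \<open>F\<close> and each
        other block at most once. So it has at most \<open>card Y\<close> vertices, one less than
        the common size.\<close>
      define blk where "blk i = (if i = v then F else closed_nbhd E W' i)" for i
      have vY: "v \<notin> Y" using Y(1) vF by (auto simp: W'_def)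
      have "\<exists>i\<in>insert v (Y - {y}). a \<in> blk i" if a: "a \<in> A" for a
      proof (cases "a \<in> F")
        case True
        then show ?thesis by (auto simp: blk_def)
      next
        case False
        then have "a \<in> W'" using a AW by (auto simp: W'_def)
        then obtain z where z: "z \<in> Y" "a \<in> closed_nbhd E W' z" using Y(3) by blast
        then have "z \<noteq> y" using a AH by (auto simp: H_def)
        with z vY show ?thesis by (intro bexI[of _ z]) (auto simp: blk_def)
      qed
      then obtain g where g: "\<And>a. a \<in> A \<Longrightarrow> g a \<in> insert v (Y - {y}) \<and> a \<in> blk (g a)" by metis
      have "inj_on g A"
      proof (rule inj_onI)
        fix a a' assume aa: "a \<in> A" "a' \<in> A" "g a = g a'"
        then have m: "a \<in> blk (g a)" "a' \<in> blk (g a)" "g a \<in> insert v Y" using g[of a] g[of a'] by auto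
        show "a = a'"
        proof (rule ccontr)
          assume ne: "a \<noteq> a'"
          have "adj E a a'"
          proof (cases "g a = v")
            case True
            then show ?thesis using m Fadj ne by (auto simp: blk_def)
          next
            case False
            then have "simplicial E W' (g a)" using m Y(2) by blast
            then show ?thesis using m ne False by (auto simp: blk_def simplicial_def pairwise_adj_def)
          qed
          then show False using indA aa by (auto simp: indep_def)
        qed
      qed
      then have "card A \<le> card (insert v (Y - {y}))"
      proof (rule card_inj_on_le)
        show "g ` A \<subseteq> insert v (Y - {y})" using g by (meson image_subsetI)
      qed (use finY in simp)
      also have "\<dots> = card Y"
        using vY card_Suc_Diff1[OF finY y] finY by simp
      finally show False using cardW[OF A(2)] by simp
    qed
    then obtain z where z: "\<And>y. y \<in> Y \<Longrightarrow> z y \<in> W' \<and> closed_nbhd E W' (z y) = closed_nbhd E W' y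
        \<and> (\<forall>b\<in>F. \<not> adj E (z y) b)" by metis
    have zN: "closed_nbhd E W (z y) = closed_nbhd E W' y" if "y \<in> Y" for y
      using z[OF that] by (auto simp: closed_nbhd_def W'_def)
    show ?thesis
    proof (intro exI[of _ "insert v (z ` Y)"] conjI ballI impI)
      show "insert v (z ` Y) \<subseteq> W" using vW z W'(3) by blast
      show "simplicial E W s" if "s \<in> insert v (z ` Y)" for s
        using that v z zN Y(2) W'(3) by (auto simp: simplicial_def)
      show "W = (\<Union>y\<in>insert v (z ` Y). closed_nbhd E W y)"
      proof -
        have "(\<Union>y\<in>insert v (z ` Y). closed_nbhd E W y) = F \<union> (\<Union>y\<in>Y. closed_nbhd E W' y)"
          using zN by (auto simp: F_def)
        also have "\<dots> = F \<union> W'" using Y(3) by simp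
        finally show ?thesis using FW by (auto simp: W'_def)
      qed
      fix s t assume st: "s \<in> insert v (z ` Y)" "t \<in> insert v (z ` Y)" "s \<noteq> t"
      have d: "F \<inter> closed_nbhd E W' y = {}" for y by (auto simp: closed_nbhd_def W'_def)
      show "closed_nbhd E W s \<inter> closed_nbhd E W t = {}"
      proof (cases "s = v")
        case True
        then show ?thesis using st d zN by (auto simp flip: F_def)
      next
        case False
        then obtain y where y: "y \<in> Y" "s = z y" using st by blast
        show ?thesis
        proof (cases "t = v")
          case True
          then show ?thesis using y d[of y] zN[of y] by (auto simp flip: F_def)
        next
          case False
          then obtain y' where y': "y' \<in> Y" "t = z y'" using st by blast
          then show ?thesis using y zN Y(4)[of y y'] st by auto
        qed
      qed
    qed
  qed
qed

section \<open>Regular sequences modulo edge ideals\<close>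

context mpoly_ring
begin

text \<open>Horner evaluation at \<open>t\<close> of the one-variable polynomial with coefficient
  list \<open>cs\<close>, constant term first. The list can be evaluated both at a variable and at a
  sum of variables.\<close>

primrec heval :: "'a list \<Rightarrow> ('v multiset \<Rightarrow> 'a) \<Rightarrow> 'v multiset \<Rightarrow> 'a" where
  "heval [] t = \<zero>"
| "heval (c # cs) t = mon c {#} \<oplus> t \<otimes> heval cs t"

lemma heval_closed: "set cs \<subseteq> carrier K \<Longrightarrow> t \<in> carrier S \<Longrightarrow> heval cs t \<in> carrier S"
  by (induction cs) (auto simp: mon_closed)

lemma heval_subpolys: "set cs \<subseteq> carrier K \<Longrightarrow> t \<in> subpolys Z \<Longrightarrow> heval cs t \<in> subpolys Z"
  by (induction cs) (auto simp: subpolys_zero intro!: subpolys_add subpolys_mult mon_in_subpolys)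

text \<open>By Horner's recursion, the difference of the two values is a multiple of
  \<open>t \<ominus> t'\<close>.\<close>

lemma heval_cong:
  assumes J: "ideal J S" and t: "t \<in> carrier S" "t' \<in> carrier S" "t \<ominus> t' \<in> J"
    and "set cs \<subseteq> carrier K"
  shows "heval cs t \<ominus> heval cs t' \<in> J"
  using assms(5)
proof (induction cs)
  case Nil
  then show ?case using ideal_zero[OF J] by (simp add: a_minus_def)
next
  case (Cons c cs)
  then have c: "mon c {#} \<in> carrier S" "heval cs t \<in> carrier S" "heval cs t' \<in> carrier S"
    using t by (auto simp: mon_closed heval_closed)
  have "heval (c # cs) t \<ominus> heval (c # cs) t'
     = t \<otimes> (heval cs t \<ominus> heval cs t') \<oplus> heval cs t' \<otimes> (t \<ominus> t')"
    unfolding heval.simps using c t by algebra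
  also have "\<dots> \<in> J"
    by (rule ideal_add[OF J ideal.I_l_closed[OF J Cons.IH t(1)] ideal.I_l_closed[OF J t(3) c(3)]])
      (use Cons in simp)
  finally show ?case .
qed

lemma heval_zero_coeffs: "\<forall>c\<in>set cs. c = \<zero>\<^bsub>K\<^esub> \<Longrightarrow> t \<in> carrier S \<Longrightarrow> heval cs t = \<zero>"
proof (induction cs)
  case (Cons c cs)
  have "mon \<zero>\<^bsub>K\<^esub> {#} = \<zero>" by (auto simp: mon_def zero_S)
  with Cons show ?case by simp
qed simp

text \<open>The constant coefficient is split off and the rest divided by the variable;
  \<open>n\<close> bounds the degree.\<close>

lemma exists_heval:
  assumes v: "v \<in> V" and f: "f \<in> subpolys {v}"
  shows "\<exists>cs. set cs \<subseteq> carrier K \<and> f = heval cs (var v)"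
proof -
  have "\<exists>cs. set cs \<subseteq> carrier K \<and> f = heval cs (var v)"
    if "f \<in> subpolys {v}" "\<And>m. m \<in> supp f \<Longrightarrow> size m < n" for n f
    using that
  proof (induction n arbitrary: f)
    case 0
    then have "supp f = {}" by blast
    then show ?case by (intro exI[of _ "[]"]) (simp add: supp_empty_iff)
  next
    case (Suc n)
    have fc: "f \<in> carrier S" using Suc(2) by (rule subpolys_carrier)
    have "shift v f \<in> subpolys {v}"
    proof -
      have "set_mset m \<subseteq> {v}" if "m \<in> supp (shift v f)" for m
      proof -
        have "set_mset (add_mset v m) \<subseteq> {v}" using that Suc(2) unfolding supp_shift subpolys_def by blast
        then show ?thesis by simp
      qed
      then show ?thesis using shift_closed[OF fc] by (simp add: subpolys_def)
    qed
    moreover have "size m < n" if "m \<in> supp (shift v f)" for m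
      using Suc(3)[of "add_mset v m"] that by (simp add: supp_shift)
    ultimately obtain cs where cs: "set cs \<subseteq> carrier K" "shift v f = heval cs (var v)"
      using Suc(1) by blast
    have "part (\<lambda>m. v \<notin># m) f = mon (f {#}) {#}"
    proof
      fix m
      have "f m = \<zero>\<^bsub>K\<^esub>" if "v \<notin># m" "m \<noteq> {#}"
      proof (rule ccontr)
        assume "f m \<noteq> \<zero>\<^bsub>K\<^esub>"
        then have "set_mset m \<subseteq> {v}" using Suc(2) by (simp add: subpolys_def supp_def)
        with that show False by auto
      qed
      then show "part (\<lambda>m. v \<notin># m) f m = mon (f {#}) {#} m"
        by (auto simp: part_def mon_def)
    qed
    then have "f = heval (f {#} # cs) (var v)"
      using shift_decomp[OF fc, of v] cs by simp
    then show ?case using cs fc by (intro exI[of _ "f {#} # cs"]) simp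
  qed
  moreover have "\<And>m. m \<in> supp f \<Longrightarrow> size m < Suc (Max (size ` supp f))"
    using finite_supp[OF subpolys_carrier[OF f]] by (simp add: less_Suc_eq_le)
  ultimately show ?thesis using f by blast
qed

text \<open>The coefficient of the \<open>k\<close>-th power of \<open>v\<close>, a polynomial free
  of \<open>v\<close>.\<close>

definition coef :: "'v \<Rightarrow> nat \<Rightarrow> ('v multiset \<Rightarrow> 'a) \<Rightarrow> 'v multiset \<Rightarrow> 'a" where
  "coef v k f = part (\<lambda>m. v \<notin># m) ((shift v ^^ k) f)"

lemma shift_pow_closed: "f \<in> carrier S \<Longrightarrow> (shift v ^^ k) f \<in> carrier S"
  by (induction k) (auto simp: shift_closed)

lemma coef_closed: "f \<in> carrier S \<Longrightarrow> coef v k f \<in> carrier S"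
  by (simp add: coef_def part_closed shift_pow_closed)

lemma coef_shift: "coef v k (shift v f) = coef v (Suc k) f"
  by (simp add: coef_def funpow_swap1)

lemma coef_add: "coef v k (f \<oplus> g) = coef v k f \<oplus> coef v k g"
proof -
  have s: "shift v (f \<oplus> g) = shift v f \<oplus> shift v g" for f g by (simp add: shift_def add_S)
  have "(shift v ^^ k) (f \<oplus> g) = (shift v ^^ k) f \<oplus> (shift v ^^ k) g" by (induction k) (simp_all add: s)
  then show ?thesis by (auto simp: coef_def part_def add_S fun_eq_iff)
qed

lemma supp_coef: "m \<in> supp (coef v k f) \<longleftrightarrow> v \<notin># m \<and> m + replicate_mset k v \<in> supp f"
proof -
  have "m \<in> supp ((shift v ^^ k) f) \<longleftrightarrow> m + replicate_mset k v \<in> supp f" for m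
    by (induction k arbitrary: m) (simp_all add: supp_shift)
  then show ?thesis by (auto simp: coef_def supp_part)
qed

lemma shift_var_mult: "f \<in> carrier S \<Longrightarrow> shift v (var v \<otimes> f) = f"
  by (auto simp: shift_def mult_mon fun_eq_iff)

lemma coef_var_mult:
  assumes "v \<in> V" "f \<in> carrier S"
  shows "coef v 0 (var v \<otimes> f) = \<zero>" "coef v (Suc k) (var v \<otimes> f) = coef v k f"
  using assms by (simp add: coef_def part_def mult_mon zero_S fun_eq_iff)
    (simp add: coef_shift[symmetric] shift_var_mult assms)

lemma shift_mon_mult:
  assumes "c \<in> carrier K" "v \<notin># p" "g \<in> carrier S"
  shows "shift v (mon c p \<otimes> g) = mon c p \<otimes> shift v g"
proof
  fix m
  have "p \<subseteq># add_mset v m \<longleftrightarrow> p \<subseteq># m"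
  proof -
    have "count p a \<le> count (add_mset v m) a \<longleftrightarrow> count p a \<le> count m a" for a
      using assms(2) by (cases "a = v") (auto simp: not_in_iff)
    then show ?thesis by (simp add: subseteq_mset_def)
  qed
  moreover have "add_mset v m - p = add_mset v (m - p)"
    using assms(2) by (auto simp: multiset_eq_iff not_in_iff)
  ultimately show "shift v (mon c p \<otimes> g) m = (mon c p \<otimes> shift v g) m"
    using assms shift_closed[of g v] by (simp add: mult_mon) (simp add: shift_def mult_mon)
qed

lemma part_mon_mult:
  assumes "c \<in> carrier K" "v \<notin># p" "g \<in> carrier S"
  shows "part (\<lambda>m. v \<notin># m) (mon c p \<otimes> g) = mon c p \<otimes> part (\<lambda>m. v \<notin># m) g"
proof
  fix m
  have "p \<subseteq># m \<Longrightarrow> v \<in># m - p \<longleftrightarrow> v \<in># m"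
    using assms(2) by (metis count_diff diff_zero not_in_iff count_eq_zero_iff)
  then show "part (\<lambda>m. v \<notin># m) (mon c p \<otimes> g) m = (mon c p \<otimes> part (\<lambda>m. v \<notin># m) g) m"
    using assms part_closed[of g] by (simp add: mult_mon) (simp add: part_def mult_mon)
qed

lemma coef_mult:
  assumes f: "f \<in> subpolys (V - {v})" and g: "g \<in> carrier S"
  shows "coef v k (f \<otimes> g) = f \<otimes> coef v k g"
proof -
  have "f \<in> carrier S" using f by (rule subpolys_carrier)
  then show ?thesis
  proof (induction rule: mpoly_induct)
    case zero
    have "coef v k \<zero> = \<zero>" unfolding supp_empty_iff[symmetric] by (auto simp: supp_coef supp_zero)
    then show ?case using g by (simp add: coef_closed)
  next
    case (mon_add c p h)
    have "v \<notin># p" using f mon_add(4) by (auto simp: subpolys_def)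
    then have s: "(shift v ^^ k) (mon c p \<otimes> g) = mon c p \<otimes> (shift v ^^ k) g"
      using mon_add(1) g by (induction k) (simp_all add: shift_mon_mult shift_pow_closed)
    have "coef v k (mon c p \<otimes> g) = mon c p \<otimes> coef v k g"
      unfolding coef_def s using mon_add(1) \<open>v \<notin># p\<close> g by (simp add: part_mon_mult shift_pow_closed)
    then show ?case using mon_add g by (simp add: l_distr coef_add mon_closed coef_closed)
  qed
qed

text \<open>\<open>a\<close> is the sum of its coefficients times powers of \<open>v\<close>,
  recovered by dividing repeatedly by \<open>v\<close>.\<close>

lemma ideal_mem_of_coefs:
  assumes J: "ideal J S" and v: "v \<in> V" and a: "a \<in> carrier S" and c: "\<And>k. coef v k a \<in> J"
  shows "a \<in> J"
proof -
  have "a \<in> J" if "a \<in> carrier S" "\<And>k. coef v k a \<in> J" "\<And>m. m \<in> supp a \<Longrightarrow> count m v < n" for n a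
    using that
  proof (induction n arbitrary: a)
    case 0
    then have "supp a = {}" by blast
    then show ?case using ideal_zero[OF J] by (simp add: supp_empty_iff)
  next
    case (Suc n)
    have "shift v a \<in> J"
    proof (rule Suc(1)[OF shift_closed[OF Suc(2)]])
      show "coef v k (shift v a) \<in> J" for k using Suc(3) by (simp add: coef_shift)
      show "count m v < n" if "m \<in> supp (shift v a)" for m
        using Suc(4)[of "add_mset v m"] that by (simp add: supp_shift)
    qed
    then have "var v \<otimes> shift v a \<in> J" using v by (intro ideal.I_l_closed[OF J]) (auto simp: var_closed)
    moreover have "part (\<lambda>m. v \<notin># m) a \<in> J" using Suc(3)[of 0] by (simp add: coef_def)
    ultimately show ?case using shift_decomp[OF Suc(2), of v] ideal_add[OF J] by metis
  qed
  moreover have "\<And>m. m \<in> supp a \<Longrightarrow> count m v < Suc (Max ((\<lambda>m. count m v) ` supp a))"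
    using finite_supp[OF a] by (simp add: less_Suc_eq_le)
  ultimately show ?thesis using a c by blast
qed

text \<open>Homogeneity for the degree in \<open>v\<close>, as for ideals generated by polynomials not involving \<open>v\<close>.\<close>

definition homogeneous_in :: "'v \<Rightarrow> ('v multiset \<Rightarrow> 'a) set \<Rightarrow> bool" where
  "homogeneous_in v J \<longleftrightarrow> (\<forall>a\<in>J. \<forall>k. coef v k a \<in> J)"

lemma homogeneous_in_face_prime: "v \<in> Y \<Longrightarrow> homogeneous_in v (face_prime Y)"
  unfolding homogeneous_in_def
proof (intro ballI allI)
  fix a k assume v: "v \<in> Y" and a: "a \<in> face_prime Y"
  have "\<not> set_mset m \<subseteq> Y" if "m \<in> supp (coef v k a)" for m
  proof -
    have "\<not> set_mset (m + replicate_mset k v) \<subseteq> Y"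
      using that a unfolding supp_coef mono_ideal_def by blast
    then show ?thesis using v by (auto split: if_splits)
  qed
  then show "coef v k a \<in> face_prime Y" using a by (simp add: mono_ideal_def coef_closed)
qed

text \<open>Multiplication by \<open>g\<close> commutes with taking coefficients in
  \<open>v\<close>, so a decomposition over \<open>J\<close> passes to each coefficient.\<close>

lemma homogeneous_in_adjoin:
  assumes J: "ideal J S" "homogeneous_in v J" and g: "g \<in> subpolys (V - {v})"
  shows "homogeneous_in v (adjoin S J g)"
  unfolding homogeneous_in_def
proof (intro ballI allI)
  fix a k assume "a \<in> adjoin S J g"
  then obtain b r where b: "b \<in> J" "r \<in> carrier S" "a = b \<oplus> g \<otimes> r" by (rule adjoinE)
  have "coef v k a = coef v k b \<oplus> g \<otimes> coef v k r"
    unfolding b(3) coef_add coef_mult[OF g b(2)] ..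
  then show "coef v k a \<in> adjoin S J g"
    using J(2) b coef_closed[OF b(2)] by (auto simp: homogeneous_in_def intro!: adjoinI)
qed

text \<open>The coefficient of degree \<open>k\<close> of the product only involves the coefficients
  of \<open>a\<close> up to degree \<open>k\<close>.\<close>

lemma coef_heval_mult:
  assumes J: "ideal J S" and v: "v \<in> V" and a: "a \<in> carrier S" and cs: "set cs \<subseteq> carrier K"
    and "\<And>l. l \<le> k \<Longrightarrow> coef v l a \<in> J"
  shows "coef v k (heval cs (var v) \<otimes> a) \<in> J"
  using cs assms(5)
proof (induction cs arbitrary: k)
  case Nil
  have "coef v k \<zero> = \<zero>" unfolding supp_empty_iff[symmetric] by (auto simp: supp_coef supp_zero)
  then show ?case using a ideal_zero[OF J] by simp
next
  case (Cons c cs)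
  have c: "mon c {#} \<in> carrier S" "mon c {#} \<in> subpolys (V - {v})" "heval cs (var v) \<in> carrier S" "var v \<in> carrier S"
    using Cons v by (auto simp: mon_closed mon_in_subpolys heval_closed var_closed)
  have "heval (c # cs) (var v) \<otimes> a = mon c {#} \<otimes> a \<oplus> var v \<otimes> (heval cs (var v) \<otimes> a)"
    using c a by (simp add: l_distr m_assoc)
  then have e: "coef v k (heval (c # cs) (var v) \<otimes> a)
      = mon c {#} \<otimes> coef v k a \<oplus> coef v k (var v \<otimes> (heval cs (var v) \<otimes> a))"
    by (simp only: coef_add coef_mult[OF c(2) a])
  have "coef v k (var v \<otimes> (heval cs (var v) \<otimes> a)) \<in> J"
  proof (cases k)
    case 0
    then show ?thesis using coef_var_mult(1)[OF v] c a ideal_zero[OF J] by simp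
  next
    case (Suc j)
    have "coef v j (heval cs (var v) \<otimes> a) \<in> J" by (rule Cons.IH) (use Cons Suc in auto)
    then show ?thesis using coef_var_mult(2)[OF v] c a Suc by simp
  qed
  moreover have "mon c {#} \<otimes> coef v k a \<in> J" using Cons(3) c by (intro ideal.I_l_closed[OF J]) auto
  ultimately show ?case unfolding e by (intro ideal_add[OF J])
qed

text \<open>Vanishing low coefficients amount to a power of the variable, which is regular by
  homogeneity. A nonzero constant coefficient is a unit; it isolates \<open>coef v k a\<close>
  modulo contributions of lower coefficients, and induction on \<open>k\<close> puts all of them
  into \<open>J\<close>.\<close>

lemma heval_regular:
  assumes J: "ideal J S" "homogeneous_in v J" and v: "v \<in> V" and cs: "set cs \<subseteq> carrier K" "\<exists>c\<in>set cs. c \<noteq> \<zero>\<^bsub>K\<^esub>"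
    and a: "a \<in> carrier S" "heval cs (var v) \<otimes> a \<in> J"
  shows "a \<in> J"
  using cs a(2)
proof (induction cs)
  case Nil
  then show ?case by simp
next
  case (Cons c cs)
  have c: "mon c {#} \<in> carrier S" "mon c {#} \<in> subpolys (V - {v})" "heval cs (var v) \<in> carrier S" "var v \<in> carrier S"
    using Cons v by (auto simp: mon_closed mon_in_subpolys heval_closed var_closed)
  have e: "heval (c # cs) (var v) \<otimes> a = mon c {#} \<otimes> a \<oplus> var v \<otimes> (heval cs (var v) \<otimes> a)"
    using c a by (simp add: l_distr m_assoc)
  have fa: "heval cs (var v) \<otimes> a \<in> carrier S" using c a by simp
  show ?case
  proof (cases "c = \<zero>\<^bsub>K\<^esub>")
    case True
    then have "mon c {#} = \<zero>" by (auto simp: mon_def zero_S)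
    then have "var v \<otimes> (heval cs (var v) \<otimes> a) \<in> J" using Cons(4) e c a by simp
    then have "coef v k (heval cs (var v) \<otimes> a) \<in> J" for k
      using J(2) coef_var_mult(2)[OF v fa] unfolding homogeneous_in_def by metis
    then have "heval cs (var v) \<otimes> a \<in> J" by (rule ideal_mem_of_coefs[OF J(1) v fa])
    then show ?thesis using Cons True by auto
  next
    case False
    have u: "mon c {#} \<in> Units S" using Cons False by (intro const_unit) auto
    have "coef v k a \<in> J" for k
    proof (induction k rule: less_induct)
      case (less k)
      have 1: "coef v k (var v \<otimes> (heval cs (var v) \<otimes> a)) \<in> J"
      proof (cases k)
        case 0
        then show ?thesis using coef_var_mult(1)[OF v fa] ideal_zero[OF J(1)] by simp
      next
        case (Suc j)
        have "coef v j (heval cs (var v) \<otimes> a) \<in> J"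
          by (rule coef_heval_mult[OF J(1) v a(1)]) (use Cons less Suc in auto)
        then show ?thesis using coef_var_mult(2)[OF v fa] Suc by simp
      qed
      have ck: "coef v k a \<in> carrier S" "coef v k (var v \<otimes> (heval cs (var v) \<otimes> a)) \<in> carrier S"
        using a c by (auto simp: coef_closed)
      have "coef v k (heval (c # cs) (var v) \<otimes> a) \<in> J" using Cons(4) J(2) by (simp only: homogeneous_in_def)
      then have 2: "mon c {#} \<otimes> coef v k a \<oplus> coef v k (var v \<otimes> (heval cs (var v) \<otimes> a)) \<in> J"
        unfolding e coef_add coef_mult[OF c(2) a(1)] .
      have "mon c {#} \<otimes> coef v k a
        = (mon c {#} \<otimes> coef v k a \<oplus> coef v k (var v \<otimes> (heval cs (var v) \<otimes> a))) \<ominus> coef v k (var v \<otimes> (heval cs (var v) \<otimes> a))"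
        using ck c(1) by algebra
      then have "mon c {#} \<otimes> coef v k a \<in> J" using ideal.diff_closed[OF J(1) 2 1] by simp
      then have "inv (mon c {#}) \<otimes> (mon c {#} \<otimes> coef v k a) \<in> J"
        by (rule ideal.I_l_closed[OF J(1)]) (use u in simp)
      moreover have "inv (mon c {#}) \<otimes> (mon c {#} \<otimes> coef v k a) = coef v k a"
        using u ck by (simp add: Units_closed flip: m_assoc)
      ultimately show ?case by simp
    qed
    then show ?thesis by (rule ideal_mem_of_coefs[OF J(1) v a(1)])
  qed
qed

text \<open>The polynomials involve distinct variables, so adjoining one of them keeps the ideal
  homogeneous in the variables of the others.\<close>

lemma heval_weakly_regular:
  assumes "ideal J S" "distinct is" "inj_on y (set is)"
    and "\<And>i. i \<in> set is \<Longrightarrow> y i \<in> V \<and> homogeneous_in (y i) J \<and> set (cs i) \<subseteq> carrier K \<and> (\<exists>c\<in>set (cs i). c \<noteq> \<zero>\<^bsub>K\<^esub>)"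
  shows "weakly_regular S J (map (\<lambda>i. heval (cs i) (var (y i))) is)"
  using assms
proof (induction "is" arbitrary: J)
  case Nil
  then show ?case by simp
next
  case (Cons i "is")
  let ?f = "heval (cs i) (var (y i))"
  have i: "y i \<in> V" "homogeneous_in (y i) J" "set (cs i) \<subseteq> carrier K" "\<exists>c\<in>set (cs i). c \<noteq> \<zero>\<^bsub>K\<^esub>"
    using Cons(5)[of i] by auto
  have fc: "?f \<in> carrier S" using i by (simp add: heval_closed var_closed)
  have "weakly_regular S (adjoin S J ?f) (map (\<lambda>i. heval (cs i) (var (y i))) is)"
  proof (rule Cons(1)[OF adjoin_ideal[OF Cons(2) fc]])
    fix j assume j: "j \<in> set is"
    then have "y j \<noteq> y i" using Cons(3,4) by (auto simp: inj_on_def)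
    then have "?f \<in> subpolys (V - {y j})" using i by (intro heval_subpolys subpolys_var) auto
    then show "y j \<in> V \<and> homogeneous_in (y j) (adjoin S J ?f) \<and> set (cs j) \<subseteq> carrier K \<and> (\<exists>c\<in>set (cs j). c \<noteq> \<zero>\<^bsub>K\<^esub>)"
      using Cons(5)[of j] j homogeneous_in_adjoin[OF Cons(2)] by simp
  qed (use Cons in auto)
  then show ?case using heval_regular[OF Cons(2) i(2,1,3,4)] by simp
qed

section \<open>Block sums and the ideals of induced subgraphs\<close>

lemma ideal_finsum:
  assumes J: "ideal J S" and "finite A" "\<And>a. a \<in> A \<Longrightarrow> f a \<in> J"
  shows "(\<Oplus>a\<in>A. f a) \<in> J"
  using assms(2,3)
proof (induction A)
  case empty
  then show ?case using ideal_zero[OF J] by simp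
next
  case (insert a A)
  then have "f \<in> A \<rightarrow> carrier S" "f a \<in> carrier S" using ideal.Icarr[OF J] by auto
  then show ?case using insert ideal_add[OF J] by simp
qed

definition block_sum :: "'v set \<Rightarrow> 'v multiset \<Rightarrow> 'a" where
  "block_sum A = (\<Oplus>v\<in>A. var v)"

lemma block_sum_closed: "A \<subseteq> V \<Longrightarrow> block_sum A \<in> carrier S"
  unfolding block_sum_def by (rule finsum_closed) (auto intro: var_closed)

lemma block_sum_cong:
  assumes J: "ideal J S" and A: "A \<subseteq> V" "w \<in> A" and "\<And>v. v \<in> A \<Longrightarrow> v \<noteq> w \<Longrightarrow> var v \<in> J"
  shows "block_sum A \<ominus> var w \<in> J"
proof -
  have fin: "finite A" using A finite_vars finite_subset by blast
  have s: "(\<Oplus>v\<in>A - {w}. var v) \<in> J" by (rule ideal_finsum[OF J]) (use fin assms in auto)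
  have "(\<Oplus>v\<in>insert w (A - {w}). var v) = var w \<oplus> (\<Oplus>v\<in>A - {w}. var v)"
    by (rule finsum_insert) (use fin A in \<open>auto intro!: var_closed\<close>)
  then have "block_sum A = var w \<oplus> (\<Oplus>v\<in>A - {w}. var v)"
    by (simp only: block_sum_def insert_Diff[OF A(2)])
  moreover have "var w \<in> carrier S" "(\<Oplus>v\<in>A - {w}. var v) \<in> carrier S"
    using A s ideal.Icarr[OF J] by (auto simp: var_closed)
  moreover have "(a \<oplus> b) \<ominus> a = b" if "a \<in> carrier S" "b \<in> carrier S" for a b
    using that by algebra
  ultimately have "block_sum A \<ominus> var w = (\<Oplus>v\<in>A - {w}. var v)" by presburger
  with s show ?thesis by simp
qed

text \<open>The Stanley-Reisner ideal of the independence complex of the graph induced on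
  \<open>W\<close>, enlarged by the variables outside \<open>W\<close>, so that all the subgraphs
  met in the induction live in the one ring \<open>S\<close>.\<close>

definition face_ideal :: "'v set set \<Rightarrow> 'v set \<Rightarrow> ('v multiset \<Rightarrow> 'a) set" where
  "face_ideal E W = mono_ideal (\<lambda>A. \<not> (A \<subseteq> W \<and> indep E A))"

lemma face_ideal_mono: "mono (\<lambda>A :: 'v set. \<not> (A \<subseteq> W \<and> indep E A))"
proof (rule monoI)
  fix A B :: "'v set" assume "A \<subseteq> B"
  then show "(\<not> (A \<subseteq> W \<and> indep E A)) \<le> (\<not> (B \<subseteq> W \<and> indep E B))"
    using indep_mono[of E B A] by (auto simp: le_bool_def)
qed

lemma face_ideal_ideal: "ideal (face_ideal E W) S"
  unfolding face_ideal_def by (rule mono_ideal_is_ideal[OF face_ideal_mono])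

text \<open>An independent set stays independent together with \<open>x\<close> exactly when it
  avoids the neighbours of \<open>x\<close>; the colon is thus again the ideal of an induced
  subgraph.\<close>

lemma face_ideal_colon:
  assumes x: "x \<in> W" "x \<in> V"
  shows "colon S (face_ideal E W) (var x) = face_ideal E {u \<in> W. \<not> adj E x u}"
proof -
  have "colon S (face_ideal E W) (var x) = mono_ideal (\<lambda>A. \<not> (A \<union> {x} \<subseteq> W \<and> indep E (A \<union> {x})))"
  proof -
    have "f \<otimes> var x \<in> face_ideal E W \<longleftrightarrow> f \<in> mono_ideal (\<lambda>A. \<not> (A \<union> {x} \<subseteq> W \<and> indep E (A \<union> {x})))"
      if f: "f \<in> carrier S" for f
      using mono_ideal_colon[of "{#x#}" f "\<lambda>A. \<not> (A \<subseteq> W \<and> indep E A)"] x f m_comm[OF f var_closed[OF x(2)]]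
      unfolding face_ideal_def by simp
    then show ?thesis unfolding colon_def by (auto simp: mono_ideal_def)
  qed
  also have "\<dots> = face_ideal E {u \<in> W. \<not> adj E x u}"
    unfolding face_ideal_def using x by (intro mono_ideal_cong) (auto simp: indep_insert)
  finally show ?thesis .
qed

lemma face_ideal_adjoin:
  assumes "x \<in> V" shows "adjoin S (face_ideal E W) (var x) = face_ideal E (W - {x})"
  unfolding face_ideal_def mono_ideal_add_var[OF face_ideal_mono assms]
  by (intro mono_ideal_cong) auto

lemma closed_nbhd_subset: "W' \<subseteq> W \<Longrightarrow> closed_nbhd E W' y = closed_nbhd E W y \<inter> W'"
  by (auto simp: closed_nbhd_def)

text \<open>The invariant is that every block retains a vertex \<open>y i\<close> whose closed
  neighbourhood in \<open>W\<close> is what is left of the block. It survives both the colon by and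
  the addition of a variable \<open>x\<close> outside these vertices, so \<open>W\<close> shrinks
  until it consists of them alone.\<close>

theorem face_ideal_weakly_regular:
  assumes F: "distinct is" "\<And>i. i \<in> set is \<Longrightarrow> F i \<subseteq> V \<and> pairwise_adj E (F i)"
      "\<And>i j. i \<in> set is \<Longrightarrow> j \<in> set is \<Longrightarrow> i \<noteq> j \<Longrightarrow> F i \<inter> F j = {}"
    and cs: "\<And>i. i \<in> set is \<Longrightarrow> set (cs i) \<subseteq> carrier K \<and> (\<exists>c\<in>set (cs i). c \<noteq> \<zero>\<^bsub>K\<^esub>)"
    and "W \<subseteq> V" "W \<subseteq> (\<Union>i\<in>set is. F i)"
      "\<And>i. i \<in> set is \<Longrightarrow> y i \<in> F i \<inter> W \<and> closed_nbhd E W (y i) = F i \<inter> W"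
  shows "weakly_regular S (face_ideal E W) (map (\<lambda>i. heval (cs i) (block_sum (F i))) is)"
  using assms(5-)
proof (induction "card W" arbitrary: W y rule: less_induct)
  case less
  have finW: "finite W" using less(2) finite_vars finite_subset by blast
  have yF: "\<And>i. i \<in> set is \<Longrightarrow> y i \<in> F i" "\<And>i. i \<in> set is \<Longrightarrow> y i \<in> W"
    and yN: "\<And>i. i \<in> set is \<Longrightarrow> closed_nbhd E W (y i) = F i \<inter> W" using less(4) by auto
  have bc: "block_sum (F i) \<in> carrier S" if "i \<in> set is" for i using F(2)[OF that] block_sum_closed by blast
  show ?case
  proof (cases "W \<subseteq> y ` set is")
    \<comment> \<open>Only representatives are left. They belong to different blocks and are not
      adjacent, so the ideal is the prime generated by the other variables, and modulo it each block
      sum is its representative.\<close>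
    case True
    then have W: "W = y ` set is" using yF by auto
    have nadj: "\<not> adj E (y i) (y j)" if "i \<in> set is" "j \<in> set is" for i j
    proof
      assume a: "adj E (y i) (y j)"
      then have "y j \<in> closed_nbhd E W (y i)" using yF that by (simp add: closed_nbhd_def)
      then have "y j \<in> F i" using yN that by blast
      then have "i = j" using F(3)[of i j] that yF(1)[of j] by blast
      with a show False by simp
    qed
    have "indep E A" if "A \<subseteq> W" for A
    proof (rule indep_mono[OF _ that])
      show "indep E W" unfolding W indep_def using nadj by blast
    qed
    then have eq: "face_ideal E W = face_prime W"
      unfolding face_ideal_def by (intro mono_ideal_cong) auto
    have "weakly_regular S (face_prime W) (map (\<lambda>i. heval (cs i) (var (y i))) is)"
    proof (rule heval_weakly_regular[OF face_prime_ideal F(1)])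
      show "inj_on y (set is)"
      proof (rule inj_onI)
        fix i j assume ij: "i \<in> set is" "j \<in> set is" "y i = y j"
        then show "i = j" using F(3)[of i j] yF(1)[of i] yF(1)[of j] by auto
      qed
      show "y i \<in> V \<and> homogeneous_in (y i) (face_prime W) \<and> set (cs i) \<subseteq> carrier K \<and> (\<exists>c\<in>set (cs i). c \<noteq> \<zero>\<^bsub>K\<^esub>)"
        if "i \<in> set is" for i using cs[OF that] yF(2)[OF that] less(2) homogeneous_in_face_prime by blast
    qed
    then have "weakly_regular S (face_prime W) (map (\<lambda>i. heval (cs i) (block_sum (F i))) is)"
    proof (rule weakly_regular_cong[OF face_prime_ideal, rotated])
      show "list_all2 (\<lambda>x z. x \<in> carrier S \<and> z \<in> carrier S \<and> x \<ominus> z \<in> face_prime W)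
        (map (\<lambda>i. heval (cs i) (var (y i))) is) (map (\<lambda>i. heval (cs i) (block_sum (F i))) is)"
        unfolding list_all2_map1 list_all2_map2
      proof (rule list.rel_refl_strong)
        fix i assume i: "i \<in> set is"
        have yV: "y i \<in> V" using yF(2)[OF i] less(2) by blast
        have vc: "var (y i) \<in> carrier S" using yV by (rule var_closed)
        have "block_sum (F i) \<ominus> var (y i) \<in> face_prime W"
        proof (rule block_sum_cong[OF face_prime_ideal])
          fix v assume v: "v \<in> F i" "v \<noteq> y i"
          have "v \<notin> W"
          proof
            assume "v \<in> W"
            then obtain j where j: "j \<in> set is" "v = y j" unfolding W by blast
            then show False using F(3)[OF i j(1)] yF(1)[OF j(1)] v by (cases "i = j") auto
          qed
          moreover have "v \<in> V" using v F(2)[OF i] by blast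
          ultimately show "var v \<in> face_prime W" by (simp add: mono_ideal_def var_closed supp_mon_eq)
        qed (use F(2)[OF i] yF(1)[OF i] in auto)
        then have "heval (cs i) (block_sum (F i)) \<ominus> heval (cs i) (var (y i)) \<in> face_prime W"
          by (rule heval_cong[OF face_prime_ideal bc[OF i] vc]) (use cs[OF i] in simp)
        then have "\<ominus> (heval (cs i) (block_sum (F i)) \<ominus> heval (cs i) (var (y i))) \<in> face_prime W"
          by (rule additive_subgroup.a_inv_closed[OF ideal.axioms(1)[OF face_prime_ideal]])
        moreover have hc: "heval (cs i) (block_sum (F i)) \<in> carrier S" "heval (cs i) (var (y i)) \<in> carrier S"
          using cs[OF i] bc[OF i] vc by (auto simp: heval_closed)
        moreover have "\<ominus> (heval (cs i) (block_sum (F i)) \<ominus> heval (cs i) (var (y i)))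
            = heval (cs i) (var (y i)) \<ominus> heval (cs i) (block_sum (F i))" using hc by algebra
        ultimately show "heval (cs i) (var (y i)) \<in> carrier S \<and> heval (cs i) (block_sum (F i)) \<in> carrier S \<and>
            heval (cs i) (var (y i)) \<ominus> heval (cs i) (block_sum (F i)) \<in> face_prime W" by simp
      qed
    qed
    then show ?thesis unfolding eq .
  next
    case False
    then obtain x where x: "x \<in> W" "x \<notin> y ` set is" by blast
    then obtain i0 where i0: "i0 \<in> set is" "x \<in> F i0" using less(3) by blast
    have xV: "x \<in> V" using x less(2) by blast
    have vc: "var x \<in> carrier S" using xV by (rule var_closed)
    let ?W2 = "{u \<in> W. \<not> adj E x u}"
    have "adj E x (y i0)"
    proof -
      have "x \<in> closed_nbhd E W (y i0)" using yN[OF i0(1)] i0 x by blast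
      then show ?thesis using x i0(1) adj_sym[of E "y i0" x] by (auto simp: closed_nbhd_def)
    qed
    then have lt2: "card ?W2 < card W" using yF(2)[OF i0(1)] finW by (intro psubset_card_mono) auto
    have "weakly_regular S (face_ideal E ?W2) (map (\<lambda>i. heval (cs i) (block_sum (F i))) is)"
    \<comment> \<open>In the colon the neighbours of \<open>x\<close> are gone, among them the rest
      of its block with the old representative; so \<open>x\<close> itself represents
      \<open>F i0\<close>.\<close>
    proof (rule less(1)[OF lt2, of "y(i0 := x)"])
      show "?W2 \<subseteq> V" "?W2 \<subseteq> (\<Union>i\<in>set is. F i)" using less(2,3) by auto
      fix i assume i: "i \<in> set is"
      show "(y(i0 := x)) i \<in> F i \<inter> ?W2 \<and> closed_nbhd E ?W2 ((y(i0 := x)) i) = F i \<inter> ?W2"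
      proof (cases "i = i0")
        case True
        have "F i0 \<inter> ?W2 = {x}"
          using i0 x F(2)[OF i0(1)] unfolding pairwise_adj_def by auto
        moreover have "closed_nbhd E ?W2 x = {x}" using x by (auto simp: closed_nbhd_def)
        ultimately show ?thesis using True by auto
      next
        case False
        have "\<not> adj E x (y i)"
        proof
          assume "adj E x (y i)"
          then have "x \<in> closed_nbhd E W (y i)" using x adj_sym[of E x "y i"] by (simp add: closed_nbhd_def)
          then have "x \<in> F i" using yN[OF i] by blast
          then show False using F(3)[OF i i0(1) False] i0 by blast
        qed
        then show ?thesis
          using False yF[OF i] yN[OF i] closed_nbhd_subset[of ?W2 W E "y i"] by auto
      qed
    qed
    then have 1: "weakly_regular S (colon S (face_ideal E W) (var x)) (map (\<lambda>i. heval (cs i) (block_sum (F i))) is)"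
      by (simp only: face_ideal_colon[OF x(1) xV])
    have lt1: "card (W - {x}) < card W" using x finW by (intro psubset_card_mono) auto
    have "weakly_regular S (face_ideal E (W - {x})) (map (\<lambda>i. heval (cs i) (block_sum (F i))) is)"
    proof (rule less(1)[OF lt1, of y])
      show "W - {x} \<subseteq> V" "W - {x} \<subseteq> (\<Union>i\<in>set is. F i)" using less(2,3) by auto
      fix i assume i: "i \<in> set is"
      have "y i \<noteq> x" using x i by blast
      then show "y i \<in> F i \<inter> (W - {x}) \<and> closed_nbhd E (W - {x}) (y i) = F i \<inter> (W - {x})"
        using yF[OF i] yN[OF i] closed_nbhd_subset[of "W - {x}" W E "y i"] by auto
    qed
    then have 2: "weakly_regular S (adjoin S (face_ideal E W) (var x)) (map (\<lambda>i. heval (cs i) (block_sum (F i))) is)"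
      by (simp only: face_ideal_adjoin[OF xV])
    have "set (map (\<lambda>i. heval (cs i) (block_sum (F i))) is) \<subseteq> carrier S"
      using cs bc by (auto intro!: heval_closed)
    then show ?thesis by (rule weakly_regular_exact[OF face_ideal_ideal vc _ 1 2])
  qed
qed

text \<open>A monomial whose set of variables is not independent is divisible by the product over an
  edge.\<close>

lemma edge_ideal_eq:
  assumes E: "\<And>e. e \<in> E \<Longrightarrow> \<exists>i\<in>V. \<exists>j\<in>V. i \<noteq> j \<and> e = {i, j}"
  shows "edge_ideal K V E = face_ideal E V"
proof -
  let ?G = "{var i \<otimes> var j | i j. {i, j} \<in> E}"
  have edge: "i \<in> V \<and> j \<in> V \<and> i \<noteq> j" if "{i, j} \<in> E" for i j
    using E[OF that] by (auto simp: doubleton_eq_iff)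
  have G: "?G \<subseteq> carrier S" using edge by (auto simp: var_closed)
  have "edge_ideal K V E = Idl ?G"
    unfolding edge_ideal_def S_def[symmetric] indexed_var_eq ..
  also have "\<dots> = face_ideal E V"
  proof
    show "Idl ?G \<subseteq> face_ideal E V"
    proof (rule genideal_minimal[OF face_ideal_ideal])
      have "var i \<otimes> var j \<in> face_ideal E V" if e: "{i, j} \<in> E" for i j
      proof -
        have m: "var i \<otimes> var j = mon \<one>\<^bsub>K\<^esub> {#i, j#}" using edge[OF e] by (simp add: mon_mult_mon add_mset_commute)
        have "\<not> indep E {i, j}" using edge[OF e] e by (auto simp: indep_def adj_def)
        moreover have "mon \<one>\<^bsub>K\<^esub> {#i, j#} \<in> carrier S" using edge[OF e] by (simp add: mon_closed)
        ultimately show ?thesis unfolding m by (simp add: face_ideal_def mono_ideal_def supp_mon_eq)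
      qed
      then show "?G \<subseteq> face_ideal E V" by blast
    qed
    show "face_ideal E V \<subseteq> Idl ?G"
    proof
      fix f assume f: "f \<in> face_ideal E V"
      have J: "ideal (Idl ?G) S" by (rule genideal_ideal[OF G])
      have fc: "f \<in> carrier S" using f by (simp add: face_ideal_def mono_ideal_def)
      show "f \<in> Idl ?G"
      proof (rule ideal_memI[OF J fc])
        fix m assume m: "m \<in> supp f"
        have mV: "set_mset m \<subseteq> V" by (rule supp_vars[OF fc m])
        then have "\<not> indep E (set_mset m)" using f m by (auto simp: face_ideal_def mono_ideal_def)
        then obtain i j where ij: "i \<in># m" "j \<in># m" "i \<noteq> j" "{i, j} \<in> E" by (auto simp: indep_def adj_def)
        obtain p where p: "m = add_mset i p" using ij(1) by (blast dest: multi_member_split)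
        then have "j \<in># p" using ij by auto
        then obtain q where q: "p = add_mset j q" by (blast dest: multi_member_split)
        have V: "i \<in> V" "j \<in> V" "set_mset q \<subseteq> V" using mV p q by auto
        have "mon \<one>\<^bsub>K\<^esub> m = (var i \<otimes> var j) \<otimes> mon \<one>\<^bsub>K\<^esub> q"
          using V p q by (simp add: mon_mult_mon add_mset_commute)
        moreover have "var i \<otimes> var j \<in> Idl ?G" using genideal_self[OF G] ij(4) by blast
        ultimately show "mon \<one>\<^bsub>K\<^esub> m \<in> Idl ?G"
          using ideal.I_r_closed[OF J] mon_closed[OF K.one_closed V(3)] by simp
      qed
    qed
  qed
  finally show ?thesis .
qed

end

section \<open>Cohen--Macaulay edge ideals\<close>

lemma prime_chain_Cons:
  assumes "prime_chain R r Q" "primeideal P R" "P \<subset> Q 0"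
  shows "prime_chain R (Suc r) (case_nat P Q)"
  using assms by (auto simp: prime_chain_def split: nat.split)

lemma prime_chain_append:
  assumes P: "prime_chain R r P" and Q: "prime_chain R q Q" and e: "P r = Q 0"
  shows "prime_chain R (r + q) (\<lambda>i. if i \<le> r then P i else Q (i - r))"
  unfolding prime_chain_def
proof (intro conjI allI impI)
  fix i assume "i \<le> r + q"
  then show "primeideal (if i \<le> r then P i else Q (i - r)) R"
    using P Q by (auto simp: prime_chain_def)
next
  fix i assume i: "i < r + q"
  show "(if i \<le> r then P i else Q (i - r)) \<subset> (if Suc i \<le> r then P (Suc i) else Q (Suc i - r))"
  proof (cases "i < r")
    case True
    then show ?thesis using P by (simp add: prime_chain_def)
  next
    case False
    then have "Q (i - r) \<subset> Q (Suc (i - r))" using Q i by (simp add: prime_chain_def)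
    then show ?thesis using False e by (auto simp: Suc_diff_le)
  qed
qed

lemma (in cring) maximal_inverse:
  assumes M: "maximalideal M R" and g: "g \<in> carrier R" "g \<notin> M"
  shows "\<exists>r\<in>carrier R. g \<otimes> r \<ominus> \<one> \<in> M"
proof -
  have I: "ideal M R" using M by (rule maximalideal.axioms)
  note A = adjoin_ideal[OF I g(1)]
  have "adjoin R M g \<noteq> M" using mem_adjoin[OF I g(1)] g(2) by blast
  then have "adjoin R M g = carrier R"
    using maximalideal.I_maximal[OF M A subset_adjoin[OF I g(1)]] ideal.Icarr[OF A] by blast
  then have "\<one> \<in> adjoin R M g" by simp
  then obtain b r where b: "b \<in> M" "r \<in> carrier R" "\<one> = b \<oplus> g \<otimes> r" by (rule adjoinE)
  have bc: "b \<in> carrier R" using b ideal.Icarr[OF I] by simp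
  have "g \<otimes> r \<ominus> (b \<oplus> g \<otimes> r) = \<ominus> b" using bc b(2) g(1) by algebra
  then have "g \<otimes> r \<ominus> \<one> = \<ominus> b" using b(3) by simp
  moreover have "\<ominus> b \<in> M" using b(1) I by (simp add: additive_subgroup.a_inv_closed ideal.axioms(1))
  ultimately have "g \<otimes> r \<ominus> \<one> \<in> M" by (simp only:)
  with b(2) show ?thesis by blast
qed

lemma (in cring) quotient_facts:
  assumes I: "ideal I R"
  shows "carrier (R Quot I) = (+>) I ` carrier R"
    and "\<And>a. a \<in> carrier R \<Longrightarrow> I +> a = \<zero>\<^bsub>R Quot I\<^esub> \<longleftrightarrow> a \<in> I"
proof -
  show "carrier (R Quot I) = (+>) I ` carrier R"
    unfolding FactRing_def A_RCOSETS_def' by auto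
  have z: "\<zero>\<^bsub>R Quot I\<^esub> = I" by (simp add: FactRing_def)
  show "I +> a = \<zero>\<^bsub>R Quot I\<^esub> \<longleftrightarrow> a \<in> I" if a: "a \<in> carrier R" for a
    unfolding z using ideal.rcos_const_imp_mem[OF I a] a_rcos_zero[OF I] by blast
qed

lemma (in cring) noetherian_quotient:
  assumes N: "noetherian_ring R" and I: "ideal I R" shows "noetherian_ring (R Quot I)"
proof -
  let ?Q = "R Quot I" and ?q = "(+>) I"
  interpret Q: cring ?Q using ideal.quotient_is_cring[OF I is_cring] .
  interpret q: ring_hom_cring R ?Q ?q using ideal.rcos_ring_hom_cring[OF I is_cring] .
  show ?thesis
  proof (rule Q.noetherian_ringI)
    fix J assume J: "ideal J ?Q"
    have "ideal {r \<in> carrier R. ?q r \<in> J} R" by (rule q.ring.ideal_vimage[OF J])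
    then obtain A where A: "A \<subseteq> carrier R" "finite A" "{r \<in> carrier R. ?q r \<in> J} = Idl A"
      using noetherian_ring.finetely_gen[OF N] by blast
    have qA: "?q ` A \<subseteq> carrier ?Q" using A(1) q.hom_closed by blast
    have I': "ideal (Idl\<^bsub>?Q\<^esub> (?q ` A)) ?Q" by (rule Q.genideal_ideal[OF qA])
    have "A \<subseteq> {r \<in> carrier R. ?q r \<in> Idl\<^bsub>?Q\<^esub> (?q ` A)}" using A(1) Q.genideal_self[OF qA] by blast
    then have le: "Idl A \<subseteq> {r \<in> carrier R. ?q r \<in> Idl\<^bsub>?Q\<^esub> (?q ` A)}"
      by (rule genideal_minimal[OF q.ring.ideal_vimage[OF I']])
    have "J \<subseteq> Idl\<^bsub>?Q\<^esub> (?q ` A)"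
    proof
      fix x assume x: "x \<in> J"
      then have "x \<in> carrier ?Q" using ideal.Icarr[OF J] by simp
      then obtain r where r: "r \<in> carrier R" "x = ?q r" using quotient_facts(1)[OF I] by blast
      then have "r \<in> Idl A" using x A(3) by blast
      then show "x \<in> Idl\<^bsub>?Q\<^esub> (?q ` A)" using le r by blast
    qed
    moreover have "?q ` A \<subseteq> J" using genideal_self[OF A(1)] A(3) by blast
    then have "Idl\<^bsub>?Q\<^esub> (?q ` A) \<subseteq> J" by (rule Q.genideal_minimal[OF J])
    ultimately have "J = Idl\<^bsub>?Q\<^esub> (?q ` A)" by blast
    then show "\<exists>A\<subseteq>carrier ?Q. finite A \<and> J = Idl\<^bsub>?Q\<^esub> A" using qA A(2) by blast
  qed
qed

text \<open>Composition with the residue map replaces the zero ideal of the quotient by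
  \<open>I\<close> and \<open>M\<close> by its preimage, so a localization of the quotient can be
  studied from \<open>R\<close> itself.\<close>

lemma (in cring) loc_map_quotient:
  assumes I: "ideal I R" and L: "loc_map (R Quot I) T h M {\<zero>\<^bsub>R Quot I\<^esub>}"
  shows "loc_map R T (\<lambda>a. h (I +> a)) {a \<in> carrier R. I +> a \<in> M} I"
proof -
  let ?Q = "R Quot I" and ?q = "(+>) I" and ?M = "{a \<in> carrier R. I +> a \<in> M}"
  interpret L: loc_map ?Q T h M "{\<zero>\<^bsub>?Q\<^esub>}" by (rule L)
  interpret q: ring_hom_cring R ?Q ?q using ideal.rcos_ring_hom_cring[OF I is_cring] .
  note Q = quotient_facts[OF I]
  have MI: "ideal M ?Q" using L.M by (rule primeideal.axioms)
  have lift: "\<exists>a\<in>carrier R. x = ?q a" if "x \<in> carrier ?Q" for x using that Q(1) by blast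
  show ?thesis
  proof (intro loc_map.intro loc_map_axioms.intro)
    show "cring R" by (rule is_cring)
    show "cring T" by (rule L.T.is_cring)
    have h: "h \<in> ring_hom ?Q T" by (rule L.hom)
    show "(\<lambda>a. h (?q a)) \<in> ring_hom R T"
      by (rule ring_hom_memI)
        (use ring_hom_closed[OF h] ring_hom_mult[OF h] ring_hom_add[OF h] ring_hom_one[OF h] in
          \<open>simp_all add: q.hom_closed q.hom_mult q.hom_add q.hom_one\<close>)
    show "primeideal ?M R"
    proof (rule primeidealI)
      show "ideal ?M R" by (rule q.ring.ideal_vimage[OF MI])
      show "cring R" by (rule is_cring)
      have "?q \<one> \<notin> M" using primeideal.one_not_mem[OF L.M] q.hom_one by simp
      then show "carrier R \<noteq> ?M" by blast
      fix a b assume ab: "a \<in> carrier R" "b \<in> carrier R" "a \<otimes> b \<in> ?M"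
      then have "?q a \<otimes>\<^bsub>?Q\<^esub> ?q b \<in> M" using q.hom_mult[OF ab(1,2)] by simp
      then show "a \<in> ?M \<or> b \<in> ?M"
        using primeideal.I_prime[OF L.M q.hom_closed[OF ab(1)] q.hom_closed[OF ab(2)]] ab(1,2) by blast
    qed
    show "ideal I R" by (rule I)
    show "I \<subseteq> ?M"
    proof
      fix a assume a: "a \<in> I"
      have ac: "a \<in> carrier R" using a ideal.Icarr[OF I] by simp
      then have "?q a = \<zero>\<^bsub>?Q\<^esub>" using Q(2) a by simp
      then show "a \<in> ?M" using ac ideal_zero[OF MI] by simp
    qed
    fix t assume "t \<in> carrier T"
    then obtain x y where x: "x \<in> carrier ?Q" "y \<in> carrier ?Q - M" "t \<otimes>\<^bsub>T\<^esub> h y = h x" using L.frac by blast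
    obtain a where a: "a \<in> carrier R" "x = ?q a" using lift[OF x(1)] by blast
    obtain s where s: "s \<in> carrier R" "y = ?q s" using lift[of y] x(2) by blast
    show "\<exists>a\<in>carrier R. \<exists>s\<in>carrier R - ?M. t \<otimes>\<^bsub>T\<^esub> h (?q s) = h (?q a)"
      using a s x by blast
  next
    fix s assume "s \<in> carrier R - ?M"
    then have "?q s \<in> carrier ?Q - M" using q.hom_closed by blast
    then show "h (?q s) \<in> Units T" by (rule L.unit)
  next
    fix a assume a: "a \<in> carrier R"
    have "h (?q a) = \<zero>\<^bsub>T\<^esub> \<longleftrightarrow> (\<exists>x\<in>carrier ?Q - M. x \<otimes>\<^bsub>?Q\<^esub> ?q a \<in> {\<zero>\<^bsub>?Q\<^esub>})"
      by (rule L.ker[OF q.hom_closed[OF a]])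
    also have "\<dots> \<longleftrightarrow> (\<exists>s\<in>carrier R - ?M. ?q s \<otimes>\<^bsub>?Q\<^esub> ?q a = \<zero>\<^bsub>?Q\<^esub>)"
      using lift q.hom_closed by blast
    also have "\<dots> \<longleftrightarrow> (\<exists>s\<in>carrier R - ?M. s \<otimes> a \<in> I)"
    proof -
      have "?q s \<otimes>\<^bsub>?Q\<^esub> ?q a = \<zero>\<^bsub>?Q\<^esub> \<longleftrightarrow> s \<otimes> a \<in> I" if "s \<in> carrier R" for s
        using q.hom_mult[OF that a] Q(2)[of "s \<otimes> a"] that a by simp
      then show ?thesis by blast
    qed
    finally show "h (?q a) = \<zero>\<^bsub>T\<^esub> \<longleftrightarrow> (\<exists>s\<in>carrier R - ?M. s \<otimes> a \<in> I)" .
  qed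
qed

lemma (in loc_map) ring_depth_le_krull_dim:
  assumes "noetherian_ring R" shows "ring_depth T (ext M) \<le> krull_dim T"
  unfolding ring_depth_def
proof (rule Sup_least)
  fix n assume "n \<in> {enat (length xs) |xs. regular_sequence T xs \<and> set xs \<subseteq> ext M}"
  then obtain xs where xs: "regular_sequence T xs" "set xs \<subseteq> ext M" "n = enat (length xs)" by blast
  obtain Q where "prime_chain T (length xs) Q" by (rule regular_sequence_chain[OF assms xs(1,2)])
  then show "n \<le> krull_dim T" unfolding krull_dim_def xs(3) by (intro Sup_upper) blast
qed

context mpoly_ring
begin

text \<open>From the prime of \<open>B \<union> C\<close> on, the variables of \<open>C\<close> are
  added to the ideal one at a time, each enlarging it strictly.\<close>

lemma face_prime_chain:
  assumes "B \<union> C \<subseteq> V" "B \<inter> C = {}"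
  shows "\<exists>Q. prime_chain S (card C) Q \<and> Q 0 = face_prime (B \<union> C) \<and> Q (card C) = face_prime B"
proof -
  have "finite C" using assms finite_vars finite_subset by blast
  then show ?thesis using assms
  proof (induction C)
    case empty
    then show ?case
      by (intro exI[of _ "\<lambda>_. face_prime B"]) (simp add: prime_chain_def primeideal_face_prime)
  next
    case (insert c C)
    then obtain Q where Q: "prime_chain S (card C) Q" "Q 0 = face_prime (B \<union> C)" "Q (card C) = face_prime B"
      by auto
    let ?P = "face_prime (B \<union> insert c C)"
    have "\<not> Q 0 \<subseteq> ?P"
      unfolding Q(2) using face_prime_le_iff[OF insert(4), of "B \<union> C"] insert(2,5) by blast
    moreover have "?P \<subseteq> Q 0" unfolding Q(2) by (rule face_prime_mono) blast
    ultimately have "?P \<subset> Q 0" by blast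
    from prime_chain_Cons[OF Q(1) primeideal_face_prime this]
    have "prime_chain S (Suc (card C)) (case_nat ?P Q) \<and> case_nat ?P Q 0 = ?P \<and>
        case_nat ?P Q (Suc (card C)) = face_prime B"
      by (simp only: nat.case Q(3) simp_thms)
    then show ?case unfolding card_insert_disjoint[OF insert(1,2)] by (rule exI[of _ "case_nat ?P Q"])
  qed
qed

text \<open>A chain of \<open>card (V - A)\<close> steps up to \<open>face_prime A\<close> is glued
  underneath; the total is at most the number of variables.\<close>

lemma prime_chain_above_face_prime:
  assumes A: "A \<subseteq> V" and Q: "prime_chain S r Q" "face_prime A \<subseteq> Q 0"
  shows "r \<le> card A"
proof -
  obtain P where P: "prime_chain S (card (V - A)) P" "P (card (V - A)) = face_prime A"
    using face_prime_chain[of A "V - A"] A by blast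
  \<comment> \<open>The bottom prime is replaced by \<open>face_prime A\<close> so that the two
    chains meet.\<close>
  have Q': "prime_chain S r (Q(0 := face_prime A))"
    unfolding prime_chain_def
  proof (intro conjI allI impI)
    fix i assume i: "i < r"
    then have "Q i \<subset> Q (Suc i)" using Q(1) by (simp add: prime_chain_def)
    then show "(Q(0 := face_prime A)) i \<subset> (Q(0 := face_prime A)) (Suc i)"
      using Q(2) by (cases "i = 0") auto
  qed (use Q(1) primeideal_face_prime in \<open>simp add: prime_chain_def\<close>)
  have "prime_chain S (card (V - A) + r) (\<lambda>i. if i \<le> card (V - A) then P i else (Q(0 := face_prime A)) (i - card (V - A)))"
    by (rule prime_chain_append[OF P(1) Q']) (use P(2) in simp)
  then have "card (V - A) + r \<le> card V" by (rule prime_chain_length_le)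
  moreover have "card (V - A) = card V - card A" "card A \<le> card V"
    using A finite_vars by (auto simp: card_Diff_subset finite_subset card_mono)
  ultimately show ?thesis by simp
qed

text \<open>The lower bound is the explicit chain from zero. For the upper bound any chain is
  continued to the ideal of all variables and the bound on chain lengths applied.\<close>

lemma prime_height_face_prime:
  assumes A: "A \<subseteq> V" shows "prime_height S (face_prime A) = enat (card V - card A)"
  unfolding prime_height_def
proof (rule antisym)
  have cA: "card (V - A) = card V - card A" "card A \<le> card V"
    using A finite_vars by (auto simp: card_Diff_subset finite_subset card_mono)
  obtain P where "prime_chain S (card (V - A)) P" "P (card (V - A)) = face_prime A"
    using face_prime_chain[of A "V - A"] A by blast
  then show "enat (card V - card A) \<le> Sup {enat r |r P. prime_chain S r P \<and> P r = face_prime A}"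
    unfolding cA(1) by (intro Sup_upper) blast
  show "Sup {enat r |r P. prime_chain S r P \<and> P r = face_prime A} \<le> enat (card V - card A)"
  proof (rule Sup_least)
    fix n assume "n \<in> {enat r |r P. prime_chain S r P \<and> P r = face_prime A}"
    then obtain r P where P: "n = enat r" "prime_chain S r P" "P r = face_prime A" by blast
    obtain Q where Q: "prime_chain S (card A) Q" "Q 0 = face_prime A"
      using face_prime_chain[of "{}" A] A by auto
    have "r + card A \<le> card V"
      by (rule prime_chain_length_le[OF prime_chain_append[OF P(2) Q(1)]]) (use P(3) Q(2) in simp)
    then show "n \<le> enat (card V - card A)" using P(1) by simp
  qed
qed

lemma face_ideal_subset_face_prime: "indep E A \<Longrightarrow> face_ideal E V \<subseteq> face_prime A"
  using supp_vars unfolding face_ideal_def mono_ideal_def by (auto dest: indep_mono)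

text \<open>The product of the variables in \<open>B\<close> is the witness: by maximality, a
  monomial multiplied by it has independent support exactly when it is supported in
  \<open>B\<close>.\<close>

lemma face_ideal_colon_max_indep:
  assumes B: "max_indep E V B"
  shows "{a \<in> carrier S. a \<otimes> mon \<one>\<^bsub>K\<^esub> (mset_set B) \<in> face_ideal E V} = face_prime B"
proof -
  have BV: "B \<subseteq> V" using B by (simp add: max_indep_def)
  then have fin: "finite B" using finite_vars finite_subset by blast
  have f: "mon \<one>\<^bsub>K\<^esub> (mset_set B) \<in> carrier S" using BV fin by (simp add: mon_closed)
  have iff: "A \<subseteq> B \<longleftrightarrow> A \<union> B \<subseteq> V \<and> indep E (A \<union> B)" if A: "A \<subseteq> V" for A
  proof
    assume "A \<subseteq> B"
    then have "A \<union> B = B" by blast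
    then show "A \<union> B \<subseteq> V \<and> indep E (A \<union> B)" using B by (simp add: max_indep_def)
  next
    assume i: "A \<union> B \<subseteq> V \<and> indep E (A \<union> B)"
    show "A \<subseteq> B"
    proof (rule subsetI, rule ccontr)
      fix a assume a: "a \<in> A" "a \<notin> B"
      then obtain b where "b \<in> B" "adj E a b" using B A unfolding max_indep_def by blast
      then show False using i a(1) unfolding indep_def by blast
    qed
  qed
  have "a \<otimes> mon \<one>\<^bsub>K\<^esub> (mset_set B) \<in> face_ideal E V \<longleftrightarrow> a \<in> face_prime B" if a: "a \<in> carrier S" for a
  proof -
    have "a \<otimes> mon \<one>\<^bsub>K\<^esub> (mset_set B) \<in> face_ideal E V \<longleftrightarrow>
      a \<in> mono_ideal (\<lambda>A. \<not> (A \<union> B \<subseteq> V \<and> indep E (A \<union> B)))"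
      using mono_ideal_colon[of "mset_set B" a "\<lambda>A. \<not> (A \<subseteq> V \<and> indep E A)"] BV fin a m_comm[OF a f]
      by (simp add: face_ideal_def)
    also have "mono_ideal (\<lambda>A. \<not> (A \<union> B \<subseteq> V \<and> indep E (A \<union> B))) = face_prime B"
      by (rule mono_ideal_cong) (simp only: iff)
    finally show ?thesis .
  qed
  moreover have "face_prime B \<subseteq> carrier S" by (auto simp: mono_ideal_def)
  ultimately show ?thesis by blast
qed

lemma prod_vars_mem_face_ideal:
  assumes "u \<in> V" "v \<in> V" "adj E u v" shows "var u \<otimes> var v \<in> face_ideal E V"
proof -
  have m: "var u \<otimes> var v = mon \<one>\<^bsub>K\<^esub> {#u, v#}" using assms by (simp add: mon_mult_mon add_mset_commute)
  have "\<not> indep E {u, v}" using assms by (auto simp: indep_def)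
  moreover have "mon \<one>\<^bsub>K\<^esub> {#u, v#} \<in> carrier S" using assms by (simp add: mon_closed)
  ultimately show ?thesis unfolding m by (simp add: face_ideal_def mono_ideal_def supp_mon_eq)
qed

text \<open>The variables outside a prime above the ideal form an independent set, because the
  product over an edge lies in the prime.\<close>

lemma prime_above_face_ideal:
  assumes P: "primeideal P S" "face_ideal E V \<subseteq> P"
  obtains A where "A \<subseteq> V" "indep E A" "face_prime A \<subseteq> P"
proof -
  define A where "A = {v \<in> V. var v \<notin> P}"
  have "indep E A"
    unfolding indep_def
  proof (intro ballI notI)
    fix u v assume uv: "u \<in> A" "v \<in> A" "adj E u v"
    then have "var u \<otimes> var v \<in> P" using prod_vars_mem_face_ideal[of u v E] P(2) by (auto simp: A_def)
    then show False using primeideal.I_prime[OF P(1), of "var u" "var v"] uv by (auto simp: A_def var_closed)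
  qed
  moreover have "face_prime A \<subseteq> P"
    by (rule face_prime_le[OF primeideal.axioms(1)[OF P(1)]]) (auto simp: A_def)
  ultimately show ?thesis using that[of A] by (auto simp: A_def)
qed

text \<open>If \<open>P\<close> is the colon by \<open>f\<close>, some monomial of \<open>f\<close>
  has independent support; let \<open>B\<close> be maximal independent above it. Then
  \<open>face_prime B\<close> contains \<open>P\<close>, which contains \<open>face_prime A\<close>
  for an independent \<open>A\<close>. So \<open>B \<subseteq> A\<close>, and maximality gives
  equality throughout.\<close>

lemma associated_prime_face_ideal:
  "associated_prime S (face_ideal E V) P \<longleftrightarrow> (\<exists>B. max_indep E V B \<and> P = face_prime B)"
proof
  assume "associated_prime S (face_ideal E V) P"
  then obtain f where P: "primeideal P S" and f: "f \<in> carrier S" "P = {a \<in> carrier S. a \<otimes> f \<in> face_ideal E V}"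
    unfolding associated_prime_def by blast
  have "f \<notin> face_ideal E V" using primeideal.one_not_mem[OF P] f by auto
  then obtain m where m: "m \<in> supp f" "indep E (set_mset m)"
    using f(1) unfolding face_ideal_def mono_ideal_def by blast
  obtain B where B: "set_mset m \<subseteq> B" "max_indep E V B"
    using extend_indep[OF finite_vars m(2) supp_vars[OF f(1) m(1)]] by metis
  have fB: "f \<notin> face_prime B" using m B(1) by (auto simp: mono_ideal_def)
  have le: "P \<subseteq> face_prime B"
  proof
    fix a assume "a \<in> P"
    then have a: "a \<in> carrier S" "a \<otimes> f \<in> face_ideal E V" using f(2) by auto
    then have "a \<otimes> f \<in> face_prime B"
      using face_ideal_subset_face_prime[of E B] B(2) by (auto simp: max_indep_def)
    then show "a \<in> face_prime B"
      using primeideal.I_prime[OF primeideal_face_prime a(1) f(1)] fB by blast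
  qed
  have IP: "face_ideal E V \<subseteq> P"
    using f ideal.Icarr[OF face_ideal_ideal] ideal.I_r_closed[OF face_ideal_ideal] by auto
  obtain A where A: "A \<subseteq> V" "indep E A" "face_prime A \<subseteq> P" by (rule prime_above_face_ideal[OF P IP])
  have "B \<subseteq> A" using face_prime_le_iff[of B A] B(2) A(3) le by (auto simp: max_indep_def)
  moreover have "A \<subseteq> B"
  proof (rule subsetI, rule ccontr)
    fix a assume a: "a \<in> A" "a \<notin> B"
    then obtain b where "b \<in> B" "adj E a b" using B(2) A(1) unfolding max_indep_def by blast
    then show False using A(2) a(1) \<open>B \<subseteq> A\<close> unfolding indep_def by blast
  qed
  ultimately have "A = B" by blast
  then show "\<exists>B. max_indep E V B \<and> P = face_prime B" using A(3) le B(2) by blast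
next
  assume "\<exists>B. max_indep E V B \<and> P = face_prime B"
  then obtain B where B: "max_indep E V B" "P = face_prime B" by blast
  have "finite B" using B(1) finite_vars finite_subset by (auto simp: max_indep_def)
  then have "mon \<one>\<^bsub>K\<^esub> (mset_set B) \<in> carrier S" using B(1) by (simp add: mon_closed max_indep_def)
  then show "associated_prime S (face_ideal E V) P"
    unfolding associated_prime_def B(2)
    using primeideal_face_prime face_ideal_colon_max_indep[OF B(1)] by blast
qed

theorem height_unmixed_iff_well_covered:
  "height_unmixed S (face_ideal E V) \<longleftrightarrow> well_covered E V"
proof -
  have "prime_height S (face_prime A) = prime_height S (face_prime B) \<longleftrightarrow> card A = card B"
    if "max_indep E V A" "max_indep E V B" for A B
  proof -
    have AB: "A \<subseteq> V" "B \<subseteq> V" using that by (auto simp: max_indep_def)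
    then have "card A \<le> card V" "card B \<le> card V" using finite_vars by (auto intro: card_mono)
    then show ?thesis using prime_height_face_prime[OF AB(1)] prime_height_face_prime[OF AB(2)] by auto
  qed
  then show ?thesis
    unfolding height_unmixed_def well_covered_def associated_prime_face_ideal by blast
qed

lemma localization_map:
  assumes M: "maximalideal M (S Quot face_ideal E V)"
  shows "loc_map S (localization (S Quot face_ideal E V) M)
      (\<lambda>a. loc_frac (S Quot face_ideal E V) M (face_ideal E V +> a) \<one>\<^bsub>S Quot face_ideal E V\<^esub>)
      {a \<in> carrier S. face_ideal E V +> a \<in> M} (face_ideal E V)"
proof -
  interpret Q: cring "S Quot face_ideal E V"
    using ideal.quotient_is_cring[OF face_ideal_ideal is_cring] .
  have "primeideal M (S Quot face_ideal E V)" by (rule Q.maximalideal_prime[OF M])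
  from primeideal.loc_map_localization[OF this] show ?thesis by (rule loc_map_quotient[OF face_ideal_ideal])
qed

text \<open>An independent set meets a clique at most once.\<close>

lemma (in -) card_indep_le_blocks:
  assumes "finite J" "A \<subseteq> (\<Union>i\<in>J. F i)" "\<And>i. i \<in> J \<Longrightarrow> pairwise_adj E (F i)" "indep E A"
  shows "card A \<le> card J"
proof -
  have "\<forall>a\<in>A. \<exists>i\<in>J. a \<in> F i" using assms(2) by blast
  then obtain g where g: "\<forall>a\<in>A. g a \<in> J \<and> a \<in> F (g a)" by metis
  have "inj_on g A"
  proof (rule inj_onI)
    fix a b assume ab: "a \<in> A" "b \<in> A" "g a = g b"
    then have "a \<in> F (g a)" "b \<in> F (g a)" "pairwise_adj E (F (g a))" using g assms(3) by auto
    moreover have "\<not> adj E a b" using assms(4) ab by (simp add: indep_def)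
    ultimately show "a = b" unfolding pairwise_adj_def by blast
  qed
  moreover have "g ` A \<subseteq> J" using g by blast
  ultimately show ?thesis by (rule card_inj_on_le) (rule assms(1))
qed

theorem cohen_macaulay_of_partition:
  assumes F: "distinct is" "\<And>i. i \<in> set is \<Longrightarrow> pairwise_adj E (F i)"
      "\<And>i j. i \<in> set is \<Longrightarrow> j \<in> set is \<Longrightarrow> i \<noteq> j \<Longrightarrow> F i \<inter> F j = {}"
      "V = (\<Union>i\<in>set is. F i)"
    and y: "\<And>i. i \<in> set is \<Longrightarrow> y i \<in> F i \<and> closed_nbhd E V (y i) = F i"
  shows "cohen_macaulay (S Quot face_ideal E V)"
proof -
  let ?I = "face_ideal E V"
  let ?Q = "S Quot ?I"
  have I: "ideal ?I S" by (rule face_ideal_ideal)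
  have FV: "F i \<subseteq> V" if "i \<in> set is" for i using F(4) that by blast
  have "cring ?Q" using ideal.quotient_is_cring[OF I is_cring] .
  moreover have "noetherian_ring ?Q" by (rule noetherian_quotient[OF noetherian_S I])
  moreover have "local_cohen_macaulay (localization ?Q M')" if M': "maximalideal M' ?Q" for M'
  proof -
    define T where "T = localization ?Q M'"
    define h where "h = (\<lambda>a. loc_frac ?Q M' (?I +> a) \<one>\<^bsub>?Q\<^esub>)"
    define M where "M = {a \<in> carrier S. ?I +> a \<in> M'}"
    interpret Q: cring ?Q using ideal.quotient_is_cring[OF I is_cring] .
    interpret q: ring_hom_cring S ?Q "(+>) ?I" using ideal.rcos_ring_hom_cring[OF I is_cring] .
    interpret L: loc_map S T h M ?I
      unfolding T_def h_def M_def by (rule localization_map[OF M'])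
    have MP: "primeideal M S" by (rule L.M)
    have MI: "ideal M S" using MP by (rule primeideal.axioms)
    have inv: "\<exists>r\<in>carrier S. g \<otimes> r \<ominus> \<one> \<in> M" if g: "g \<in> carrier S" "g \<notin> M" for g
    proof -
      have "?I +> g \<in> carrier ?Q" "?I +> g \<notin> M'" using g q.hom_closed by (auto simp: M_def)
      then obtain x where x: "x \<in> carrier ?Q" "(?I +> g) \<otimes>\<^bsub>?Q\<^esub> x \<ominus>\<^bsub>?Q\<^esub> \<one>\<^bsub>?Q\<^esub> \<in> M'"
        using Q.maximal_inverse[OF M'] by blast
      then obtain r where r: "r \<in> carrier S" "x = ?I +> r" using quotient_facts(1)[OF I] by blast
      have "?I +> (g \<otimes> r \<ominus> \<one>) = (?I +> g) \<otimes>\<^bsub>?Q\<^esub> x \<ominus>\<^bsub>?Q\<^esub> \<one>\<^bsub>?Q\<^esub>"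
        unfolding r(2) a_minus_def
        using g(1) r(1) q.hom_add[of "g \<otimes> r" "\<ominus> \<one>"] q.hom_mult[of g r] q.hom_a_inv[of \<one>] q.hom_one by simp
      then have "?I +> (g \<otimes> r \<ominus> \<one>) \<in> M'" using x(2) by simp
      moreover have "g \<otimes> r \<ominus> \<one> \<in> carrier S" using g(1) r(1) by simp
      ultimately show ?thesis using r(1) by (auto simp: M_def)
    qed
    have "\<exists>cs. set cs \<subseteq> carrier K \<and> (\<exists>c\<in>set cs. c \<noteq> \<zero>\<^bsub>K\<^esub>) \<and> heval cs (block_sum (F i)) \<in> M"
      if i: "i \<in> set is" for i
    proof -
      \<comment> \<open>Products of adjacent variables are in the prime \<open>M\<close>, so at most
        one variable of the clique \<open>F i\<close> is outside it. The block sum is thus congruent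
        to one variable, and a polynomial relation for that variable passes to the block sum. If all
        variables are in \<open>M\<close>, any member such as \<open>y i\<close> will do.\<close>
      obtain w where w: "w \<in> F i" "\<And>v. v \<in> F i \<Longrightarrow> v \<noteq> w \<Longrightarrow> var v \<in> M"
      proof (cases "\<forall>v\<in>F i. var v \<in> M")
        case True
        then show ?thesis using that[of "y i"] y[OF i] by blast
      next
        case False
        then obtain w where w: "w \<in> F i" "var w \<notin> M" by blast
        have "var v \<in> M" if v: "v \<in> F i" "v \<noteq> w" for v
        proof -
          have V: "v \<in> V" "w \<in> V" using v w FV[OF i] by auto
          have "adj E v w" using F(2)[OF i] v w by (simp add: pairwise_adj_def)
          then have "var v \<otimes> var w \<in> M" using prod_vars_mem_face_ideal[OF V] L.I(2) by blast
          then show ?thesis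
            using primeideal.I_prime[OF MP var_closed[OF V(1)] var_closed[OF V(2)]] w(2) by blast
        qed
        with w(1) that show ?thesis by blast
      qed
      have wV: "w \<in> V" using w FV[OF i] by blast
      obtain f where f: "f \<in> subpolys {w}" "f \<noteq> \<zero>" "f \<in> M" by (rule algebraic_mod_maximal[OF MP inv wV])
      obtain cs where cs: "set cs \<subseteq> carrier K" "f = heval cs (var w)" using exists_heval[OF wV f(1)] by blast
      have vc: "var w \<in> carrier S" by (rule var_closed[OF wV])
      have "\<exists>c\<in>set cs. c \<noteq> \<zero>\<^bsub>K\<^esub>" using heval_zero_coeffs[OF _ vc, of cs] cs(2) f(2) by blast
      moreover have "heval cs (block_sum (F i)) \<in> M"
      proof -
        have "block_sum (F i) \<ominus> var w \<in> M" by (rule block_sum_cong[OF MI FV[OF i] w])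
        then have d: "heval cs (block_sum (F i)) \<ominus> f \<in> M"
          unfolding cs(2) by (rule heval_cong[OF MI block_sum_closed[OF FV[OF i]] vc _ cs(1)])
        have "heval cs (block_sum (F i)) = (heval cs (block_sum (F i)) \<ominus> f) \<oplus> f"
        proof -
          have "a = (a \<ominus> b) \<oplus> b" if "a \<in> carrier S" "b \<in> carrier S" for a b using that by algebra
          then show ?thesis
            using heval_closed[OF cs(1) block_sum_closed[OF FV[OF i]]] subpolys_carrier[OF f(1)] by blast
        qed
        then show ?thesis using ideal_add[OF MI d f(3)] by simp
      qed
      ultimately show ?thesis using cs(1) by blast
    qed
    then obtain cs where cs: "\<And>i. i \<in> set is \<Longrightarrow> set (cs i) \<subseteq> carrier K \<and> (\<exists>c\<in>set (cs i). c \<noteq> \<zero>\<^bsub>K\<^esub>)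
      \<and> heval (cs i) (block_sum (F i)) \<in> M" by metis
    let ?xs = "map (\<lambda>i. heval (cs i) (block_sum (F i))) is"
    have "weakly_regular S ?I ?xs"
    proof (rule face_ideal_weakly_regular[OF F(1)])
      show "F i \<subseteq> V \<and> pairwise_adj E (F i)" if "i \<in> set is" for i using FV F(2) that by blast
      show "F i \<inter> F j = {}" if "i \<in> set is" "j \<in> set is" "i \<noteq> j" for i j using F(3) that by blast
      show "set (cs i) \<subseteq> carrier K \<and> (\<exists>c\<in>set (cs i). c \<noteq> \<zero>\<^bsub>K\<^esub>)" if "i \<in> set is" for i using cs that by blast
      show "V \<subseteq> (\<Union>i\<in>set is. F i)" using F(4) by blast
      show "y i \<in> F i \<inter> V \<and> closed_nbhd E V (y i) = F i \<inter> V" if "i \<in> set is" for i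
        using y[OF that] FV[OF that] by blast
    qed simp
    moreover have "set ?xs \<subseteq> M" using cs by auto
    ultimately have reg: "regular_sequence T (map h ?xs)" "set (map h ?xs) \<subseteq> L.ext M"
      using L.regular_sequence_ext by blast+
    have lower: "enat (length is) \<le> ring_depth T (L.ext M)"
      unfolding ring_depth_def
    proof (rule Sup_upper)
      have "enat (length is) = enat (length (map h ?xs))" by simp
      with reg show "enat (length is) \<in> {enat (length xs) |xs. regular_sequence T xs \<and> set xs \<subseteq> L.ext M}"
        by blast
    qed
    \<comment> \<open>The bottom of the contracted chain contains \<open>face_prime A\<close> for
      some independent \<open>A\<close>; this bounds the length by \<open>card A\<close>, and
      \<open>A\<close> meets each block at most once.\<close>
    have upper: "krull_dim T \<le> enat (length is)"
      unfolding krull_dim_def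
    proof (rule Sup_least)
      fix n assume "n \<in> {enat r |r P. prime_chain T r P}"
      then obtain r P where P: "n = enat r" "prime_chain T r P" by blast
      note c = L.prime_chain_contr[OF P(2)]
      have "primeideal (L.contr (P 0)) S" using c(1) by (simp add: prime_chain_def)
      then obtain A where A: "A \<subseteq> V" "indep E A" "face_prime A \<subseteq> L.contr (P 0)"
        using prime_above_face_ideal c(2) by blast
      have "r \<le> card A" by (rule prime_chain_above_face_prime[OF A(1) c(1) A(3)])
      also have "card A \<le> card (set is)"
        by (rule card_indep_le_blocks[OF _ _ F(2) A(2)]) (use A(1) F(4) in auto)
      also have "\<dots> = length is" using F(1) by (rule distinct_card)
      finally show "n \<le> enat (length is)" using P(1) by simp
    qed
    have "ring_depth T (L.ext M) = krull_dim T"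
      using lower upper L.ring_depth_le_krull_dim[OF noetherian_S] by (metis order.trans antisym)
    then show ?thesis
      unfolding local_cohen_macaulay_def T_def[symmetric]
      using L.T.is_cring L.noetherian[OF noetherian_S] L.maximal_ideals by blast
  qed
  ultimately show ?thesis unfolding cohen_macaulay_def by blast
qed

text \<open>\<open>face_prime {}\<close> consists of the polynomials without constant term. A
  polynomial outside it is congruent modulo it to its nonzero constant term, a unit, so any larger
  ideal is the whole ring.\<close>

lemma maximalideal_origin:
  "maximalideal ((+>) (face_ideal E V) ` face_prime {}) (S Quot face_ideal E V)" (is "maximalideal ?M ?Q")
  and origin_preimage: "{a \<in> carrier S. face_ideal E V +> a \<in> (+>) (face_ideal E V) ` face_prime {}} = face_prime {}"
proof -
  let ?I = "face_ideal E V"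
  have I: "ideal ?I S" by (rule face_ideal_ideal)
  have I0: "?I \<subseteq> face_prime {}" by (rule face_ideal_subset_face_prime) (simp add: indep_def)
  have J0: "ideal (face_prime {}) S" by (rule face_prime_ideal)
  interpret Q: cring ?Q using ideal.quotient_is_cring[OF I is_cring] .
  interpret q: ring_hom_cring S ?Q "(+>) ?I" using ideal.rcos_ring_hom_cring[OF I is_cring] .
  show pre: "{a \<in> carrier S. ?I +> a \<in> ?M} = face_prime {}"
  proof (intro subset_antisym subsetI)
    fix a assume "a \<in> {a \<in> carrier S. ?I +> a \<in> ?M}"
    then obtain b where a: "a \<in> carrier S" and b: "b \<in> face_prime {}" "?I +> a = ?I +> b" by blast
    have bc: "b \<in> carrier S" using b(1) ideal.Icarr[OF J0] by simp
    have "a \<ominus> b \<in> ?I" using quotient_eq_iff_same_a_r_cos[OF I a bc] b(2) by simp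
    then have "(a \<ominus> b) \<oplus> b \<in> face_prime {}" using I0 b(1) by (intro ideal_add[OF J0]) auto
    moreover have "(a \<ominus> b) \<oplus> b = a" using a bc by algebra
    ultimately show "a \<in> face_prime {}" by simp
  qed (use ideal.Icarr[OF J0] in auto)
  show "maximalideal ?M ?Q"
  proof (rule maximalidealI)
    show M: "ideal ?M ?Q" by (rule ring_ideal_imp_quot_ideal[OF I J0])
    have "?I +> \<one> \<notin> ?M" using pre primeideal.one_not_mem[OF primeideal_face_prime, of "{}"] by blast
    then show "carrier ?Q \<noteq> ?M" using q.hom_closed[OF one_closed] by blast
    fix J assume J: "ideal J ?Q" "?M \<subseteq> J" "J \<subseteq> carrier ?Q"
    show "J = ?M \<or> J = carrier ?Q"
    proof (cases "J \<subseteq> ?M")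
      case False
      then obtain x where x: "x \<in> J" "x \<notin> ?M" by blast
      then obtain g where g: "g \<in> carrier S" "x = ?I +> g" using J(3) quotient_facts(1)[OF I] by blast
      have g0: "g \<notin> face_prime {}" using x g by blast
      then have c: "g {#} \<noteq> \<zero>\<^bsub>K\<^esub>" using g(1) by (auto simp: mono_ideal_def supp_def)
      have u: "mon (g {#}) {#} \<in> Units S" using c g(1) by (intro const_unit) auto
      define r where "r = part (\<lambda>m. m \<noteq> {#}) g"
      have rc: "r \<in> carrier S" unfolding r_def by (rule part_closed[OF g(1)])
      have r0: "r \<in> face_prime {}" using rc by (auto simp: mono_ideal_def r_def supp_part)
      have ge: "mon (g {#}) {#} = g \<ominus> r"
        using g(1) rc by (auto simp: a_minus_def add_S uminus_S r_def part_def mon_def fun_eq_iff K.r_neg)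
      have JV: "ideal {a \<in> carrier S. ?I +> a \<in> J} S" by (rule q.ring.ideal_vimage[OF J(1)])
      have "g \<in> {a \<in> carrier S. ?I +> a \<in> J}" "r \<in> {a \<in> carrier S. ?I +> a \<in> J}"
        using g x rc r0 J(2) by auto
      then have "mon (g {#}) {#} \<in> {a \<in> carrier S. ?I +> a \<in> J}"
        unfolding ge by (rule ideal.diff_closed[OF JV])
      then have "inv (mon (g {#}) {#}) \<otimes> mon (g {#}) {#} \<in> {a \<in> carrier S. ?I +> a \<in> J}"
        by (rule ideal.I_l_closed[OF JV]) (use u in simp)
      then have "?I +> \<one> \<in> J" using u by simp
      then have "\<one>\<^bsub>?Q\<^esub> \<in> J" using q.hom_one by simp
      then show ?thesis using ideal.one_imp_carrier[OF J(1)] by simp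
    qed (use J(2) in blast)
  qed
qed

theorem cohen_macaulay_imp_well_covered:
  assumes CM: "cohen_macaulay (S Quot face_ideal E V)"
  shows "well_covered E V"
proof -
  let ?I = "face_ideal E V"
  let ?Q = "S Quot ?I"
  define M' where "M' = (+>) ?I ` face_prime {}"
  have M': "maximalideal M' ?Q" unfolding M'_def by (rule maximalideal_origin)
  define T where "T = localization ?Q M'"
  define h where "h = (\<lambda>a. loc_frac ?Q M' (?I +> a) \<one>\<^bsub>?Q\<^esub>)"
  have "{a \<in> carrier S. ?I +> a \<in> M'} = face_prime {}" unfolding M'_def by (rule origin_preimage)
  then interpret L: loc_map S T h "face_prime {}" ?I
    using localization_map[OF M'] unfolding T_def h_def by simp
  obtain N where N: "{J. maximalideal J T} = {N}" "ring_depth T N = krull_dim T"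
    using CM M' unfolding cohen_macaulay_def local_cohen_macaulay_def T_def by blast
  have "N = L.ext (face_prime {})" using N(1) L.maximal_ideals by simp
  with N(2) have depth: "ring_depth T (L.ext (face_prime {})) = krull_dim T" by simp
  \<comment> \<open>\<open>A\<close> bounds the dimension from below, by the chain that adds its
    variables one by one up to the origin; \<open>B\<close> bounds the depth from above. Exchanging
    their roles gives equality.\<close>
  have le: "card A \<le> card B" if AB: "max_indep E V A" "max_indep E V B" for A B
  proof -
    have A: "A \<subseteq> V" "indep E A" and B: "B \<subseteq> V" using AB by (auto simp: max_indep_def)
    obtain P where P: "prime_chain S (card A) P" "P 0 = face_prime A" "P (card A) = face_prime {}"
      using face_prime_chain[of "{}" A] A by auto
    have "prime_chain T (card A) (\<lambda>i. L.ext (P i))"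
      using face_ideal_subset_face_prime[OF A(2)] P by (intro L.prime_chain_ext) auto
    then have "enat (card A) \<le> krull_dim T" unfolding krull_dim_def by (intro Sup_upper) blast
    also have "krull_dim T = ring_depth T (L.ext (face_prime {}))" using depth by simp
    also have "\<dots> \<le> enat (card B)"
      unfolding ring_depth_def
    proof (rule Sup_least)
      fix n assume "n \<in> {enat (length xs) |xs. regular_sequence T xs \<and> set xs \<subseteq> L.ext (face_prime {})}"
      then obtain xs where xs: "regular_sequence T xs" "set xs \<subseteq> L.ext (face_prime {})" "n = enat (length xs)"
        by blast
      have "finite B" using B finite_vars finite_subset by blast
      then have f: "mon \<one>\<^bsub>K\<^esub> (mset_set B) \<in> carrier S" using B by (simp add: mon_closed)
      obtain Q where "prime_chain S (length xs) Q" "Q 0 = face_prime B"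
        by (rule L.regular_sequence_chain_from[OF noetherian_S xs(1,2) primeideal_face_prime
          face_prime_mono f face_ideal_colon_max_indep[OF AB(2), symmetric]]) auto
      then have "length xs \<le> card B" by (intro prime_chain_above_face_prime[OF B]) auto
      then show "n \<le> enat (card B)" using xs(3) by simp
    qed
    finally show ?thesis by simp
  qed
  then show ?thesis unfolding well_covered_def by (meson antisym)
qed

end

section \<open>Chordal graphs and Cohen--Macaulayness\<close>

text \<open>Condition (a) quantifies over the fields on the type \<open>'b\<close>; to draw a
  conclusion from it such a field has to exist. Two distinct elements \<open>z\<close> and
  \<open>e\<close> become the zero and the one of a field with two elements.\<close>

lemma exists_two_element_field: "\<exists>L :: 'b :: infinite ring. field L"
proof -
  obtain z e :: 'b where ze: "z \<noteq> e"
  proof -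
    have "\<exists>z e :: 'b. z \<noteq> e"
    proof (rule ccontr)
      assume "\<not> ?thesis"
      then have "(UNIV :: 'b set) = {undefined}" by blast
      then show False using infinite_UNIV by (metis finite.emptyI finite_insert)
    qed
    then show ?thesis using that by blast
  qed
  define L :: "'b ring" where
    "L = \<lparr>carrier = {z, e}, monoid.mult = (\<lambda>x y. if x = e \<and> y = e then e else z), monoid.one = e,
      ring.zero = z, ring.add = (\<lambda>x y. if x = y then z else e)\<rparr>"
  interpret cring L
  proof (rule cringI)
    show "abelian_group L" by (rule abelian_groupI) (use ze in \<open>auto simp: L_def\<close>)
    show "comm_monoid L" by (rule comm_monoidI) (use ze in \<open>auto simp: L_def\<close>)
  qed (use ze in \<open>auto simp: L_def\<close>)
  have "field L"
    by (rule cring_fieldI) (use ze in \<open>auto simp: L_def Units_def\<close>)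
  then show ?thesis by blast
qed

section \<open>Facets with a free vertex as closed neighbourhoods of simplicial vertices\<close>

lemma clique_iff: "clique V E F \<longleftrightarrow> F \<subseteq> V \<and> pairwise_adj E F"
  by (auto simp: clique_def pairwise_adj_def adj_def)

lemma clique_subset_facet:
  assumes "finite V" "clique V E F"
  obtains H where "H \<in> facets (clique_complex V E)" "F \<subseteq> H"
proof -
  let ?P = "\<lambda>H. clique V E H \<and> F \<subseteq> H"
  have "\<forall>H. ?P H \<longrightarrow> card H < Suc (card V)"
    using assms(1) by (auto simp: clique_iff less_Suc_eq_le intro: card_mono)
  then obtain H where H: "?P H" "\<And>H'. ?P H' \<Longrightarrow> card H' \<le> card H"
    using ex_has_greatest_nat[of ?P F card "Suc (card V)"] assms(2) by blast
  have "H \<in> facets (clique_complex V E)"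
    unfolding facets_def clique_complex_def
  proof (intro CollectI conjI ballI impI)
    show "clique V E H" using H(1) by blast
    fix H' assume H': "H' \<in> {F. clique V E F}" "H \<subseteq> H'"
    then have "finite H'" using assms(1) finite_subset by (auto simp: clique_iff)
    then show "H = H'" using H'(2) H(1) H(2)[of H'] H'(1) by (intro card_seteq) auto
  qed
  with H(1) that show ?thesis by blast
qed

lemma mem_closed_nbhd: "v \<in> W \<Longrightarrow> v \<in> closed_nbhd E W v"
  by (simp add: closed_nbhd_def)

lemma clique_subset_closed_nbhd: "F \<subseteq> V \<Longrightarrow> pairwise_adj E F \<Longrightarrow> v \<in> F \<Longrightarrow> F \<subseteq> closed_nbhd E V v"
  by (auto simp: pairwise_adj_def closed_nbhd_def)

text \<open>If \<open>v\<close> is free in \<open>H\<close>, every edge at \<open>v\<close> extends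
  to a facet through \<open>v\<close>, which must be \<open>H\<close>; so \<open>H\<close> is the
  closed neighbourhood of \<open>v\<close>. Conversely, the closed neighbourhood of a simplicial
  vertex contains every clique through it.\<close>

lemma facets_with_free_vertex:
  assumes V: "finite V"
  shows "{H \<in> facets (clique_complex V E). \<exists>v. free_vertex (clique_complex V E) H v}
    = closed_nbhd E V ` {v. simplicial E V v}"
proof (intro subset_antisym subsetI)
  fix H assume "H \<in> {H \<in> facets (clique_complex V E). \<exists>v. free_vertex (clique_complex V E) H v}"
  then obtain v where H: "H \<in> facets (clique_complex V E)" "v \<in> H"
    "\<And>H'. H' \<in> facets (clique_complex V E) \<Longrightarrow> v \<in> H' \<Longrightarrow> H' = H"
    by (auto simp: free_vertex_def)
  have cl: "H \<subseteq> V" "pairwise_adj E H" using H(1) by (auto simp: facets_def clique_complex_def clique_iff)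
  have "u \<in> H" if u: "u \<in> closed_nbhd E V v" for u
  proof -
    have "pairwise_adj E {u, v}" using u adj_sym[of E v u] by (auto simp: closed_nbhd_def pairwise_adj_def)
    then have "clique V E {u, v}" using u H(2) cl(1) by (auto simp: clique_iff closed_nbhd_def)
    then obtain H' where "H' \<in> facets (clique_complex V E)" "{u, v} \<subseteq> H'"
      using clique_subset_facet[OF V] by metis
    with H(3) show ?thesis by blast
  qed
  then have "H = closed_nbhd E V v" using clique_subset_closed_nbhd[OF cl H(2)] by blast
  moreover from this have "simplicial E V v" using cl H(2) by (auto simp: simplicial_def)
  ultimately show "H \<in> closed_nbhd E V ` {v. simplicial E V v}" by blast
next
  fix H assume "H \<in> closed_nbhd E V ` {v. simplicial E V v}"
  then obtain v where v: "simplicial E V v" "H = closed_nbhd E V v" by blast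
  have vH: "v \<in> H" using v by (simp add: simplicial_def mem_closed_nbhd)
  have H: "H \<subseteq> V" "pairwise_adj E H" using v by (auto simp: simplicial_def closed_nbhd_def)
  have max: "H' \<subseteq> H" if "clique V E H'" "v \<in> H'" for H'
    using that clique_subset_closed_nbhd[of H' V E v] v(2) by (auto simp: clique_iff)
  have HF: "H \<in> facets (clique_complex V E)"
    unfolding facets_def clique_complex_def using H max vH by (auto simp: clique_iff)
  moreover have "free_vertex (clique_complex V E) H v"
    unfolding free_vertex_def
  proof (intro conjI ballI impI)
    fix H' assume H': "H' \<in> facets (clique_complex V E)" "v \<in> H'"
    then have "clique V E H'" by (simp add: facets_def clique_complex_def)
    then have "H' \<subseteq> H" using max H'(2) by blast
    then show "H' = H" using H'(1) HF by (auto simp: facets_def)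
  qed (rule vH)
  ultimately show "H \<in> {H \<in> facets (clique_complex V E). \<exists>v. free_vertex (clique_complex V E) H v}" by blast
qed

lemma simplicial_closed_nbhd_eq:
  assumes "simplicial E V v" "simplicial E V y" "v \<in> closed_nbhd E V y"
  shows "closed_nbhd E V v = closed_nbhd E V y"
proof -
  have y: "y \<in> closed_nbhd E V v"
    using assms adj_sym[of E y v] by (auto simp: simplicial_def closed_nbhd_def)
  have "closed_nbhd E V y \<subseteq> closed_nbhd E V v"
    using assms(2,3) by (intro clique_subset_closed_nbhd) (auto simp: simplicial_def closed_nbhd_def)
  moreover have "closed_nbhd E V v \<subseteq> closed_nbhd E V y"
    using assms(1) y by (intro clique_subset_closed_nbhd) (auto simp: simplicial_def closed_nbhd_def)
  ultimately show ?thesis by blast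
qed

text \<open>The simplicial vertex of a facet listed by \<open>F\<close> lies in some block of the
  partition of the well-covered graph, and then facet and block coincide. Injectivity of
  \<open>F\<close> turns distinct indices into distinct blocks.\<close>

lemma well_covered_imp_partition:
  assumes "chordal E" "finite V" "well_covered E V"
    and F: "bij_betw F J (closed_nbhd E V ` {v. simplicial E V v})"
  shows "(\<Union>i\<in>J. F i) = V \<and> disjoint_family_on F J"
proof -
  from chordal_well_covered_partition[OF assms(1-3)] obtain Y where Y: "Y \<subseteq> V"
    "\<forall>y\<in>Y. simplicial E V y" "V = (\<Union>y\<in>Y. closed_nbhd E V y)"
    "\<forall>y\<in>Y. \<forall>z\<in>Y. y \<noteq> z \<longrightarrow> closed_nbhd E V y \<inter> closed_nbhd E V z = {}"
    by (elim exE conjE)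
  have blk: "\<exists>y\<in>Y. H = closed_nbhd E V y" if H: "H \<in> closed_nbhd E V ` {v. simplicial E V v}" for H
  proof -
    obtain v where v: "simplicial E V v" "H = closed_nbhd E V v" using H by blast
    then have "v \<in> (\<Union>y\<in>Y. closed_nbhd E V y)" using Y(3) by (simp add: simplicial_def)
    then obtain y where y: "y \<in> Y" "v \<in> closed_nbhd E V y" by blast
    then show ?thesis using simplicial_closed_nbhd_eq[OF v(1) _ y(2)] Y(2) v(2) by blast
  qed
  have img: "F ` J = closed_nbhd E V ` {v. simplicial E V v}" using F by (simp add: bij_betw_def)
  have "\<Union>(closed_nbhd E V ` {v. simplicial E V v}) = V"
  proof
    show "\<Union>(closed_nbhd E V ` {v. simplicial E V v}) \<subseteq> V" by (auto simp: closed_nbhd_def)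
    have "Y \<subseteq> {v. simplicial E V v}" using Y(2) by blast
    then have "(\<Union>y\<in>Y. closed_nbhd E V y) \<subseteq> (\<Union>y\<in>{v. simplicial E V v}. closed_nbhd E V y)"
      by (rule UN_mono) simp
    then show "V \<subseteq> \<Union>(closed_nbhd E V ` {v. simplicial E V v})" by (simp only: Y(3)[symmetric])
  qed
  moreover have "disjoint_family_on F J"
    unfolding disjoint_family_on_def
  proof (intro ballI impI)
    fix i j assume ij: "i \<in> J" "j \<in> J" "i \<noteq> j"
    have "F i \<in> closed_nbhd E V ` {v. simplicial E V v}" "F j \<in> closed_nbhd E V ` {v. simplicial E V v}"
      using imageI[OF ij(1), of F] imageI[OF ij(2), of F] by (simp_all only: img)
    from blk[OF this(1)] blk[OF this(2)] obtain y z where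
      y: "y \<in> Y" "F i = closed_nbhd E V y" and z: "z \<in> Y" "F j = closed_nbhd E V z" by (elim bexE)
    have "F i \<noteq> F j" using F ij by (auto simp: bij_betw_def inj_on_def)
    then have "y \<noteq> z" using y z by auto
    then show "F i \<inter> F j = {}" using Y(4) y z by auto
  qed
  ultimately show ?thesis using img by simp
qed

lemma partition_imp_cohen_macaulay_graph:
  fixes V :: "'v :: wellorder set"
  assumes K: "field K" and V: "finite V" and E: "\<And>e. e \<in> E \<Longrightarrow> \<exists>i\<in>V. \<exists>j\<in>V. i \<noteq> j \<and> e = {i, j}"
    and F: "bij_betw F {1..m :: nat} (closed_nbhd E V ` {v. simplicial E V v})"
    and d: "(\<Union>i\<in>{1..m}. F i) = V" "disjoint_family_on F {1..m}"
  shows "cohen_macaulay_graph K V E"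
proof -
  interpret mpoly_ring K V "indexed_poly_ring K V"
    by (intro mpoly_ring.intro mpoly_ring_axioms.intro K V refl)
  have eq: "edge_ideal K V E = face_ideal E V" by (rule edge_ideal_eq) (rule E)
  have "\<forall>i\<in>{1..m}. \<exists>y. simplicial E V y \<and> F i = closed_nbhd E V y"
    using F unfolding bij_betw_def by blast
  then obtain y where y: "\<forall>i\<in>{1..m}. simplicial E V (y i) \<and> F i = closed_nbhd E V (y i)" by metis
  have s: "set [1..<Suc m] = {1..m}" by auto
  have "cohen_macaulay (indexed_poly_ring K V Quot face_ideal E V)"
  proof (rule cohen_macaulay_of_partition[where ?is = "[1..<Suc m]" and F = F and y = y])
    show "pairwise_adj E (F i)" if "i \<in> set [1..<Suc m]" for i
      using that y unfolding s by (simp add: simplicial_def)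
    show "F i \<inter> F j = {}" if "i \<in> set [1..<Suc m]" "j \<in> set [1..<Suc m]" "i \<noteq> j" for i j
      using that d(2) unfolding s by (simp add: disjoint_family_on_def)
    show "y i \<in> F i \<and> closed_nbhd E V (y i) = F i" if "i \<in> set [1..<Suc m]" for i
      using that y unfolding s by (simp add: simplicial_def mem_closed_nbhd)
  qed (use d(1) in \<open>simp_all only: s distinct_upt\<close>)
  then show ?thesis unfolding cohen_macaulay_graph_def eq .
qed

lemma cohen_macaulay_graph_imp_well_covered:
  fixes V :: "'v :: wellorder set"
  assumes K: "field K" and V: "finite V" and E: "\<And>e. e \<in> E \<Longrightarrow> \<exists>i\<in>V. \<exists>j\<in>V. i \<noteq> j \<and> e = {i, j}"
    and CM: "cohen_macaulay_graph K V E"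
  shows "well_covered E V"
proof -
  interpret mpoly_ring K V "indexed_poly_ring K V"
    by (intro mpoly_ring.intro mpoly_ring_axioms.intro K V refl)
  have eq: "edge_ideal K V E = face_ideal E V" by (rule edge_ideal_eq) (rule E)
  show ?thesis
    using CM unfolding cohen_macaulay_graph_def eq by (rule cohen_macaulay_imp_well_covered)
qed

lemma unmixed_graph_iff_well_covered:
  fixes V :: "'v :: wellorder set"
  assumes K: "field K" and V: "finite V" and E: "\<And>e. e \<in> E \<Longrightarrow> \<exists>i\<in>V. \<exists>j\<in>V. i \<noteq> j \<and> e = {i, j}"
  shows "unmixed_graph K V E \<longleftrightarrow> well_covered E V"
proof -
  interpret mpoly_ring K V "indexed_poly_ring K V"
    by (intro mpoly_ring.intro mpoly_ring_axioms.intro K V refl)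
  have eq: "edge_ideal K V E = face_ideal E V" by (rule edge_ideal_eq) (rule E)
  show ?thesis unfolding unmixed_graph_def eq by (rule height_unmixed_iff_well_covered)
qed

theorem theorem2p1:
  fixes K :: "'a ring" and n m :: nat and E :: "nat set set" and F :: "nat \<Rightarrow> nat set"
  assumes "field K"
    and "simple_graph {1..n} E"
    and "chordal E"
    and "bij_betw F {1..m}
           {H \<in> facets (clique_complex {1..n} E). \<exists>v. free_vertex (clique_complex {1..n} E) H v}"
  shows "((\<forall>L :: 'b :: infinite ring. field L \<longrightarrow> cohen_macaulay_graph L {1..n} E)
            \<longleftrightarrow> cohen_macaulay_graph K {1..n} E)
       \<and> (cohen_macaulay_graph K {1..n} E \<longleftrightarrow> unmixed_graph K {1..n} E)
       \<and> (unmixed_graph K {1..n} E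
            \<longleftrightarrow> (\<Union>i\<in>{1..m}. F i) = {1..n} \<and> disjoint_family_on F {1..m})"
proof -
  let ?V = "{1..n}" and ?D = "(\<Union>i\<in>{1..m}. F i) = {1..n} \<and> disjoint_family_on F {1..m}"
  have E: "\<exists>i\<in>?V. \<exists>j\<in>?V. i \<noteq> j \<and> e = {i, j}" if "e \<in> E" for e
    using assms(2) that unfolding simple_graph_def by blast
  have F: "bij_betw F {1..m} (closed_nbhd E ?V ` {v. simplicial E ?V v})"
    using assms(4) unfolding facets_with_free_vertex[OF finite_atLeastAtMost] .
  have wc_D: "well_covered E ?V \<Longrightarrow> ?D"
    by (rule well_covered_imp_partition[OF assms(3) finite_atLeastAtMost _ F])
  have D_CM: "?D \<Longrightarrow> cohen_macaulay_graph K ?V E"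
    by (rule partition_imp_cohen_macaulay_graph[OF assms(1) finite_atLeastAtMost E F]) auto
  have D_CM': "?D \<Longrightarrow> cohen_macaulay_graph L ?V E" if "field L" for L :: "'b ring"
    by (rule partition_imp_cohen_macaulay_graph[OF that finite_atLeastAtMost E F]) auto
  have CM_wc: "cohen_macaulay_graph K ?V E \<Longrightarrow> well_covered E ?V"
    by (rule cohen_macaulay_graph_imp_well_covered[OF assms(1) finite_atLeastAtMost E])
  obtain L0 :: "'b ring" where L0: "field L0" using exists_two_element_field by blast
  have CM_wc': "cohen_macaulay_graph L0 ?V E \<Longrightarrow> well_covered E ?V"
    by (rule cohen_macaulay_graph_imp_well_covered[OF L0 finite_atLeastAtMost E])
  have "unmixed_graph K ?V E \<longleftrightarrow> well_covered E ?V"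
    by (rule unmixed_graph_iff_well_covered[OF assms(1) finite_atLeastAtMost E])
  then show ?thesis using wc_D D_CM D_CM' CM_wc CM_wc' L0 by blast
qed

end
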